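(* Fix $\beta>0$. With $\Lambda_0(\beta,a)$ the smallest eigenvalue of $\mathfrak{G}_{\beta,a}$ and $TW_\beta$ the general beta Tracy–Widom law, $$\frac{\eta-\Lambda_0\big(\beta,2\sqrt\eta-\tfrac{2}{\beta}\big)}{\eta^{2/3}}\Rightarrow TW_\beta$$ in distribution as $\eta\to\infty$.
   Context: For $a>-1$, $\Lambda_0(\beta,a)$ is the smallest eigenvalue of the random operator $\mathfrak{G}_{\beta,a}$: with $b$ a standard Brownian motion, $m(dx)=e^{-(a+1)x-\frac{2}{\sqrt\beta}b(x)}dx$ and $s(dx)=e^{ax+\frac{2}{\sqrt\beta}b(x)}dx$ on $[0,\infty)$, $\lambda$ is an eigenvalue iff there is $0\ne\psi\in L^2(\mathbb{R}_+,m)$ with $\psi(x)=\lambda\int_0^\infty(\int_0^{x\wedge y}s(dz))\psi(y)\,m(dy)$. (For $\eta$ large, $a=2\sqrt\eta-2/\beta>-1$.) $TW_\beta$ is the law of the top eigenvalue of the random Schrödinger operator $\frac{d^2}{dx^2}-x+\frac{2}{\sqrt\beta}b'(x)$ on $[0,\infty)$ with Dirichlet condition at $0$; equivalently, $P(TW_\beta<\mu)$ equals the probability that the diffusion $dq(x)=\frac{2}{\sqrt\beta}db(x)+(x+\mu-q^2(x))dx$ started from $+\infty$ at $x=0$ never hits $-\infty$. *)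

theory Defs
  imports "HOL-Probability.Probability"
begin

definition is_std_BM :: "'a measure \<Rightarrow> ('a \<Rightarrow> real \<Rightarrow> real) \<Rightarrow> bool" where
  "is_std_BM M b \<longleftrightarrow>
     prob_space M \<and>
     (\<forall>t\<ge>0. (\<lambda>w. b w t) \<in> borel_measurable M) \<and>
     (\<forall>w\<in>space M. b w 0 = 0 \<and> continuous_on {0..} (b w)) \<and>
     (\<forall>s t. 0 \<le> s \<and> s < t \<longrightarrow>
        distributed M lborel (\<lambda>w. b w t - b w s)
          (\<lambda>x. ennreal (normal_density 0 (sqrt (t - s)) x))) \<and>
     (\<forall>(ts::nat \<Rightarrow> real) n. 0 \<le> ts 0 \<and> (\<forall>i<n. ts i < ts (Suc i)) \<longrightarrow>
        prob_space.indep_vars M (\<lambda>_. borel)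
          (\<lambda>i w. b w (ts (Suc i)) - b w (ts i)) {..<n})"

text \<open>Speed and scale densities of the operator G_{beta,a}, for a fixed path bp.\<close>
definition m_dens :: "real \<Rightarrow> real \<Rightarrow> (real \<Rightarrow> real) \<Rightarrow> real \<Rightarrow> real" where
  "m_dens \<beta> a bp x = exp (- (a + 1) * x - (2 / sqrt \<beta>) * bp x)"

definition s_dens :: "real \<Rightarrow> real \<Rightarrow> (real \<Rightarrow> real) \<Rightarrow> real \<Rightarrow> real" where
  "s_dens \<beta> a bp x = exp (a * x + (2 / sqrt \<beta>) * bp x)"

definition scale_fun :: "real \<Rightarrow> real \<Rightarrow> (real \<Rightarrow> real) \<Rightarrow> real \<Rightarrow> real" where
  "scale_fun \<beta> a bp x = (LINT z:{0..x}|lborel. s_dens \<beta> a bp z)"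

definition is_G_eigenvalue :: "real \<Rightarrow> real \<Rightarrow> (real \<Rightarrow> real) \<Rightarrow> real \<Rightarrow> bool" where
  "is_G_eigenvalue \<beta> a bp lam \<longleftrightarrow>
     (\<exists>\<psi>::real \<Rightarrow> real.
        \<psi> \<in> borel_measurable lborel \<and>
        set_integrable lborel {0..} (\<lambda>y. (\<psi> y)\<^sup>2 * m_dens \<beta> a bp y) \<and>
        \<not> (AE y in lborel. y \<ge> 0 \<longrightarrow> \<psi> y = 0) \<and>
        (\<forall>x\<ge>0. set_integrable lborel {0..}
                   (\<lambda>y. scale_fun \<beta> a bp (min x y) * \<psi> y * m_dens \<beta> a bp y) \<and>
                 \<psi> x = lam * (LINT y:{0..}|lborel.
                   scale_fun \<beta> a bp (min x y) * \<psi> y * m_dens \<beta> a bp y)))"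

definition Lambda0 :: "real \<Rightarrow> real \<Rightarrow> (real \<Rightarrow> real) \<Rightarrow> real" where
  "Lambda0 \<beta> a bp = Inf {lam. is_G_eigenvalue \<beta> a bp lam}"

text \<open>The Riccati diffusion dq = (2/sqrt beta) db + (x + mu - q^2) dx, started from +inf at x = 0,
  never hits -inf: there is a continuous solution on (0,inf) with q(x) -> +inf as x -> 0+.\<close>
definition riccati_no_explosion :: "real \<Rightarrow> real \<Rightarrow> (real \<Rightarrow> real) \<Rightarrow> bool" where
  "riccati_no_explosion \<beta> \<mu> bp \<longleftrightarrow>
     (\<exists>q::real \<Rightarrow> real.
        continuous_on {0<..} q \<and>
        filterlim q at_top (at_right 0) \<and>
        (\<forall>x y. 0 < y \<and> y \<le> x \<longrightarrow>
           q x - q y = (2 / sqrt \<beta>) * (bp x - bp y) + (LBINT t=y..x. t + \<mu> - (q t)\<^sup>2)))"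

text \<open>P(TW_beta < mu), computed from a standard Brownian motion b on M.\<close>
definition TW_cdf_left :: "'a measure \<Rightarrow> ('a \<Rightarrow> real \<Rightarrow> real) \<Rightarrow> real \<Rightarrow> real \<Rightarrow> real" where
  "TW_cdf_left M b \<beta> \<mu> = measure M {w \<in> space M. riccati_no_explosion \<beta> \<mu> (b w)}"

end

theory Submission
  imports Defs
begin

text \<open>Sturm oscillation: \<open>\<lambda> \<le> \<Lambda>\<^sub>0\<close> holds iff the derivative of the solution of the string equation
  \<open>(f'/s)' = - \<lambda> m f\<close>, \<open>f 0 = 0\<close>, stays positive on \<open>[0,\<infinity>)\<close>; this needs \<open>S m\<close> to be integrable, which the growth
  of Brownian paths gives almost surely. With \<open>\<epsilon> = \<eta> powr (-1/6)\<close> and the Brownian scaling \<open>b \<mapsto> \<epsilon> b (\<cdot> / \<epsilon>\<^sup>2)\<close>, the logarithmic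
  derivative of \<open>f\<close> becomes, for a fixed path, a perturbation of the Riccati equation of \<open>TW\<^sub>\<beta>\<close>.
  If the Riccati solution explodes, so does the perturbed one for small \<open>\<epsilon>\<close>, by continuous dependence on compact
  intervals. If it does not explode for some \<open>\<mu>' < \<mu>\<close>, then at level \<open>\<mu>\<close> it returns to positive values at
  arbitrarily late times, after which a barrier at \<open>- max (sqrt t) (\<epsilon> t) / 4\<close> keeps the perturbed solution alive for all
  small \<open>\<epsilon>\<close>. So the event in question is squeezed between the events for \<open>\<mu>'\<close> and \<open>\<mu>\<close>, and
  continuity of the distribution function at \<open>\<mu>\<close> closes the gap.\<close>

section \<open>Linear first-order systems\<close>

text \<open>Three points lie behind the overview. First, \<open>measure\<close> is 0 on
  non-measurable sets and \<open>M\<close> need not be complete, so an almost sure description of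
  \<open>Lambda0\<close> is not enough: its events must be shown measurable over all paths,
  including those where \<open>SS m\<close> is not integrable. There the eigenvalue condition is
  analysed separately (\<open>ev_iff_nonTC\<close>), and the quantifier over the spectral parameter
  is made countable by compactness. Second, no derivative of the noise may occur: subtracting
  \<open>\<sigma> W\<close> from the Riccati solution leaves an ordinary differential equation,
  whose linear form \<open>f' = s h\<close>, \<open>h' = - g f\<close> is also that of the string
  equation. One theory of such systems, built on explicit Picard iterates that are visibly
  measurable in the path, serves both. Third, solutions converge on compact intervals only, while
  positivity is wanted on a half-line. Hence the barrier must take over at a time \<open>T\<close>
  independent of \<open>\<epsilon>\<close>; this is why the return of the Riccati solution to
  positive values and global growth bounds on the path are established. Equality in law of rescaled
  motions lets one path serve for every \<open>\<epsilon>\<close>.\<close>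

lemma integrable_on_atLeast_subinterval:
  fixes f :: "real \<Rightarrow> real"
  assumes "continuous_on {0..} f" "0 \<le> a"
  shows "f integrable_on {a..b}"
  by (rule integrable_continuous_real, rule continuous_on_subset[OF assms(1)]) (use assms in auto)

lemma integral_diff_atLeast:
  fixes f :: "real \<Rightarrow> real"
  assumes "continuous_on {0..} f" "0 \<le> x" "x \<le> y"
  shows "integral {0..y} f - integral {0..x} f = integral {x..y} f"
  using Henstock_Kurzweil_Integration.integral_combine[of 0 x y f] integrable_on_atLeast_subinterval[OF assms(1), of 0 y] assms by auto

lemma continuous_on_integral_upper:
  fixes f :: "real \<Rightarrow> real"
  assumes "continuous_on {0..} f"
  shows "continuous_on {0..} (\<lambda>x. integral {0..x} f)"
proof -
  have "continuous (at x within {0..}) (\<lambda>x. integral {0..x} f)" if "x \<ge> 0" for x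
  proof -
    have "continuous_on {0..x+1} (\<lambda>x. integral {0..x} f)"
      by (rule indefinite_integral_continuous_1, rule integrable_on_atLeast_subinterval[OF assms]) auto
    then have "continuous (at x within {0..x+1}) (\<lambda>x. integral {0..x} f)"
      using that by (auto simp: continuous_on_eq_continuous_within)
    moreover have "at x within {0..x+1} = at x within {0..}"
      by (rule at_within_nhd[of x "{x-1<..<x+1}"]) auto
    ultimately show ?thesis by (simp add: continuous_within)
  qed
  then show ?thesis by (auto simp: continuous_on_eq_continuous_within)
qed

lemma DERIV_integral_upper:
  fixes f :: "real \<Rightarrow> real"
  assumes "continuous_on {0..} f" "x > 0"
  shows "DERIV (\<lambda>x. integral {0..x} f) x :> f x"
proof -
  have "((\<lambda>x. integral {0..x} f) has_real_derivative f x) (at x within {0..x+1})"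
    by (rule integral_has_real_derivative, rule continuous_on_subset[OF assms(1)]) (use assms in auto)
  moreover have "at x within {0..x+1} = at x" using assms by (intro at_within_interior) auto
  ultimately show ?thesis by simp
qed

lemma integral_of_DERIV:
  fixes f F :: "real \<Rightarrow> real"
  assumes "continuous_on {0..} F" "\<And>x. x > 0 \<Longrightarrow> DERIV F x :> f x" "0 \<le> a" "a \<le> b"
  shows "integral {a..b} f = F b - F a"
proof -
  have "(f has_integral (F b - F a)) {a..b}"
    by (rule fundamental_theorem_of_calculus_interior)
       (use assms in \<open>auto intro: continuous_on_subset simp: has_real_derivative_iff_has_vector_derivative[symmetric]\<close>)
  then show ?thesis by (rule integral_unique)
qed

text \<open>The integrating factor \<open>exp (- K * x)\<close> makes
  \<open>c + K * integral {0..x} e\<close> nonincreasing. Only the integral is differentiated, so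
  continuity of \<open>e\<close> suffices.\<close>

lemma gronwall:
  fixes e :: "real \<Rightarrow> real"
  assumes "continuous_on {0..T} e" "K \<ge> 0" "\<And>x. 0 \<le> x \<Longrightarrow> x \<le> T \<Longrightarrow> e x \<le> c + K * integral {0..x} e"
    and "0 \<le> x" "x \<le> T"
  shows "e x \<le> c * exp (K * x)"
proof -
  let ?F = "\<lambda>x. (c + K * integral {0..x} e) * exp (- K * x)"
  have "?F x \<le> ?F 0"
  proof (rule DERIV_nonpos_imp_decreasing_open[where f="?F" and a=0 and b=x])
    show "0 \<le> x" by fact
    show "continuous_on {0..x} ?F"
      by (intro continuous_intros indefinite_integral_continuous_1 integrable_continuous_real continuous_on_subset[OF assms(1)])
        (use assms in auto)
    fix y assume y: "0 < y" "y < x"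
    have "((\<lambda>x. integral {0..x} e) has_real_derivative e y) (at y within {0..T})"
      by (rule integral_has_real_derivative) (use assms y in auto)
    moreover have "at y within {0..T} = at y" using assms y by (intro at_within_interior) auto
    ultimately have d: "DERIV (\<lambda>x. integral {0..x} e) y :> e y" by simp
    have "DERIV ?F y :> K * e y * exp (- K * y) + (c + K * integral {0..y} e) * (exp (- K * y) * - K)"
      by (rule derivative_eq_intros d | simp)+
    moreover have "K * e y * exp (- K * y) + (c + K * integral {0..y} e) * (exp (- K * y) * - K)
       = - (K * exp (- K * y)) * (c + K * integral {0..y} e - e y)" by (simp add: algebra_simps)
    moreover have "\<dots> \<le> 0" using assms(2) assms(3)[of y] y assms by (intro mult_nonpos_nonneg) auto
    ultimately show "\<exists>z. DERIV ?F y :> z \<and> z \<le> 0" by metis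
  qed
  then have "(c + K * integral {0..x} e) * exp (- K * x) \<le> c" by simp
  then have "c + K * integral {0..x} e \<le> c * exp (K * x)" by (simp add: exp_minus field_simps)
  then show ?thesis using assms(3)[of x] assms(4,5) by linarith
qed

text \<open>The witness is the infimum of the closed set where \<open>f <= 0\<close>; the
  intermediate value theorem excludes a negative value there. The strict sign before the first zero
  is what the later continuation arguments rest on.\<close>

lemma first_zero:
  fixes f :: "real \<Rightarrow> real"
  assumes "continuous_on {a..b} f" "f a > 0" "f b \<le> 0" "a \<le> b"
  obtains c where "a < c" "c \<le> b" "f c = 0" "\<And>x. a \<le> x \<Longrightarrow> x < c \<Longrightarrow> f x > 0"
proof -
  let ?Z = "{x \<in> {a..b}. f x \<le> 0}"
  have cl: "closed ?Z"
    using continuous_on_closed_Collect_le[OF assms(1), of "\<lambda>_. 0"] by (simp add: continuous_on_const)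
  have ne: "b \<in> ?Z" using assms by auto
  have bd: "bdd_below ?Z" by (rule bdd_belowI[of _ a]) auto
  define c where "c = Inf ?Z"
  have cZ: "c \<in> ?Z" unfolding c_def using closed_contains_Inf[OF _ bd cl] ne by blast
  have pos: "f x > 0" if "a \<le> x" "x < c" for x
  proof (rule ccontr)
    assume "\<not> f x > 0"
    then have "x \<in> ?Z" using that cZ by auto
    then have "c \<le> x" unfolding c_def by (rule cInf_lower[OF _ bd])
    then show False using that by simp
  qed
  have ac: "a < c" using cZ assms(2) by (cases "a = c") auto
  have "f c \<ge> 0"
  proof (rule ccontr)
    assume "\<not> f c \<ge> 0"
    then obtain x where x: "a \<le> x" "x \<le> c" "f x = 0"
      using IVT2'[of f c 0 a] assms cZ ac continuous_on_subset[OF assms(1), of "{a..c}"] by auto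
    with pos[of x] \<open>\<not> f c \<ge> 0\<close> show False by (cases "x = c") auto
  qed
  then have "f c = 0" using cZ by auto
  then show ?thesis using that[of c] pos ac cZ by auto
qed

text \<open>Time reversal turns the last visit of a level into a first zero.\<close>

lemma last_reach:
  fixes f :: "real \<Rightarrow> real"
  assumes "continuous_on {a..b} f" "f a \<ge> y" "f b < y" "a \<le> b"
  obtains c where "a \<le> c" "c < b" "f c = y" "\<And>x. c < x \<Longrightarrow> x \<le> b \<Longrightarrow> f x < y"
proof -
  have "continuous_on {- b.. - a} (\<lambda>x. y - f (- x))"
    by (intro continuous_intros continuous_on_compose2[OF assms(1)]) auto
  moreover have "y - f (- (- b)) > 0" "y - f (- (- a)) \<le> 0" "- b \<le> - a" using assms by auto
  ultimately obtain c where c: "- b < c" "c \<le> - a" "y - f (- c) = 0" "\<And>x. - b \<le> x \<Longrightarrow> x < c \<Longrightarrow> y - f (- x) > 0"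
    using first_zero[of "-b" "-a" "\<lambda>x. y - f (- x)"] by metis
  show ?thesis
  proof (rule that[of "- c"])
    show "f x < y" if "- c < x" "x \<le> b" for x using c(4)[of "- x"] that by auto
  qed (use c in auto)
qed

text \<open>The Sturm-Liouville equation \<open>(f' / s)' = - g f\<close> for the pair of
  \<open>f\<close> and its quasi-derivative \<open>h = f' / s\<close>, so that the coefficients need
  not be differentiable. Derivatives are asked for at positive points only; continuity carries the
  behaviour at 0.\<close>

definition lsol :: "(real \<Rightarrow> real) \<Rightarrow> (real \<Rightarrow> real) \<Rightarrow> (real \<Rightarrow> real) \<Rightarrow> (real \<Rightarrow> real) \<Rightarrow> bool" where
  "lsol s g f h \<longleftrightarrow> continuous_on {0..} f \<and> continuous_on {0..} h \<and>
     (\<forall>x>0. DERIV f x :> s x * h x) \<and> (\<forall>x>0. DERIV h x :> - g x * f x)"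

lemma lsolD:
  assumes "lsol s g f h"
  shows "continuous_on {0..} f" "continuous_on {0..} h"
    "\<And>x. x > 0 \<Longrightarrow> DERIV f x :> s x * h x" "\<And>x. x > 0 \<Longrightarrow> DERIV h x :> - g x * f x"
  using assms unfolding lsol_def by auto

lemma lsol_integral:
  assumes "lsol s g f h" "0 \<le> a" "a \<le> b"
  shows "f b - f a = integral {a..b} (\<lambda>t. s t * h t)" "h b - h a = - integral {a..b} (\<lambda>t. g t * f t)"
  using integral_of_DERIV[OF lsolD(1,3)[OF assms(1)] assms(2,3)] integral_of_DERIV[OF lsolD(2,4)[OF assms(1)] assms(2,3)]
  by auto

lemma continuous_bounded_Icc:
  fixes f :: "real \<Rightarrow> real"
  assumes "continuous_on {0..} f"
  obtains K where "K > 0" "\<And>x. 0 \<le> x \<Longrightarrow> x \<le> T \<Longrightarrow> \<bar>f x\<bar> \<le> K"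
proof -
  have "bounded (f ` {0..T})"
    by (intro compact_imp_bounded compact_continuous_image continuous_on_subset[OF assms]) auto
  then obtain K where "K > 0" "\<forall>y \<in> f ` {0..T}. norm y \<le> K" using bounded_pos by blast
  then show ?thesis using that[of K] by auto
qed

text \<open>Gronwall for \<open>|f| + |h|\<close> with zero initial data, the coefficients being
  bounded on \<open>[0, x]\<close>.\<close>

lemma lsol_zero:
  assumes "lsol s g f h" "continuous_on {0..} s" "continuous_on {0..} g" "f 0 = 0" "h 0 = 0" "x \<ge> 0"
  shows "f x = 0" "h x = 0"
proof -
  note D = lsolD[OF assms(1)]
  obtain K1 where K1: "K1 > 0" "\<And>t. 0 \<le> t \<Longrightarrow> t \<le> x \<Longrightarrow> \<bar>s t\<bar> \<le> K1" using continuous_bounded_Icc[OF assms(2)] by blast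
  obtain K2 where K2: "K2 > 0" "\<And>t. 0 \<le> t \<Longrightarrow> t \<le> x \<Longrightarrow> \<bar>g t\<bar> \<le> K2" using continuous_bounded_Icc[OF assms(3)] by blast
  define K where "K = K1 + K2"
  let ?e = "\<lambda>t. \<bar>f t\<bar> + \<bar>h t\<bar>"
  have ce: "continuous_on {0..} ?e" by (intro continuous_intros D)
  have "?e x \<le> 0 * exp (K * x)"
  proof (rule gronwall)
    show "continuous_on {0..x} ?e" by (rule continuous_on_subset[OF ce]) auto
    show "0 \<le> K" using K1 K2 by (simp add: K_def)
    fix y assume y: "0 \<le> y" "y \<le> x"
    have "\<bar>f y\<bar> \<le> integral {0..y} (\<lambda>t. K1 * \<bar>h t\<bar>)"
    proof -
      have "norm (integral {0..y} (\<lambda>t. s t * h t)) \<le> integral {0..y} (\<lambda>t. K1 * \<bar>h t\<bar>)"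
        by (rule integral_norm_bound_integral)
          (use y K1 in \<open>auto intro!: integrable_on_atLeast_subinterval continuous_intros assms D mult_mono simp: abs_mult\<close>)
      then show ?thesis using lsol_integral(1)[OF assms(1), of 0 y] y assms by simp
    qed
    moreover have "\<bar>h y\<bar> \<le> integral {0..y} (\<lambda>t. K2 * \<bar>f t\<bar>)"
    proof -
      have "norm (integral {0..y} (\<lambda>t. g t * f t)) \<le> integral {0..y} (\<lambda>t. K2 * \<bar>f t\<bar>)"
        by (rule integral_norm_bound_integral)
          (use y K2 in \<open>auto intro!: integrable_on_atLeast_subinterval continuous_intros assms D mult_mono simp: abs_mult\<close>)
      then show ?thesis using lsol_integral(2)[OF assms(1), of 0 y] y assms by simp
    qed
    moreover have "integral {0..y} (\<lambda>t. K1 * \<bar>h t\<bar>) \<le> integral {0..y} (\<lambda>t. K * \<bar>h t\<bar>)"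
      by (rule integral_le) (auto intro!: integrable_on_atLeast_subinterval continuous_intros D mult_right_mono simp: K_def K2(1) less_imp_le)
    moreover have "integral {0..y} (\<lambda>t. K2 * \<bar>f t\<bar>) \<le> integral {0..y} (\<lambda>t. K * \<bar>f t\<bar>)"
      by (rule integral_le) (auto intro!: integrable_on_atLeast_subinterval continuous_intros D mult_right_mono simp: K_def K1(1) less_imp_le)
    moreover have "integral {0..y} (\<lambda>t. K * \<bar>f t\<bar>) + integral {0..y} (\<lambda>t. K * \<bar>h t\<bar>) = K * integral {0..y} ?e"
      by (simp add: Henstock_Kurzweil_Integration.integral_add integrable_on_atLeast_subinterval continuous_intros D distrib_left)
    ultimately show "?e y \<le> 0 + K * integral {0..y} ?e" by linarith
  qed (use assms in auto)
  then show "f x = 0" "h x = 0" by auto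
qed

text \<open>Picard iterates for the initial data \<open>(0, 1)\<close>. An explicit iteration is
  chosen because each iterate arises from the coefficients by products and integrals, hence is
  measurable in the sample point when they are random.\<close>

primrec pic :: "(real \<Rightarrow> real) \<Rightarrow> (real \<Rightarrow> real) \<Rightarrow> nat \<Rightarrow> real \<Rightarrow> real \<times> real" where
  "pic s g 0 = (\<lambda>x. (0, 1))"
| "pic s g (Suc n) = (\<lambda>x. (integral {0..x} (\<lambda>t. s t * snd (pic s g n t)),
      1 - integral {0..x} (\<lambda>t. g t * fst (pic s g n t))))"

definition phi :: "(real \<Rightarrow> real) \<Rightarrow> (real \<Rightarrow> real) \<Rightarrow> real \<Rightarrow> real" where
  "phi s g x = lim (\<lambda>n. fst (pic s g n x))"

definition uu :: "(real \<Rightarrow> real) \<Rightarrow> (real \<Rightarrow> real) \<Rightarrow> real \<Rightarrow> real" where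
  "uu s g x = lim (\<lambda>n. snd (pic s g n x))"

lemma pic_cong:
  assumes "\<And>t. t \<ge> 0 \<Longrightarrow> s t = s' t" "\<And>t. t \<ge> 0 \<Longrightarrow> g t = g' t" "x \<ge> 0"
  shows "pic s g n x = pic s' g' n x"
  using assms(3)
proof (induction n arbitrary: x)
  case (Suc n)
  have "integral {0..x} (\<lambda>t. s t * snd (pic s g n t)) = integral {0..x} (\<lambda>t. s' t * snd (pic s' g' n t))"
    by (rule Henstock_Kurzweil_Integration.integral_cong) (use Suc.IH assms in auto)
  moreover have "integral {0..x} (\<lambda>t. g t * fst (pic s g n t)) = integral {0..x} (\<lambda>t. g' t * fst (pic s' g' n t))"
    by (rule Henstock_Kurzweil_Integration.integral_cong) (use Suc.IH assms in auto)
  ultimately show ?case by simp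
qed simp

text \<open>Used when a functional of the path is transported to paths restricted to nonnegative
  times.\<close>

lemma phi_cong:
  assumes "\<And>t. t \<ge> 0 \<Longrightarrow> s t = s' t" "\<And>t. t \<ge> 0 \<Longrightarrow> g t = g' t" "x \<ge> 0"
  shows "phi s g x = phi s' g' x" "uu s g x = uu s' g' x"
  unfolding phi_def uu_def using pic_cong[OF assms] by simp_all

lemma continuous_on_atLeast_from_Icc:
  fixes f :: "real \<Rightarrow> real"
  assumes "\<And>T. continuous_on {0..T} f"
  shows "continuous_on {0..} f"
proof -
  have "continuous (at x within {0..}) f" if "x \<ge> 0" for x
  proof -
    have "continuous (at x within {0..x+1}) f"
      using that assms[of "x+1"] by (auto simp: continuous_on_eq_continuous_within)
    moreover have "at x within {0..x+1} = at x within {0..}"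
      by (rule at_within_nhd[of x "{x-1<..<x+1}"]) auto
    ultimately show ?thesis by (simp add: continuous_within)
  qed
  then show ?thesis by (auto simp: continuous_on_eq_continuous_within)
qed

section \<open>Existence and uniqueness by Picard iteration\<close>

context
  fixes s g :: "real \<Rightarrow> real"
  assumes cs: "continuous_on {0..} s" and cg: "continuous_on {0..} g"
begin

lemma continuous_pic:
  "continuous_on {0..} (\<lambda>x. fst (pic s g n x))" "continuous_on {0..} (\<lambda>x. snd (pic s g n x))"
  by (induction n) (auto intro!: continuous_intros continuous_on_integral_upper cs cg)

text \<open>Integrating \<open>K\<close> times one term of the exponential series for
  \<open>K * x\<close> gives the next term. The increments of the iterates are thus dominated by
  that series, which gives uniform convergence on compact intervals.\<close>

lemma pic_step_bound:
  assumes K: "K > 0" "\<And>t. 0 \<le> t \<Longrightarrow> t \<le> T \<Longrightarrow> \<bar>s t\<bar> \<le> K" "\<And>t. 0 \<le> t \<Longrightarrow> t \<le> T \<Longrightarrow> \<bar>g t\<bar> \<le> K"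
    and "0 \<le> x" "x \<le> T"
  shows "\<bar>fst (pic s g (Suc n) x) - fst (pic s g n x)\<bar> \<le> (K * x) ^ Suc n / fact (Suc n) \<and>
     \<bar>snd (pic s g (Suc n) x) - snd (pic s g n x)\<bar> \<le> (K * x) ^ Suc n / fact (Suc n)"
  using assms(4,5)
proof (induction n arbitrary: x)
  case 0
  have "norm (integral {0..x} s) \<le> integral {0..x} (\<lambda>_. K)"
    by (rule integral_norm_bound_integral) (use 0 K in \<open>auto intro!: integrable_on_atLeast_subinterval cs\<close>)
  then show ?case using 0 K by (simp add: mult.commute)
next
  case (Suc n)
  have int: "integral {0..x} (\<lambda>t. K * ((K * t) ^ Suc n / fact (Suc n))) = (K * x) ^ Suc (Suc n) / fact (Suc (Suc n))"
  proof -
    have e: "real (Suc (Suc n)) * (K * t) ^ Suc n * K / fact (Suc (Suc n)) = K * ((K * t) ^ Suc n / fact (Suc n))" for t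
      by (simp add: fact_Suc[of "Suc n"] del: of_nat_Suc fact_Suc)
    have "integral {0..x} (\<lambda>t. K * ((K * t) ^ Suc n / fact (Suc n)))
        = (K * x) ^ Suc (Suc n) / fact (Suc (Suc n)) - (K * 0) ^ Suc (Suc n) / fact (Suc (Suc n))"
    proof (rule integral_of_DERIV)
      fix t :: real
      have "DERIV (\<lambda>x. (K * x) ^ Suc (Suc n) / fact (Suc (Suc n))) t :> real (Suc (Suc n)) * (K * t) ^ Suc n * K / fact (Suc (Suc n))"
        by (rule derivative_eq_intros refl | simp)+
      then show "DERIV (\<lambda>x. (K * x) ^ Suc (Suc n) / fact (Suc (Suc n))) t :> K * ((K * t) ^ Suc n / fact (Suc n))"
        unfolding e .
    qed (use Suc in \<open>auto intro!: continuous_intros\<close>)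
    then show ?thesis by simp
  qed
  have a: "\<bar>integral {0..x} (\<lambda>t. k t * f t) - integral {0..x} (\<lambda>t. k t * f' t)\<bar> \<le> (K * x) ^ Suc (Suc n) / fact (Suc (Suc n))"
    if ck: "continuous_on {0..} k" and cf: "continuous_on {0..} f" "continuous_on {0..} f'"
    and kb: "\<And>t. 0 \<le> t \<Longrightarrow> t \<le> T \<Longrightarrow> \<bar>k t\<bar> \<le> K"
    and fb: "\<And>t. 0 \<le> t \<Longrightarrow> t \<le> T \<Longrightarrow> \<bar>f t - f' t\<bar> \<le> (K * t) ^ Suc n / fact (Suc n)" for k f f' :: "real \<Rightarrow> real"
  proof -
    have "integral {0..x} (\<lambda>t. k t * f t) - integral {0..x} (\<lambda>t. k t * f' t) = integral {0..x} (\<lambda>t. k t * (f t - f' t))"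
      by (subst Henstock_Kurzweil_Integration.integral_diff[symmetric])
        (auto intro!: integrable_on_atLeast_subinterval continuous_intros ck cf simp: algebra_simps)
    moreover have "norm (integral {0..x} (\<lambda>t. k t * (f t - f' t))) \<le> integral {0..x} (\<lambda>t. K * ((K * t) ^ Suc n / fact (Suc n)))"
    proof (rule integral_norm_bound_integral)
      fix t assume "t \<in> {0..x}"
      then have "0 \<le> t" "t \<le> T" using Suc by auto
      then show "norm (k t * (f t - f' t)) \<le> K * ((K * t) ^ Suc n / fact (Suc n))"
        unfolding real_norm_def abs_mult by (intro mult_mono kb fb) (use K in auto)
    qed (auto intro!: integrable_on_atLeast_subinterval continuous_intros ck cf)
    ultimately show ?thesis using int by simp
  qed
  have "\<bar>fst (pic s g (Suc (Suc n)) x) - fst (pic s g (Suc n) x)\<bar> \<le> (K * x) ^ Suc (Suc n) / fact (Suc (Suc n))"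
    using a[OF cs continuous_pic(2)[of "Suc n"] continuous_pic(2)[of n] K(2)] Suc.IH by (simp del: fact_Suc power_Suc)
  moreover have "\<bar>snd (pic s g (Suc (Suc n)) x) - snd (pic s g (Suc n) x)\<bar> \<le> (K * x) ^ Suc (Suc n) / fact (Suc (Suc n))"
    using a[OF cg continuous_pic(1)[of "Suc n"] continuous_pic(1)[of n] K(3)] Suc.IH
    by (simp del: fact_Suc power_Suc add: abs_minus_commute)
  ultimately show ?case by blast
qed

lemma pic_uniform_limit:
  "uniform_limit {0..T} (\<lambda>n x. fst (pic s g n x)) (phi s g) sequentially"
  "uniform_limit {0..T} (\<lambda>n x. snd (pic s g n x)) (uu s g) sequentially"
proof -
  obtain K1 where K1: "K1 > 0" "\<And>t. 0 \<le> t \<Longrightarrow> t \<le> T \<Longrightarrow> \<bar>s t\<bar> \<le> K1" using continuous_bounded_Icc[OF cs] by blast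
  obtain K2 where K2: "K2 > 0" "\<And>t. 0 \<le> t \<Longrightarrow> t \<le> T \<Longrightarrow> \<bar>g t\<bar> \<le> K2" using continuous_bounded_Icc[OF cg] by blast
  define K where "K = K1 + K2"
  have K: "K > 0" "\<And>t. 0 \<le> t \<Longrightarrow> t \<le> T \<Longrightarrow> \<bar>s t\<bar> \<le> K" "\<And>t. 0 \<le> t \<Longrightarrow> t \<le> T \<Longrightarrow> \<bar>g t\<bar> \<le> K"
  proof -
    show "K > 0" using K1 K2 by (simp add: K_def)
    show "\<bar>s t\<bar> \<le> K" if "0 \<le> t" "t \<le> T" for t using K1(2)[OF that] K2(1) by (simp add: K_def)
    show "\<bar>g t\<bar> \<le> K" if "0 \<le> t" "t \<le> T" for t using K2(2)[OF that] K1(1) by (simp add: K_def)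
  qed
  have sm: "summable (\<lambda>n. (K * T) ^ Suc n / fact (Suc n))"
    using summable_exp[of "K * T"] summable_Suc_iff[of "\<lambda>n. (K * T) ^ n / fact n"]
    by (simp only: divide_inverse mult.commute)
  have *: "uniform_limit {0..T} p (\<lambda>x. lim (\<lambda>n. p n x)) sequentially"
    if b: "\<And>n x. x \<in> {0..T} \<Longrightarrow> \<bar>p (Suc n) x - p n x\<bar> \<le> (K * x) ^ Suc n / fact (Suc n)" for p :: "nat \<Rightarrow> real \<Rightarrow> real"
  proof -
    have "uniformly_convergent_on {0..T} (\<lambda>n x. \<Sum>i<n. (p (Suc i) x - p i x))"
    proof (rule Weierstrass_m_test'[OF _ sm])
      fix n x assume x: "x \<in> {0..T}"
      have "(K * x) ^ Suc n / fact (Suc n) \<le> (K * T) ^ Suc n / fact (Suc n)"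
        using x K(1) by (intro divide_right_mono power_mono mult_left_mono) auto
      then show "norm (p (Suc n) x - p n x) \<le> (K * T) ^ Suc n / fact (Suc n)" using b[OF x, of n] by simp
    qed
    then obtain l where "uniform_limit {0..T} (\<lambda>n x. \<Sum>i<n. (p (Suc i) x - p i x)) l sequentially"
      by (auto simp: uniformly_convergent_on_def)
    then have "uniform_limit {0..T} (\<lambda>n x. p n x - p 0 x) l sequentially"
      using sum_lessThan_telescope[of "\<lambda>i. p i _"] by simp
    then have "uniform_limit {0..T} (\<lambda>n x. (p n x - p 0 x) + p 0 x) (\<lambda>x. l x + p 0 x) sequentially"
      by (intro uniform_limit_add uniform_limit_const)
    then have u: "uniform_limit {0..T} p (\<lambda>x. l x + p 0 x) sequentially" by simp
    have "lim (\<lambda>n. p n x) = l x + p 0 x" if "x \<in> {0..T}" for x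
      by (rule limI) (rule tendsto_uniform_limitI[OF u that])
    then show ?thesis using u by (subst uniform_limit_cong'[OF refl]) auto
  qed
  show "uniform_limit {0..T} (\<lambda>n x. fst (pic s g n x)) (phi s g) sequentially"
    "uniform_limit {0..T} (\<lambda>n x. snd (pic s g n x)) (uu s g) sequentially"
    unfolding phi_def[abs_def] uu_def[abs_def] by (intro *; use pic_step_bound[OF K] in auto)+
qed

lemma pic_tendsto:
  assumes "x \<ge> 0"
  shows "(\<lambda>n. fst (pic s g n x)) \<longlonglongrightarrow> phi s g x" "(\<lambda>n. snd (pic s g n x)) \<longlonglongrightarrow> uu s g x"
  using tendsto_uniform_limitI[OF pic_uniform_limit(1)[of x]] tendsto_uniform_limitI[OF pic_uniform_limit(2)[of x]] assms by auto

lemma continuous_phi: "continuous_on {0..} (phi s g)"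
  by (intro continuous_on_atLeast_from_Icc uniform_limit_theorem[OF _ pic_uniform_limit(1)] always_eventually allI
      continuous_on_subset[OF continuous_pic(1)]) auto

lemma continuous_uu: "continuous_on {0..} (uu s g)"
  by (intro continuous_on_atLeast_from_Icc uniform_limit_theorem[OF _ pic_uniform_limit(2)] always_eventually allI
      continuous_on_subset[OF continuous_pic(2)]) auto

lemma phi_integral:
  assumes "x \<ge> 0"
  shows "phi s g x = integral {0..x} (\<lambda>t. s t * uu s g t)" "uu s g x = 1 - integral {0..x} (\<lambda>t. g t * phi s g t)"
proof -
  have *: "(\<lambda>n. integral {0..x} (\<lambda>t. k t * p n t)) \<longlonglongrightarrow> integral {0..x} (\<lambda>t. k t * l t)"
    if k: "continuous_on {0..} k" and p: "\<And>n. continuous_on {0..} (p n)" and l: "continuous_on {0..} l"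
      and u: "uniform_limit {0..x} p l sequentially" for k l :: "real \<Rightarrow> real" and p
  proof -
    have b: "bounded (f ` {0..x})" if "continuous_on {0..} f" for f :: "real \<Rightarrow> real"
      by (intro compact_imp_bounded compact_continuous_image continuous_on_subset[OF that]) auto
    have "uniform_limit {0..x} (\<lambda>n t. k t * p n t) (\<lambda>t. k t * l t) sequentially"
      by (intro uniform_lim_mult uniform_limit_const u b k l)
    then obtain I J where IJ: "\<And>n. ((\<lambda>t. k t * p n t) has_integral I n) {0..x}" "((\<lambda>t. k t * l t) has_integral J) {0..x}" "I \<longlonglongrightarrow> J"
      by (rule uniform_limit_integral) (auto intro!: continuous_intros continuous_on_subset[OF k] continuous_on_subset[OF p])
    have "integral {0..x} (\<lambda>t. k t * l t) = J" "\<And>n. integral {0..x} (\<lambda>t. k t * p n t) = I n"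
      using IJ(1,2) integral_unique by blast+
    then show ?thesis using IJ(3) by presburger
  qed
  have "(\<lambda>n. fst (pic s g (Suc n) x)) \<longlonglongrightarrow> integral {0..x} (\<lambda>t. s t * uu s g t)"
    by simp (intro * cs continuous_pic continuous_uu pic_uniform_limit)
  with LIMSEQ_Suc[OF pic_tendsto(1)[OF assms]] show "phi s g x = integral {0..x} (\<lambda>t. s t * uu s g t)"
    using LIMSEQ_unique by blast
  have "(\<lambda>n. snd (pic s g (Suc n) x)) \<longlonglongrightarrow> 1 - integral {0..x} (\<lambda>t. g t * phi s g t)"
    by simp (intro tendsto_intros * cg continuous_pic continuous_phi pic_uniform_limit)
  with LIMSEQ_Suc[OF pic_tendsto(2)[OF assms]] show "uu s g x = 1 - integral {0..x} (\<lambda>t. g t * phi s g t)"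
    using LIMSEQ_unique by blast
qed

lemma phi_0 [simp]: "phi s g 0 = 0" and uu_0 [simp]: "uu s g 0 = 1"
  using phi_integral[of 0] by auto

lemma lsol_phi: "lsol s g (phi s g) (uu s g)"
proof -
  have "DERIV (phi s g) x :> s x * uu s g x" if "x > 0" for x
    by (rule has_field_derivative_transform_within_open[OF DERIV_integral_upper[OF _ that], where S="{0<..}"])
      (use that in \<open>auto intro!: continuous_intros cs continuous_uu simp: phi_integral\<close>)
  moreover have "DERIV (uu s g) x :> - g x * phi s g x" if "x > 0" for x
  proof -
    have "DERIV (\<lambda>x. 1 - integral {0..x} (\<lambda>t. g t * phi s g t)) x :> - g x * phi s g x"
      by (rule derivative_eq_intros DERIV_integral_upper | rule that continuous_intros cg continuous_phi | simp)+
    then show ?thesis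
      by (rule has_field_derivative_transform_within_open[where S="{0<..}"])
        (use that in \<open>auto simp: phi_integral(2)\<close>)
  qed
  ultimately show ?thesis unfolding lsol_def using continuous_phi continuous_uu by auto
qed

lemma lsol_unique:
  assumes "lsol s g f h" "f 0 = 0" "x \<ge> 0"
  shows "f x = h 0 * phi s g x" "h x = h 0 * uu s g x"
proof -
  have "lsol s g (\<lambda>x. f x - h 0 * phi s g x) (\<lambda>x. h x - h 0 * uu s g x)"
    unfolding lsol_def using lsolD[OF assms(1)] lsolD[OF lsol_phi]
    by (auto intro!: continuous_intros derivative_eq_intros simp: algebra_simps)
  from lsol_zero[OF this cs cg _ _ assms(3)] assms(2)
  show "f x = h 0 * phi s g x" "h x = h 0 * uu s g x" by auto
qed

end

section \<open>Zeros and signs of solutions\<close>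

lemma le_by_deriv:
  fixes F F' :: "real \<Rightarrow> real"
  assumes "a \<le> b" "continuous_on {a..b} F" "\<And>x. a < x \<Longrightarrow> x < b \<Longrightarrow> DERIV F x :> F' x" "\<And>x. a < x \<Longrightarrow> x < b \<Longrightarrow> F' x \<ge> 0"
  shows "F a \<le> F b"
  using DERIV_nonneg_imp_increasing_open[of a b F] assms by blast

lemma ge_by_deriv:
  fixes F F' :: "real \<Rightarrow> real"
  assumes "a \<le> b" "continuous_on {a..b} F" "\<And>x. a < x \<Longrightarrow> x < b \<Longrightarrow> DERIV F x :> F' x" "\<And>x. a < x \<Longrightarrow> x < b \<Longrightarrow> F' x \<le> 0"
  shows "F b \<le> F a"
  using DERIV_nonpos_imp_decreasing_open[of a b F] assms by blast

lemma less_by_deriv: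
  fixes F F' :: "real \<Rightarrow> real"
  assumes "a < b" "continuous_on {a..b} F" "\<And>x. a < x \<Longrightarrow> x < b \<Longrightarrow> DERIV F x :> F' x" "\<And>x. a < x \<Longrightarrow> x < b \<Longrightarrow> F' x > 0"
  shows "F a < F b"
  using DERIV_pos_imp_increasing_open[of a b F] assms by blast

lemma lsol_increasing:
  assumes "lsol s g f h" "0 \<le> a" "a < b" "\<And>x. a < x \<Longrightarrow> x < b \<Longrightarrow> s x * h x > 0"
  shows "f a < f b"
  by (rule DERIV_pos_imp_increasing_open[OF assms(3)])
    (use assms lsolD[OF assms(1)] in \<open>auto intro!: continuous_on_subset[OF lsolD(1)[OF assms(1)]] exI[of _ "s _ * h _"]\<close>)

lemma phi_uu_pos_near_0:
  assumes cs: "continuous_on {0..} s" and cg: "continuous_on {0..} g" and pos: "\<And>x. x \<ge> 0 \<Longrightarrow> s x > 0"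
  obtains d where "d > 0" "\<And>x. 0 < x \<Longrightarrow> x \<le> d \<Longrightarrow> phi s g x > 0 \<and> uu s g x > 1/2"
proof -
  note cu = continuous_uu[OF cs cg]
  obtain d where d: "d > 0" "\<And>x. 0 \<le> x \<Longrightarrow> dist x 0 < d \<Longrightarrow> dist (uu s g x) (uu s g 0) < 1/2"
    using cu unfolding continuous_on_iff by (metis atLeast_iff order_refl half_gt_zero zero_less_one)
  have u: "uu s g x > 1/2" if "0 \<le> x" "x < d" for x
    using d(2)[of x] that uu_0[OF cs cg] unfolding dist_real_def by (smt (verit) field_sum_of_halves)
  show ?thesis
  proof (rule that[of "d/2"])
    fix x assume x: "0 < x" "x \<le> d/2"
    have "phi s g 0 < phi s g x"
    proof (rule lsol_increasing[OF lsol_phi[OF cs cg]])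
      fix y assume y: "0 < y" "y < x"
      have "s y > 0" using pos y by simp
      moreover have "uu s g y > 1/2" using u[of y] y x d(1) by linarith
      ultimately show "s y * uu s g y > 0" by simp
    qed (use x in auto)
    then show "phi s g x > 0 \<and> uu s g x > 1/2" using u[of x] x d(1) phi_0[OF cs cg] by auto
  qed (use d in auto)
qed

text \<open>Swapping the two coefficients with opposite signs produces the second fundamental
  solution: \<open>uu\<close> and \<open>phi\<close> for the swapped system solve the original one
  with data \<open>(1, 0)\<close>. The determinant of the fundamental matrix is constant, so
  \<open>phi s g\<close> and \<open>uu s g\<close> have no common zero.\<close>

lemma phi_uu_det:
  assumes cs: "continuous_on {0..} s" and cg: "continuous_on {0..} g" and x: "x \<ge> 0"
  shows "uu (\<lambda>x. - g x) (\<lambda>x. - s x) x * uu s g x - phi (\<lambda>x. - g x) (\<lambda>x. - s x) x * phi s g x = 1"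
proof -
  have cs': "continuous_on {0..} (\<lambda>x. - s x)" and cg': "continuous_on {0..} (\<lambda>x. - g x)"
    by (intro continuous_intros cs cg)+
  note D = lsolD[OF lsol_phi[OF cs cg]] and D' = lsolD[OF lsol_phi[OF cg' cs']]
  let ?f = "\<lambda>x. uu (\<lambda>x. - g x) (\<lambda>x. - s x) x * uu s g x - phi (\<lambda>x. - g x) (\<lambda>x. - s x) x * phi s g x"
  have "?f x = ?f 0"
  proof (cases "x = 0")
    case False
    then show ?thesis using x
      by (intro DERIV_isconst_end[where f="?f" and a=0 and b=x])
        (auto intro!: continuous_intros continuous_on_subset[OF D(1)] continuous_on_subset[OF D(2)] continuous_on_subset[OF D'(1)]
          continuous_on_subset[OF D'(2)] derivative_eq_intros D D')
  qed simp
  then show ?thesis using cs cg cs' cg' by simp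
qed

text \<open>At the first zero of \<open>phi\<close> the determinant identity forbids
  \<open>uu = 0\<close>, and a positive slope would make \<open>phi\<close> negative just
  before.\<close>

lemma phi_zero_uu_neg:
  assumes cs: "continuous_on {0..} s" and cg: "continuous_on {0..} g" and pos: "\<And>x. x \<ge> 0 \<Longrightarrow> s x > 0"
    and "\<not> (\<forall>x>0. phi s g x > 0)"
  obtains c where "c > 0" "phi s g c = 0" "uu s g c < 0"
proof -
  obtain d where d: "d > 0" "\<And>x. 0 < x \<Longrightarrow> x \<le> d \<Longrightarrow> phi s g x > 0 \<and> uu s g x > 1/2"
    using phi_uu_pos_near_0[OF cs cg pos] by blast
  obtain b where b: "b > 0" "phi s g b \<le> 0" using assms(4) by force
  have db: "d \<le> b" using d(2)[of b] b by (cases "d \<le> b") auto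
  obtain c where c: "d < c" "c \<le> b" "phi s g c = 0" "\<And>x. d \<le> x \<Longrightarrow> x < c \<Longrightarrow> phi s g x > 0"
    using first_zero[of d b "phi s g"] d b db continuous_on_subset[OF continuous_phi[OF cs cg], of "{d..b}"] by auto
  have c0: "c > 0" using c d by simp
  have ne: "uu s g c \<noteq> 0" using phi_uu_det[OF cs cg, of c] c c0 by auto
  have D: "DERIV (phi s g) c :> s c * uu s g c" using lsolD(3)[OF lsol_phi[OF cs cg] c0] .
  have "\<not> uu s g c > 0"
  proof
    assume "uu s g c > 0"
    then have "s c * uu s g c > 0" using pos[of c] c0 by simp
    from DERIV_pos_inc_left[OF D this] obtain e where e: "e > 0" "\<And>h. 0 < h \<Longrightarrow> h < e \<Longrightarrow> phi s g (c - h) < phi s g c" by auto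
    define h where "h = min (e/2) (c - d)"
    have "0 < h" "h < e" "d \<le> c - h" "c - h < c" using e c by (auto simp: h_def min_def)
    then show False using e(2)[of h] c(4)[of "c - h"] c(3) by force
  qed
  then show ?thesis using that[of c] ne c0 c(3) by auto
qed

text \<open>The zero is crossed with negative slope. Unlike a zero, a strictly negative value
  survives a small perturbation of the coefficients.\<close>

lemma exists_phi_neg:
  assumes cs: "continuous_on {0..} s" and cg: "continuous_on {0..} g" and pos: "\<And>x. x \<ge> 0 \<Longrightarrow> s x > 0"
    and "\<not> (\<forall>x>0. phi s g x > 0)"
  obtains x where "x > 0" "phi s g x < 0"
proof -
  obtain c where c: "c > 0" "phi s g c = 0" "uu s g c < 0" by (rule phi_zero_uu_neg[OF assms]) auto
  have D: "DERIV (phi s g) c :> s c * uu s g c" using lsolD(3)[OF lsol_phi[OF cs cg] c(1)] .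
  have "s c * uu s g c < 0" using c pos[of c] by (intro mult_pos_neg) auto
  from DERIV_neg_dec_right[OF D this] obtain e where e: "e > 0" "\<And>h. 0 < h \<Longrightarrow> h < e \<Longrightarrow> phi s g c > phi s g (c + h)" by auto
  show ?thesis using that[of "c + e/2"] e(1) e(2)[of "e/2"] c by auto
qed

text \<open>Up to the first zero of \<open>uu\<close> the solution \<open>phi\<close> increases, so
  it is positive there and \<open>uu' = - g phi\<close> is strictly negative. Again the gain is a
  strict sign that persists under limits.\<close>

lemma exists_uu_neg:
  assumes cs: "continuous_on {0..} s" and cg: "continuous_on {0..} g" and pos: "\<And>x. x \<ge> 0 \<Longrightarrow> s x > 0"
    and gpos: "\<And>x. x \<ge> 0 \<Longrightarrow> g x > 0" and "\<not> (\<forall>x\<ge>0. uu s g x > 0)"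
  obtains x where "x > 0" "uu s g x < 0"
proof -
  obtain b where b: "b \<ge> 0" "uu s g b \<le> 0" using assms(5) by force
  obtain c where c: "0 < c" "c \<le> b" "uu s g c = 0" "\<And>x. 0 \<le> x \<Longrightarrow> x < c \<Longrightarrow> uu s g x > 0"
    using first_zero[of 0 b "uu s g"] b uu_0[OF cs cg] continuous_on_subset[OF continuous_uu[OF cs cg], of "{0..b}"] by auto
  have "phi s g 0 < phi s g c"
    by (rule lsol_increasing[OF lsol_phi[OF cs cg]]) (use c pos in auto)
  then have p: "phi s g c > 0" using phi_0[OF cs cg] by simp
  have D: "DERIV (uu s g) c :> - g c * phi s g c" using lsolD(4)[OF lsol_phi[OF cs cg]] c by auto
  have "- g c * phi s g c < 0" using gpos[of c] p c by simp
  from DERIV_neg_dec_right[OF D this] obtain e where e: "e > 0" "\<And>h. 0 < h \<Longrightarrow> h < e \<Longrightarrow> uu s g c > uu s g (c + h)" by auto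
  show ?thesis using that[of "c + e/2"] e(1) e(2)[of "e/2"] c by auto
qed

text \<open>For \<open>g <= 0\<close> every Picard iterate stays in the region where the first
  component is at least 0 and the second at least 1.\<close>

lemma uu_ge_1_if_nonpos:
  assumes cs: "continuous_on {0..} s" and cg: "continuous_on {0..} g" and pos: "\<And>x. x \<ge> 0 \<Longrightarrow> s x > 0"
    and gneg: "\<And>x. x \<ge> 0 \<Longrightarrow> g x \<le> 0" and x: "x \<ge> 0"
  shows "uu s g x \<ge> 1"
proof -
  have "\<forall>x\<ge>0. fst (pic s g n x) \<ge> 0 \<and> snd (pic s g n x) \<ge> 1" for n
  proof (induction n)
    case (Suc n)
    show ?case
    proof (intro allI impI conjI)
      fix x :: real assume x: "0 \<le> x"
      have "0 \<le> s t * snd (pic s g n t)" if "t \<ge> 0" for t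
        using Suc pos[OF that] that by (intro mult_nonneg_nonneg) force+
      then have "0 \<le> integral {0..x} (\<lambda>t. s t * snd (pic s g n t))"
        by (intro integral_nonneg) (auto intro!: integrable_on_atLeast_subinterval continuous_intros cs continuous_pic[OF cs cg])
      then show "fst (pic s g (Suc n) x) \<ge> 0" by simp
      have "0 \<le> integral {0..x} (\<lambda>t. - (g t * fst (pic s g n t)))"
        by (rule integral_nonneg) (use Suc gneg x in \<open>auto intro!: integrable_on_atLeast_subinterval continuous_intros cg continuous_pic[OF cs cg] mult_nonpos_nonneg\<close>)
      then show "snd (pic s g (Suc n) x) \<ge> 1" by simp
    qed
  qed auto
  then show ?thesis using x by (intro LIMSEQ_le_const[OF pic_tendsto(2)[OF cs cg x]]) auto
qed

section \<open>Wronskians and Sturm comparison\<close>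

definition wron :: "(real \<Rightarrow> real) \<Rightarrow> (real \<Rightarrow> real) \<Rightarrow> (real \<Rightarrow> real) \<Rightarrow> real \<Rightarrow> real" where
  "wron s g1 g2 x = phi s g2 x * uu s g1 x - phi s g1 x * uu s g2 x"

context
  fixes s g1 g2 :: "real \<Rightarrow> real"
  assumes cs: "continuous_on {0..} s" and cg1: "continuous_on {0..} g1" and cg2: "continuous_on {0..} g2"
    and pos: "\<And>x. x \<ge> 0 \<Longrightarrow> s x > 0" and le: "\<And>x. x \<ge> 0 \<Longrightarrow> g1 x \<le> g2 x"
begin

lemma continuous_wron: "continuous_on {0..} (wron s g1 g2)"
  unfolding wron_def[abs_def] by (intro continuous_intros continuous_phi continuous_uu cs cg1 cg2)

lemma DERIV_wron:
  assumes "x > 0" shows "DERIV (wron s g1 g2) x :> (g2 x - g1 x) * (phi s g1 x * phi s g2 x)"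
proof -
  note D = lsolD[OF lsol_phi[OF cs cg1]] and D' = lsolD[OF lsol_phi[OF cs cg2]]
  show ?thesis unfolding wron_def[abs_def]
    by (auto intro!: derivative_eq_intros D D' assms simp: algebra_simps)
qed

lemma wron_mono:
  assumes "0 \<le> a" "a \<le> b" "\<And>x. a < x \<Longrightarrow> x < b \<Longrightarrow> phi s g1 x * phi s g2 x \<ge> 0"
  shows "wron s g1 g2 a \<le> wron s g1 g2 b"
  by (rule le_by_deriv[OF assms(2)], rule continuous_on_subset[OF continuous_wron], use assms in simp, rule DERIV_wron)
    (use assms le in auto)

lemma wron_0: "wron s g1 g2 0 = 0" using cs cg1 cg2 by (simp add: wron_def)

lemma DERIV_phi_ratio:
  assumes "x > 0" "phi s g2 x \<noteq> 0"
  shows "DERIV (\<lambda>x. phi s g1 x / phi s g2 x) x :> s x * wron s g1 g2 x / (phi s g2 x)\<^sup>2"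
proof -
  note D = lsolD[OF lsol_phi[OF cs cg1]] and D' = lsolD[OF lsol_phi[OF cs cg2]]
  show ?thesis
    using assms by (auto intro!: derivative_eq_intros D D' simp: algebra_simps power2_eq_square wron_def)
qed

text \<open>Up to a first zero of the \<open>g1\<close> solution the Wronskian is nonnegative. The
  quotient \<open>phi s g1 / phi s g2\<close>, whose derivative is \<open>s\<close> times the
  Wronskian over a square, is then nondecreasing and cannot fall to 0.\<close>

lemma sturm_phi_pos:
  assumes p2: "\<And>x. 0 < x \<Longrightarrow> x \<le> X \<Longrightarrow> phi s g2 x > 0" and b: "0 < b" "b \<le> X"
  shows "phi s g1 b > 0"
proof (rule ccontr)
  assume nb: "\<not> phi s g1 b > 0"
  obtain d where d: "d > 0" "\<And>x. 0 < x \<Longrightarrow> x \<le> d \<Longrightarrow> phi s g1 x > 0 \<and> uu s g1 x > 1/2"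
    using phi_uu_pos_near_0[OF cs cg1 pos] by blast
  have db: "d \<le> b" using d(2)[of b] b nb by (cases "d \<le> b") auto
  obtain c where c: "d < c" "c \<le> b" "phi s g1 c = 0" "\<And>x. d \<le> x \<Longrightarrow> x < c \<Longrightarrow> phi s g1 x > 0"
    using first_zero[of d b "phi s g1"] d b db nb continuous_on_subset[OF continuous_phi[OF cs cg1], of "{d..b}"] by auto
  have p1: "phi s g1 x > 0" if "0 < x" "x < c" for x using d(2)[of x] c(4)[of x] that by (cases "x \<le> d") auto
  have w: "wron s g1 g2 x \<ge> 0" if "0 \<le> x" "x \<le> c" for x
  proof -
    have "0 \<le> phi s g1 y * phi s g2 y" if "0 < y" "y < x" for y
      using p1[of y] p2[of y] that \<open>x \<le> c\<close> c b by (intro mult_nonneg_nonneg) auto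
    then show ?thesis using wron_mono[of 0 x] wron_0 that by auto
  qed
  have "phi s g1 d / phi s g2 d \<le> phi s g1 c / phi s g2 c"
  proof (rule DERIV_nonneg_imp_increasing_open[where f="\<lambda>x. phi s g1 x / phi s g2 x"])
    fix x assume x: "d < x" "x < c"
    then have "x > 0" "phi s g2 x \<noteq> 0" "s x * wron s g1 g2 x / (phi s g2 x)\<^sup>2 \<ge> 0"
      using p2[of x] w[of x] d c b pos[of x] by auto
    then show "\<exists>y. ((\<lambda>x. phi s g1 x / phi s g2 x) has_real_derivative y) (at x) \<and> 0 \<le> y"
      using DERIV_phi_ratio[of x] by blast
  next
    have "phi s g2 x \<noteq> 0" if "x \<in> {d..c}" for x using p2[of x] that d c b by auto
    then show "continuous_on {d..c} (\<lambda>x. phi s g1 x / phi s g2 x)"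
      by (intro continuous_intros continuous_on_subset[OF continuous_phi[OF cs cg1]] continuous_on_subset[OF continuous_phi[OF cs cg2]])
        (use d in auto)
  qed (use c in auto)
  moreover have "phi s g1 d / phi s g2 d > 0" using d(2)[of d] p2[of d] d db b by auto
  ultimately show False using c by simp
qed

lemma sturm_wron_nonneg:
  assumes p2: "\<And>x. 0 < x \<Longrightarrow> x \<le> X \<Longrightarrow> phi s g2 x > 0" and b: "0 \<le> b" "b \<le> X"
  shows "wron s g1 g2 b \<ge> 0"
proof -
  have "0 \<le> phi s g1 y * phi s g2 y" if "0 < y" "y < b" for y
    using sturm_phi_pos[of X y] p2 that b by (intro mult_nonneg_nonneg) (auto intro: less_imp_le)
  then show ?thesis using wron_mono[of 0 b] wron_0 b by auto
qed

text \<open>The bound is the value at 1, since the Wronskian grows afterwards. A bound uniform up to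
  infinity is what excludes smaller eigenvalues and what separates two Riccati solutions.\<close>

lemma wron_pos_strict:
  assumes p2: "\<And>x. 0 < x \<Longrightarrow> phi s g2 x > 0" and less: "\<And>x. x > 0 \<Longrightarrow> g1 x < g2 x"
  obtains e where "e > 0" "\<And>x. x \<ge> 1 \<Longrightarrow> wron s g1 g2 x \<ge> e"
proof (rule that[of "wron s g1 g2 1"])
  have p: "phi s g1 x * phi s g2 x > 0" if "x > 0" for x
    using sturm_phi_pos[of x x] p2 that by simp
  have "wron s g1 g2 0 < wron s g1 g2 1"
    by (rule less_by_deriv, simp, rule continuous_on_subset[OF continuous_wron], simp, rule DERIV_wron)
      (use less p in auto)
  then show "wron s g1 g2 1 > 0" using wron_0 by simp
  show "wron s g1 g2 x \<ge> wron s g1 g2 1" if "x \<ge> 1" for x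
    using wron_mono[of 1 x] that p by (simp add: less_imp_le)
qed

end

text \<open>In the difference of the integral equations, \<open>sn\<close> multiplies the difference
  of the solutions and \<open>sn - s\<close> multiplies the limit solution, and likewise for
  \<open>gn\<close>. Dominated convergence makes the second kind of term small in the mean, so
  bounded pointwise convergence of the coefficients gives uniform convergence of the solutions
  through Gronwall.\<close>

lemma phi_continuous_dependence:
  fixes s g :: "real \<Rightarrow> real" and sn gn :: "nat \<Rightarrow> real \<Rightarrow> real"
  assumes cs: "continuous_on {0..} s" and cg: "continuous_on {0..} g"
    and csn: "\<And>n. continuous_on {0..} (sn n)" and cgn: "\<And>n. continuous_on {0..} (gn n)"
    and K: "\<And>n t. 0 \<le> t \<Longrightarrow> t \<le> T \<Longrightarrow> \<bar>sn n t\<bar> \<le> K" "\<And>n t. 0 \<le> t \<Longrightarrow> t \<le> T \<Longrightarrow> \<bar>gn n t\<bar> \<le> K"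
    and lims: "\<And>t. 0 \<le> t \<Longrightarrow> t \<le> T \<Longrightarrow> (\<lambda>n. sn n t) \<longlonglongrightarrow> s t"
    and limg: "\<And>t. 0 \<le> t \<Longrightarrow> t \<le> T \<Longrightarrow> (\<lambda>n. gn n t) \<longlonglongrightarrow> g t" and T: "T \<ge> 0"
  shows "uniform_limit {0..T} (\<lambda>n. phi (sn n) (gn n)) (phi s g) sequentially"
    "uniform_limit {0..T} (\<lambda>n. uu (sn n) (gn n)) (uu s g) sequentially"
proof -
  note C = cs cg csn cgn continuous_phi[OF cs cg] continuous_uu[OF cs cg] continuous_phi[OF csn cgn] continuous_uu[OF csn cgn]
  have K0: "K \<ge> 0" using K(1)[of 0] T by force
  obtain B1 where B1: "B1 > 0" "\<And>t. 0 \<le> t \<Longrightarrow> t \<le> T \<Longrightarrow> \<bar>phi s g t\<bar> \<le> B1" using continuous_bounded_Icc[OF continuous_phi[OF cs cg]] by metis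
  obtain B2 where B2: "B2 > 0" "\<And>t. 0 \<le> t \<Longrightarrow> t \<le> T \<Longrightarrow> \<bar>uu s g t\<bar> \<le> B2" using continuous_bounded_Icc[OF continuous_uu[OF cs cg]] by metis
  define c where "c n = integral {0..T} (\<lambda>t. B2 * \<bar>sn n t - s t\<bar> + B1 * \<bar>gn n t - g t\<bar>)" for n
  have sK: "\<bar>s t\<bar> \<le> K" if "0 \<le> t" "t \<le> T" for t
    using LIMSEQ_le_const2[OF tendsto_rabs[OF lims[OF that]]] K(1)[OF that] by blast
  have gK: "\<bar>g t\<bar> \<le> K" if "0 \<le> t" "t \<le> T" for t
    using LIMSEQ_le_const2[OF tendsto_rabs[OF limg[OF that]]] K(2)[OF that] by blast
  have "c \<longlonglongrightarrow> integral {0..T} (\<lambda>t. 0)"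
    unfolding c_def
  proof (rule dominated_convergence(2))
    show "(\<lambda>t. B2 * \<bar>sn n t - s t\<bar> + B1 * \<bar>gn n t - g t\<bar>) integrable_on {0..T}" for n
      by (intro integrable_on_atLeast_subinterval continuous_intros C) auto
    show "(\<lambda>t. B2 * (2 * K) + B1 * (2 * K)) integrable_on {0..T}" by (rule integrable_const_ivl)
    fix n t assume t: "t \<in> {0..T}"
    have "\<bar>sn n t - s t\<bar> \<le> 2 * K" "\<bar>gn n t - g t\<bar> \<le> 2 * K" using K(1)[of t n] K(2)[of t n] sK[of t] gK[of t] t by auto
    then have "B2 * \<bar>sn n t - s t\<bar> + B1 * \<bar>gn n t - g t\<bar> \<le> B2 * (2 * K) + B1 * (2 * K)"
      using B1 B2 by (intro add_mono mult_left_mono) auto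
    then show "norm (B2 * \<bar>sn n t - s t\<bar> + B1 * \<bar>gn n t - g t\<bar>) \<le> B2 * (2 * K) + B1 * (2 * K)" using B1 B2 by simp
  next
    fix t assume t: "t \<in> {0..T}"
    then have "(\<lambda>n. B2 * \<bar>sn n t - s t\<bar> + B1 * \<bar>gn n t - g t\<bar>) \<longlonglongrightarrow> B2 * \<bar>s t - s t\<bar> + B1 * \<bar>g t - g t\<bar>"
      by (intro tendsto_intros lims limg) auto
    then show "(\<lambda>n. B2 * \<bar>sn n t - s t\<bar> + B1 * \<bar>gn n t - g t\<bar>) \<longlonglongrightarrow> 0" by simp
  qed
  then have c0: "c \<longlonglongrightarrow> 0" by simp
  have main: "\<bar>phi (sn n) (gn n) x - phi s g x\<bar> + \<bar>uu (sn n) (gn n) x - uu s g x\<bar> \<le> c n * exp (K * T)"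
    if x: "x \<in> {0..T}" for n x
  proof -
    let ?a = "\<lambda>x. phi (sn n) (gn n) x - phi s g x" and ?b = "\<lambda>x. uu (sn n) (gn n) x - uu s g x"
    have cn: "c n \<ge> 0" unfolding c_def
      by (intro integral_nonneg integrable_on_atLeast_subinterval continuous_intros C) (use B1 B2 in auto)
    have "\<bar>?a x\<bar> + \<bar>?b x\<bar> \<le> c n * exp (K * x)"
    proof (rule gronwall[where T=T])
      show "continuous_on {0..T} (\<lambda>x. \<bar>?a x\<bar> + \<bar>?b x\<bar>)"
        by (rule continuous_on_subset[of "{0..}"]) (auto intro!: continuous_intros C)
      fix y assume y: "0 \<le> y" "y \<le> T"
      have "?a y = integral {0..y} (\<lambda>t. sn n t * ?b t + (sn n t - s t) * uu s g t)"
        unfolding phi_integral(1)[OF csn cgn y(1)] phi_integral(1)[OF cs cg y(1)]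
        by (subst Henstock_Kurzweil_Integration.integral_diff[symmetric])
          (auto intro!: integrable_on_atLeast_subinterval continuous_intros C simp: algebra_simps)
      moreover have "norm (integral {0..y} (\<lambda>t. sn n t * ?b t + (sn n t - s t) * uu s g t))
          \<le> integral {0..y} (\<lambda>t. K * \<bar>?b t\<bar> + B2 * \<bar>sn n t - s t\<bar>)"
      proof (rule integral_norm_bound_integral)
        fix t assume t: "t \<in> {0..y}"
        have "\<bar>sn n t * ?b t\<bar> \<le> K * \<bar>?b t\<bar>" using K(1)[of t n] t y by (auto simp: abs_mult intro!: mult_right_mono)
        moreover have "\<bar>(sn n t - s t) * uu s g t\<bar> \<le> B2 * \<bar>sn n t - s t\<bar>" using B2(2)[of t] t y
          by (auto simp: abs_mult mult.commute intro!: mult_right_mono)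
        ultimately show "norm (sn n t * ?b t + (sn n t - s t) * uu s g t) \<le> K * \<bar>?b t\<bar> + B2 * \<bar>sn n t - s t\<bar>"
          unfolding real_norm_def by linarith
      qed (auto intro!: integrable_on_atLeast_subinterval continuous_intros C)
      ultimately have 1: "\<bar>?a y\<bar> \<le> integral {0..y} (\<lambda>t. K * \<bar>?b t\<bar> + B2 * \<bar>sn n t - s t\<bar>)" by simp
      have "?b y = - integral {0..y} (\<lambda>t. gn n t * ?a t + (gn n t - g t) * phi s g t)"
      proof -
        have "?b y = - (integral {0..y} (\<lambda>t. gn n t * phi (sn n) (gn n) t) - integral {0..y} (\<lambda>t. g t * phi s g t))"
          unfolding phi_integral(2)[OF csn cgn y(1)] phi_integral(2)[OF cs cg y(1)] by simp
        also have "integral {0..y} (\<lambda>t. gn n t * phi (sn n) (gn n) t) - integral {0..y} (\<lambda>t. g t * phi s g t)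
          = integral {0..y} (\<lambda>t. gn n t * ?a t + (gn n t - g t) * phi s g t)"
          by (subst Henstock_Kurzweil_Integration.integral_diff[symmetric])
            (auto intro!: integrable_on_atLeast_subinterval continuous_intros C simp: algebra_simps)
        finally show ?thesis .
      qed
      moreover have "norm (integral {0..y} (\<lambda>t. gn n t * ?a t + (gn n t - g t) * phi s g t))
          \<le> integral {0..y} (\<lambda>t. K * \<bar>?a t\<bar> + B1 * \<bar>gn n t - g t\<bar>)"
      proof (rule integral_norm_bound_integral)
        fix t assume t: "t \<in> {0..y}"
        have "\<bar>gn n t * ?a t\<bar> \<le> K * \<bar>?a t\<bar>" using K(2)[of t n] t y by (auto simp: abs_mult intro!: mult_right_mono)
        moreover have "\<bar>(gn n t - g t) * phi s g t\<bar> \<le> B1 * \<bar>gn n t - g t\<bar>" using B1(2)[of t] t y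
          by (auto simp: abs_mult mult.commute intro!: mult_right_mono)
        ultimately show "norm (gn n t * ?a t + (gn n t - g t) * phi s g t) \<le> K * \<bar>?a t\<bar> + B1 * \<bar>gn n t - g t\<bar>"
          unfolding real_norm_def by linarith
      qed (auto intro!: integrable_on_atLeast_subinterval continuous_intros C)
      ultimately have 2: "\<bar>?b y\<bar> \<le> integral {0..y} (\<lambda>t. K * \<bar>?a t\<bar> + B1 * \<bar>gn n t - g t\<bar>)" by simp
      have "integral {0..y} (\<lambda>t. K * \<bar>?b t\<bar> + B2 * \<bar>sn n t - s t\<bar>) + integral {0..y} (\<lambda>t. K * \<bar>?a t\<bar> + B1 * \<bar>gn n t - g t\<bar>)
         = integral {0..y} (\<lambda>t. (B2 * \<bar>sn n t - s t\<bar> + B1 * \<bar>gn n t - g t\<bar>) + K * (\<bar>?a t\<bar> + \<bar>?b t\<bar>))"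
        by (subst Henstock_Kurzweil_Integration.integral_add[symmetric])
          (auto intro!: integrable_on_atLeast_subinterval continuous_intros C simp: algebra_simps)
      also have "\<dots> = integral {0..y} (\<lambda>t. B2 * \<bar>sn n t - s t\<bar> + B1 * \<bar>gn n t - g t\<bar>) + K * integral {0..y} (\<lambda>t. \<bar>?a t\<bar> + \<bar>?b t\<bar>)"
        by (subst Henstock_Kurzweil_Integration.integral_add)
          (auto intro!: integrable_on_atLeast_subinterval continuous_intros C)
      also have "integral {0..y} (\<lambda>t. B2 * \<bar>sn n t - s t\<bar> + B1 * \<bar>gn n t - g t\<bar>) \<le> c n"
        unfolding c_def
        by (rule integral_subset_le) (use y B1 B2 in \<open>auto intro!: integrable_on_atLeast_subinterval continuous_intros C\<close>)
      finally show "\<bar>?a y\<bar> + \<bar>?b y\<bar> \<le> c n + K * integral {0..y} (\<lambda>t. \<bar>?a t\<bar> + \<bar>?b t\<bar>)" using 1 2 by linarith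
    qed (use x K0 in auto)
    also have "\<dots> \<le> c n * exp (K * T)" using x K0 cn by (intro mult_left_mono) (auto intro!: mult_left_mono)
    finally show ?thesis .
  qed
  have lim: "(\<lambda>n. c n * exp (K * T)) \<longlonglongrightarrow> 0" using tendsto_mult_left_zero[OF c0] by simp
  show "uniform_limit {0..T} (\<lambda>n. phi (sn n) (gn n)) (phi s g) sequentially"
    "uniform_limit {0..T} (\<lambda>n. uu (sn n) (gn n)) (uu s g) sequentially"
  proof -
    have "\<forall>\<^sub>F n in sequentially. \<forall>x\<in>{0..T}. dist (phi (sn n) (gn n) x) (phi s g x) < e \<and> dist (uu (sn n) (gn n) x) (uu s g x) < e"
      if "e > 0" for e
      using order_tendstoD(2)[OF lim that]
    proof eventually_elim
      case (elim n)
      show ?case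
      proof (intro ballI)
        fix x assume "x \<in> {0..T}"
        from main[OF this, of n] elim
        show "dist (phi (sn n) (gn n) x) (phi s g x) < e \<and> dist (uu (sn n) (gn n) x) (uu s g x) < e"
          unfolding dist_real_def by linarith
      qed
    qed
    then have "\<forall>\<^sub>F n in sequentially. \<forall>x\<in>{0..T}. dist (phi (sn n) (gn n) x) (phi s g x) < e"
      "\<forall>\<^sub>F n in sequentially. \<forall>x\<in>{0..T}. dist (uu (sn n) (gn n) x) (uu s g x) < e" if "e > 0" for e
      using that eventually_mono by (smt (verit, best))+
    then show "uniform_limit {0..T} (\<lambda>n. phi (sn n) (gn n)) (phi s g) sequentially"
      "uniform_limit {0..T} (\<lambda>n. uu (sn n) (gn n)) (uu s g) sequentially"
      by (auto intro!: uniform_limitI)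
  qed
qed

section \<open>The string equation and its lowest eigenvalue\<close>

text \<open>For continuous nonnegative integrands this is integrability on the half-line
  (\<open>set_integrable_iff_bddint\<close>), phrased with compact intervals so that it can be
  tested by countably many conditions.\<close>

definition bddint :: "(real \<Rightarrow> real) \<Rightarrow> bool" where
  "bddint f \<longleftrightarrow> (\<exists>K. \<forall>x\<ge>0. integral {0..x} f \<le> K)"

lemma mono_bounded_tendsto:
  fixes F :: "real \<Rightarrow> real"
  assumes mono: "\<And>x y. a \<le> x \<Longrightarrow> x \<le> y \<Longrightarrow> F x \<le> F y" and bd: "\<And>x. a \<le> x \<Longrightarrow> F x \<le> K"
  obtains L where "(F \<longlongrightarrow> L) at_top" "\<And>x. a \<le> x \<Longrightarrow> F x \<le> L"
proof -
  have bdd: "bdd_above (F ` {a..})" by (rule bdd_aboveI[of _ K]) (use bd in auto)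
  have up: "F x \<le> Sup (F ` {a..})" if "a \<le> x" for x
    by (rule cSup_upper[OF _ bdd]) (use that in auto)
  have "(F \<longlongrightarrow> Sup (F ` {a..})) at_top"
  proof (rule increasing_tendsto)
    show "\<forall>\<^sub>F x in at_top. F x \<le> Sup (F ` {a..})"
      using eventually_ge_at_top[of a] by eventually_elim (rule up)
    fix y assume "y < Sup (F ` {a..})"
    then obtain x where x: "x \<ge> a" "y < F x" using less_cSup_iff[OF _ bdd, of y] by auto
    show "\<forall>\<^sub>F x in at_top. y < F x"
      using eventually_ge_at_top[of x] by eventually_elim (use x mono[of x] in force)
  qed
  then show ?thesis using that up by blast
qed

lemma integral_mono_upper:
  fixes f :: "real \<Rightarrow> real"
  assumes "continuous_on {0..} f" "\<And>x. x \<ge> 0 \<Longrightarrow> f x \<ge> 0" "0 \<le> x" "x \<le> y"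
  shows "integral {0..x} f \<le> integral {0..y} f"
  by (rule integral_subset_le) (use assms in \<open>auto intro!: integrable_on_atLeast_subinterval\<close>)

lemma bddint_compare:
  assumes cf: "continuous_on {0..} f" and cg: "continuous_on {0..} g" and g0: "\<And>x. x \<ge> 0 \<Longrightarrow> g x \<ge> 0"
    and c: "c \<ge> 0" and X: "X \<ge> 0" and le: "\<And>x. x \<ge> X \<Longrightarrow> f x \<le> c * g x" and g: "bddint g"
  shows "bddint f"
proof -
  obtain K where K: "\<And>x. x \<ge> 0 \<Longrightarrow> integral {0..x} g \<le> K" using g by (auto simp: bddint_def)
  obtain B where B: "B > 0" "\<And>x. 0 \<le> x \<Longrightarrow> x \<le> X \<Longrightarrow> \<bar>integral {0..x} f\<bar> \<le> B"
    using continuous_bounded_Icc[OF continuous_on_integral_upper[OF cf]] by metis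
  have K0: "K \<ge> 0" using K[of 0] by simp
  have "integral {0..x} f \<le> B + c * K" if x: "x \<ge> 0" for x
  proof (cases "x \<le> X")
    case True
    then show ?thesis using B(2)[OF x] c K0 by (smt (verit) mult_nonneg_nonneg)
  next
    case False
    have "integral {X..x} f \<le> integral {X..x} (\<lambda>t. c * g t)"
      by (rule integral_le) (use X le in \<open>auto intro!: integrable_on_atLeast_subinterval continuous_intros cf cg\<close>)
    also have "\<dots> = c * (integral {0..x} g - integral {0..X} g)"
      using integral_diff_atLeast[OF cg X, of x] False by simp
    also have "\<dots> \<le> c * K"
      using K[OF x] integral_nonneg[OF integrable_on_atLeast_subinterval[OF cg, of 0 X]] g0 c
      by (intro mult_left_mono) auto
    finally show ?thesis using integral_diff_atLeast[OF cf X, of x] False B(2)[OF X] by auto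
  qed
  then show ?thesis unfolding bddint_def by blast
qed

lemma bddint_abs_converges:
  assumes cf: "continuous_on {0..} f" and b: "bddint (\<lambda>x. \<bar>f x\<bar>)"
  obtains L where "((\<lambda>x. integral {0..x} f) \<longlongrightarrow> L) at_top"
proof -
  obtain K where K: "\<And>x. x \<ge> 0 \<Longrightarrow> integral {0..x} (\<lambda>x. \<bar>f x\<bar>) \<le> K" using b by (auto simp: bddint_def)
  have ca: "continuous_on {0..} (\<lambda>x. \<bar>f x\<bar>)" and cp: "continuous_on {0..} (\<lambda>x. \<bar>f x\<bar> + f x)"
    by (intro continuous_intros cf)+
  have eq: "integral {0..x} (\<lambda>x. \<bar>f x\<bar> + f x) = integral {0..x} (\<lambda>x. \<bar>f x\<bar>) + integral {0..x} f" for x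
    by (rule Henstock_Kurzweil_Integration.integral_add) (auto intro!: integrable_on_atLeast_subinterval ca cf)
  have le: "integral {0..x} f \<le> integral {0..x} (\<lambda>x. \<bar>f x\<bar>)" for x
    by (rule integral_le) (auto intro!: integrable_on_atLeast_subinterval ca cf)
  obtain L1 where L1: "((\<lambda>x. integral {0..x} (\<lambda>x. \<bar>f x\<bar>)) \<longlongrightarrow> L1) at_top"
    by (rule mono_bounded_tendsto[of 0 "\<lambda>x. integral {0..x} (\<lambda>x. \<bar>f x\<bar>)" K]) (use integral_mono_upper[OF ca] K in auto)
  have 1: "integral {0..x} (\<lambda>x. \<bar>f x\<bar> + f x) \<le> integral {0..y} (\<lambda>x. \<bar>f x\<bar> + f x)" if "0 \<le> x" "x \<le> y" for x y
    by (rule integral_mono_upper[OF cp]) (use that in auto)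
  have 2: "integral {0..x} (\<lambda>x. \<bar>f x\<bar> + f x) \<le> 2 * K" if "0 \<le> x" for x
    using K[OF that] le[of x] eq[of x] by simp
  obtain L2 where L2: "((\<lambda>x. integral {0..x} (\<lambda>x. \<bar>f x\<bar> + f x)) \<longlongrightarrow> L2) at_top"
    by (rule mono_bounded_tendsto[of 0, OF 1 2]) auto
  have "((\<lambda>x. integral {0..x} (\<lambda>x. \<bar>f x\<bar> + f x) - integral {0..x} (\<lambda>x. \<bar>f x\<bar>)) \<longlongrightarrow> L2 - L1) at_top"
    by (intro tendsto_intros L1 L2)
  then show ?thesis using that eq by simp
qed

section \<open>Positivity of the derivative and the lowest eigenvalue under the trace
  condition\<close>

locale string_eq =
  fixes s m :: "real \<Rightarrow> real"
  assumes cs: "continuous_on {0..} s" and cm: "continuous_on {0..} m"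
    and spos: "\<And>x. x \<ge> 0 \<Longrightarrow> s x > 0" and mpos: "\<And>x. x \<ge> 0 \<Longrightarrow> m x > 0"
begin

definition SS :: "real \<Rightarrow> real" where "SS x = integral {0..x} s"
definition P :: "real \<Rightarrow> real \<Rightarrow> real" where "P lam = phi s (\<lambda>t. lam * m t)"
definition U :: "real \<Rightarrow> real \<Rightarrow> real" where "U lam = uu s (\<lambda>t. lam * m t)"
definition NN :: "real \<Rightarrow> bool" where "NN lam \<longleftrightarrow> (\<forall>x\<ge>0. U lam x > 0)"
text \<open>Trace condition: the kernel \<open>SS (min x y)\<close> has the trace
  \<open>integral SS m\<close> on the L2 space of \<open>m\<close>.\<close>

definition TC :: bool where "TC \<longleftrightarrow> bddint (\<lambda>t. SS t * m t)"
text \<open>The eigenvalue condition read off the solution that vanishes at 0: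
  \<open>U lam -> 0\<close> is the boundary condition at infinity implicit in the integral equation,
  and integrability of \<open>P lam\<close> against \<open>m\<close> makes that integral converge.
  \<open>gev_iff_ev\<close> is the equivalence with the integral equation.\<close>

definition ev :: "real \<Rightarrow> bool" where
  "ev lam \<longleftrightarrow> lam \<noteq> 0 \<and> bddint (\<lambda>t. \<bar>P lam t\<bar> * m t) \<and> bddint (\<lambda>t. (P lam t)\<^sup>2 * m t) \<and> (U lam \<longlongrightarrow> 0) at_top"

lemma cg: "continuous_on {0..} (\<lambda>t. lam * m t)" by (intro continuous_intros cm)
lemma cP: "continuous_on {0..} (P lam)" unfolding P_def by (rule continuous_phi[OF cs cg])
lemma cU: "continuous_on {0..} (U lam)" unfolding U_def by (rule continuous_uu[OF cs cg])
lemma cS: "continuous_on {0..} SS" unfolding SS_def[abs_def] by (rule continuous_on_integral_upper[OF cs])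
lemma lsolPU: "lsol s (\<lambda>t. lam * m t) (P lam) (U lam)" unfolding P_def U_def by (rule lsol_phi[OF cs cg])
lemma P0[simp]: "P lam 0 = 0" and U0[simp]: "U lam 0 = 1" and S0[simp]: "SS 0 = 0"
  unfolding P_def U_def SS_def using phi_0[OF cs cg] uu_0[OF cs cg] by auto
lemma DS: "x > 0 \<Longrightarrow> DERIV SS x :> s x" unfolding SS_def[abs_def] by (rule DERIV_integral_upper[OF cs])
lemma DP: "x > 0 \<Longrightarrow> DERIV (P lam) x :> s x * U lam x" using lsolD(3)[OF lsolPU] .
lemma DU: "x > 0 \<Longrightarrow> DERIV (U lam) x :> - (lam * m x * P lam x)" using lsolD(4)[OF lsolPU] by simp

lemmas C = cs cm cP cU cS

lemma S_strict: "0 \<le> x \<Longrightarrow> x < y \<Longrightarrow> SS x < SS y"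
  by (rule less_by_deriv[where F'=s], simp, rule continuous_on_subset[OF cS], simp, rule DS) (auto intro: spos)
lemma S_mono: "0 \<le> x \<Longrightarrow> x \<le> y \<Longrightarrow> SS x \<le> SS y" using S_strict[of x y] by (cases "x = y") auto
lemma S_pos: "x > 0 \<Longrightarrow> SS x > 0" using S_strict[of 0 x] by simp
lemma S_nonneg: "x \<ge> 0 \<Longrightarrow> SS x \<ge> 0" using S_mono[of 0 x] by simp
lemma S_diff: "0 \<le> x \<Longrightarrow> x \<le> y \<Longrightarrow> SS y - SS x = integral {x..y} s"
  unfolding SS_def by (rule integral_diff_atLeast[OF cs])

text \<open>The derivative of \<open>SS * U lam - P lam\<close> is
  \<open>- lam * SS * P lam * m\<close>. The identity yields both the concavity inequality
  \<open>SS * U lam <= P lam\<close> and, in the end, the integral equation itself.\<close>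

lemma SU_identity:
  assumes "x \<ge> 0"
  shows "P lam x = SS x * U lam x + lam * integral {0..x} (\<lambda>t. SS t * P lam t * m t)"
proof -
  have "integral {0..x} (\<lambda>t. - (lam * (SS t * P lam t * m t))) = (SS x * U lam x - P lam x) - (SS 0 * U lam 0 - P lam 0)"
    by (rule integral_of_DERIV) (use assms in \<open>auto intro!: continuous_intros C derivative_eq_intros DS DP DU\<close>)
  then show ?thesis by simp
qed

lemma U_diff:
  assumes "0 \<le> x" "x \<le> y"
  shows "U lam x - U lam y = lam * integral {x..y} (\<lambda>t. P lam t * m t)"
  using lsol_integral(2)[OF lsolPU assms, of lam] by (simp add: ac_simps)

lemma P_diff:
  assumes "0 \<le> x" "x \<le> y"
  shows "P lam y - P lam x = integral {x..y} (\<lambda>t. s t * U lam t)"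
  using lsol_integral(1)[OF lsolPU assms, of lam] by simp

text \<open>For \<open>lam <= 0\<close> the derivative \<open>U lam\<close> stays at least 1 and
  cannot decay.\<close>

lemma ev_pos: assumes "ev lam" shows "lam > 0"
proof (rule ccontr)
  assume "\<not> lam > 0"
  then have "U lam x \<ge> 1" if "x \<ge> 0" for x
    unfolding U_def using uu_ge_1_if_nonpos[OF cs cg spos _ that, of lam] mpos
    by (simp add: mult_nonpos_nonneg less_imp_le)
  then have "\<forall>\<^sub>F x in at_top. U lam x \<ge> 1" using eventually_ge_at_top[of 0] by (rule eventually_mono[rotated])
  moreover have "\<forall>\<^sub>F x in at_top. U lam x < 1" using assms unfolding ev_def by (auto intro: order_tendstoD)
  ultimately have "\<forall>\<^sub>F x::real in at_top. False" by eventually_elim auto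
  then show False by simp
qed

text \<open>Stated on an initial interval rather than on the half-line, because \<open>NN\<close> is
  itself proved by continuation up to a possible first zero of \<open>U lam\<close>.\<close>

lemma region:
  assumes lam: "lam > 0" and pos: "\<And>x. 0 \<le> x \<Longrightarrow> x < X \<Longrightarrow> U lam x > 0" and xy: "0 \<le> x" "x \<le> y" "y \<le> X"
  shows "U lam y \<le> U lam x" "P lam x \<ge> 0" "P lam x \<le> P lam y" "U lam x \<le> 1" "P lam x \<le> SS x"
    "0 < x \<Longrightarrow> P lam x > 0"
proof -
  have Pm: "P lam a \<le> P lam b" if "0 \<le> a" "a \<le> b" "b \<le> X" for a b
  proof (rule le_by_deriv[OF that(2)])
    fix t assume t: "a < t" "t < b"
    show "DERIV (P lam) t :> s t * U lam t" by (rule DP) (use t that in auto)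
    have "s t > 0" "U lam t > 0" using t that pos[of t] spos[of t] by auto
    then show "s t * U lam t \<ge> 0" by simp
  qed (use that in \<open>auto intro!: continuous_on_subset[OF cP]\<close>)
  have P0': "P lam a \<ge> 0" if "0 \<le> a" "a \<le> X" for a using Pm[of 0 a] that by simp
  have Um: "U lam b \<le> U lam a" if "0 \<le> a" "a \<le> b" "b \<le> X" for a b
  proof (rule ge_by_deriv[OF that(2)])
    fix t assume t: "a < t" "t < b"
    show "DERIV (U lam) t :> - (lam * m t * P lam t)" by (rule DU) (use t that in auto)
    have "m t > 0" "P lam t \<ge> 0" using t that P0'[of t] mpos[of t] by auto
    then show "- (lam * m t * P lam t) \<le> 0" using lam by simp
  qed (use that in \<open>auto intro!: continuous_on_subset[OF cU]\<close>)
  show "U lam y \<le> U lam x" "P lam x \<ge> 0" "P lam x \<le> P lam y" using Um Pm P0' xy by auto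
  show "U lam x \<le> 1" using Um[of 0 x] xy by simp
  have "SS 0 - P lam 0 \<le> SS x - P lam x"
  proof (rule le_by_deriv[where F="\<lambda>t. SS t - P lam t" and F'="\<lambda>t. s t - s t * U lam t"])
    fix t assume t: "0 < t" "t < x"
    show "DERIV (\<lambda>t. SS t - P lam t) t :> s t - s t * U lam t" using t by (intro derivative_intros DS DP)
    have "U lam t \<le> 1" using Um[of 0 t] t xy by simp
    then show "s t - s t * U lam t \<ge> 0" using spos[of t] t by (simp add: mult_left_le)
  qed (use xy in \<open>auto intro!: continuous_intros continuous_on_subset[OF cS] continuous_on_subset[OF cP]\<close>)
  then show "P lam x \<le> SS x" by simp
  show "P lam x > 0" if "0 < x"
    using lsol_increasing[OF lsolPU, of 0 x lam] that pos spos xy by simp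
qed

lemma NN_region:
  assumes "lam > 0" "NN lam" "0 \<le> x" "x \<le> y"
  shows "U lam y \<le> U lam x" "P lam x \<ge> 0" "P lam x \<le> P lam y" "U lam x \<le> 1" "P lam x \<le> SS x" "0 < x \<Longrightarrow> P lam x > 0"
  using region[OF assms(1), of y x y] assms unfolding NN_def by auto

lemma cSm: "continuous_on {0..} (\<lambda>t. SS t * m t)" by (intro continuous_intros C)
lemma Sm_nonneg: "t \<ge> 0 \<Longrightarrow> SS t * m t \<ge> 0" using S_nonneg mpos by (simp add: less_imp_le)

text \<open>Up to a first zero \<open>c\<close> beyond \<open>X\<close> one has
  \<open>P lam <= SS\<close>, so the drop of \<open>U lam\<close> from \<open>X\<close> to
  \<open>c\<close> is at most \<open>lam\<close> times a tail of \<open>integral SS m\<close>.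
  Positivity on the half-line is thereby reduced to a compact interval.\<close>

lemma NN_tail:
  assumes lam: "lam > 0" and X: "X \<ge> 0" and pos: "\<And>x. 0 \<le> x \<Longrightarrow> x \<le> X \<Longrightarrow> U lam x > 0"
    and K: "\<And>y. y \<ge> X \<Longrightarrow> lam * integral {X..y} (\<lambda>t. SS t * m t) < U lam X"
  shows "NN lam"
  unfolding NN_def
proof (rule ccontr)
  assume "\<not> (\<forall>x\<ge>0. U lam x > 0)"
  then obtain b where b: "b \<ge> 0" "U lam b \<le> 0" by force
  have Xb: "X \<le> b" using pos[of b] b by (cases "X \<le> b") auto
  obtain c where c: "X < c" "c \<le> b" "U lam c = 0" "\<And>x. X \<le> x \<Longrightarrow> x < c \<Longrightarrow> U lam x > 0"
    using first_zero[of X b "U lam"] b pos[of X] X Xb continuous_on_subset[OF cU, of "{X..b}"] by auto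
  have p: "U lam x > 0" if "0 \<le> x" "x < c" for x using pos[of x] c(4)[of x] that by (cases "x \<le> X") auto
  have "integral {X..c} (\<lambda>t. P lam t * m t) \<le> integral {X..c} (\<lambda>t. SS t * m t)"
  proof (rule integral_le)
    fix t assume t: "t \<in> {X..c}"
    show "P lam t * m t \<le> SS t * m t"
      using region(5)[OF lam p, of c t c] t X mpos[of t] by (intro mult_right_mono) auto
  qed (use X in \<open>auto intro!: integrable_on_atLeast_subinterval continuous_intros C\<close>)
  then have "lam * integral {X..c} (\<lambda>t. P lam t * m t) \<le> lam * integral {X..c} (\<lambda>t. SS t * m t)" using lam by simp
  then show False using U_diff[of X c lam] c X K[of c] by auto
qed

text \<open>Nonnegativity of the Wronskian reads \<open>P l2 * U l1 >= P l1 * U l2\<close>, and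
  Sturm comparison makes the right-hand side positive.\<close>

lemma NN_antimono:
  assumes "NN l2" "l1 \<le> l2" "l2 > 0"
  shows "NN l1"
  unfolding NN_def
proof (intro allI impI)
  fix x :: real assume x: "x \<ge> 0"
  show "U l1 x > 0"
  proof (cases "x = 0")
    case False
    have le: "l1 * m t \<le> l2 * m t" if "t \<ge> 0" for t using mpos[OF that] assms by simp
    have p2: "phi s (\<lambda>t. l2 * m t) t > 0" if "t > 0" for t using NN_region(6)[OF assms(3,1), of t t] that by (simp add: P_def)
    have p1: "phi s (\<lambda>t. l1 * m t) x > 0" using sturm_phi_pos[OF cs cg cg spos le p2, of x x] x False by simp
    have "wron s (\<lambda>t. l1 * m t) (\<lambda>t. l2 * m t) x \<ge> 0" using sturm_wron_nonneg[OF cs cg cg spos le p2, of x x] x by simp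
    then have "phi s (\<lambda>t. l2 * m t) x * U l1 x \<ge> phi s (\<lambda>t. l1 * m t) x * U l2 x" by (simp add: wron_def U_def)
    moreover have "phi s (\<lambda>t. l1 * m t) x * U l2 x > 0" using p1 assms x by (simp add: NN_def)
    ultimately have "phi s (\<lambda>t. l2 * m t) x * U l1 x > 0" by linarith
    then show ?thesis using p2[of x] x False by (simp add: zero_less_mult_iff)
  qed simp
qed

lemma TC_tail:
  assumes TC "e > 0"
  obtains X where "X \<ge> 1" "\<And>x y. X \<le> x \<Longrightarrow> x \<le> y \<Longrightarrow> integral {x..y} (\<lambda>t. SS t * m t) \<le> e"
proof -
  let ?k = "\<lambda>x. integral {0..x} (\<lambda>t. SS t * m t)"
  obtain K where K: "\<And>x. x \<ge> 0 \<Longrightarrow> ?k x \<le> K" using assms(1) by (auto simp: TC_def bddint_def)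
  have mono: "?k x \<le> ?k y" if "0 \<le> x" "x \<le> y" for x y using integral_mono_upper[OF cSm Sm_nonneg that] .
  obtain L where L: "(?k \<longlongrightarrow> L) at_top" "\<And>x. 0 \<le> x \<Longrightarrow> ?k x \<le> L"
    by (rule mono_bounded_tendsto[of 0 ?k K, OF mono K]) auto
  have "\<forall>\<^sub>F x in at_top. ?k x > L - e" using order_tendstoD(1)[OF L(1)] assms(2) by simp
  then obtain X where X: "\<And>x. x \<ge> X \<Longrightarrow> ?k x > L - e" unfolding eventually_at_top_linorder by auto
  show ?thesis
  proof (rule that[of "max X 1"])
    fix x y assume xy: "max X 1 \<le> x" "x \<le> y"
    have "integral {x..y} (\<lambda>t. SS t * m t) = ?k y - ?k x" using integral_diff_atLeast[OF cSm, of x y] xy by simp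
    then show "integral {x..y} (\<lambda>t. SS t * m t) \<le> e" using X[of x] L(2)[of y] xy by simp
  qed simp
qed

text \<open>The solution is concave in the scale \<open>SS\<close>, so \<open>P / SS\<close> decreases. If moreover \<open>U\<close> tends to
  \<open>0\<close>, the tail of \<open>SS m\<close> controls \<open>U\<close> by \<open>P / (2 SS)\<close>, which makes \<open>P\<^sup>2 / SS\<close> decrease.\<close>

lemma P_square_le_S:
  assumes tc: TC and lam: "lam > 0" and N: "NN lam" and lim: "(U lam \<longlongrightarrow> 0) at_top"
  obtains C X where "C > 0" "X \<ge> 1" "\<And>x. x \<ge> X \<Longrightarrow> (P lam x)\<^sup>2 \<le> C * SS x"
proof -
  obtain X where X: "X \<ge> 1" "\<And>x y. X \<le> x \<Longrightarrow> x \<le> y \<Longrightarrow> integral {x..y} (\<lambda>t. SS t * m t) \<le> 1 / (2 * lam)"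
    using TC_tail[OF tc, of "1 / (2 * lam)"] lam by (metis divide_pos_pos zero_less_mult_iff zero_less_numeral zero_less_one)
  note R = NN_region[OF lam N]
  have PSU: "SS x * U lam x \<le> P lam x" if "x \<ge> 0" for x
  proof -
    have "0 \<le> integral {0..x} (\<lambda>t. SS t * P lam t * m t)"
    proof (rule integral_nonneg)
      fix t assume "t \<in> {0..x}"
      then show "0 \<le> SS t * P lam t * m t" using S_nonneg[of t] R(2)[of t x] mpos[of t] by simp
    qed (auto intro!: integrable_on_atLeast_subinterval continuous_intros C)
    then show ?thesis using SU_identity[OF that, of lam] lam by simp
  qed
  have conc: "P lam y / SS y \<le> P lam x / SS x" if "0 < x" "x \<le> y" for x y
  proof (rule ge_by_deriv[where F="\<lambda>x. P lam x / SS x" and F'="\<lambda>x. (s x * U lam x * SS x - P lam x * s x) / (SS x * SS x)", OF that(2)])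
    have "SS t \<noteq> 0" if "t \<in> {x..y}" for t using S_pos[of t] that \<open>0 < x\<close> by auto
    then show "continuous_on {x..y} (\<lambda>x. P lam x / SS x)" using that
      by (intro continuous_intros continuous_on_subset[OF cP] continuous_on_subset[OF cS]) auto
    fix t assume t: "x < t" "t < y"
    show "((\<lambda>x. P lam x / SS x) has_real_derivative (s t * U lam t * SS t - P lam t * s t) / (SS t * SS t)) (at t)"
      by (rule DERIV_divide[OF DP DS]) (use t that S_pos[of t] in auto)
    have "s t * (SS t * U lam t) \<le> s t * P lam t" using PSU[of t] spos[of t] t that by simp
    then show "(s t * U lam t * SS t - P lam t * s t) / (SS t * SS t) \<le> 0"
      by (intro divide_nonpos_nonneg) (auto simp: algebra_simps)
  qed
  have Ub: "U lam x \<le> P lam x / (2 * SS x)" if x: "x \<ge> X" for x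
  proof (rule tendsto_upperbound[where F=at_top and f="\<lambda>y. U lam x - U lam y"])
    show "((\<lambda>y. U lam x - U lam y) \<longlongrightarrow> U lam x) at_top" using tendsto_diff[OF tendsto_const lim, of "U lam x"] by simp
    show "\<forall>\<^sub>F y in at_top. U lam x - U lam y \<le> P lam x / (2 * SS x)"
      using eventually_ge_at_top[of x]
    proof eventually_elim
      case (elim y)
      have x0: "x > 0" using x X by simp
      have "integral {x..y} (\<lambda>t. P lam t * m t) \<le> integral {x..y} (\<lambda>t. P lam x / SS x * (SS t * m t))"
      proof (rule integral_le)
        fix t assume t: "t \<in> {x..y}"
        have "P lam t \<le> P lam x / SS x * SS t" using conc[of x t] t x0 S_pos[of t] S_pos[of x] by (simp add: field_simps)
        then have "P lam t * m t \<le> P lam x / SS x * SS t * m t" using mpos[of t] t x0 by (intro mult_right_mono) auto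
        then show "P lam t * m t \<le> P lam x / SS x * (SS t * m t)" by (simp add: mult.assoc)
      qed (use x0 S_pos[OF x0] in \<open>auto intro!: integrable_on_atLeast_subinterval continuous_intros C\<close>)
      also have "\<dots> = P lam x / SS x * integral {x..y} (\<lambda>t. SS t * m t)" by simp
      also have "\<dots> \<le> P lam x / SS x * (1 / (2 * lam))"
        using X(2)[OF x elim] R(2)[of x x] S_pos[OF x0] x0 by (intro mult_left_mono) auto
      finally have "lam * integral {x..y} (\<lambda>t. P lam t * m t) \<le> lam * (P lam x / SS x * (1 / (2 * lam)))" using lam by (intro mult_left_mono) auto
      also have "\<dots> = P lam x / (2 * SS x)" using lam by (simp add: field_simps)
      finally show ?case using U_diff[of x y lam] x0 elim by simp
    qed
  qed simp
  show ?thesis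
  proof (rule that[of "(P lam X)\<^sup>2 / SS X" X])
    show "(P lam X)\<^sup>2 / SS X > 0" using R(6)[of X X] X S_pos[of X] by simp
    show "X \<ge> 1" by fact
    fix x assume x: "x \<ge> X"
    have "(P lam x)\<^sup>2 / SS x \<le> (P lam X)\<^sup>2 / SS X"
    proof (rule ge_by_deriv[where F="\<lambda>x. (P lam x)\<^sup>2 / SS x" and F'="\<lambda>x. (2 * P lam x * (s x * U lam x) * SS x - (P lam x)\<^sup>2 * s x) / (SS x * SS x)", OF x])
      have "SS t \<noteq> 0" if "t \<in> {X..x}" for t using S_pos[of t] that X by auto
      then show "continuous_on {X..x} (\<lambda>x. (P lam x)\<^sup>2 / SS x)" using X
        by (intro continuous_intros continuous_on_subset[OF cP] continuous_on_subset[OF cS]) auto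
      fix t assume t: "X < t" "t < x"
      have t0: "t > 0" using t X by simp
      have "DERIV (\<lambda>x. (P lam x)\<^sup>2) t :> 2 * P lam t * (s t * U lam t)"
        by (auto intro!: derivative_eq_intros DP t0)
      from DERIV_divide[OF this DS[OF t0]] S_pos[OF t0]
      show "((\<lambda>x. (P lam x)\<^sup>2 / SS x) has_real_derivative (2 * P lam t * (s t * U lam t) * SS t - (P lam t)\<^sup>2 * s t) / (SS t * SS t)) (at t)"
        by simp
      have "2 * U lam t * SS t \<le> P lam t" using Ub[of t] t S_pos[OF t0] by (simp add: field_simps)
      then have "(s t * P lam t) * (2 * U lam t * SS t) \<le> (s t * P lam t) * P lam t"
        using spos[of t] R(2)[of t t] t0 by (intro mult_left_mono) auto
      then show "(2 * P lam t * (s t * U lam t) * SS t - (P lam t)\<^sup>2 * s t) / (SS t * SS t) \<le> 0"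
        by (intro divide_nonpos_nonneg) (auto simp: algebra_simps power2_eq_square)
    qed
    then show "(P lam x)\<^sup>2 \<le> (P lam X)\<^sup>2 / SS X * SS x" using S_pos[of x] x X by (simp add: field_simps)
  qed
qed

text \<open>The Wronskian of \<open>P l\<close> and \<open>P lam\<close> stays above some
  \<open>w > 0\<close>. If \<open>SS\<close> is bounded, this keeps \<open>U l\<close> away from 0.
  If \<open>SS\<close> is unbounded, the bound \<open>(P l)^2 <= C * SS\<close> makes the derivative
  of \<open>P lam / P l\<close> at most \<open>- (w / C) * s / SS\<close>; the quotient then falls
  at least as fast as \<open>- (w / C) * ln SS\<close> and would become negative.\<close>

lemma no_ev_below:
  assumes tc: TC and N: "NN lam" and e: "ev l" and less: "l < lam"
  shows False
proof -
  have l: "l > 0" by (rule ev_pos[OF e])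
  have lam: "lam > 0" using l less by simp
  have Nl: "NN l" using NN_antimono[OF N _ lam] less by simp
  have lim: "(U l \<longlongrightarrow> 0) at_top" using e by (simp add: ev_def)
  note R = NN_region[OF lam N] and Rl = NN_region[OF l Nl]
  have less': "l * m t < lam * m t" if "t \<ge> 0" for t using mpos[OF that] less by simp
  have p2: "phi s (\<lambda>t. lam * m t) t > 0" if "t > 0" for t using R(6)[of t t] that by (simp add: P_def)
  obtain w where w: "w > 0" "\<And>x. x \<ge> 1 \<Longrightarrow> wron s (\<lambda>t. l * m t) (\<lambda>t. lam * m t) x \<ge> w"
    using wron_pos_strict[OF cs cg cg spos less_imp_le[OF less'] p2] less' by (metis less_imp_le)
  have w': "w \<le> P lam x * U l x - P l x * U lam x" if "x \<ge> 1" for x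
    using w(2)[OF that] by (simp add: wron_def P_def U_def)
  show False
  proof (cases "\<exists>B. \<forall>x\<ge>0. SS x \<le> B")
    case True
    then obtain B where B: "\<And>x. x \<ge> 0 \<Longrightarrow> SS x \<le> B" by auto
    have B0: "B > 0" using B[of 1] S_pos[of 1] by simp
    have "\<forall>\<^sub>F x in at_top. U l x < w / B" using order_tendstoD(2)[OF lim] w B0 by simp
    moreover have "\<forall>\<^sub>F x in at_top. U l x \<ge> w / B"
      using eventually_ge_at_top[of 1]
    proof eventually_elim
      case (elim x)
      have "U lam x > 0" "U l x > 0" using N Nl elim by (auto simp: NN_def)
      have "P l x * U lam x \<ge> 0" using Rl(2)[of x x] \<open>U lam x > 0\<close> elim by simp
      then have "w \<le> P lam x * U l x" using w'[OF elim] by simp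
      also have "\<dots> \<le> B * U l x" using R(5)[of x x] B[of x] elim \<open>U l x > 0\<close> by (intro mult_right_mono) auto
      finally show ?case using B0 by (simp add: field_simps)
    qed
    ultimately have "\<forall>\<^sub>F x::real in at_top. False" by eventually_elim auto
    then show False by simp
  next
    case False
    obtain C X where CX: "C > 0" "X \<ge> 1" "\<And>x. x \<ge> X \<Longrightarrow> (P l x)\<^sup>2 \<le> C * SS x"
      using P_square_le_S[OF tc l Nl lim] by blast
    let ?F = "\<lambda>x. P lam x / P l x + w / C * ln (SS x)"
    have dec: "?F x \<le> ?F X" if x: "x \<ge> X" for x
    proof (rule ge_by_deriv[where F="?F" and F'="\<lambda>x. (s x * U lam x * P l x - P lam x * (s x * U l x)) / (P l x * P l x) + w / C * (s x / SS x)", OF x])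
      have "P l t \<noteq> 0" "SS t \<noteq> 0" "SS t > 0" if "t \<in> {X..x}" for t using Rl(6)[of t t] S_pos[of t] that CX by auto
      then show "continuous_on {X..x} ?F" using CX
        by (intro continuous_intros continuous_on_subset[OF cP] continuous_on_subset[OF cS]) auto
      fix t assume t: "X < t" "t < x"
      have t0: "t > 0" using t CX by simp
      have Pp: "P l t > 0" using Rl(6)[of t t] t0 by simp
      have Sp: "SS t > 0" using S_pos t0 by simp
      have "DERIV (\<lambda>x. P lam x / P l x) t :> (s t * U lam t * P l t - P lam t * (s t * U l t)) / (P l t * P l t)"
        by (rule DERIV_divide[OF DP[OF t0] DP[OF t0]]) (use Pp in auto)
      moreover have "DERIV (\<lambda>x. w / C * ln (SS x)) t :> w / C * (s t / SS t)"
        using Sp CX(1) by (auto intro!: derivative_eq_intros DS t0 simp: field_simps)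
      ultimately show "(?F has_real_derivative (s t * U lam t * P l t - P lam t * (s t * U l t)) / (P l t * P l t) + w / C * (s t / SS t)) (at t)"
        by (rule DERIV_add)
      have "(s t * U lam t * P l t - P lam t * (s t * U l t)) / (P l t * P l t) = - (s t * (P lam t * U l t - P l t * U lam t)) / (P l t)\<^sup>2"
        by (simp add: algebra_simps power2_eq_square)
      also have "\<dots> \<le> - (s t * w) / (P l t)\<^sup>2"
        using w'[of t] t CX spos[of t] t0 by (intro divide_right_mono) auto
      also have "\<dots> \<le> - (s t * w) / (C * SS t)"
      proof -
        have "s t * w / (C * SS t) \<le> s t * w / (P l t)\<^sup>2"
          using CX(3)[of t] t Pp Sp CX spos[of t] t0 w by (intro divide_left_mono) auto
        then show ?thesis by simp
      qed
      finally show "(s t * U lam t * P l t - P lam t * (s t * U l t)) / (P l t * P l t) + w / C * (s t / SS t) \<le> 0"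
        by (simp add: mult.commute)
    qed
    have "SS x \<le> exp (?F X * C / w)" if x: "x \<ge> X" for x
    proof -
      have "P lam x / P l x \<ge> 0" using R(2)[of x x] Rl(2)[of x x] x CX by simp
      then have "w / C * ln (SS x) \<le> ?F X" using dec[OF x] by linarith
      then have "(w / C * ln (SS x)) * (C / w) \<le> ?F X * (C / w)" using w(1) CX(1) by (intro mult_right_mono) auto
      then have "ln (SS x) \<le> ?F X * C / w" using w(1) CX(1) by simp
      then have "exp (ln (SS x)) \<le> exp (?F X * C / w)" by (simp only: exp_le_cancel_iff)
      then show ?thesis using S_pos[of x] x CX by simp
    qed
    then have "SS x \<le> exp (?F X * C / w)" if "x \<ge> 0" for x
      using S_mono[of x X] that CX(2) by (cases "x \<ge> X") (force intro: order_trans)+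
    then show False using False by blast
  qed
qed

lemma P_U_continuous_in_lam:
  assumes "l \<longlonglongrightarrow> lam" "X \<ge> 0"
  shows "uniform_limit {0..X} (\<lambda>n. P (l n)) (P lam) sequentially" "uniform_limit {0..X} (\<lambda>n. U (l n)) (U lam) sequentially"
proof -
  obtain B where B: "B > 0" "\<And>n. norm (l n) \<le> B" using convergent_imp_Bseq[OF convergentI[OF assms(1)]] by (auto simp: Bseq_def)
  obtain K1 where K1: "K1 > 0" "\<And>t. 0 \<le> t \<Longrightarrow> t \<le> X \<Longrightarrow> \<bar>s t\<bar> \<le> K1" using continuous_bounded_Icc[OF cs] by metis
  obtain K2 where K2: "K2 > 0" "\<And>t. 0 \<le> t \<Longrightarrow> t \<le> X \<Longrightarrow> \<bar>m t\<bar> \<le> K2" using continuous_bounded_Icc[OF cm] by metis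
  define K where "K = K1 + B * K2"
  have a: "\<bar>s t\<bar> \<le> K" "\<bar>l n * m t\<bar> \<le> K" if "0 \<le> t" "t \<le> X" for n t
  proof -
    show "\<bar>s t\<bar> \<le> K" using K1(2)[OF that] B(1) K2(1) unfolding K_def by (smt (verit) mult_pos_pos)
    have "\<bar>l n\<bar> * \<bar>m t\<bar> \<le> B * K2" using B(2)[of n] K2(2)[OF that] B(1) by (intro mult_mono) auto
    then show "\<bar>l n * m t\<bar> \<le> K" using K1(1) by (simp add: K_def abs_mult)
  qed
  have b: "(\<lambda>n. l n * m t) \<longlonglongrightarrow> lam * m t" for t by (intro tendsto_intros assms)
  show "uniform_limit {0..X} (\<lambda>n. P (l n)) (P lam) sequentially" "uniform_limit {0..X} (\<lambda>n. U (l n)) (U lam) sequentially"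
    unfolding P_def U_def
    using phi_continuous_dependence[OF cs cg[of lam] cs cg[of "l _"] a tendsto_const b assms(2)] by simp_all
qed

text \<open>The eigenvalue is the supremum \<open>L\<close> of the positive parameters with
  \<open>NN\<close>. A negative value of \<open>U L\<close> would persist for slightly smaller
  parameters, so \<open>NN L\<close> holds. A positive limit of \<open>U L\<close> would give
  \<open>NN\<close> slightly above \<open>L\<close>, by continuity on a compact interval and
  \<open>NN_tail\<close> beyond it. Hence \<open>U L\<close> decays to 0, and the two integrability
  conditions follow from \<open>U_diff\<close> and \<open>P_square_le_S\<close>.\<close>

lemma ev_below:
  assumes tc: TC and lam: "lam > 0" and nN: "\<not> NN lam"
  obtains l where "ev l" "l < lam"
proof -
  obtain K where K: "\<And>x. x \<ge> 0 \<Longrightarrow> integral {0..x} (\<lambda>t. SS t * m t) \<le> K" using tc by (auto simp: TC_def bddint_def)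
  have K0: "K \<ge> 0" using K[of 0] by simp
  define A where "A = {l. l > 0 \<and> NN l}"
  \<comment> \<open>Small enough for \<open>NN_tail\<close> to apply from \<open>X = 0\<close>: the
    total drop of \<open>U\<close> is at most \<open>l0 * K < 1\<close>.\<close>
  define l0 where "l0 = 1 / (2 * (K + 1))"
  have l0A: "l0 \<in> A"
  proof -
    have l0: "l0 > 0" using K0 by (simp add: l0_def)
    have "NN l0"
    proof (rule NN_tail[OF l0, of 0])
      fix y :: real assume "y \<ge> 0"
      then have "l0 * integral {0..y} (\<lambda>t. SS t * m t) \<le> l0 * K" using K l0 by simp
      also have "\<dots> < 1" using K0 by (simp add: l0_def field_simps)
      finally show "l0 * integral {0..y} (\<lambda>t. SS t * m t) < U l0 0" by simp
    qed auto
    then show ?thesis using l0 by (simp add: A_def)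
  qed
  have Alam: "l < lam" if "l \<in> A" for l
    using NN_antimono[of l lam] that nN by (force simp: A_def)
  have bdd: "bdd_above A" by (rule bdd_aboveI[of _ lam]) (use Alam in force)
  define L where "L = Sup A"
  have Lup: "l \<le> L" if "l \<in> A" for l unfolding L_def by (rule cSup_upper[OF that bdd])
  have L0: "L > 0" using Lup[OF l0A] l0A by (auto simp: A_def)
  have below: "NN l" if "l < L" for l
  proof -
    have "\<exists>a\<in>A. l < a" using that less_cSup_iff[OF _ bdd, of l] l0A unfolding L_def by blast
    then obtain a where "a \<in> A" "l < a" by blast
    then show ?thesis using NN_antimono[of a l] by (auto simp: A_def)
  qed
  have above: "\<not> NN l" if "l > L" for l
    using Lup[of l] that L0 by (auto simp: A_def)
  have NL: "NN L"
  proof (rule ccontr)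
    assume "\<not> NN L"
    then obtain x where x: "x > 0" "U L x < 0"
      unfolding NN_def U_def using exists_uu_neg[OF cs cg spos, of L] mpos L0 by (metis mult_pos_pos)
    have lim: "(\<lambda>n. L - 1 / real (Suc n)) \<longlonglongrightarrow> L - 0"
      using LIMSEQ_inverse_real_of_nat by (intro tendsto_diff tendsto_const) (simp add: inverse_eq_divide)
    have "(\<lambda>n. U (L - 1 / real (Suc n)) x) \<longlonglongrightarrow> U L x"
      using tendsto_uniform_limitI[OF P_U_continuous_in_lam(2)[OF lim, of x]] x by simp
    from order_tendstoD(2)[OF this x(2)] obtain n where "U (L - 1 / real (Suc n)) x < 0"
      by (auto simp: eventually_sequentially)
    moreover have "NN (L - 1 / real (Suc n))" by (rule below) simp
    ultimately show False using x(1) unfolding NN_def by (metis less_imp_le less_asym)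
  qed
  note R = NN_region[OF L0 NL]
  have Upos: "U L x > 0" if "x \<ge> 0" for x using NL that by (simp add: NN_def)
  obtain nu where nu: "((\<lambda>x. - U L x) \<longlongrightarrow> nu) at_top" "\<And>x. 0 \<le> x \<Longrightarrow> - U L x \<le> nu"
    by (rule mono_bounded_tendsto[of 0 "\<lambda>x. - U L x" 0]) (use R(1) Upos in \<open>auto simp: less_imp_le\<close>)
  define u where "u = - nu"
  have ulim: "(U L \<longlongrightarrow> u) at_top" using tendsto_minus[OF nu(1)] by (simp add: u_def)
  have uge: "u \<le> U L x" if "x \<ge> 0" for x using nu(2)[OF that] by (simp add: u_def)
  have u0: "u \<ge> 0"
    by (rule tendsto_lowerbound[OF ulim]) (auto intro!: eventually_mono[OF eventually_ge_at_top[of 0]] less_imp_le[OF Upos])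
  have "u = 0"
  proof (rule ccontr)
    assume "u \<noteq> 0"
    then have up: "u > 0" using u0 by simp
    \<comment> \<open>Then \<open>l * e <= u / 4\<close> for all \<open>l <= L + 1\<close>, which is
      below the value \<open>u / 2\<close> that \<open>U l\<close> keeps on the compact
      interval.\<close>
    define e where "e = u / (4 * (L + 1))"
    have e: "e > 0" using up L0 by (simp add: e_def)
    obtain X where X: "X \<ge> 1" "\<And>x y. X \<le> x \<Longrightarrow> x \<le> y \<Longrightarrow> integral {x..y} (\<lambda>t. SS t * m t) \<le> e"
      using TC_tail[OF tc e] by blast
    have lim: "(\<lambda>n. L + 1 / real (Suc n)) \<longlonglongrightarrow> L + 0"
      using LIMSEQ_inverse_real_of_nat by (intro tendsto_add tendsto_const) (simp add: inverse_eq_divide)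
    have "\<forall>\<^sub>F n in sequentially. \<forall>x\<in>{0..X}. dist (U (L + 1 / real (Suc n)) x) (U L x) < u / 2"
      using uniform_limitD[OF P_U_continuous_in_lam(2)[OF lim, of X], of "u / 2"] X up by simp
    then obtain n where "\<forall>x\<in>{0..X}. dist (U (L + 1 / real (Suc n)) x) (U L x) < u / 2"
      unfolding eventually_sequentially by blast
    then have n: "dist (U (L + 1 / real (Suc n)) x) (U L x) < u / 2" if "0 \<le> x" "x \<le> X" for x using that by auto
    define l where "l = L + 1 / real (Suc n)"
    have l: "l > L" "l \<le> L + 1" by (auto simp: l_def)
    have Ul: "U l x > u / 2" if "0 \<le> x" "x \<le> X" for x
      using n[OF that] uge[OF that(1)] unfolding l_def dist_real_def by (smt (verit) field_sum_of_halves)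
    have "NN l"
    proof (rule NN_tail[of l X])
      fix y assume y: "y \<ge> X"
      have "l * integral {X..y} (\<lambda>t. SS t * m t) \<le> (L + 1) * e"
      proof (rule mult_mono)
        show "0 \<le> integral {X..y} (\<lambda>t. SS t * m t)"
          using X by (intro integral_nonneg integrable_on_atLeast_subinterval cSm Sm_nonneg) auto
      qed (use X(2)[of X y] y l L0 e in auto)
      also have "\<dots> = u / 4" using L0 by (simp add: e_def field_simps)
      also have "\<dots> < U l X" using Ul[of X] X up by simp
      finally show "l * integral {X..y} (\<lambda>t. SS t * m t) < U l X" .
    next
      fix x assume "0 \<le> x" "x \<le> X"
      then show "U l x > 0" using Ul[of x] up by simp
    qed (use l L0 X in auto)
    then show False using above[OF l(1)] by simp
  qed
  then have lim0: "(U L \<longlongrightarrow> 0) at_top" using ulim by simp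
  have "bddint (\<lambda>t. \<bar>P L t\<bar> * m t)"
    unfolding bddint_def
  proof (intro exI allI impI)
    fix x :: real assume x: "x \<ge> 0"
    have "integral {0..x} (\<lambda>t. \<bar>P L t\<bar> * m t) = integral {0..x} (\<lambda>t. P L t * m t)"
      by (rule Henstock_Kurzweil_Integration.integral_cong) (use R(2) in auto)
    also have "\<dots> = (1 - U L x) / L" using U_diff[of 0 x L] x L0 by simp
    also have "\<dots> \<le> 1 / L" using Upos[OF x] L0 by (intro divide_right_mono) auto
    finally show "integral {0..x} (\<lambda>t. \<bar>P L t\<bar> * m t) \<le> 1 / L" .
  qed
  moreover have "bddint (\<lambda>t. (P L t)\<^sup>2 * m t)"
  proof -
    obtain C X where CX: "C > 0" "X \<ge> 1" "\<And>x. x \<ge> X \<Longrightarrow> (P L x)\<^sup>2 \<le> C * SS x"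
      using P_square_le_S[OF tc L0 NL lim0] by blast
    show ?thesis
    proof (rule bddint_compare[where g="\<lambda>t. SS t * m t" and c=C and X=X])
      show "(P L x)\<^sup>2 * m x \<le> C * (SS x * m x)" if "x \<ge> X" for x
        using mult_right_mono[OF CX(3)[OF that], of "m x"] mpos[of x] that CX(2) by (simp add: mult.assoc)
      show "bddint (\<lambda>t. SS t * m t)" using tc by (simp add: TC_def)
    qed (use CX in \<open>auto intro!: continuous_intros C Sm_nonneg\<close>)
  qed
  ultimately have "ev L" using lim0 L0 by (simp add: ev_def)
  moreover have "L < lam"
  proof -
    have "L \<in> A" using NL L0 by (simp add: A_def)
    then show ?thesis by (rule Alam)
  qed
  ultimately show ?thesis using that by blast
qed

text \<open>Since \<open>P lam 1 >= SS 1 * U lam 1\<close>, the drop of \<open>U lam\<close> over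
  \<open>[1, 2]\<close> is at least \<open>lam * SS 1 * d * U lam 1\<close>. For
  \<open>lam = 1 / (SS 1 * d)\<close> this is all of \<open>U lam 1\<close>.\<close>

lemma exists_not_NN: obtains lam where "lam > 0" "\<not> NN lam"
proof -
  define d where "d = integral {1..2} m"
  have d: "d > 0"
  proof -
    have "integral {0..1} m < integral {0..2} m"
      by (rule less_by_deriv[where F'=m], simp, rule continuous_on_subset[OF continuous_on_integral_upper[OF cm]], simp, rule DERIV_integral_upper[OF cm])
        (auto intro: mpos)
    then show ?thesis using integral_diff_atLeast[OF cm, of 1 2] by (simp add: d_def)
  qed
  define lam where "lam = 1 / (SS 1 * d)"
  have lam: "lam > 0" using d S_pos[of 1] by (simp add: lam_def)
  have "\<not> NN lam"
  proof
    assume N: "NN lam"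
    note R = NN_region[OF lam N]
    have "0 \<le> integral {0..1} (\<lambda>t. SS t * P lam t * m t)"
    proof (rule integral_nonneg)
      fix t :: real assume "t \<in> {0..1}"
      then show "0 \<le> SS t * P lam t * m t" using S_nonneg[of t] R(2)[of t 1] mpos[of t] by simp
    qed (auto intro!: integrable_on_atLeast_subinterval continuous_intros C)
    then have P1: "SS 1 * U lam 1 \<le> P lam 1" using SU_identity[of 1 lam] lam by simp
    have "integral {1..2} (\<lambda>t. P lam 1 * m t) \<le> integral {1..2} (\<lambda>t. P lam t * m t)"
    proof (rule integral_le)
      fix t :: real assume "t \<in> {1..2}"
      then show "P lam 1 * m t \<le> P lam t * m t" using R(3)[of 1 t] mpos[of t] by (intro mult_right_mono) auto
    qed (auto intro!: integrable_on_atLeast_subinterval continuous_intros C)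
    then have "lam * (P lam 1 * d) \<le> U lam 1 - U lam 2" using U_diff[of 1 2 lam] lam by (simp add: d_def)
    moreover have "lam * (P lam 1 * d) \<ge> lam * (SS 1 * U lam 1 * d)" using P1 lam d by simp
    moreover have "lam * (SS 1 * U lam 1 * d) = U lam 1" using S_pos[of 1] d by (simp add: lam_def)
    moreover have "U lam 2 > 0" using N by (simp add: NN_def)
    ultimately show False by linarith
  qed
  then show ?thesis using that lam by blast
qed

theorem TC_NN_iff:
  assumes TC
  shows "\<exists>l. ev l" "lam > 0 \<Longrightarrow> NN lam \<longleftrightarrow> (\<forall>l. ev l \<longrightarrow> lam \<le> l)"
proof -
  obtain l where "l > 0" "\<not> NN l" by (rule exists_not_NN)
  then show "\<exists>l. ev l" using ev_below[OF assms, of l] by blast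
  assume lam: "lam > 0"
  show "NN lam \<longleftrightarrow> (\<forall>l. ev l \<longrightarrow> lam \<le> l)"
  proof
    assume "NN lam"
    then show "\<forall>l. ev l \<longrightarrow> lam \<le> l" using no_ev_below[OF assms, of lam] by force
  next
    assume a: "\<forall>l. ev l \<longrightarrow> lam \<le> l"
    show "NN lam"
    proof (rule ccontr)
      assume "\<not> NN lam"
      then obtain l where "ev l" "l < lam" by (rule ev_below[OF assms lam])
      then show False using a by auto
    qed
  qed
qed

end

lemma mult_right_le:
  fixes a b c k :: real
  assumes "a \<le> c * b" "k \<ge> 0" shows "a * k \<le> c * (b * k)"
  using mult_right_mono[OF assms] by (simp add: mult.assoc)

lemma bddint_cong:
  assumes "\<And>x. x \<ge> 0 \<Longrightarrow> f x = g x" shows "bddint f \<longleftrightarrow> bddint g"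
proof -
  have "integral {0..x} f = integral {0..x} g" for x
    by (rule Henstock_Kurzweil_Integration.integral_cong) (use assms in auto)
  then show ?thesis by (simp add: bddint_def)
qed

lemma set_integral_Icc_eq_integral:
  fixes f :: "real \<Rightarrow> real"
  assumes "continuous_on {0..} f" "0 \<le> a"
  shows "set_integrable lborel {a..b} f" "(LINT y:{a..b}|lborel. f y) = integral {a..b} f"
proof -
  show 1: "set_integrable lborel {a..b} f"
    by (rule borel_integrable_atLeastAtMost', rule continuous_on_subset[OF assms(1)]) (use assms in auto)
  show "(LINT y:{a..b}|lborel. f y) = integral {a..b} f"
    by (rule set_borel_integral_eq_integral(2)[OF 1])
qed

lemma set_borel_measurable_atLeast:
  fixes f :: "real \<Rightarrow> real"
  assumes "continuous_on {0..} f" shows "set_borel_measurable lborel {0..} f"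
  unfolding set_borel_measurable_def using borel_measurable_continuous_on_indicator[OF _ assms] by simp

lemma set_integrable_iff_bddint:
  fixes f :: "real \<Rightarrow> real"
  assumes cf: "continuous_on {0..} f" and pos: "\<And>x. x \<ge> 0 \<Longrightarrow> f x \<ge> 0"
  shows "set_integrable lborel {0..} f \<longleftrightarrow> bddint f"
proof
  assume i: "set_integrable lborel {0..} f"
  have "integral {0..x} f \<le> (LINT y:{0..}|lborel. f y)" if "x \<ge> 0" for x
  proof -
    have "(LINT y:{0..x}|lborel. f y) \<le> (LINT y:{0..}|lborel. f y)"
      unfolding set_lebesgue_integral_def
      by (rule integral_mono)
        (use pos i set_integral_Icc_eq_integral(1)[OF cf, of 0 x] in \<open>auto simp: set_integrable_def indicator_def\<close>)
    then show ?thesis using set_integral_Icc_eq_integral[OF cf, of 0 x] by simp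
  qed
  then show "bddint f" unfolding bddint_def by blast
next
  assume "bddint f"
  then obtain K where K: "\<And>x. x \<ge> 0 \<Longrightarrow> integral {0..x} f \<le> K" by (auto simp: bddint_def)
  obtain L where L: "((\<lambda>x. integral {0..x} f) \<longlongrightarrow> L) at_top"
    by (rule mono_bounded_tendsto[of 0 "\<lambda>x. integral {0..x} f" K]) (use integral_mono_upper[OF cf pos] K in auto)
  show "set_integrable lborel {0..} f"
    unfolding set_integrable_def
  proof (rule integrable_monotone_convergence[where x=L and f="\<lambda>i x. indicator {0..real i} x *\<^sub>R f x"])
    show "integrable lborel (\<lambda>x. indicator {0..real i} x *\<^sub>R f x)" for i
      using set_integral_Icc_eq_integral(1)[OF cf, of 0 "real i"] by (simp add: set_integrable_def)
    show "AE x in lborel. mono (\<lambda>n. indicator {0..real n} x *\<^sub>R f x)"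
    proof (intro AE_I2 monoI)
      fix x :: real and i j :: nat assume "i \<le> j"
      then show "indicator {0..real i} x *\<^sub>R f x \<le> indicator {0..real j} x *\<^sub>R f x"
        using pos[of x] by (auto simp: indicator_def)
    qed
    show "AE x in lborel. (\<lambda>i. indicator {0..real i} x *\<^sub>R f x) \<longlonglongrightarrow> indicator {0..} x *\<^sub>R f x"
    proof (intro AE_I2 tendsto_eventually)
      fix x :: real
      show "\<forall>\<^sub>F i in sequentially. indicator {0..real i} x *\<^sub>R f x = indicator {0..} x *\<^sub>R f x"
        using eventually_ge_at_top[of "nat \<lceil>x\<rceil>"] by eventually_elim (auto simp: indicator_def)
    qed
    have "(\<lambda>i. integral {0..real i} f) \<longlonglongrightarrow> L"
      using filterlim_compose[OF L filterlim_real_sequentially] by simp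
    then show "(\<lambda>i. LINT x|lborel. indicator {0..real i} x *\<^sub>R f x) \<longlonglongrightarrow> L"
      using set_integral_Icc_eq_integral(2)[OF cf, of 0] by (simp add: set_lebesgue_integral_def)
    show "(\<lambda>x. indicator {0..} x *\<^sub>R f x) \<in> borel_measurable lborel"
      using set_borel_measurable_atLeast[OF cf] by (simp add: set_borel_measurable_def)
  qed
qed

context string_eq
begin

lemma U_eq: "x \<ge> 0 \<Longrightarrow> U lam x = 1 - lam * integral {0..x} (\<lambda>t. P lam t * m t)"
  using U_diff[of 0 x lam] by simp

lemma U_converges:
  assumes "bddint (\<lambda>t. \<bar>P lam t\<bar> * m t)"
  obtains L where "(U lam \<longlongrightarrow> L) at_top"
proof -
  have "bddint (\<lambda>t. \<bar>P lam t * m t\<bar>)"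
    using assms bddint_cong[of "\<lambda>t. \<bar>P lam t\<bar> * m t" "\<lambda>t. \<bar>P lam t * m t\<bar>"] mpos by (simp add: abs_mult less_imp_le)
  then obtain L where "((\<lambda>x. integral {0..x} (\<lambda>t. P lam t * m t)) \<longlongrightarrow> L) at_top"
    using bddint_abs_converges[of "\<lambda>t. P lam t * m t"] by (auto intro!: continuous_intros C)
  then have "((\<lambda>x. 1 - lam * integral {0..x} (\<lambda>t. P lam t * m t)) \<longlongrightarrow> 1 - lam * L) at_top" by (intro tendsto_intros)
  moreover have "\<forall>\<^sub>F x in at_top. 1 - lam * integral {0..x} (\<lambda>t. P lam t * m t) = U lam x"
    using eventually_ge_at_top[of 0] by eventually_elim (simp add: U_eq)
  ultimately have "(U lam \<longlongrightarrow> 1 - lam * L) at_top" by (rule Lim_transform_eventually)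
  then show ?thesis using that by blast
qed

text \<open>The factor \<open>sgn L\<close> orients the increment: eventually
  \<open>U lam * sgn L\<close> exceeds half of its limit \<open>|L|\<close>, and this is integrated
  against \<open>s\<close>.\<close>

lemma P_increment_lower:
  assumes lim: "(U lam \<longlongrightarrow> L) at_top" and L: "L \<noteq> 0"
  obtains X where "X \<ge> 0" "\<And>x y. X \<le> x \<Longrightarrow> x \<le> y \<Longrightarrow> \<bar>P lam y - P lam x\<bar> \<ge> \<bar>L\<bar> / 2 * (SS y - SS x)"
proof -
  have "((\<lambda>x. U lam x * sgn L) \<longlongrightarrow> L * sgn L) at_top" by (intro tendsto_intros lim)
  moreover have "L * sgn L > \<bar>L\<bar> / 2" using L by (auto simp: sgn_if)
  ultimately have "\<forall>\<^sub>F x in at_top. U lam x * sgn L > \<bar>L\<bar> / 2" by (rule order_tendstoD)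
  then obtain X where X: "\<And>x. x \<ge> X \<Longrightarrow> U lam x * sgn L > \<bar>L\<bar> / 2" unfolding eventually_at_top_linorder by auto
  show ?thesis
  proof (rule that[of "max X 0"])
    fix x y assume xy: "max X 0 \<le> x" "x \<le> y"
    have "\<bar>L\<bar> / 2 * (SS y - SS x) = integral {x..y} (\<lambda>t. \<bar>L\<bar> / 2 * s t)" using S_diff[of x y] xy by simp
    also have "\<dots> \<le> integral {x..y} (\<lambda>t. sgn L * (s t * U lam t))"
    proof (rule integral_le)
      fix t assume t: "t \<in> {x..y}"
      have "s t * (\<bar>L\<bar> / 2) \<le> s t * (U lam t * sgn L)" using X[of t] spos[of t] t xy by (intro mult_left_mono) auto
      then show "\<bar>L\<bar> / 2 * s t \<le> sgn L * (s t * U lam t)" by (simp add: ac_simps)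
    qed (use xy in \<open>auto intro!: integrable_on_atLeast_subinterval continuous_intros C\<close>)
    also have "\<dots> = sgn L * (P lam y - P lam x)" using P_diff[of x y lam] xy by simp
    also have "\<dots> \<le> \<bar>P lam y - P lam x\<bar>" by (auto simp: sgn_if)
    finally show "\<bar>P lam y - P lam x\<bar> \<ge> \<bar>L\<bar> / 2 * (SS y - SS x)" .
  qed simp
qed

section \<open>Eigenvalues when the trace condition fails\<close>

definition Sunb :: bool where "Sunb \<longleftrightarrow> (\<forall>B::nat. \<exists>n::nat. SS (real n) > real B)"
text \<open>The scale remaining up to infinity, meaningful when \<open>SS\<close> is bounded. For
  unbounded \<open>SS\<close> the value of \<open>lim\<close> is arbitrary, but the disjunction in
  \<open>ev_iff_nonTC\<close> is then already decided by \<open>Sunb\<close>.\<close>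

definition RR :: "real \<Rightarrow> real" where "RR x = lim (\<lambda>n. SS (real n)) - SS x"

lemma cR: "continuous_on {0..} RR" unfolding RR_def[abs_def] by (intro continuous_intros cS)

lemma cPm: "continuous_on {0..} (\<lambda>t. \<bar>P lam t\<bar> * m t)" by (intro continuous_intros C)

text \<open>A nonzero limit of \<open>U lam\<close> makes \<open>|P lam|\<close> grow like
  \<open>SS\<close>; integrability of \<open>|P lam| * m\<close> would then give the trace
  condition.\<close>

lemma U_tendsto_0_if_Sunb:
  assumes nTC: "\<not> TC" and unb: Sunb and L1: "bddint (\<lambda>t. \<bar>P lam t\<bar> * m t)"
  shows "(U lam \<longlongrightarrow> 0) at_top"
proof -
  obtain L where L: "(U lam \<longlongrightarrow> L) at_top" by (rule U_converges[OF L1])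
  have "L = 0"
  proof (rule ccontr)
    assume L0: "L \<noteq> 0"
    obtain X where X: "X \<ge> 0" "\<And>x y. X \<le> x \<Longrightarrow> x \<le> y \<Longrightarrow> \<bar>P lam y - P lam x\<bar> \<ge> \<bar>L\<bar> / 2 * (SS y - SS x)"
      by (rule P_increment_lower[OF L L0]) auto
    \<comment> \<open>Once \<open>SS x >= c\<close>, half of the lower bound for the increment
      absorbs the values at \<open>X\<close>, and \<open>|P lam x| >= |L| / 4 * SS x\<close>
      remains.\<close>
    define c where "c = (\<bar>P lam X\<bar> + \<bar>L\<bar> / 2 * SS X) / (\<bar>L\<bar> / 4)"
    obtain n where n: "SS (real n) > real (nat \<lceil>c\<rceil>)" using unb by (auto simp: Sunb_def)
    define X1 where "X1 = max X (real n)"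
    have "TC"
      unfolding TC_def
    proof (rule bddint_compare[where g="\<lambda>t. \<bar>P lam t\<bar> * m t" and X=X1 and c="4 / \<bar>L\<bar>"])
      fix x assume x: "x \<ge> X1"
      have "SS x \<ge> SS (real n)" using x by (intro S_mono) (auto simp: X1_def)
      then have "SS x \<ge> c" using n by linarith
      then have "(\<bar>L\<bar> / 4) * c \<le> \<bar>L\<bar> / 4 * SS x" by (intro mult_left_mono) auto
      then have "\<bar>P lam X\<bar> + \<bar>L\<bar> / 2 * SS X \<le> \<bar>L\<bar> / 4 * SS x" using L0 by (simp add: c_def)
      moreover have "\<bar>L\<bar> / 2 * SS x - \<bar>L\<bar> / 2 * SS X \<le> \<bar>P lam x - P lam X\<bar>"
        using X(2)[of X x] x by (simp add: X1_def right_diff_distrib)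
      ultimately have "\<bar>L\<bar> / 4 * SS x \<le> \<bar>P lam x\<bar>" by linarith
      then have "SS x \<le> 4 / \<bar>L\<bar> * \<bar>P lam x\<bar>" using L0 by (simp add: field_simps)
      moreover have "m x > 0" using mpos[of x] x X by (simp add: X1_def)
      ultimately show "SS x * m x \<le> 4 / \<bar>L\<bar> * (\<bar>P lam x\<bar> * m x)" by (intro mult_right_le) auto
    qed (use L1 X mpos in \<open>auto intro!: cSm cPm simp: X1_def less_imp_le\<close>)
    then show False using nTC by simp
  qed
  then show ?thesis using L by simp
qed

lemma not_Sunb:
  assumes "\<not> Sunb"
  obtains B where "\<And>x. x \<ge> 0 \<Longrightarrow> SS x \<le> B" "(SS \<longlongrightarrow> lim (\<lambda>n. SS (real n))) at_top" "\<And>x. x \<ge> 0 \<Longrightarrow> RR x \<ge> 0" "B > 0"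
proof -
  obtain B :: nat where B: "\<And>n::nat. SS (real n) \<le> real B" using assms unfolding Sunb_def by (meson not_less)
  have B': "SS x \<le> real B" if "x \<ge> 0" for x
    using S_mono[of x "real (nat \<lceil>x\<rceil>)"] B[of "nat \<lceil>x\<rceil>"] that by linarith
  obtain L where L: "(SS \<longlongrightarrow> L) at_top" "\<And>x. 0 \<le> x \<Longrightarrow> SS x \<le> L"
    by (rule mono_bounded_tendsto[of 0 SS "real B"]) (use S_mono B' in auto)
  have "lim (\<lambda>n. SS (real n)) = L" by (rule limI) (rule filterlim_compose[OF L(1) filterlim_real_sequentially])
  moreover have "real B > 0" using S_pos[of 1] B'[of 1] by simp
  ultimately show ?thesis using that[of "real B"] B' L by (simp add: RR_def)
qed

text \<open>With \<open>SS\<close> bounded, failure of the trace condition forces \<open>m\<close>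
  to have infinite mass. As \<open>U lam\<close> is bounded and \<open>s\<close> integrable,
  \<open>P lam\<close> converges, and a nonzero limit would make the mass of \<open>m\<close>
  finite.\<close>

lemma P_tendsto_0:
  assumes nTC: "\<not> TC" and unb: "\<not> Sunb" and L1: "bddint (\<lambda>t. \<bar>P lam t\<bar> * m t)"
  shows "(P lam \<longlongrightarrow> 0) at_top"
proof -
  obtain B where B: "\<And>x. x \<ge> 0 \<Longrightarrow> SS x \<le> B" "B > 0" by (rule not_Sunb[OF unb]) auto
  have nm: "\<not> bddint m"
  proof
    assume b: "bddint m"
    have TC unfolding TC_def
      by (rule bddint_compare[where g=m and X=0 and c=B]) (use b B mpos in \<open>auto intro!: cSm cm mult_right_mono simp: less_imp_le\<close>)
    then show False using nTC by simp
  qed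
  obtain K where K: "\<And>x. x \<ge> 0 \<Longrightarrow> integral {0..x} (\<lambda>t. \<bar>P lam t\<bar> * m t) \<le> K" using L1 by (auto simp: bddint_def)
  have Ub: "\<bar>U lam x\<bar> \<le> 1 + \<bar>lam\<bar> * K" if "x \<ge> 0" for x
  proof -
    have "norm (integral {0..x} (\<lambda>t. P lam t * m t)) \<le> integral {0..x} (\<lambda>t. \<bar>P lam t\<bar> * m t)"
      by (rule integral_norm_bound_integral) (use mpos in \<open>auto intro!: integrable_on_atLeast_subinterval continuous_intros C simp: abs_mult less_imp_le\<close>)
    then have "\<bar>lam\<bar> * \<bar>integral {0..x} (\<lambda>t. P lam t * m t)\<bar> \<le> \<bar>lam\<bar> * K" using K[OF that] by (intro mult_left_mono) auto
    then have "\<bar>lam * integral {0..x} (\<lambda>t. P lam t * m t)\<bar> \<le> \<bar>lam\<bar> * K" by (simp add: abs_mult)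
    then show ?thesis using U_eq[OF that, of lam] by linarith
  qed
  have "bddint s" unfolding bddint_def using B by (auto simp: SS_def[symmetric])
  then have "bddint (\<lambda>t. \<bar>s t * U lam t\<bar>)"
  proof (rule bddint_compare[where g=s and X=0 and c="1 + \<bar>lam\<bar> * K", rotated -1])
    fix x :: real assume x: "0 \<le> x"
    show "\<bar>s x * U lam x\<bar> \<le> (1 + \<bar>lam\<bar> * K) * s x" using Ub[OF x] spos[OF x] by (simp add: abs_mult mult.commute mult_left_mono)
  next
    show "0 \<le> 1 + \<bar>lam\<bar> * K" using Ub[of 0] by simp
  qed (use spos in \<open>auto intro!: continuous_intros C simp: less_imp_le\<close>)
  then obtain p where p: "((\<lambda>x. integral {0..x} (\<lambda>t. s t * U lam t)) \<longlongrightarrow> p) at_top"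
    using bddint_abs_converges[of "\<lambda>t. s t * U lam t"] by (auto intro!: continuous_intros C)
  have Pp: "(P lam \<longlongrightarrow> p) at_top"
    by (rule Lim_transform_eventually[OF p])
      (use P_diff[of 0 _ lam] in \<open>auto intro!: eventually_mono[OF eventually_ge_at_top[of 0]]\<close>)
  have "p = 0"
  proof (rule ccontr)
    assume p0: "p \<noteq> 0"
    have "\<forall>\<^sub>F x in at_top. \<bar>P lam x\<bar> > \<bar>p\<bar> / 2" using order_tendstoD(1)[OF tendsto_rabs[OF Pp], of "\<bar>p\<bar> / 2"] p0 by simp
    then obtain X where X: "\<And>x. x \<ge> X \<Longrightarrow> \<bar>P lam x\<bar> > \<bar>p\<bar> / 2" unfolding eventually_at_top_linorder by auto
    have "bddint m"
    proof (rule bddint_compare[where g="\<lambda>t. \<bar>P lam t\<bar> * m t" and X="max X 0" and c="2 / \<bar>p\<bar>"])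
      fix x assume x: "x \<ge> max X 0"
      have "1 \<le> 2 / \<bar>p\<bar> * \<bar>P lam x\<bar>" using X[of x] x p0 by (simp add: field_simps)
      then show "m x \<le> 2 / \<bar>p\<bar> * (\<bar>P lam x\<bar> * m x)" using mult_right_le[of 1 "2 / \<bar>p\<bar>" "\<bar>P lam x\<bar>" "m x"] mpos[of x] x by simp
    qed (use L1 mpos in \<open>auto intro!: cPm cm simp: less_imp_le\<close>)
    then show False using nm by simp
  qed
  then show ?thesis using Pp by simp
qed

text \<open>Integrating back from infinity, where \<open>P lam\<close> vanishes, a nonzero limit
  \<open>L\<close> of \<open>U lam\<close> forces \<open>|P lam| >= |L| / 2 * RR\<close> far out,
  and hence integrability of \<open>RR m\<close>.\<close>

lemma U_tendsto_0_if_RR: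
  assumes nTC: "\<not> TC" and unb: "\<not> Sunb" and L1: "bddint (\<lambda>t. \<bar>P lam t\<bar> * m t)" and R: "\<not> bddint (\<lambda>t. RR t * m t)"
  shows "(U lam \<longlongrightarrow> 0) at_top"
proof -
  obtain L where L: "(U lam \<longlongrightarrow> L) at_top" by (rule U_converges[OF L1])
  have SL: "(SS \<longlongrightarrow> lim (\<lambda>n. SS (real n))) at_top" by (rule not_Sunb[OF unb]) auto
  have "L = 0"
  proof (rule ccontr)
    assume L0: "L \<noteq> 0"
    obtain X where X: "X \<ge> 0" "\<And>x y. X \<le> x \<Longrightarrow> x \<le> y \<Longrightarrow> \<bar>P lam y - P lam x\<bar> \<ge> \<bar>L\<bar> / 2 * (SS y - SS x)"
      by (rule P_increment_lower[OF L L0]) auto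
    have low: "\<bar>L\<bar> / 2 * RR x \<le> \<bar>P lam x\<bar>" if "x \<ge> X" for x
    proof -
      have "((\<lambda>y. \<bar>P lam y - P lam x\<bar>) \<longlongrightarrow> \<bar>0 - P lam x\<bar>) at_top" by (intro tendsto_intros P_tendsto_0[OF nTC unb L1])
      moreover have "((\<lambda>y. \<bar>L\<bar> / 2 * (SS y - SS x)) \<longlongrightarrow> \<bar>L\<bar> / 2 * (lim (\<lambda>n. SS (real n)) - SS x)) at_top" by (intro tendsto_intros SL)
      ultimately have "\<bar>L\<bar> / 2 * (lim (\<lambda>n. SS (real n)) - SS x) \<le> \<bar>0 - P lam x\<bar>"
        by (rule tendsto_le[rotated]) (use X(2)[OF that] in \<open>auto intro!: eventually_mono[OF eventually_ge_at_top[of x]]\<close>)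
      then show ?thesis by (simp add: RR_def)
    qed
    have "bddint (\<lambda>t. RR t * m t)"
    proof (rule bddint_compare[where g="\<lambda>t. \<bar>P lam t\<bar> * m t" and X=X and c="2 / \<bar>L\<bar>"])
      fix x assume x: "x \<ge> X"
      have "RR x \<le> 2 / \<bar>L\<bar> * \<bar>P lam x\<bar>" using low[OF x] L0 by (simp add: field_simps)
      then show "RR x * m x \<le> 2 / \<bar>L\<bar> * (\<bar>P lam x\<bar> * m x)" using mpos[of x] x X(1) by (intro mult_right_le) auto
    qed (use L1 X mpos in \<open>auto intro!: cPm continuous_intros cR cm simp: less_imp_le\<close>)
    then show False using R by simp
  qed
  then show ?thesis using L by simp
qed

text \<open>A contraction argument at infinity, where both \<open>P lam\<close> and
  \<open>U lam\<close> would vanish. With \<open>M\<close> the supremum of \<open>|U lam|\<close>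
  beyond \<open>X\<close>, integrating back gives \<open>|P lam| <= M * RR\<close> and then
  \<open>|U lam| <= M / 2\<close>, since the tails of \<open>lam * integral RR m\<close> beyond
  \<open>X\<close> are at most 1/2. So \<open>M = 0\<close>, and \<open>P lam\<close>,
  \<open>U lam\<close> have a common zero, against \<open>phi_uu_det\<close>.\<close>

lemma no_ev_if_RR:
  assumes nTC: "\<not> TC" and unb: "\<not> Sunb" and R: "bddint (\<lambda>t. RR t * m t)"
  shows "\<not> ev lam"
proof
  assume e: "ev lam"
  have L1: "bddint (\<lambda>t. \<bar>P lam t\<bar> * m t)" and U0': "(U lam \<longlongrightarrow> 0) at_top" using e by (auto simp: ev_def)
  note P0' = P_tendsto_0[OF nTC unb L1]
  have lam: "lam > 0" by (rule ev_pos[OF e])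
  have SL: "(SS \<longlongrightarrow> lim (\<lambda>n. SS (real n))) at_top" and RRpos: "\<And>x. x \<ge> 0 \<Longrightarrow> RR x \<ge> 0" by (rule not_Sunb[OF unb], auto)+
  have cRm: "continuous_on {0..} (\<lambda>t. RR t * m t)" by (intro continuous_intros cR cm)
  have Rm0: "RR t * m t \<ge> 0" if "t \<ge> 0" for t using RRpos[OF that] mpos[OF that] by simp
  obtain K where K: "\<And>x. x \<ge> 0 \<Longrightarrow> integral {0..x} (\<lambda>t. RR t * m t) \<le> K" using R by (auto simp: bddint_def)
  obtain k where k: "((\<lambda>x. integral {0..x} (\<lambda>t. RR t * m t)) \<longlongrightarrow> k) at_top" "\<And>x. 0 \<le> x \<Longrightarrow> integral {0..x} (\<lambda>t. RR t * m t) \<le> k"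
    by (rule mono_bounded_tendsto[of 0 "\<lambda>x. integral {0..x} (\<lambda>t. RR t * m t)" K]) (use integral_mono_upper[OF cRm Rm0] K in auto)
  have "\<forall>\<^sub>F x in at_top. integral {0..x} (\<lambda>t. RR t * m t) > k - 1 / (2 * lam)" using order_tendstoD(1)[OF k(1)] lam by simp
  then have "\<forall>\<^sub>F x in at_top. x \<ge> 0 \<and> integral {0..x} (\<lambda>t. RR t * m t) > k - 1 / (2 * lam)"
    using eventually_conj[OF eventually_ge_at_top[of 0]] by blast
  then obtain X where X: "X \<ge> 0" "\<And>x. x \<ge> X \<Longrightarrow> integral {0..x} (\<lambda>t. RR t * m t) > k - 1 / (2 * lam)"
    unfolding eventually_at_top_linorder by (metis order_refl)
  have tail: "lam * integral {x..y} (\<lambda>t. RR t * m t) \<le> 1 / 2" if "X \<le> x" "x \<le> y" for x y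
  proof -
    have "integral {x..y} (\<lambda>t. RR t * m t) \<le> 1 / (2 * lam)"
      using integral_diff_atLeast[OF cRm, of x y] X(2)[of x] k(2)[of y] that X(1) by simp
    then show ?thesis using lam by (simp add: field_simps)
  qed
  obtain Bu where Bu: "\<And>x. x \<ge> X \<Longrightarrow> \<bar>U lam x\<bar> \<le> Bu"
  proof -
    have "\<forall>\<^sub>F x in at_top. \<bar>U lam x\<bar> < 1" using order_tendstoD(2)[OF tendsto_rabs[OF U0']] by simp
    then obtain Y where Y: "\<And>x. x \<ge> Y \<Longrightarrow> \<bar>U lam x\<bar> < 1" unfolding eventually_at_top_linorder by auto
    obtain B where B: "B > 0" "\<And>x. 0 \<le> x \<Longrightarrow> x \<le> Y \<Longrightarrow> \<bar>U lam x\<bar> \<le> B" by (rule continuous_bounded_Icc[OF cU]) auto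
    have "\<bar>U lam x\<bar> \<le> max 1 B" if "x \<ge> X" for x using Y[of x] B(2)[of x] that X(1) by (cases "x \<ge> Y") auto
    then show ?thesis using that by blast
  qed
  define M where "M = Sup ((\<lambda>x. \<bar>U lam x\<bar>) ` {X..})"
  have bdd: "bdd_above ((\<lambda>x. \<bar>U lam x\<bar>) ` {X..})" by (rule bdd_aboveI[of _ Bu]) (use Bu in auto)
  have UM: "\<bar>U lam x\<bar> \<le> M" if "x \<ge> X" for x unfolding M_def by (rule cSup_upper[OF _ bdd]) (use that in auto)
  have M0: "M \<ge> 0" using UM[of X] by simp
  have PM: "\<bar>P lam x\<bar> \<le> M * RR x" if x: "x \<ge> X" for x
  proof -
    have "\<forall>\<^sub>F y in at_top. \<bar>P lam y - P lam x\<bar> \<le> M * (SS y - SS x)"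
      using eventually_ge_at_top[of x]
    proof eventually_elim
      case (elim y)
      have "norm (integral {x..y} (\<lambda>t. s t * U lam t)) \<le> integral {x..y} (\<lambda>t. M * s t)"
      proof (rule integral_norm_bound_integral)
        fix t assume t: "t \<in> {x..y}"
        show "norm (s t * U lam t) \<le> M * s t" using UM[of t] spos[of t] t x X(1) by (simp add: abs_mult mult.commute mult_left_mono)
      qed (use x X(1) in \<open>auto intro!: integrable_on_atLeast_subinterval continuous_intros C\<close>)
      then show ?case using P_diff[of x y lam] S_diff[of x y] x X(1) elim by simp
    qed
    moreover have "((\<lambda>y. \<bar>P lam y - P lam x\<bar>) \<longlongrightarrow> \<bar>0 - P lam x\<bar>) at_top" by (intro tendsto_intros P0')
    moreover have "((\<lambda>y. M * (SS y - SS x)) \<longlongrightarrow> M * (lim (\<lambda>n. SS (real n)) - SS x)) at_top" by (intro tendsto_intros SL)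
    ultimately have "\<bar>0 - P lam x\<bar> \<le> M * (lim (\<lambda>n. SS (real n)) - SS x)" by (intro tendsto_le[OF trivial_limit_at_top_linorder])
    then show ?thesis by (simp add: RR_def)
  qed
  have UM2: "\<bar>U lam x\<bar> \<le> M / 2" if x: "x \<ge> X" for x
  proof (rule tendsto_upperbound[where F=at_top and f="\<lambda>y. \<bar>U lam x - U lam y\<bar>"])
    have "((\<lambda>y. \<bar>U lam x - U lam y\<bar>) \<longlongrightarrow> \<bar>U lam x - 0\<bar>) at_top" by (intro tendsto_intros U0')
    then show "((\<lambda>y. \<bar>U lam x - U lam y\<bar>) \<longlongrightarrow> \<bar>U lam x\<bar>) at_top" by simp
    show "\<forall>\<^sub>F y in at_top. \<bar>U lam x - U lam y\<bar> \<le> M / 2"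
      using eventually_ge_at_top[of x]
    proof eventually_elim
      case (elim y)
      have "norm (integral {x..y} (\<lambda>t. P lam t * m t)) \<le> integral {x..y} (\<lambda>t. M * (RR t * m t))"
      proof (rule integral_norm_bound_integral)
        fix t assume t: "t \<in> {x..y}"
        show "norm (P lam t * m t) \<le> M * (RR t * m t)"
          using mult_right_mono[OF PM[of t], of "m t"] mpos[of t] t x X(1) by (simp add: abs_mult mult.assoc)
      qed (use x X(1) in \<open>auto intro!: integrable_on_atLeast_subinterval continuous_intros C cR\<close>)
      then have "lam * \<bar>integral {x..y} (\<lambda>t. P lam t * m t)\<bar> \<le> lam * (M * integral {x..y} (\<lambda>t. RR t * m t))" using lam by simp
      also have "\<dots> = M * (lam * integral {x..y} (\<lambda>t. RR t * m t))" by simp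
      also have "\<dots> \<le> M * (1 / 2)" by (rule mult_left_mono[OF tail[OF x elim] M0])
      finally show ?case using U_diff[of x y lam] x X(1) elim lam by (simp add: abs_mult)
    qed
  qed simp
  have "M \<le> M / 2" unfolding M_def[symmetric] by (subst M_def, rule cSup_least) (use UM2 in auto)
  then have "M = 0" using M0 by simp
  then have "U lam X = 0" "P lam X = 0" using UM[of X] PM[of X] by auto
  then show False using phi_uu_det[OF cs cg[of lam] X(1)] by (simp add: P_def U_def)
qed

text \<open>Without the trace condition, the boundary condition \<open>U lam -> 0\<close> either
  follows from integrability or can never be met. What remains involves \<open>lam\<close> through
  its sign and two integrability conditions, a form suited to the measurability proof.\<close>

theorem ev_iff_nonTC:
  assumes "\<not> TC"
  shows "ev lam \<longleftrightarrow> (Sunb \<or> \<not> bddint (\<lambda>t. RR t * m t)) \<and> lam > 0 \<and> bddint (\<lambda>t. \<bar>P lam t\<bar> * m t) \<and> bddint (\<lambda>t. (P lam t)\<^sup>2 * m t)"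
proof
  assume e: "ev lam"
  then have "Sunb \<or> \<not> bddint (\<lambda>t. RR t * m t)" using no_ev_if_RR[OF assms, of lam] by blast
  then show "(Sunb \<or> \<not> bddint (\<lambda>t. RR t * m t)) \<and> lam > 0 \<and> bddint (\<lambda>t. \<bar>P lam t\<bar> * m t) \<and> bddint (\<lambda>t. (P lam t)\<^sup>2 * m t)"
    using e ev_pos[OF e] unfolding ev_def by blast
next
  assume a: "(Sunb \<or> \<not> bddint (\<lambda>t. RR t * m t)) \<and> lam > 0 \<and> bddint (\<lambda>t. \<bar>P lam t\<bar> * m t) \<and> bddint (\<lambda>t. (P lam t)\<^sup>2 * m t)"
  then have "(U lam \<longlongrightarrow> 0) at_top"
    using U_tendsto_0_if_Sunb[OF assms, of lam] U_tendsto_0_if_RR[OF assms, of lam] by blast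
  then show "ev lam" using a unfolding ev_def by auto
qed

section \<open>The integral equation and the boundary condition at infinity\<close>

lemma kernel_split:
  assumes f: "set_integrable lborel {0..} f" and x: "x \<ge> 0"
  shows "set_integrable lborel {0..} (\<lambda>y. SS (min x y) * f y)"
    "(LINT y:{0..}|lborel. SS (min x y) * f y) = integral {0..x} (\<lambda>y. SS y * f y) + SS x * ((LINT y:{0..}|lborel. f y) - integral {0..x} f)"
    "(\<lambda>y. SS y * f y) integrable_on {0..x}" "f integrable_on {0..x}"
proof -
  have cmin: "continuous_on {0..} (\<lambda>y. SS (min x y))"
    by (rule continuous_on_compose2[OF cS]) (use x in \<open>auto intro!: continuous_intros\<close>)
  have "set_borel_measurable lborel {0..} (\<lambda>y. SS (min x y) * f y)"
  proof -
    have "(\<lambda>y. (indicator {0..} y *\<^sub>R SS (min x y)) * (indicator {0..} y *\<^sub>R f y)) \<in> borel_measurable lborel"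
      using set_borel_measurable_atLeast[OF cmin] f
      by (intro borel_measurable_times) (auto simp: set_borel_measurable_def set_integrable_def)
    moreover have "(\<lambda>y. (indicator {0..} y *\<^sub>R SS (min x y)) * (indicator {0..} y *\<^sub>R f y)) = (\<lambda>y. indicator {0..} y *\<^sub>R (SS (min x y) * f y))"
      by (auto simp: indicator_def)
    ultimately show ?thesis by (simp add: set_borel_measurable_def)
  qed
  note meas = this
  have bd: "set_integrable lborel {0..} (\<lambda>y. SS x * f y)" using f by simp
  have le: "norm (SS (min x y) * f y) \<le> norm (SS x * f y)" if "y \<in> {0..}" for y
  proof -
    have "0 \<le> SS (min x y)" "SS (min x y) \<le> SS x" using S_nonneg[of "min x y"] S_mono[of "min x y" x] x that by auto
    then show ?thesis by (simp add: abs_mult mult_right_mono)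
  qed
  show i: "set_integrable lborel {0..} (\<lambda>y. SS (min x y) * f y)"
    by (rule set_integrable_bound[OF bd meas]) (use le in blast)
  have sp: "{0..} = {0..x} \<union> {x<..}" using x by auto
  have sub: "set_integrable lborel {0..x} h" "set_integrable lborel {x<..} h" if "set_integrable lborel {0..} h" for h :: "real \<Rightarrow> real"
    by (rule set_integrable_subset[OF that]; use x in auto)+
  have split: "(LINT y:{0..}|lborel. h y) = (LINT y:{0..x}|lborel. h y) + (LINT y:{x<..}|lborel. h y)"
    if "set_integrable lborel {0..} h" for h :: "real \<Rightarrow> real"
    unfolding sp by (rule set_integral_Un) (use sub[OF that] in auto)
  have 1: "set_integrable lborel {0..x} (\<lambda>y. SS y * f y)"
  proof -
    have "set_integrable lborel {0..x} (\<lambda>y. SS (min x y) * f y)" by (rule sub(1)[OF i])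
    moreover have "set_integrable lborel {0..x} (\<lambda>y. SS (min x y) * f y) = set_integrable lborel {0..x} (\<lambda>y. SS y * f y)"
      by (rule set_integrable_cong) auto
    ultimately show ?thesis by simp
  qed
  show "(\<lambda>y. SS y * f y) integrable_on {0..x}" "f integrable_on {0..x}"
    using set_borel_integral_eq_integral(1)[OF 1] set_borel_integral_eq_integral(1)[OF sub(1)[OF f]] by auto
  have "(LINT y:{0..x}|lborel. SS (min x y) * f y) = (LINT y:{0..x}|lborel. SS y * f y)"
    by (rule set_lebesgue_integral_cong) auto
  moreover have "(LINT y:{x<..}|lborel. SS (min x y) * f y) = (LINT y:{x<..}|lborel. SS x * f y)"
    by (rule set_lebesgue_integral_cong) auto
  ultimately show "(LINT y:{0..}|lborel. SS (min x y) * f y) = integral {0..x} (\<lambda>y. SS y * f y) + SS x * ((LINT y:{0..}|lborel. f y) - integral {0..x} f)"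
    using split[OF i] split[OF f] set_borel_integral_eq_integral(2)[OF 1] set_borel_integral_eq_integral(2)[OF sub(1)[OF f]] by simp
qed

end

context string_eq
begin

text \<open>The notion \<open>is_G_eigenvalue\<close> for general coefficients.\<close>

definition gev :: "real \<Rightarrow> bool" where
  "gev lam \<longleftrightarrow> (\<exists>\<psi>::real \<Rightarrow> real. \<psi> \<in> borel_measurable lborel \<and> set_integrable lborel {0..} (\<lambda>y. (\<psi> y)\<^sup>2 * m y) \<and>
        \<not> (AE y in lborel. y \<ge> 0 \<longrightarrow> \<psi> y = 0) \<and>
        (\<forall>x\<ge>0. set_integrable lborel {0..} (\<lambda>y. SS (min x y) * \<psi> y * m y) \<and>
                 \<psi> x = lam * (LINT y:{0..}|lborel. SS (min x y) * \<psi> y * m y)))"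

text \<open>The equation holds at every point, so \<open>\<psi>\<close> inherits continuity from its
  right-hand side and solves the canonical system with quasi-derivative \<open>H\<close>, which is
  \<open>lam\<close> times the integral of \<open>\<psi> m\<close> beyond \<open>x\<close> and so
  tends to 0. Uniqueness makes \<open>\<psi>\<close> a nonzero multiple of
  \<open>P lam\<close>.\<close>

lemma gev_imp_ev: assumes "gev lam" shows "ev lam"
proof -
  obtain \<psi> where meas: "\<psi> \<in> borel_measurable lborel" and L2: "set_integrable lborel {0..} (\<lambda>y. (\<psi> y)\<^sup>2 * m y)"
    and nz: "\<not> (AE y in lborel. y \<ge> 0 \<longrightarrow> \<psi> y = 0)"
    and i: "\<And>x. x \<ge> 0 \<Longrightarrow> set_integrable lborel {0..} (\<lambda>y. SS (min x y) * \<psi> y * m y)"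
    and eq: "\<And>x. x \<ge> 0 \<Longrightarrow> \<psi> x = lam * (LINT y:{0..}|lborel. SS (min x y) * \<psi> y * m y)"
    using assms unfolding gev_def by auto
  have nz': "\<exists>x\<ge>0. \<psi> x \<noteq> 0"
  proof (rule ccontr)
    assume "\<not> (\<exists>x\<ge>0. \<psi> x \<noteq> 0)"
    then have "AE y in lborel. y \<ge> 0 \<longrightarrow> \<psi> y = 0" by (intro AE_I2) blast
    then show False using nz by contradiction
  qed
  then obtain x0 where x0: "x0 \<ge> 0" "\<psi> x0 \<noteq> 0" by blast
  have lam: "lam \<noteq> 0" using eq[OF x0(1)] x0(2) by (metis mult_zero_left)
  let ?f = "\<lambda>y. \<psi> y * m y"
  have mI: "(\<lambda>y. indicator {0..} y *\<^sub>R m y) \<in> borel_measurable lborel"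
    using set_borel_measurable_atLeast[OF cm] by (simp add: set_borel_measurable_def)
  \<comment> \<open>On \<open>[1, \<infinity>)\<close> the kernel at \<open>x = 1\<close> is the
    positive constant \<open>SS 1\<close>, so its integrability is that of \<open>\<psi> m\<close>.
    On \<open>[0, 1]\<close> square integrability and \<open>|\<psi>| <= 1 + \<psi>^2\<close>
    suffice.\<close>
  have f: "set_integrable lborel {0..} ?f"
  proof -
    have "set_integrable lborel {1..} (\<lambda>y. SS (min 1 y) * \<psi> y * m y)"
      by (rule set_integrable_subset[OF i[of 1]]) auto
    moreover have "set_integrable lborel {1..} (\<lambda>y. SS (min 1 y) * \<psi> y * m y) = set_integrable lborel {1..} (\<lambda>y. SS 1 * (\<psi> y * m y))"
      by (rule set_integrable_cong) auto
    ultimately have 1: "set_integrable lborel {1..} ?f" using S_pos[of 1] by simp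
    have 2: "set_integrable lborel {0..1} ?f"
    proof (rule set_integrable_bound[where f="\<lambda>y. m y + (\<psi> y)\<^sup>2 * m y"])
      have "set_integrable lborel {0..1} (\<lambda>y. (\<psi> y)\<^sup>2 * m y)" by (rule set_integrable_subset[OF L2]) auto
      then show "set_integrable lborel {0..1} (\<lambda>y. m y + (\<psi> y)\<^sup>2 * m y)"
        using set_integral_Icc_eq_integral(1)[OF cm, of 0 1] by (intro set_integral_add) auto
      have "(\<lambda>y. indicator {0..1} y *\<^sub>R (\<psi> y * (indicator {0..} y *\<^sub>R m y))) \<in> borel_measurable lborel"
        using mI meas by measurable
      moreover have "(\<lambda>y. indicator {0..1} y *\<^sub>R (\<psi> y * (indicator {0..} y *\<^sub>R m y))) = (\<lambda>y. indicator {0..1} y *\<^sub>R (\<psi> y * m y))"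
        by (auto simp: indicator_def)
      ultimately show "set_borel_measurable lborel {0..1} ?f" by (simp add: set_borel_measurable_def)
      have "\<bar>\<psi> y\<bar> * m y \<le> (1 + (\<psi> y)\<^sup>2) * m y" if "y \<ge> 0" for y
      proof (rule mult_right_mono)
        have "0 \<le> (\<bar>\<psi> y\<bar> - 1/2)\<^sup>2" by simp
        then show "\<bar>\<psi> y\<bar> \<le> 1 + (\<psi> y)\<^sup>2" by (simp add: power2_eq_square algebra_simps)
      qed (use mpos[OF that] in simp)
      then show "AE y in lborel. y \<in> {0..1} \<longrightarrow> norm (?f y) \<le> norm (m y + (\<psi> y)\<^sup>2 * m y)"
        using mpos by (intro AE_I2) (auto simp: abs_mult distrib_right less_imp_le intro!: order_trans[OF _ abs_ge_self])
    qed
    have "set_integrable lborel ({0..1} \<union> {1..}) ?f" by (rule set_integrable_Un[OF 2 1]) auto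
    moreover have "{0..1} \<union> {1..} = {0::real..}" by auto
    ultimately show ?thesis by simp
  qed
  define I where "I = (LINT y:{0..}|lborel. ?f y)"
  have Feq: "\<psi> x = lam * (integral {0..x} (\<lambda>y. SS y * ?f y) + SS x * (I - integral {0..x} ?f))" if "x \<ge> 0" for x
    using eq[OF that] kernel_split(2)[OF f that] by (simp add: I_def mult.assoc)
  have int4: "?f integrable_on {0..T}" and int3: "(\<lambda>y. SS y * ?f y) integrable_on {0..T}" for T
  proof -
    have "?f integrable_on {0..T} \<and> (\<lambda>y. SS y * ?f y) integrable_on {0..T}"
    proof (cases "T \<ge> 0")
      case True
      show ?thesis using kernel_split(3,4)[OF f True] by blast
    next
      case False
      then have "{0..T} = {}" by simp
      then show ?thesis using integrable_on_empty by metis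
    qed
    then show "?f integrable_on {0..T}" "(\<lambda>y. SS y * ?f y) integrable_on {0..T}" by blast+
  qed
  have cF: "continuous_on {0..} (\<lambda>x. integral {0..x} ?f)"
    by (intro continuous_on_atLeast_from_Icc indefinite_integral_continuous_1) (rule int4)
  have cG: "continuous_on {0..} (\<lambda>x. integral {0..x} (\<lambda>y. SS y * ?f y))"
    by (intro continuous_on_atLeast_from_Icc indefinite_integral_continuous_1) (rule int3)
  have c\<psi>: "continuous_on {0..} \<psi>"
  proof -
    have "continuous_on {0..} (\<lambda>x. lam * (integral {0..x} (\<lambda>y. SS y * ?f y) + SS x * (I - integral {0..x} ?f)))"
      by (intro continuous_intros cF cG cS)
    then show ?thesis by (subst continuous_on_cong[OF refl]) (auto simp: Feq[symmetric])
  qed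
  have cf: "continuous_on {0..} ?f" by (intro continuous_intros c\<psi> cm)
  define H where "H x = lam * (I - integral {0..x} ?f)" for x
  have sol: "lsol s (\<lambda>t. lam * m t) \<psi> H"
    unfolding lsol_def
  proof (intro conjI allI impI)
    show "continuous_on {0..} \<psi>" by fact
    show "continuous_on {0..} H" unfolding H_def[abs_def] by (intro continuous_intros cF)
    fix x :: real assume x: "x > 0"
    have DF: "DERIV (\<lambda>x. integral {0..x} ?f) x :> ?f x" by (rule DERIV_integral_upper[OF cf x])
    have DG: "DERIV (\<lambda>x. integral {0..x} (\<lambda>y. SS y * ?f y)) x :> SS x * ?f x"
      by (rule DERIV_integral_upper[OF _ x]) (intro continuous_intros cS c\<psi> cm)
    have "DERIV (\<lambda>x. lam * (integral {0..x} (\<lambda>y. SS y * ?f y) + SS x * (I - integral {0..x} ?f))) x :> s x * H x"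
      by (rule derivative_eq_intros DF DG DS x refl)+ (simp add: H_def algebra_simps)
    then show "DERIV \<psi> x :> s x * H x"
      by (rule has_field_derivative_transform_within_open[where S="{0<..}"]) (use x Feq in auto)
    show "DERIV H x :> - (lam * m x) * \<psi> x"
      unfolding H_def[abs_def] by (rule derivative_eq_intros DF refl)+ (simp add: algebra_simps)
  qed
  have "\<psi> 0 = 0" using Feq[of 0] by simp
  note un = lsol_unique[OF cs cg sol this, folded P_def U_def]
  have H0: "H 0 \<noteq> 0" using x0 un(1)[OF x0(1)] by auto
  have Hlim: "(H \<longlongrightarrow> 0) at_top"
  proof -
    have "((\<lambda>b. LINT y:{0..b}|lborel. ?f y) \<longlongrightarrow> I) at_top"
      unfolding I_def by (rule tendsto_set_lebesgue_integral_at_top) (use f in auto)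
    moreover have "(LINT y:{0..b}|lborel. ?f y) = integral {0..b} ?f" for b
      by (rule set_integral_Icc_eq_integral(2)[OF cf]) simp
    ultimately have "((\<lambda>b. lam * (I - integral {0..b} ?f)) \<longlongrightarrow> lam * (I - I)) at_top" by (intro tendsto_intros) simp
    then show ?thesis by (simp add: H_def[abs_def])
  qed
  have "((\<lambda>x. H x / H 0) \<longlongrightarrow> 0 / H 0) at_top" by (intro tendsto_intros Hlim H0)
  then have Hlim': "((\<lambda>x. H x / H 0) \<longlongrightarrow> 0) at_top" by simp
  have "\<forall>\<^sub>F x in at_top. H x / H 0 = U lam x"
    using eventually_ge_at_top[of 0] 
  proof eventually_elim
    case (elim x)
    show ?case unfolding un(2)[OF elim] using H0 by simp
  qed
  with Hlim' have "(U lam \<longlongrightarrow> 0) at_top" by (rule Lim_transform_eventually)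
  moreover have "bddint (\<lambda>t. \<bar>P lam t\<bar> * m t)"
  proof -
    have "set_integrable lborel {0..} (\<lambda>y. (1 / \<bar>H 0\<bar>) * \<bar>?f y\<bar>)" using set_integrable_abs[OF f] by simp
    also have "?this \<longleftrightarrow> set_integrable lborel {0..} (\<lambda>t. \<bar>P lam t\<bar> * m t)"
      by (rule set_integrable_cong) (use un(1) H0 mpos in \<open>auto simp: abs_mult less_imp_le\<close>)
    finally show ?thesis by (subst set_integrable_iff_bddint[symmetric]) (use mpos in \<open>auto intro!: cPm simp: less_imp_le\<close>)
  qed
  moreover have "bddint (\<lambda>t. (P lam t)\<^sup>2 * m t)"
  proof -
    have "set_integrable lborel {0..} (\<lambda>y. (1 / (H 0)\<^sup>2) * ((\<psi> y)\<^sup>2 * m y))" using L2 by simp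
    also have "?this \<longleftrightarrow> set_integrable lborel {0..} (\<lambda>t. (P lam t)\<^sup>2 * m t)"
      by (rule set_integrable_cong) (use un(1) H0 in \<open>auto simp: power_mult_distrib\<close>)
    finally show ?thesis by (subst set_integrable_iff_bddint[symmetric]) (use mpos in \<open>auto intro!: continuous_intros C simp: less_imp_le\<close>)
  qed
  ultimately show ?thesis using lam by (simp add: ev_def)
qed

text \<open>Decay of \<open>U lam\<close> says that \<open>lam * integral P m\<close> over the
  half-line is 1. The part beyond \<open>x\<close>, times \<open>lam\<close>, is therefore
  \<open>U lam x\<close>, and \<open>kernel_split\<close> reduces the integral equation to
  \<open>SU_identity\<close>. The indicator makes the eigenfunction measurable on the whole
  line.\<close>

lemma ev_imp_gev: assumes e: "ev lam" shows "gev lam"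
proof -
  have lam: "lam \<noteq> 0" and L1: "bddint (\<lambda>t. \<bar>P lam t\<bar> * m t)" and L2: "bddint (\<lambda>t. (P lam t)\<^sup>2 * m t)"
    and lim: "(U lam \<longlongrightarrow> 0) at_top" using e by (auto simp: ev_def)
  let ?p = "\<lambda>x. indicator {0..} x *\<^sub>R P lam x"
  let ?f = "\<lambda>y. P lam y * m y"
  have cf: "continuous_on {0..} ?f" by (intro continuous_intros C)
  have f: "set_integrable lborel {0..} ?f"
  proof (rule set_integrable_bound[where f="\<lambda>t. \<bar>P lam t\<bar> * m t"])
    show "set_integrable lborel {0..} (\<lambda>t. \<bar>P lam t\<bar> * m t)"
      using L1 by (subst set_integrable_iff_bddint) (use mpos in \<open>auto intro!: cPm simp: less_imp_le\<close>)
  qed (auto intro!: set_borel_measurable_atLeast cf simp: abs_mult)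
  define I where "I = (LINT y:{0..}|lborel. ?f y)"
  have "((\<lambda>b. LINT y:{0..b}|lborel. ?f y) \<longlongrightarrow> I) at_top"
    unfolding I_def by (rule tendsto_set_lebesgue_integral_at_top) (use f in auto)
  moreover have "(LINT y:{0..b}|lborel. ?f y) = integral {0..b} ?f" for b
    by (rule set_integral_Icc_eq_integral(2)[OF cf]) simp
  ultimately have "((\<lambda>b. 1 - lam * integral {0..b} ?f) \<longlongrightarrow> 1 - lam * I) at_top" by (intro tendsto_intros) simp
  then have "(U lam \<longlongrightarrow> 1 - lam * I) at_top"
    by (rule Lim_transform_eventually[OF _ eventually_mono[OF eventually_ge_at_top[of 0]]]) (simp add: U_eq)
  then have "1 - lam * I = 0" using lim tendsto_unique trivial_limit_at_top_linorder by blast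
  then have lI: "lam * (I - integral {0..x} ?f) = U lam x" if "x \<ge> 0" for x
    using U_eq[OF that, of lam] by (simp add: right_diff_distrib)
  have cong: "set_integrable lborel {0..} (\<lambda>y. SS (min x y) * ?p y * m y) = set_integrable lborel {0..} (\<lambda>y. SS (min x y) * ?f y)"
    "(LINT y:{0..}|lborel. SS (min x y) * ?p y * m y) = (LINT y:{0..}|lborel. SS (min x y) * ?f y)" for x
    by (rule set_integrable_cong set_lebesgue_integral_cong; simp)+
  show ?thesis
    unfolding gev_def
  proof (intro exI[of _ ?p] conjI allI impI)
    show "?p \<in> borel_measurable lborel" using set_borel_measurable_atLeast[OF cP] by (simp add: set_borel_measurable_def)
    have "set_integrable lborel {0..} (\<lambda>y. (?p y)\<^sup>2 * m y) = set_integrable lborel {0..} (\<lambda>y. (P lam y)\<^sup>2 * m y)"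
      by (rule set_integrable_cong) auto
    also have \<dots> using L2 by (subst set_integrable_iff_bddint) (use mpos in \<open>auto intro!: continuous_intros C simp: less_imp_le\<close>)
    finally show "set_integrable lborel {0..} (\<lambda>y. (?p y)\<^sup>2 * m y)" by simp
    show "\<not> (AE y in lborel. 0 \<le> y \<longrightarrow> ?p y = 0)"
    proof
      assume a: "AE y in lborel. 0 \<le> y \<longrightarrow> ?p y = 0"
      obtain d where d: "d > 0" "\<And>x. 0 < x \<Longrightarrow> x \<le> d \<Longrightarrow> phi s (\<lambda>t. lam * m t) x > 0 \<and> uu s (\<lambda>t. lam * m t) x > 1/2"
        using phi_uu_pos_near_0[OF cs cg spos] by blast
      have "AE y in lborel. y \<notin> {0<..d}"
        using a by eventually_elim (use d(2) in \<open>force simp: P_def\<close>)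
      then have "emeasure lborel {0<..d} = 0" by (subst (asm) AE_iff_measurable[of "{0<..d}"]) auto
      then show False using d(1) by simp
    qed
    fix x :: real assume x: "0 \<le> x"
    show "set_integrable lborel {0..} (\<lambda>y. SS (min x y) * ?p y * m y)" unfolding cong by (rule kernel_split(1)[OF f x])
    have "lam * (LINT y:{0..}|lborel. SS (min x y) * ?f y) = lam * integral {0..x} (\<lambda>y. SS y * ?f y) + SS x * (lam * (I - integral {0..x} ?f))"
      unfolding kernel_split(2)[OF f x] I_def by (simp add: algebra_simps)
    also have "\<dots> = P lam x" unfolding lI[OF x] using SU_identity[OF x, of lam] by (simp add: mult.assoc)
    finally show "?p x = lam * (LINT y:{0..}|lborel. SS (min x y) * ?p y * m y)" unfolding cong using x by simp
  qed
qed

lemma gev_iff_ev: "gev lam \<longleftrightarrow> ev lam" using gev_imp_ev ev_imp_gev by blast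

text \<open>Supplies the continuity hypothesis of \<open>pred_compact_exists\<close> for the
  truncated integrals \<open>LL\<close>.\<close>

lemma P_integral_continuous_in_lam:
  assumes "l \<longlonglongrightarrow> lam" "X \<ge> 0"
  shows "(\<lambda>n. integral {0..X} (\<lambda>t. (\<bar>P (l n) t\<bar> + (P (l n) t)\<^sup>2) * m t)) \<longlonglongrightarrow> integral {0..X} (\<lambda>t. (\<bar>P lam t\<bar> + (P lam t)\<^sup>2) * m t)"
proof -
  note u = P_U_continuous_in_lam(1)[OF assms]
  obtain B where B: "B > 0" "\<And>x. 0 \<le> x \<Longrightarrow> x \<le> X \<Longrightarrow> \<bar>P lam x\<bar> \<le> B" by (rule continuous_bounded_Icc[OF cP]) auto
  have "\<forall>\<^sub>F n in sequentially. \<forall>x\<in>{0..X}. dist (P (l n) x) (P lam x) < 1" using uniform_limitD[OF u, of 1] by simp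
  then obtain N where N: "\<And>n x. n \<ge> N \<Longrightarrow> x \<in> {0..X} \<Longrightarrow> dist (P (l n) x) (P lam x) < 1"
    unfolding eventually_sequentially by blast
  have b: "\<bar>P (l (n + N)) x\<bar> \<le> B + 1" if "x \<in> {0..X}" for n x
    using N[of "n + N" x] B(2)[of x] that by (auto simp: dist_real_def)
  have "(\<lambda>n. integral {0..X} (\<lambda>t. (\<bar>P (l (n + N)) t\<bar> + (P (l (n + N)) t)\<^sup>2) * m t)) \<longlonglongrightarrow> integral {0..X} (\<lambda>t. (\<bar>P lam t\<bar> + (P lam t)\<^sup>2) * m t)"
  proof (rule dominated_convergence(2))
    show "(\<lambda>t. (\<bar>P (l (n + N)) t\<bar> + (P (l (n + N)) t)\<^sup>2) * m t) integrable_on {0..X}" for n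
      by (intro integrable_on_atLeast_subinterval continuous_intros C) auto
    show "(\<lambda>t. ((B + 1) + (B + 1)\<^sup>2) * m t) integrable_on {0..X}"
      by (intro integrable_on_atLeast_subinterval continuous_intros C) auto
    fix n t assume t: "t \<in> {0..X}"
    have "(P (l (n + N)) t)\<^sup>2 \<le> (B + 1)\<^sup>2" using b[OF t, of n] B(1) by (intro abs_le_square_iff[THEN iffD1]) auto
    then have "(\<bar>P (l (n + N)) t\<bar> + (P (l (n + N)) t)\<^sup>2) * m t \<le> ((B + 1) + (B + 1)\<^sup>2) * m t"
      using b[OF t, of n] mpos[of t] t by (intro mult_right_mono add_mono) auto
    then show "norm ((\<bar>P (l (n + N)) t\<bar> + (P (l (n + N)) t)\<^sup>2) * m t) \<le> ((B + 1) + (B + 1)\<^sup>2) * m t"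
      using mpos[of t] t by (simp add: abs_mult)
  next
    fix t assume t: "t \<in> {0..X}"
    have "(\<lambda>n. P (l n) t) \<longlonglongrightarrow> P lam t" by (rule tendsto_uniform_limitI[OF u t])
    then have "(\<lambda>n. P (l (n + N)) t) \<longlonglongrightarrow> P lam t" by (rule LIMSEQ_ignore_initial_segment)
    then show "(\<lambda>n. (\<bar>P (l (n + N)) t\<bar> + (P (l (n + N)) t)\<^sup>2) * m t) \<longlonglongrightarrow> (\<bar>P lam t\<bar> + (P lam t)\<^sup>2) * m t"
      by (intro tendsto_intros)
  qed
  then show ?thesis by (rule LIMSEQ_offset)
qed

lemma bddint_sum_iff:
  "bddint (\<lambda>t. \<bar>P lam t\<bar> * m t) \<and> bddint (\<lambda>t. (P lam t)\<^sup>2 * m t) \<longleftrightarrow> bddint (\<lambda>t. (\<bar>P lam t\<bar> + (P lam t)\<^sup>2) * m t)"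
proof
  assume "bddint (\<lambda>t. \<bar>P lam t\<bar> * m t) \<and> bddint (\<lambda>t. (P lam t)\<^sup>2 * m t)"
  then obtain K1 K2 where K: "\<And>x. x \<ge> 0 \<Longrightarrow> integral {0..x} (\<lambda>t. \<bar>P lam t\<bar> * m t) \<le> K1" "\<And>x. x \<ge> 0 \<Longrightarrow> integral {0..x} (\<lambda>t. (P lam t)\<^sup>2 * m t) \<le> K2"
    by (auto simp: bddint_def)
  have "integral {0..x} (\<lambda>t. (\<bar>P lam t\<bar> + (P lam t)\<^sup>2) * m t) = integral {0..x} (\<lambda>t. \<bar>P lam t\<bar> * m t) + integral {0..x} (\<lambda>t. (P lam t)\<^sup>2 * m t)" for x
    unfolding distrib_right by (rule Henstock_Kurzweil_Integration.integral_add) (auto intro!: integrable_on_atLeast_subinterval continuous_intros C)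
  then have "integral {0..x} (\<lambda>t. (\<bar>P lam t\<bar> + (P lam t)\<^sup>2) * m t) \<le> K1 + K2" if "x \<ge> 0" for x
    using K(1)[OF that] K(2)[OF that] by simp
  then show "bddint (\<lambda>t. (\<bar>P lam t\<bar> + (P lam t)\<^sup>2) * m t)" unfolding bddint_def by blast
next
  assume b: "bddint (\<lambda>t. (\<bar>P lam t\<bar> + (P lam t)\<^sup>2) * m t)"
  have c0: "continuous_on {0..} (\<lambda>t. (\<bar>P lam t\<bar> + (P lam t)\<^sup>2) * m t)" by (intro continuous_intros C)
  have g0: "(\<bar>P lam t\<bar> + (P lam t)\<^sup>2) * m t \<ge> 0" if "t \<ge> 0" for t using mpos[OF that] by simp
  have le: "\<bar>P lam t\<bar> * m t \<le> 1 * ((\<bar>P lam t\<bar> + (P lam t)\<^sup>2) * m t)" "(P lam t)\<^sup>2 * m t \<le> 1 * ((\<bar>P lam t\<bar> + (P lam t)\<^sup>2) * m t)" if "t \<ge> 0" for t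
    using mpos[OF that] by (simp_all add: distrib_right)
  have "bddint (\<lambda>t. \<bar>P lam t\<bar> * m t)"
    by (rule bddint_compare[OF cPm c0 g0 _ order_refl le(1) b]) auto
  moreover have "bddint (\<lambda>t. (P lam t)\<^sup>2 * m t)"
    by (rule bddint_compare[OF _ c0 g0 _ order_refl le(2) b]) (intro continuous_intros C, auto)
  ultimately show "bddint (\<lambda>t. \<bar>P lam t\<bar> * m t) \<and> bddint (\<lambda>t. (P lam t)\<^sup>2 * m t)" by simp
qed

end

section \<open>Specialisation to the densities of the operator\<close>

lemma continuous_dens:
  assumes "continuous_on {0..} bp"
  shows "continuous_on {0..} (s_dens \<beta> a bp)" "continuous_on {0..} (m_dens \<beta> a bp)"
  unfolding s_dens_def[abs_def] m_dens_def[abs_def] by (intro continuous_intros assms)+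

lemma string_eq_dens: "continuous_on {0..} bp \<Longrightarrow> string_eq (s_dens \<beta> a bp) (m_dens \<beta> a bp)"
  using continuous_dens[of bp] by unfold_locales (auto, auto simp: s_dens_def m_dens_def)

lemma is_G_eigenvalue_iff:
  assumes c: "continuous_on {0..} bp"
  shows "is_G_eigenvalue \<beta> a bp lam \<longleftrightarrow> string_eq.ev (s_dens \<beta> a bp) (m_dens \<beta> a bp) lam"
proof -
  interpret string_eq "s_dens \<beta> a bp" "m_dens \<beta> a bp" by (rule string_eq_dens[OF c])
  have sc: "scale_fun \<beta> a bp x = SS x" for x
    unfolding scale_fun_def SS_def by (rule set_integral_Icc_eq_integral(2)[OF cs]) simp
  show ?thesis unfolding is_G_eigenvalue_def sc gev_iff_ev[symmetric] gev_def ..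
qed

section \<open>Measurability of the lowest eigenvalue\<close>

text \<open>Path continuity upgrades measurability at fixed times to joint measurability, so the
  class is closed under time integrals and hence under Picard iteration.\<close>

definition proc :: "'a measure \<Rightarrow> ('a \<Rightarrow> real \<Rightarrow> real) \<Rightarrow> bool" where
  "proc M X \<longleftrightarrow> (\<forall>t\<ge>0. (\<lambda>w. X w t) \<in> borel_measurable M) \<and> (\<forall>w\<in>space M. continuous_on {0..} (X w))"

lemma procD: "proc M X \<Longrightarrow> t \<ge> 0 \<Longrightarrow> (\<lambda>w. X w t) \<in> borel_measurable M"
  "proc M X \<Longrightarrow> w \<in> space M \<Longrightarrow> continuous_on {0..} (X w)"
  by (auto simp: proc_def)

lemma proc_const: "continuous_on {0..} f \<Longrightarrow> proc M (\<lambda>w. f)" by (auto simp: proc_def)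

lemma proc_add: "proc M X \<Longrightarrow> proc M Y \<Longrightarrow> proc M (\<lambda>w t. X w t + Y w t)"
  unfolding proc_def by (auto intro!: continuous_intros borel_measurable_add)
lemma proc_diff: "proc M X \<Longrightarrow> proc M Y \<Longrightarrow> proc M (\<lambda>w t. X w t - Y w t)"
  unfolding proc_def by (auto intro!: continuous_intros borel_measurable_diff)
lemma proc_mult: "proc M X \<Longrightarrow> proc M Y \<Longrightarrow> proc M (\<lambda>w t. X w t * Y w t)"
  unfolding proc_def by (auto intro!: continuous_intros borel_measurable_times)
lemma proc_abs: "proc M X \<Longrightarrow> proc M (\<lambda>w t. \<bar>X w t\<bar>)"
  unfolding proc_def by (auto intro!: continuous_intros borel_measurable_abs)
lemma proc_power: "proc M X \<Longrightarrow> proc M (\<lambda>w t. X w t ^ n)"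
  unfolding proc_def by (auto intro!: continuous_intros borel_measurable_power)
lemma proc_exp: "proc M X \<Longrightarrow> proc M (\<lambda>w t. exp (X w t))"
  unfolding proc_def by (auto intro!: continuous_intros)
lemma proc_rv: "f \<in> borel_measurable M \<Longrightarrow> proc M (\<lambda>w t. f w)"
  unfolding proc_def by auto

text \<open>The path is approximated by its values on the grid of mesh \<open>1 / (i + 1)\<close>,
  with countably many measurable pieces at each stage; \<open>max 0\<close> extends it continuously
  to negative times.\<close>

lemma proc_jointly_measurable:
  assumes X: "proc M X"
  shows "(\<lambda>p. X (fst p) (max 0 (snd p))) \<in> borel_measurable (M \<Otimes>\<^sub>M lborel)"
proof (rule borel_measurable_LIMSEQ_real)
  fix i :: nat
  have fl: "(\<lambda>p. \<lfloor>real (Suc i) * snd p\<rfloor>) \<in> measurable (M \<Otimes>\<^sub>M lborel) (count_space UNIV)"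
    by measurable
  show "(\<lambda>p. X (fst p) (max 0 (of_int \<lfloor>real (Suc i) * snd p\<rfloor> / real (Suc i)))) \<in> borel_measurable (M \<Otimes>\<^sub>M lborel)"
  proof (rule measurable_compose_countable[OF _ fl])
    fix k :: int
    have "(\<lambda>w. X w (max 0 (of_int k / real (Suc i)))) \<in> borel_measurable M" by (rule procD(1)[OF X]) simp
    then show "(\<lambda>p. X (fst p) (max 0 (of_int k / real (Suc i)))) \<in> borel_measurable (M \<Otimes>\<^sub>M lborel)"
      by (rule measurable_compose[OF measurable_fst])
  qed
next
  fix p :: "'a \<times> real" assume "p \<in> space (M \<Otimes>\<^sub>M lborel)"
  then have w: "fst p \<in> space M" by (auto simp: space_pair_measure)
  have "continuous_on UNIV (\<lambda>t. X (fst p) (max 0 t))"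
    by (rule continuous_on_compose2[OF procD(2)[OF X w]]) (auto intro!: continuous_intros)
  then have c: "isCont (\<lambda>t. X (fst p) (max 0 t)) (snd p)" by (simp add: continuous_on_eq_continuous_at)
  have "(\<lambda>i. of_int \<lfloor>real (Suc i) * snd p\<rfloor> / real (Suc i)) \<longlonglongrightarrow> snd p"
  proof (rule tendsto_sandwich)
    show "(\<lambda>i. snd p - 1 / real (Suc i)) \<longlonglongrightarrow> snd p"
      using tendsto_diff[OF tendsto_const LIMSEQ_inverse_real_of_nat, of "snd p"] by (simp add: inverse_eq_divide)
    show "(\<lambda>i. snd p) \<longlonglongrightarrow> snd p" by simp
    show "\<forall>\<^sub>F i in sequentially. snd p - 1 / real (Suc i) \<le> of_int \<lfloor>real (Suc i) * snd p\<rfloor> / real (Suc i)"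
    proof (rule always_eventually, rule allI)
      fix i
      have "real (Suc i) * snd p - 1 \<le> of_int \<lfloor>real (Suc i) * snd p\<rfloor>" by linarith
      then have "(real (Suc i) * snd p - 1) / real (Suc i) \<le> of_int \<lfloor>real (Suc i) * snd p\<rfloor> / real (Suc i)" by (intro divide_right_mono) auto
      moreover have "(real (Suc i) * snd p - 1) / real (Suc i) = snd p - 1 / real (Suc i)" by (simp add: field_simps)
      ultimately show "snd p - 1 / real (Suc i) \<le> of_int \<lfloor>real (Suc i) * snd p\<rfloor> / real (Suc i)" by simp
    qed
    show "\<forall>\<^sub>F i in sequentially. of_int \<lfloor>real (Suc i) * snd p\<rfloor> / real (Suc i) \<le> snd p"
    proof (rule always_eventually, rule allI)
      fix i
      have "of_int \<lfloor>real (Suc i) * snd p\<rfloor> \<le> real (Suc i) * snd p" by (rule of_int_floor_le)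
      then show "of_int \<lfloor>real (Suc i) * snd p\<rfloor> / real (Suc i) \<le> snd p" by (simp add: pos_divide_le_eq mult.commute)
    qed
  qed
  from isCont_tendsto_compose[OF c this]
  show "(\<lambda>i. X (fst p) (max 0 (of_int \<lfloor>real (Suc i) * snd p\<rfloor> / real (Suc i)))) \<longlonglongrightarrow> X (fst p) (max 0 (snd p))" .
qed

lemma proc_integral:
  assumes X: "proc M X"
  shows "proc M (\<lambda>w x. integral {0..x} (X w))"
  unfolding proc_def
proof (intro conjI allI impI ballI)
  fix x :: real assume x: "0 \<le> x"
  have "(\<lambda>(w,t). indicator {0..x} t * X w (max 0 t)) \<in> borel_measurable (M \<Otimes>\<^sub>M lborel)"
    using proc_jointly_measurable[OF X] unfolding case_prod_beta by measurable
  then have "(\<lambda>w. LINT t|lborel. indicator {0..x} t * X w (max 0 t)) \<in> borel_measurable M"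
    by (rule lborel.borel_measurable_lebesgue_integral)
  also have "?this \<longleftrightarrow> (\<lambda>w. integral {0..x} (X w)) \<in> borel_measurable M"
  proof (rule measurable_cong)
    fix w assume w: "w \<in> space M"
    have "(LINT t|lborel. indicator {0..x} t * X w (max 0 t)) = (LINT t:{0..x}|lborel. X w t)"
      unfolding set_lebesgue_integral_def by (rule Bochner_Integration.integral_cong) (auto simp: indicator_def)
    also have "\<dots> = integral {0..x} (X w)" by (rule set_integral_Icc_eq_integral(2)[OF procD(2)[OF X w]]) simp
    finally show "(LINT t|lborel. indicator {0..x} t * X w (max 0 t)) = integral {0..x} (X w)" .
  qed
  finally show "(\<lambda>w. integral {0..x} (X w)) \<in> borel_measurable M" .
next
  fix w assume "w \<in> space M"
  then show "continuous_on {0..} (\<lambda>x. integral {0..x} (X w))" by (rule continuous_on_integral_upper[OF procD(2)[OF X]])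
qed

lemma proc_phi:
  assumes s: "proc M s" and g: "proc M g"
  shows "proc M (\<lambda>w. phi (s w) (g w))" "proc M (\<lambda>w. uu (s w) (g w))"
proof -
  have pic: "proc M (\<lambda>w x. fst (pic (s w) (g w) n x)) \<and> proc M (\<lambda>w x. snd (pic (s w) (g w) n x))" for n
  proof (induction n)
    case 0
    show ?case by (auto intro!: proc_const)
  next
    case (Suc n)
    then have "proc M (\<lambda>w x. integral {0..x} (\<lambda>t. s w t * snd (pic (s w) (g w) n t)))"
      "proc M (\<lambda>w x. integral {0..x} (\<lambda>t. g w t * fst (pic (s w) (g w) n t)))"
      by (auto intro!: proc_integral proc_mult s g)
    then show ?case using proc_diff[OF proc_const[of "\<lambda>_. 1"]] by simp
  qed
  have "(\<lambda>w. phi (s w) (g w) t) \<in> borel_measurable M" if "t \<ge> 0" for t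
    by (rule borel_measurable_LIMSEQ_real[where u="\<lambda>n w. fst (pic (s w) (g w) n t)"])
      (use pic that s g in \<open>auto intro!: pic_tendsto procD(2) procD(1)[of M "\<lambda>w x. fst (pic (s w) (g w) _ x)"]\<close>)
  then show "proc M (\<lambda>w. phi (s w) (g w))"
    unfolding proc_def[of _ "\<lambda>w. phi (s w) (g w)"] using continuous_phi[OF procD(2)[OF s] procD(2)[OF g]] by blast
  have "(\<lambda>w. uu (s w) (g w) t) \<in> borel_measurable M" if "t \<ge> 0" for t
    by (rule borel_measurable_LIMSEQ_real[where u="\<lambda>n w. snd (pic (s w) (g w) n t)"])
      (use pic that s g in \<open>auto intro!: pic_tendsto procD(2) procD(1)[of M "\<lambda>w x. snd (pic (s w) (g w) _ x)"]\<close>)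
  then show "proc M (\<lambda>w. uu (s w) (g w))"
    unfolding proc_def[of _ "\<lambda>w. uu (s w) (g w)"] using continuous_uu[OF procD(2)[OF s] procD(2)[OF g]] by blast
qed

lemma continuous_le_iff_rat:
  fixes f :: "real \<Rightarrow> real"
  assumes "continuous_on {0..} f" "0 \<le> a" "a < b"
  shows "(\<forall>x\<in>{a..b}. f x \<le> K) \<longleftrightarrow> (\<forall>q::rat. of_rat q \<in> {a..b} \<longrightarrow> f (of_rat q) \<le> K)"
proof (intro iffI ballI)
  fix x assume q: "\<forall>q::rat. of_rat q \<in> {a..b} \<longrightarrow> f (of_rat q) \<le> K" and x: "x \<in> {a..b}"
  show "f x \<le> K"
  proof (rule ccontr)
    assume "\<not> f x \<le> K"
    then have e: "f x - K > 0" by simp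
    have "continuous_on {a..b} f" by (rule continuous_on_subset[OF assms(1)]) (use assms in auto)
    then obtain d where d: "d > 0" "\<And>y. y \<in> {a..b} \<Longrightarrow> dist y x < d \<Longrightarrow> dist (f y) (f x) < f x - K"
      using x e unfolding continuous_on_iff by metis
    have "max a (x - d) < min b (x + d)" using x d(1) assms by auto
    then obtain q where q': "max a (x - d) < of_rat q" "of_rat q < min b (x + d)" using of_rat_dense by blast
    then have "of_rat q \<in> {a..b}" "dist (of_rat q) x < d" by (auto simp: dist_real_def)
    then have "f (of_rat q) \<le> K" "dist (f (of_rat q)) (f x) < f x - K" using q d(2) by auto
    then show False by (auto simp: dist_real_def)
  qed
qed auto

text \<open>Strict positivity cannot be tested at rationals directly. The open half-line is
  exhausted by the compact intervals \<open>[1/(n+1), n+2]\<close>, on each of which a positive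
  continuous function has a lower bound \<open>1/(k+1)\<close>; that bound can be tested at
  rationals.\<close>

lemma pred_all_pos:
  assumes X: "proc M X"
  shows "Measurable.pred M (\<lambda>w. \<forall>x>0. X w x > 0)"
proof -
  have "(\<forall>x>0. X w x > 0) \<longleftrightarrow> (\<forall>n::nat. \<exists>k::nat. \<forall>q::rat. of_rat q \<in> {1 / real (Suc n)..real (Suc (Suc n))} \<longrightarrow> - X w (max 0 (of_rat q)) \<le> - (1 / real (Suc k)))"
    if w: "w \<in> space M" for w
  proof -
    let ?I = "\<lambda>n::nat. {1 / real (Suc n)..real (Suc (Suc n))}"
    have c: "continuous_on {0..} (\<lambda>x. - X w x)" by (intro continuous_intros procD(2)[OF X w])
    have lt: "1 / real (Suc n) < real (Suc (Suc n))" for n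
      by (rule le_less_trans[of _ 1]) auto
    have "(\<forall>x\<in>?I n. - X w x \<le> - (1 / real (Suc k))) \<longleftrightarrow> (\<forall>q::rat. of_rat q \<in> ?I n \<longrightarrow> - X w (of_rat q) \<le> - (1 / real (Suc k)))" for n k
      by (rule continuous_le_iff_rat[OF c]) (use lt in auto)
    also have "\<dots> n k \<longleftrightarrow> (\<forall>q::rat. of_rat q \<in> ?I n \<longrightarrow> - X w (max 0 (of_rat q)) \<le> - (1 / real (Suc k)))" for n k
    proof -
      have "max 0 (of_rat q :: real) = of_rat q" if "of_rat q \<in> ?I n" for q
      proof -
        have "(0::real) \<le> 1 / real (Suc n)" by simp
        then have "(0::real) \<le> of_rat q" using that by (meson atLeastAtMost_iff order_trans)
        then show ?thesis by (rule max_absorb2)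
      qed
      then show ?thesis by auto
    qed
    finally have eq: "(\<forall>x\<in>?I n. - X w x \<le> - (1 / real (Suc k))) \<longleftrightarrow> (\<forall>q::rat. of_rat q \<in> ?I n \<longrightarrow> - X w (max 0 (of_rat q)) \<le> - (1 / real (Suc k)))" for n k .
    have "(\<forall>x>0. X w x > 0) \<longleftrightarrow> (\<forall>n::nat. \<exists>k::nat. \<forall>x\<in>?I n. - X w x \<le> - (1 / real (Suc k)))"
    proof
      assume pos: "\<forall>x>0. X w x > 0"
      show "\<forall>n::nat. \<exists>k::nat. \<forall>x\<in>?I n. - X w x \<le> - (1 / real (Suc k))"
      proof
        fix n
        have "continuous_on (?I n) (X w)"
          by (rule continuous_on_subset[OF procD(2)[OF X w]]) (use order_trans[of 0 "1 / real (Suc n)"] in auto)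
        then obtain x where x: "x \<in> ?I n" "\<And>y. y \<in> ?I n \<Longrightarrow> X w x \<le> X w y"
          using continuous_attains_inf[of "?I n" "X w"] lt[of n] by auto
        have "1 / real (Suc n) > 0" by simp
        then have "x > 0" using x(1) by (meson atLeastAtMost_iff less_le_trans)
        then have "X w x > 0" using pos by blast
        then obtain k where "inverse (real (Suc k)) < X w x" using reals_Archimedean by blast
        then have "\<forall>y\<in>?I n. - X w y \<le> - (1 / real (Suc k))" using x(2) by (force simp: inverse_eq_divide)
        then show "\<exists>k::nat. \<forall>x\<in>?I n. - X w x \<le> - (1 / real (Suc k))" by blast
      qed
    next
      assume a: "\<forall>n::nat. \<exists>k::nat. \<forall>x\<in>?I n. - X w x \<le> - (1 / real (Suc k))"
      show "\<forall>x>0. X w x > 0"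
      proof (intro allI impI)
        fix x :: real assume x: "x > 0"
        obtain n1 where n1: "inverse (real (Suc n1)) < x" using reals_Archimedean[OF x] by blast
        obtain n2 :: nat where n2: "x < real n2" using reals_Archimedean2 by blast
        define n where "n = max n1 n2"
        have "1 / real (Suc n) \<le> 1 / real (Suc n1)" by (rule divide_left_mono) (auto simp: n_def)
        then have "x \<in> ?I n" using n1 n2 by (auto simp: n_def inverse_eq_divide)
        moreover obtain k where "\<forall>x\<in>?I n. - X w x \<le> - (1 / real (Suc k))" using a by blast
        ultimately have "1 / real (Suc k) \<le> X w x" by auto
        then show "X w x > 0" using less_le_trans[of 0 "1 / real (Suc k)" "X w x"] by simp
      qed
    qed
    then show ?thesis using eq by simp
  qed
  note * = this
  have m: "(\<lambda>w. X w (max 0 (of_rat q))) \<in> borel_measurable M" for q :: rat by (rule procD(1)[OF X]) simp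
  have "Measurable.pred M (\<lambda>w. \<forall>n::nat. \<exists>k::nat. \<forall>q::rat. of_rat q \<in> {1 / real (Suc n)..real (Suc (Suc n))} \<longrightarrow> - X w (max 0 (of_rat q)) \<le> - (1 / real (Suc k)))"
    using m by measurable
  then show ?thesis by (subst measurable_cong[OF *])
qed

lemma pred_bddint:
  assumes X: "proc M X"
  shows "Measurable.pred M (\<lambda>w. bddint (X w))"
proof -
  have Y: "proc M (\<lambda>w x. integral {0..x} (X w))" by (rule proc_integral[OF X])
  have *: "bddint (X w) \<longleftrightarrow> (\<exists>K::nat. \<forall>n::nat. \<forall>q::rat. of_rat q \<in> {0..real (Suc n)} \<longrightarrow> integral {0..max 0 (of_rat q)} (X w) \<le> real K)"
    if w: "w \<in> space M" for w
  proof -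
    have "(\<forall>q::rat. of_rat q \<in> {0..real (Suc n)} \<longrightarrow> integral {0..max 0 (of_rat q)} (X w) \<le> real K) \<longleftrightarrow> (\<forall>x\<in>{0..real (Suc n)}. integral {0..x} (X w) \<le> real K)" for n K
      by (subst continuous_le_iff_rat[OF procD(2)[OF Y w]]) (auto simp: max_def)
    then have "(\<exists>K::nat. \<forall>n::nat. \<forall>q::rat. of_rat q \<in> {0..real (Suc n)} \<longrightarrow> integral {0..max 0 (of_rat q)} (X w) \<le> real K)
      \<longleftrightarrow> (\<exists>K::nat. \<forall>n::nat. \<forall>x\<in>{0..real (Suc n)}. integral {0..x} (X w) \<le> real K)" by simp
    also have "\<dots> \<longleftrightarrow> bddint (X w)"
    proof
      assume "\<exists>K::nat. \<forall>n::nat. \<forall>x\<in>{0..real (Suc n)}. integral {0..x} (X w) \<le> real K"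
      then obtain K :: nat where K: "\<And>n x. x \<in> {0..real (Suc n)} \<Longrightarrow> integral {0..x} (X w) \<le> real K" by blast
      have "integral {0..x} (X w) \<le> real K" if "x \<ge> 0" for x
      proof -
        obtain n :: nat where "x < real n" using reals_Archimedean2 by blast
        then show ?thesis using K[of x n] that by simp
      qed
      then show "bddint (X w)" unfolding bddint_def by blast
    next
      assume "bddint (X w)"
      then obtain K where K: "\<And>x. x \<ge> 0 \<Longrightarrow> integral {0..x} (X w) \<le> K" by (auto simp: bddint_def)
      obtain k :: nat where "K < real k" using reals_Archimedean2 by blast
      then have "\<forall>n::nat. \<forall>x\<in>{0..real (Suc n)}. integral {0..x} (X w) \<le> real k" using K by force
      then show "\<exists>K::nat. \<forall>n::nat. \<forall>x\<in>{0..real (Suc n)}. integral {0..x} (X w) \<le> real K" by blast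
    qed
    finally show ?thesis by simp
  qed
  have m: "(\<lambda>w. integral {0..max 0 (of_rat q)} (X w)) \<in> borel_measurable M" for q :: rat by (rule procD(1)[OF Y]) simp
  have "Measurable.pred M (\<lambda>w. \<exists>K::nat. \<forall>n::nat. \<forall>q::rat. of_rat q \<in> {0..real (Suc n)} \<longrightarrow> integral {0..max 0 (of_rat q)} (X w) \<le> real K)"
    using m by measurable
  then show ?thesis by (subst measurable_cong[OF *])
qed

text \<open>An existential quantifier over an uncountable compact interval is replaced by rational
  approximations at every level \<open>n\<close>; compactness of the interval and monotonicity in \<open>n\<close> recover a common witness.\<close>

lemma pred_compact_exists:
  fixes f :: "'a \<Rightarrow> nat \<Rightarrow> real \<Rightarrow> real"
  assumes meas: "\<And>n l. (\<lambda>w. f w n l) \<in> borel_measurable M" and cd: "c < d"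
    and cont: "\<And>w n l l'. w \<in> space M \<Longrightarrow> l \<longlonglongrightarrow> l' \<Longrightarrow> (\<lambda>k. f w n (l k)) \<longlonglongrightarrow> f w n l'"
    and mono: "\<And>w n n' l. w \<in> space M \<Longrightarrow> n \<le> n' \<Longrightarrow> f w n l \<le> f w n' l"
  shows "Measurable.pred M (\<lambda>w. \<exists>l\<in>{c..d}. \<forall>n. f w n l \<le> K)"
proof -
  have *: "(\<exists>l\<in>{c..d}. \<forall>n. f w n l \<le> K) \<longleftrightarrow> (\<forall>n. \<exists>q::rat. of_rat q \<in> {c..d} \<and> f w n (of_rat q) < K + 1 / real (Suc n))"
    if w: "w \<in> space M" for w
  proof
    assume "\<exists>l\<in>{c..d}. \<forall>n. f w n l \<le> K"
    then obtain l where l: "l \<in> {c..d}" "\<And>n. f w n l \<le> K" by blast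
    show "\<forall>n. \<exists>q::rat. of_rat q \<in> {c..d} \<and> f w n (of_rat q) < K + 1 / real (Suc n)"
    proof
      fix n
      have "\<exists>q::rat. of_rat q \<in> {c..d} \<and> \<bar>of_rat q - l\<bar> < 1 / real (Suc k)" for k
      proof -
        define e where "e = 1 / real (Suc k)"
        have "e > 0" by (simp add: e_def)
        then have "max c (l - e) < min d (l + e)" using l(1) cd by auto
        then obtain q where "max c (l - e) < of_rat q" "of_rat q < min d (l + e)" using of_rat_dense by blast
        then show ?thesis unfolding e_def[symmetric] by (intro exI[of _ q]) (auto simp: abs_less_iff)
      qed
      then obtain q :: "nat \<Rightarrow> rat" where q: "\<And>k. of_rat (q k) \<in> {c..d}" "\<And>k. \<bar>of_rat (q k) - l\<bar> < 1 / real (Suc k)" by metis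
      have "(\<lambda>k. of_rat (q k) - l) \<longlonglongrightarrow> 0"
        by (rule Lim_null_comparison[OF _ LIMSEQ_inverse_real_of_nat]) (use q(2) in \<open>auto simp: inverse_eq_divide less_imp_le\<close>)
      then have "(\<lambda>k. of_rat (q k)) \<longlonglongrightarrow> l" by (simp add: LIM_zero_iff)
      from cont[OF w this, of n] have lim: "(\<lambda>k. f w n (of_rat (q k))) \<longlonglongrightarrow> f w n l" .
      have "f w n l < K + 1 / real (Suc n)" using l(2)[of n] le_less_trans[of _ K "K + 1 / real (Suc n)"] by simp
      from order_tendstoD(2)[OF lim this] obtain k where "f w n (of_rat (q k)) < K + 1 / real (Suc n)"
        unfolding eventually_sequentially by blast
      then show "\<exists>q::rat. of_rat q \<in> {c..d} \<and> f w n (of_rat q) < K + 1 / real (Suc n)" using q(1) by blast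
    qed
  next
    assume "\<forall>n. \<exists>q::rat. of_rat q \<in> {c..d} \<and> f w n (of_rat q) < K + 1 / real (Suc n)"
    then obtain q :: "nat \<Rightarrow> rat" where q: "\<And>n. of_rat (q n) \<in> {c..d}" "\<And>n. f w n (of_rat (q n)) < K + 1 / real (Suc n)" by metis
    have "compact {c..d}" by simp
    then obtain l r where lr: "l \<in> {c..d}" "strict_mono (r :: nat \<Rightarrow> nat)" "((\<lambda>n. of_rat (q n)) \<circ> r) \<longlonglongrightarrow> l"
      using q(1) unfolding compact_def by (metis (no_types, lifting))
    have "f w n l \<le> K" for n
    proof (rule LIMSEQ_le)
      show "(\<lambda>k. f w n (((\<lambda>n. of_rat (q n)) \<circ> r) k)) \<longlonglongrightarrow> f w n l" by (rule cont[OF w lr(3)])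
      have "(\<lambda>k. 1 / real (Suc (r k))) \<longlonglongrightarrow> 0"
        using LIMSEQ_subseq_LIMSEQ[OF LIMSEQ_inverse_real_of_nat lr(2)] by (simp add: o_def inverse_eq_divide)
      then have "(\<lambda>k. K + 1 / real (Suc (r k))) \<longlonglongrightarrow> K + 0" by (intro tendsto_intros)
      then show "(\<lambda>k. K + 1 / real (Suc (r k))) \<longlonglongrightarrow> K" by simp
      have "f w n (of_rat (q (r k))) \<le> K + 1 / real (Suc (r k))" if "k \<ge> n" for k
      proof -
        have "n \<le> r k" using seq_suble[OF lr(2), of k] that by simp
        then show ?thesis using mono[OF w, of n "r k" "of_rat (q (r k))"] q(2)[of "r k"] by linarith
      qed
      then show "\<exists>N. \<forall>k\<ge>N. f w n (((\<lambda>n. of_rat (q n)) \<circ> r) k) \<le> K + 1 / real (Suc (r k))" by auto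
    qed
    then show "\<exists>l\<in>{c..d}. \<forall>n. f w n l \<le> K" using lr(1) by blast
  qed
  have "Measurable.pred M (\<lambda>w. \<forall>n. \<exists>q::rat. of_rat q \<in> {c..d} \<and> f w n (of_rat q) < K + 1 / real (Suc n))"
    using meas by measurable
  then show ?thesis by (subst measurable_cong[OF *])
qed

section \<open>Strings with random coefficients\<close>

locale string_proc =
  fixes M :: "'a measure" and s m :: "'a \<Rightarrow> real \<Rightarrow> real"
  assumes ps: "proc M s" and pm: "proc M m"
    and spos: "\<And>w x. w \<in> space M \<Longrightarrow> x \<ge> 0 \<Longrightarrow> s w x > 0" and mpos: "\<And>w x. w \<in> space M \<Longrightarrow> x \<ge> 0 \<Longrightarrow> m w x > 0"
begin

lemma str: "w \<in> space M \<Longrightarrow> string_eq (s w) (m w)"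
  by unfold_locales (use ps pm spos mpos in \<open>auto intro: procD(2)\<close>)

lemma proc_lam: "proc M (\<lambda>w t. lam * m w t)" by (intro proc_mult proc_const pm) auto

lemma pred_NN: "Measurable.pred M (\<lambda>w. string_eq.NN (s w) (m w) lam)"
proof -
  have *: "string_eq.NN (s w) (m w) lam \<longleftrightarrow> (\<forall>x>0. uu (s w) (\<lambda>t. lam * m w t) x > 0)" if "w \<in> space M" for w
  proof -
    interpret string_eq "s w" "m w" by (rule str[OF that])
    show ?thesis unfolding NN_def using U0[of lam] by (auto simp: U_def le_less)
  qed
  have "Measurable.pred M (\<lambda>w. \<forall>x>0. uu (s w) (\<lambda>t. lam * m w t) x > 0)"
    by (rule pred_all_pos, rule proc_phi(2)[OF ps proc_lam])
  then show ?thesis by (subst measurable_cong[OF *])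
qed

lemma proc_cong:
  assumes "\<And>w t. w \<in> space N \<Longrightarrow> t \<ge> 0 \<Longrightarrow> X w t = Y w t" "proc N X"
  shows "proc N Y"
  unfolding proc_def
proof (intro conjI allI impI ballI)
  fix t :: real assume t: "0 \<le> t"
  show "(\<lambda>w. Y w t) \<in> borel_measurable N"
    using procD(1)[OF assms(2) t] assms(1)[OF _ t] by (subst measurable_cong[of N _ "\<lambda>w. X w t"]) auto
next
  fix w assume w: "w \<in> space N"
  show "continuous_on {0..} (Y w)"
    using procD(2)[OF assms(2) w] assms(1)[OF w] by (subst continuous_on_cong[of _ "{0..}" _ "X w"]) auto
qed

lemma proc_S: "proc M (\<lambda>w. string_eq.SS (s w))"
  by (rule proc_cong[OF _ proc_integral[OF ps]]) (simp add: string_eq.SS_def[OF str])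

lemma proc_P: "proc M (\<lambda>w. string_eq.P (s w) (m w) lam)"
  by (rule proc_cong[OF _ proc_phi(1)[OF ps proc_lam[of lam]]]) (simp add: string_eq.P_def[OF str])

lemma pred_TC: "Measurable.pred M (\<lambda>w. string_eq.TC (s w) (m w))"
  by (subst measurable_cong[OF string_eq.TC_def[OF str]]) (auto intro!: pred_bddint[OF proc_mult[OF proc_S pm]])

lemma pred_Sunb: "Measurable.pred M (\<lambda>w. string_eq.Sunb (s w))"
proof -
  have m: "(\<lambda>w. string_eq.SS (s w) (real n)) \<in> borel_measurable M" for n :: nat by (rule procD(1)[OF proc_S]) simp
  have "Measurable.pred M (\<lambda>w. \<forall>B::nat. \<exists>n::nat. string_eq.SS (s w) (real n) > real B)" using m by measurable
  then show ?thesis by (subst measurable_cong[OF string_eq.Sunb_def[OF str]])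
qed

lemma pred_RR: "Measurable.pred M (\<lambda>w. bddint (\<lambda>t. string_eq.RR (s w) t * m w t))"
proof (rule pred_bddint, rule proc_mult[OF _ pm])
  have "(\<lambda>w. lim (\<lambda>n. string_eq.SS (s w) (real n))) \<in> borel_measurable M"
    by (rule borel_measurable_lim_metric, rule procD(1)[OF proc_S]) simp
  then have "proc M (\<lambda>w t. lim (\<lambda>n. string_eq.SS (s w) (real n)) - string_eq.SS (s w) t)"
    by (intro proc_diff proc_rv proc_S)
  then show "proc M (\<lambda>w. string_eq.RR (s w))"
    by (rule proc_cong[rotated]) (simp add: string_eq.RR_def[OF str])
qed

definition LL :: "'a \<Rightarrow> nat \<Rightarrow> real \<Rightarrow> real" where
  "LL w k l = integral {0..real k} (\<lambda>t. (\<bar>string_eq.P (s w) (m w) l t\<bar> + (string_eq.P (s w) (m w) l t)\<^sup>2) * m w t)"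

text \<open>Under the trace condition \<open>NN L\<close> decides. Otherwise the parameter ranges
  over \<open>(0, L)\<close>, the union of the compact intervals
  \<open>[1/(n+1), L - 1/(n+1)]\<close>; on each of them the existential quantifier falls under
  \<open>pred_compact_exists\<close>, which asks for a nondegenerate interval.\<close>

lemma ev_below_iff:
  assumes w: "w \<in> space M"
  shows "(\<exists>l<L. string_eq.ev (s w) (m w) l) \<longleftrightarrow>
    (if string_eq.TC (s w) (m w) then 0 < L \<and> \<not> string_eq.NN (s w) (m w) L
     else (string_eq.Sunb (s w) \<or> \<not> bddint (\<lambda>t. string_eq.RR (s w) t * m w t)) \<and>
       (\<exists>n::nat. 1 / real (Suc n) < L - 1 / real (Suc n) \<and>
          (\<exists>K::nat. \<exists>l\<in>{1 / real (Suc n)..L - 1 / real (Suc n)}. \<forall>k. LL w k l \<le> real K)))"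
proof -
  interpret string_eq "s w" "m w" by (rule str[OF w])
  have b: "bddint (\<lambda>t. (\<bar>P l t\<bar> + (P l t)\<^sup>2) * m w t) \<longleftrightarrow> (\<exists>K::nat. \<forall>k. LL w k l \<le> real K)" for l
  proof
    assume "bddint (\<lambda>t. (\<bar>P l t\<bar> + (P l t)\<^sup>2) * m w t)"
    then obtain K where K: "\<And>x. x \<ge> 0 \<Longrightarrow> integral {0..x} (\<lambda>t. (\<bar>P l t\<bar> + (P l t)\<^sup>2) * m w t) \<le> K" by (auto simp: bddint_def)
    obtain k :: nat where k: "K < real k" using reals_Archimedean2 by blast
    have "LL w j l \<le> real k" for j using K[of "real j"] k by (simp add: LL_def)
    then show "\<exists>K::nat. \<forall>k. LL w k l \<le> real K" by blast
  next
    assume "\<exists>K::nat. \<forall>k. LL w k l \<le> real K"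
    then obtain K :: nat where K: "\<And>k. LL w k l \<le> real K" by blast
    have "integral {0..x} (\<lambda>t. (\<bar>P l t\<bar> + (P l t)\<^sup>2) * m w t) \<le> real K" if x: "x \<ge> 0" for x
    proof -
      obtain k :: nat where k: "x < real k" using reals_Archimedean2 by blast
      have "integral {0..x} (\<lambda>t. (\<bar>P l t\<bar> + (P l t)\<^sup>2) * m w t) \<le> LL w k l"
        unfolding LL_def
      proof (rule integral_mono_upper)
        show "continuous_on {0..} (\<lambda>t. (\<bar>P l t\<bar> + (P l t)\<^sup>2) * m w t)" by (intro continuous_intros C)
        show "0 \<le> (\<bar>P l t\<bar> + (P l t)\<^sup>2) * m w t" if "t \<ge> 0" for t using mpos[OF that] by simp
      qed (use x k in auto)
      then show ?thesis using K[of k] by simp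
    qed
    then show "bddint (\<lambda>t. (\<bar>P l t\<bar> + (P l t)\<^sup>2) * m w t)" unfolding bddint_def by blast
  qed
  show ?thesis
  proof (cases TC)
    case True
    have "(\<exists>l<L. ev l) \<longleftrightarrow> 0 < L \<and> \<not> NN L"
    proof (cases "L > 0")
      case L: True
      show ?thesis using TC_NN_iff(2)[OF True L] L by (auto simp: not_le)
    next
      case False
      then show ?thesis using ev_pos by force
    qed
    then show ?thesis using True by simp
  next
    case False
    let ?Q = "Sunb \<or> \<not> bddint (\<lambda>t. RR t * m w t)"
    have e: "ev l \<longleftrightarrow> ?Q \<and> l > 0 \<and> (\<exists>K::nat. \<forall>k. LL w k l \<le> real K)" for l
      unfolding ev_iff_nonTC[OF False] bddint_sum_iff b ..
    have "(\<exists>l<L. ev l) \<longleftrightarrow> ?Q \<and> (\<exists>n::nat. 1 / real (Suc n) < L - 1 / real (Suc n) \<and>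
          (\<exists>K::nat. \<exists>l\<in>{1 / real (Suc n)..L - 1 / real (Suc n)}. \<forall>k. LL w k l \<le> real K))" (is "?L \<longleftrightarrow> ?R")
    proof
      assume ?L
      then obtain l K where l: "l < L" "l > 0" ?Q and K: "\<And>k. LL w k l \<le> real (K::nat)" unfolding e by blast
      have "min l (L - l) > 0" using l by simp
      then obtain n where n: "inverse (real (Suc n)) < min l (L - l)" using reals_Archimedean by blast
      then have "1 / real (Suc n) < l" "l < L - 1 / real (Suc n)" by (auto simp: inverse_eq_divide)
      then show ?R using l(3) K by (intro conjI exI[of _ n] exI[of _ K] bexI[of _ l]) auto
    next
      assume r: ?R
      then obtain n K l where l: "l \<in> {1 / real (Suc n)..L - 1 / real (Suc n)}" "\<And>k. LL w k l \<le> real (K::nat)" by blast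
      have "1 / real (Suc n) > 0" by simp
      then have "l > 0" "l < L" using l(1) by (simp_all only: atLeastAtMost_iff, linarith+)
      then show ?L using e l(2) r by blast
    qed
    then show ?thesis using False by simp
  qed
qed

lemma pred_ev_below: "Measurable.pred M (\<lambda>w. \<exists>l<L. string_eq.ev (s w) (m w) l)"
proof -
  have ex: "Measurable.pred M (\<lambda>w. \<exists>l\<in>{1 / real (Suc n)..L - 1 / real (Suc n)}. \<forall>k. LL w k l \<le> real K)"
    if "1 / real (Suc n) < L - 1 / real (Suc n)" for n K
  proof (rule pred_compact_exists[OF _ that])
    show "(\<lambda>w. LL w k l) \<in> borel_measurable M" for k l
      unfolding LL_def by (rule procD(1)[OF proc_integral]) (auto intro!: proc_mult proc_add proc_abs proc_power proc_P pm)
  next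
    fix w n and l :: "nat \<Rightarrow> real" and l' assume w: "w \<in> space M" and l: "l \<longlonglongrightarrow> l'"
    interpret string_eq "s w" "m w" by (rule str[OF w])
    show "(\<lambda>k. LL w n (l k)) \<longlonglongrightarrow> LL w n l'" unfolding LL_def by (rule P_integral_continuous_in_lam[OF l]) simp
  next
    fix w l and n n' :: nat assume w: "w \<in> space M" and n: "n \<le> n'"
    interpret string_eq "s w" "m w" by (rule str[OF w])
    show "LL w n l \<le> LL w n' l"
      unfolding LL_def
    proof (rule integral_mono_upper)
      show "continuous_on {0..} (\<lambda>t. (\<bar>P l t\<bar> + (P l t)\<^sup>2) * m w t)" by (intro continuous_intros C)
      show "0 \<le> (\<bar>P l t\<bar> + (P l t)\<^sup>2) * m w t" if "t \<ge> 0" for t using mpos[OF that] by simp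
    qed (use n in auto)
  qed
  have ex': "Measurable.pred M (\<lambda>w. 1 / real (Suc n) < L - 1 / real (Suc n) \<and> (\<exists>K::nat. \<exists>l\<in>{1 / real (Suc n)..L - 1 / real (Suc n)}. \<forall>k. LL w k l \<le> real K))" for n
  proof (cases "1 / real (Suc n) < L - 1 / real (Suc n)")
    case True
    have "Measurable.pred M (\<lambda>w. \<exists>K::nat. \<exists>l\<in>{1 / real (Suc n)..L - 1 / real (Suc n)}. \<forall>k. LL w k l \<le> real K)"
      by (rule pred_intros_countable, rule ex[OF True])
    then show ?thesis using True by (simp only: simp_thms)
  qed simp
  have "Measurable.pred M (\<lambda>w. if string_eq.TC (s w) (m w) then 0 < L \<and> \<not> string_eq.NN (s w) (m w) L
     else (string_eq.Sunb (s w) \<or> \<not> bddint (\<lambda>t. string_eq.RR (s w) t * m w t)) \<and>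
       (\<exists>n::nat. 1 / real (Suc n) < L - 1 / real (Suc n) \<and>
          (\<exists>K::nat. \<exists>l\<in>{1 / real (Suc n)..L - 1 / real (Suc n)}. \<forall>k. LL w k l \<le> real K)))"
    unfolding if_bool_eq_disj by (intro pred_intros_logic pred_intros_countable ex' pred_TC pred_Sunb pred_RR pred_NN) simp_all
  then show ?thesis by (subst measurable_cong[OF ev_below_iff])
qed

end

lemma Lambda0_eq:
  assumes "continuous_on {0..} bp"
  shows "Lambda0 \<beta> a bp = Inf {l. string_eq.ev (s_dens \<beta> a bp) (m_dens \<beta> a bp) l}"
  unfolding Lambda0_def is_G_eigenvalue_iff[OF assms] ..

text \<open>Without eigenvalues \<open>Lambda0\<close> is the infimum of the empty set, one fixed
  real, so the comparison no longer depends on the path. Existence of an eigenvalue is stated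
  through natural bounds to obtain a countable union of the events in
  \<open>pred_ev_below\<close>.\<close>

lemma Lambda0_ge_iff:
  assumes c: "continuous_on {0..} bp"
  shows "L \<le> Lambda0 \<beta> a bp \<longleftrightarrow>
    (if \<exists>n::nat. \<exists>l<real n. string_eq.ev (s_dens \<beta> a bp) (m_dens \<beta> a bp) l
     then \<not> (\<exists>l<L. string_eq.ev (s_dens \<beta> a bp) (m_dens \<beta> a bp) l) else L \<le> Inf {})"
proof -
  interpret string_eq "s_dens \<beta> a bp" "m_dens \<beta> a bp" by (rule string_eq_dens[OF c])
  have b: "bdd_below {l. ev l}" by (rule bdd_belowI[of _ 0]) (use ev_pos in \<open>auto simp: less_imp_le\<close>)
  show ?thesis
  proof (cases "\<exists>l. ev l")
    case True
    then have "\<exists>n::nat. \<exists>l<real n. ev l" using reals_Archimedean2 by blast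
    moreover have "L \<le> Inf {l. ev l} \<longleftrightarrow> \<not> (\<exists>l<L. ev l)"
      using le_cInf_iff[OF _ b, of L] True by (auto simp: not_less)
    ultimately show ?thesis using Lambda0_eq[OF c] by simp
  next
    case False
    then show ?thesis using Lambda0_eq[OF c] by simp
  qed
qed

lemma string_proc_dens:
  assumes "proc M b" shows "string_proc M (\<lambda>w. s_dens \<beta> a (b w)) (\<lambda>w. m_dens \<beta> a (b w))"
proof
  show "proc M (\<lambda>w. s_dens \<beta> a (b w))" "proc M (\<lambda>w. m_dens \<beta> a (b w))"
    unfolding s_dens_def[abs_def] m_dens_def[abs_def]
    by (intro proc_exp proc_add proc_diff proc_mult assms proc_const continuous_intros)+
qed (auto simp: s_dens_def m_dens_def)

lemma pred_Lambda0_ge: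
  assumes b: "proc M b"
  shows "Measurable.pred M (\<lambda>w. L \<le> Lambda0 \<beta> a (b w))"
proof -
  interpret string_proc M "\<lambda>w. s_dens \<beta> a (b w)" "\<lambda>w. m_dens \<beta> a (b w)" by (rule string_proc_dens[OF b])
  have "Measurable.pred M (\<lambda>w. if \<exists>n::nat. \<exists>l<real n. string_eq.ev (s_dens \<beta> a (b w)) (m_dens \<beta> a (b w)) l
     then \<not> (\<exists>l<L. string_eq.ev (s_dens \<beta> a (b w)) (m_dens \<beta> a (b w)) l) else L \<le> Inf {})"
    unfolding if_bool_eq_disj by (intro pred_intros_logic pred_intros_countable pred_ev_below) simp_all
  then show ?thesis by (subst measurable_cong[OF Lambda0_ge_iff[OF procD(2)[OF b]]])
qed

section \<open>The Riccati equation as a linear system\<close>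

text \<open>For a Riccati solution \<open>q\<close>, the function \<open>z = q - \<sigma> W\<close>
  satisfies \<open>z' = t + \<mu> - (\<sigma> W + z)^2\<close>; setting \<open>z = f' / f\<close>
  gives \<open>f'' + 2 \<sigma> W f' + (\<sigma>^2 W^2 - t - \<mu>) f = 0\<close>. Multiplication by
  \<open>1 / s0\<close> turns this into \<open>(f' / s0)' = - g0 f\<close>.\<close>

definition s0 :: "real \<Rightarrow> (real \<Rightarrow> real) \<Rightarrow> real \<Rightarrow> real" where
  "s0 \<sigma> W t = exp (- 2 * \<sigma> * integral {0..t} W)"

definition g0 :: "real \<Rightarrow> real \<Rightarrow> (real \<Rightarrow> real) \<Rightarrow> real \<Rightarrow> real" where
  "g0 \<sigma> \<mu> W t = (\<sigma>\<^sup>2 * (W t)\<^sup>2 - t - \<mu>) * exp (2 * \<sigma> * integral {0..t} W)"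

context
  fixes \<sigma> :: real and W :: "real \<Rightarrow> real"
  assumes cW: "continuous_on {0..} W"
begin

lemma cs0: "continuous_on {0..} (s0 \<sigma> W)"
  unfolding s0_def[abs_def] by (intro continuous_intros continuous_on_integral_upper cW)
lemma cg0: "continuous_on {0..} (g0 \<sigma> \<mu> W)"
  unfolding g0_def[abs_def] by (intro continuous_intros continuous_on_integral_upper cW)
lemma s0pos: "s0 \<sigma> W t > 0" by (simp add: s0_def)
lemma s0g0: "s0 \<sigma> W t * g0 \<sigma> \<mu> W t = \<sigma>\<^sup>2 * (W t)\<^sup>2 - t - \<mu>"
proof -
  have "exp (- 2 * \<sigma> * integral {0..t} W) * exp (2 * \<sigma> * integral {0..t} W) = 1"
    by (subst exp_add[symmetric]) simp
  then show ?thesis unfolding s0_def g0_def by (simp add: algebra_simps)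
qed

definition PP :: "real \<Rightarrow> real \<Rightarrow> real" where "PP \<mu> = phi (s0 \<sigma> W) (g0 \<sigma> \<mu> W)"
definition UU :: "real \<Rightarrow> real \<Rightarrow> real" where "UU \<mu> = uu (s0 \<sigma> W) (g0 \<sigma> \<mu> W)"

lemma cPP: "continuous_on {0..} (PP \<mu>)" unfolding PP_def by (rule continuous_phi[OF cs0 cg0])
lemma cUU: "continuous_on {0..} (UU \<mu>)" unfolding UU_def by (rule continuous_uu[OF cs0 cg0])
lemma PP0: "PP \<mu> 0 = 0" and UU0: "UU \<mu> 0 = 1"
  unfolding PP_def UU_def using phi_0[OF cs0 cg0] uu_0[OF cs0 cg0] by auto
lemma DPP: "t > 0 \<Longrightarrow> DERIV (PP \<mu>) t :> s0 \<sigma> W t * UU \<mu> t"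
  unfolding PP_def UU_def by (rule lsolD(3)[OF lsol_phi[OF cs0 cg0]])
lemma DUU: "t > 0 \<Longrightarrow> DERIV (UU \<mu>) t :> - g0 \<sigma> \<mu> W t * PP \<mu> t"
  unfolding PP_def UU_def by (rule lsolD(4)[OF lsol_phi[OF cs0 cg0]])
lemma Ds0: "t > 0 \<Longrightarrow> DERIV (s0 \<sigma> W) t :> - 2 * \<sigma> * W t * s0 \<sigma> W t"
  unfolding s0_def[abs_def] by (auto intro!: derivative_eq_intros DERIV_integral_upper[OF cW])
lemma DsU: "t > 0 \<Longrightarrow> DERIV (\<lambda>t. s0 \<sigma> W t * UU \<mu> t) t :> - 2 * \<sigma> * W t * (s0 \<sigma> W t * UU \<mu> t) - (\<sigma>\<^sup>2 * (W t)\<^sup>2 - t - \<mu>) * PP \<mu> t"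
  unfolding s0g0[symmetric] by (auto intro!: derivative_eq_intros Ds0 DUU simp: algebra_simps)

text \<open>The logarithmic derivative of \<open>PP\<close>, whose derivative is
  \<open>s0 * UU\<close>. Adding \<open>\<sigma> * W\<close> gives the Riccati solution.\<close>

definition ZZ :: "real \<Rightarrow> real \<Rightarrow> real" where "ZZ \<mu> t = s0 \<sigma> W t * UU \<mu> t / PP \<mu> t"

lemma DZZ:
  assumes t: "t > 0" and p: "PP \<mu> t > 0"
  shows "DERIV (ZZ \<mu>) t :> t + \<mu> - (\<sigma> * W t + ZZ \<mu> t)\<^sup>2"
proof -
  have "DERIV (ZZ \<mu>) t :> ((- 2 * \<sigma> * W t * (s0 \<sigma> W t * UU \<mu> t) - (\<sigma>\<^sup>2 * (W t)\<^sup>2 - t - \<mu>) * PP \<mu> t) * PP \<mu> t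
     - (s0 \<sigma> W t * UU \<mu> t) * (s0 \<sigma> W t * UU \<mu> t)) / (PP \<mu> t * PP \<mu> t)"
    unfolding ZZ_def[abs_def] by (rule DERIV_divide[OF DsU DPP]) (use t p in auto)
  moreover have "((- 2 * \<sigma> * W t * (s0 \<sigma> W t * UU \<mu> t) - (\<sigma>\<^sup>2 * (W t)\<^sup>2 - t - \<mu>) * PP \<mu> t) * PP \<mu> t
     - (s0 \<sigma> W t * UU \<mu> t) * (s0 \<sigma> W t * UU \<mu> t)) / (PP \<mu> t * PP \<mu> t) = t + \<mu> - (\<sigma> * W t + ZZ \<mu> t)\<^sup>2"
    unfolding ZZ_def using p by (simp add: field_simps power2_eq_square)
  ultimately show ?thesis by simp
qed

lemma continuous_on_pos_subset: "continuous_on {0..} f \<Longrightarrow> continuous_on {0<..} f" for f :: "real \<Rightarrow> real"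
  by (rule continuous_on_subset) auto

lemma tendsto_at_right_0: "continuous_on {0..} f \<Longrightarrow> (f \<longlongrightarrow> f 0) (at_right 0)" for f :: "real \<Rightarrow> real"
proof -
  assume "continuous_on {0..} f"
  then have "(f \<longlongrightarrow> f 0) (at 0 within {0..})" by (auto simp: continuous_on_def)
  then show ?thesis by (rule tendsto_within_subset) auto
qed

lemma interval_integral_cont:
  fixes f :: "real \<Rightarrow> real"
  assumes "continuous_on {y..x} f" "y \<le> x"
  shows "(LBINT t=y..x. f t) = integral {y..x} f"
  by (rule interval_integral_eq_integral[OF assms(2) borel_integrable_atLeastAtMost'[OF assms(1)]])

lemma riccati_if_PP_pos:
  assumes p: "\<And>t. t > 0 \<Longrightarrow> PP \<mu> t > 0" and \<sigma>: "\<sigma> = 2 / sqrt \<beta>"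
  shows "riccati_no_explosion \<beta> \<mu> W"
  unfolding riccati_no_explosion_def \<sigma>[symmetric]
proof (intro exI conjI allI impI)
  let ?q = "\<lambda>t. \<sigma> * W t + ZZ \<mu> t"
  have cZ: "continuous_on {0<..} (ZZ \<mu>)"
    unfolding ZZ_def[abs_def] by (intro continuous_intros continuous_on_pos_subset[OF cs0] continuous_on_pos_subset[OF cUU] continuous_on_pos_subset[OF cPP])
      (use p in \<open>auto simp: less_le\<close>)
  show cq: "continuous_on {0<..} ?q" by (intro continuous_intros cZ continuous_on_pos_subset[OF cW])
  show "filterlim ?q at_top (at_right 0)"
  proof (rule filterlim_tendsto_add_at_top)
    show "((\<lambda>t. \<sigma> * W t) \<longlongrightarrow> \<sigma> * W 0) (at_right 0)" by (intro tendsto_intros tendsto_at_right_0[OF cW])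
    have "((\<lambda>t. s0 \<sigma> W t * UU \<mu> t) \<longlongrightarrow> s0 \<sigma> W 0 * UU \<mu> 0) (at_right 0)"
      by (intro tendsto_intros tendsto_at_right_0[OF cs0] tendsto_at_right_0[OF cUU])
    moreover have "s0 \<sigma> W 0 * UU \<mu> 0 > 0" using s0pos UU0 by simp
    moreover have "(PP \<mu> \<longlongrightarrow> 0) (at_right 0)" using tendsto_at_right_0[OF cPP, of \<mu>] PP0 by simp
    moreover have "\<forall>\<^sub>F t in at_right 0. 0 < PP \<mu> t" using eventually_at_right_less[of 0] by eventually_elim (rule p)
    ultimately show "filterlim (ZZ \<mu>) at_top (at_right 0)" unfolding ZZ_def[abs_def] by (rule LIM_at_top_divide)
  qed
  fix x y :: real assume xy: "0 < y \<and> y \<le> x"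
  have "((\<lambda>t. t + \<mu> - (?q t)\<^sup>2) has_integral (ZZ \<mu> x - ZZ \<mu> y)) {y..x}"
  proof (rule fundamental_theorem_of_calculus)
    fix t assume "t \<in> {y..x}"
    then have "DERIV (ZZ \<mu>) t :> t + \<mu> - (?q t)\<^sup>2" using xy p by (intro DZZ) auto
    then show "(ZZ \<mu> has_vector_derivative t + \<mu> - (?q t)\<^sup>2) (at t within {y..x})"
      by (simp add: has_real_derivative_iff_has_vector_derivative has_vector_derivative_at_within)
  qed (use xy in auto)
  then have "integral {y..x} (\<lambda>t. t + \<mu> - (?q t)\<^sup>2) = ZZ \<mu> x - ZZ \<mu> y" by (rule integral_unique)
  moreover have "(LBINT t=y..x. t + \<mu> - (?q t)\<^sup>2) = integral {y..x} (\<lambda>t. t + \<mu> - (?q t)\<^sup>2)"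
    by (rule interval_integral_cont) (use xy in \<open>auto intro!: continuous_intros continuous_on_subset[OF cZ] continuous_on_subset[OF cW]\<close>)
  ultimately show "?q x - ?q y = \<sigma> * (W x - W y) + (LBINT t=y..x. t + \<mu> - (?q t)\<^sup>2)" by (simp add: algebra_simps)
qed

text \<open>A given \<open>q\<close> is only known to tend to infinity at 0, so it is compared with
  the linear solution through the defect \<open>d = z * PP - s0 * UU\<close>, where
  \<open>z = q - \<sigma> W\<close>. The defect solves a homogeneous linear equation and is positive
  at a zero of \<open>PP\<close> with \<open>UU < 0\<close>, hence at all earlier times. Near 0 it
  is nonincreasing, thus bounded below there by a positive number, whereas the initial asymptotics
  make it arbitrarily small.\<close>

lemma PP_pos_if_riccati:
  assumes r: "riccati_no_explosion \<beta> \<mu> W" and \<sigma>: "\<sigma> = 2 / sqrt \<beta>" and t: "t > 0"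
  shows "PP \<mu> t > 0"
proof (rule ccontr)
  assume "\<not> PP \<mu> t > 0"
  then have "\<not> (\<forall>x>0. phi (s0 \<sigma> W) (g0 \<sigma> \<mu> W) x > 0)" using t by (auto simp: PP_def)
  then obtain c where c: "c > 0" "PP \<mu> c = 0" "UU \<mu> c < 0"
    unfolding PP_def UU_def by (rule phi_zero_uu_neg[OF cs0 cg0 s0pos]) auto
  obtain q where cq: "continuous_on {0<..} q" and qinf: "filterlim q at_top (at_right 0)"
    and qeq: "\<And>x y. 0 < y \<Longrightarrow> y \<le> x \<Longrightarrow> q x - q y = \<sigma> * (W x - W y) + (LBINT t=y..x. t + \<mu> - (q t)\<^sup>2)"
    using r unfolding riccati_no_explosion_def \<sigma>[symmetric] by blast
  define z where "z t = q t - \<sigma> * W t" for t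
  have cz: "continuous_on {0<..} z" unfolding z_def[abs_def] by (intro continuous_intros cq continuous_on_pos_subset[OF cW])
  have Dz: "DERIV z x :> x + \<mu> - (q x)\<^sup>2" if x: "x > 0" for x
  proof -
    let ?f = "\<lambda>t. t + \<mu> - (q t)\<^sup>2"
    have cf: "continuous_on {x/2..2*x} ?f" by (intro continuous_intros continuous_on_subset[OF cq]) (use x in auto)
    have "((\<lambda>u. integral {x/2..u} ?f) has_real_derivative ?f x) (at x within {x/2..2*x})"
      by (rule integral_has_real_derivative[OF cf]) (use x in auto)
    moreover have "at x within {x/2..2*x} = at x" using x by (intro at_within_interior) auto
    ultimately have "DERIV (\<lambda>u. z (x/2) + integral {x/2..u} ?f) x :> ?f x" by (auto intro!: derivative_eq_intros)
    then show ?thesis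
    proof (rule has_field_derivative_transform_within_open[where S="{x/2<..<2*x}"])
      fix u assume u: "u \<in> {x/2<..<2*x}"
      have "q u - q (x/2) = \<sigma> * (W u - W (x/2)) + integral {x/2..u} ?f"
        using qeq[of "x/2" u] interval_integral_cont[of "x/2" u ?f] continuous_on_subset[OF cf, of "{x/2..u}"] u x by simp
      then show "z (x/2) + integral {x/2..u} ?f = z u" by (simp add: z_def algebra_simps)
    qed (use x in auto)
  qed
  have zinf: "filterlim z at_top (at_right 0)"
  proof -
    have "filterlim (\<lambda>t. - \<sigma> * W t + q t) at_top (at_right 0)"
      by (rule filterlim_tendsto_add_at_top[OF _ qinf, of _ "- \<sigma> * W 0"]) (intro tendsto_intros tendsto_at_right_0[OF cW])
    then show ?thesis by (simp add: z_def[abs_def])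
  qed
  define d where "d t = z t * PP \<mu> t - s0 \<sigma> W t * UU \<mu> t" for t
  have Dd: "DERIV d x :> - (z x + 2 * \<sigma> * W x) * d x" if x: "x > 0" for x
  proof -
    have "DERIV d x :> (x + \<mu> - (q x)\<^sup>2) * PP \<mu> x + z x * (s0 \<sigma> W x * UU \<mu> x)
       - (- 2 * \<sigma> * W x * (s0 \<sigma> W x * UU \<mu> x) - (\<sigma>\<^sup>2 * (W x)\<^sup>2 - x - \<mu>) * PP \<mu> x)"
      unfolding d_def[abs_def]
      by (rule DERIV_diff[OF _ DsU[OF x]], rule DERIV_cong[OF DERIV_mult[OF Dz[OF x] DPP[OF x]]]) simp
    moreover have "(x + \<mu> - (q x)\<^sup>2) * PP \<mu> x + z x * (s0 \<sigma> W x * UU \<mu> x)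
       - (- 2 * \<sigma> * W x * (s0 \<sigma> W x * UU \<mu> x) - (\<sigma>\<^sup>2 * (W x)\<^sup>2 - x - \<mu>) * PP \<mu> x) = - (z x + 2 * \<sigma> * W x) * d x"
    proof -
      have "q x = z x + \<sigma> * W x" by (simp add: z_def)
      then show ?thesis unfolding d_def by (simp only:) (simp add: algebra_simps power2_eq_square)
    qed
    ultimately show ?thesis by simp
  qed
  have cd: "continuous_on {0<..} d"
    by (rule DERIV_continuous_on[of _ _ "\<lambda>x. - (z x + 2 * \<sigma> * W x) * d x"]) (use Dd in \<open>auto intro: has_field_derivative_at_within\<close>)
  have dc: "d c > 0" using c s0pos[of c] by (simp add: d_def mult_pos_neg)
  have dpos: "d x > 0" if x: "0 < x" "x \<le> c" for x
  proof (rule ccontr)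
    assume n: "\<not> d x > 0"
    then have xc: "x < c" using dc x by (cases "x = c") auto
    have "continuous_on {x..c} d" by (rule continuous_on_subset[OF cd]) (use x in auto)
    then obtain x2 where x2: "x \<le> x2" "x2 \<le> c" "d x2 = 0" using IVT'[of d x 0 c] n dc xc by auto
    then have x2c: "x2 < c" using dc by (cases "x2 = c") auto
    let ?k = "\<lambda>t. z t + 2 * \<sigma> * W t"
    have ck: "continuous_on {x2..c} ?k"
      by (intro continuous_intros continuous_on_subset[OF cz] continuous_on_subset[OF cW]) (use x x2 in auto)
    \<comment> \<open>With this integrating factor a zero of \<open>d\<close> before
      \<open>c\<close> would propagate to \<open>c\<close>.\<close>
    let ?F = "\<lambda>t. d t * exp (integral {x2..t} ?k)"
    have "?F c = ?F x2"
    proof (rule DERIV_isconst_end[OF x2c])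
      show "continuous_on {x2..c} ?F"
        by (intro continuous_intros continuous_on_subset[OF cd] indefinite_integral_continuous_1 integrable_continuous_real ck) (use x x2 in auto)
      fix t assume t: "x2 < t" "t < c"
      have "((\<lambda>u. integral {x2..u} ?k) has_real_derivative ?k t) (at t within {x2..c})"
        by (rule integral_has_real_derivative[OF ck]) (use t in auto)
      moreover have "at t within {x2..c} = at t" using t by (intro at_within_interior) auto
      ultimately have "DERIV (\<lambda>u. integral {x2..u} ?k) t :> ?k t" by simp
      then show "DERIV ?F t :> 0"
        using t x x2 by (auto intro!: derivative_eq_intros Dd simp: algebra_simps)
    qed
    then show False using x2(3) dc by simp
  qed
  have ev: "\<forall>\<^sub>F t in at_right 0. z t + 2 * \<sigma> * W t > 0"
  proof -
    have "filterlim (\<lambda>t. 2 * \<sigma> * W t + z t) at_top (at_right 0)"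
      by (rule filterlim_tendsto_add_at_top[OF _ zinf, of _ "2 * \<sigma> * W 0"]) (intro tendsto_intros tendsto_at_right_0[OF cW])
    then have "\<forall>\<^sub>F t in at_right 0. 2 * \<sigma> * W t + z t > 0" by (simp add: filterlim_at_top_dense)
    then show ?thesis by (simp add: add.commute)
  qed
  \<comment> \<open>near 0 the reciprocal of z has slope close to 1, so z PP tends to 1 and d tends to 0\<close>
  have inv: "((\<lambda>t. ((q t)\<^sup>2 - t - \<mu>) / (z t)\<^sup>2) \<longlongrightarrow> 1) (at_right 0)"
  proof -
    have iz: "((\<lambda>t. inverse (z t)) \<longlongrightarrow> 0) (at_right 0)" using zinf tendsto_inverse_0_at_top by blast
    have "((\<lambda>t. (1 + \<sigma> * W t * inverse (z t))\<^sup>2 - (t + \<mu>) * (inverse (z t))\<^sup>2) \<longlongrightarrow> (1 + \<sigma> * W 0 * 0)\<^sup>2 - (0 + \<mu>) * 0\<^sup>2) (at_right 0)"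
      by (intro tendsto_intros iz tendsto_at_right_0[OF cW])
    then have l: "((\<lambda>t. (1 + \<sigma> * W t * inverse (z t))\<^sup>2 - (t + \<mu>) * (inverse (z t))\<^sup>2) \<longlongrightarrow> 1) (at_right 0)" by simp
    have "\<forall>\<^sub>F t in at_right 0. z t > 0" using zinf by (simp add: filterlim_at_top_dense)
    then have "\<forall>\<^sub>F t in at_right 0. (1 + \<sigma> * W t * inverse (z t))\<^sup>2 - (t + \<mu>) * (inverse (z t))\<^sup>2 = ((q t)\<^sup>2 - t - \<mu>) / (z t)\<^sup>2"
    proof eventually_elim
      case (elim t)
      have "q t = z t + \<sigma> * W t" by (simp add: z_def)
      then show ?case using elim by (simp only:) (simp add: field_simps power2_eq_square)
    qed
    with l show ?thesis by (rule Lim_transform_eventually)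
  qed
  have sU: "((\<lambda>t. s0 \<sigma> W t * UU \<mu> t) \<longlongrightarrow> 1) (at_right 0)"
    using tendsto_mult[OF tendsto_at_right_0[OF cs0] tendsto_at_right_0[OF cUU, of \<mu>]] UU0 by (simp add: s0_def)
  \<comment> \<open>This expression is the bound for \<open>d\<close> at a small time, from
    \<open>z * PP <= (1 + h) / (1 - h)\<close> and \<open>s0 * UU > 1 - h\<close>; it vanishes with
    \<open>h\<close>.\<close>
  have lim_h: "((\<lambda>h::real. (1 + h) / (1 - h) - (1 - h)) \<longlongrightarrow> (1 + 0) / (1 - 0) - (1 - 0)) (at_right 0)"
    by (intro tendsto_intros) auto
  obtain t0 where t0: "t0 > 0" "\<And>t. 0 < t \<Longrightarrow> t < t0 \<Longrightarrow> z t + 2 * \<sigma> * W t > 0"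
    using ev unfolding eventually_at_right_field by auto
  define t1 where "t1 = min (t0 / 2) c"
  have t1: "0 < t1" "t1 < t0" "t1 \<le> c" using t0 c by (auto simp: t1_def)
  have dmono: "d t1 \<le> d t" if "0 < t" "t \<le> t1" for t
  proof (rule ge_by_deriv[OF that(2)])
    show "continuous_on {t..t1} d" by (rule continuous_on_subset[OF cd]) (use that in auto)
    fix x assume x: "t < x" "x < t1"
    show "DERIV d x :> - (z x + 2 * \<sigma> * W x) * d x" by (rule Dd) (use x that in auto)
    have "z x + 2 * \<sigma> * W x > 0" "d x > 0" using t0(2)[of x] dpos[of x] x that t1 by auto
    then show "- (z x + 2 * \<sigma> * W x) * d x \<le> 0" by (intro mult_nonpos_nonneg) auto
  qed
  have d1: "d t1 > 0" using dpos[of t1] t1 by simp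
  have "\<forall>\<^sub>F h in at_right (0::real). (1 + h) / (1 - h) - (1 - h) < d t1" using order_tendstoD(2)[OF lim_h] d1 by simp
  moreover have "\<forall>\<^sub>F h in at_right (0::real). h < 1" by (rule eventually_at_right_real[of 0 1, THEN eventually_mono]) auto
  moreover have "\<forall>\<^sub>F h in at_right (0::real). 0 < h" by (rule eventually_at_right_less)
  ultimately have "\<forall>\<^sub>F h in at_right (0::real). 0 < h \<and> h < 1 \<and> (1 + h) / (1 - h) - (1 - h) < d t1" by eventually_elim auto
  then obtain h :: real where h: "0 < h" "h < 1" "(1 + h) / (1 - h) - (1 - h) < d t1"
    using eventually_happens'[of "at_right (0::real)"] by auto
  have "\<forall>\<^sub>F t in at_right 0. ((q t)\<^sup>2 - t - \<mu>) / (z t)\<^sup>2 > 1 - h" using order_tendstoD(1)[OF inv, of "1 - h"] h by simp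
  moreover have "\<forall>\<^sub>F t in at_right 0. s0 \<sigma> W t * UU \<mu> t > 1 - h" using order_tendstoD(1)[OF sU, of "1 - h"] h by simp
  moreover have "\<forall>\<^sub>F t in at_right 0. s0 \<sigma> W t * UU \<mu> t < 1 + h" using order_tendstoD(2)[OF sU, of "1 + h"] h by simp
  moreover have "\<forall>\<^sub>F t in at_right 0. z t > 0" using zinf by (simp add: filterlim_at_top_dense)
  ultimately have "\<forall>\<^sub>F t in at_right 0. ((q t)\<^sup>2 - t - \<mu>) / (z t)\<^sup>2 > 1 - h \<and> s0 \<sigma> W t * UU \<mu> t > 1 - h \<and> s0 \<sigma> W t * UU \<mu> t < 1 + h \<and> z t > 0"
    by eventually_elim auto
  then obtain t2 where t2: "t2 > 0" "\<And>t. 0 < t \<Longrightarrow> t < t2 \<Longrightarrow> ((q t)\<^sup>2 - t - \<mu>) / (z t)\<^sup>2 > 1 - h \<and> s0 \<sigma> W t * UU \<mu> t > 1 - h \<and> s0 \<sigma> W t * UU \<mu> t < 1 + h \<and> z t > 0"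
    unfolding eventually_at_right_field by auto
  define x where "x = min (t2 / 2) t1"
  have x: "0 < x" "x < t2" "x \<le> t1" using t2 t1 by (auto simp: x_def)
  have zx: "1 / z x \<ge> (1 - h) * x"
  proof -
    have mono: "1 / z a - (1 - h) * a \<le> 1 / z x - (1 - h) * x" if a: "0 < a" "a \<le> x" for a
    proof (rule le_by_deriv[where F="\<lambda>t. 1 / z t - (1 - h) * t" and F'="\<lambda>t. ((q t)\<^sup>2 - t - \<mu>) / (z t)\<^sup>2 - (1 - h)", OF a(2)])
      have "z t \<noteq> 0" if "t \<in> {a..x}" for t using t2(2)[of t] that a x by auto
      then show "continuous_on {a..x} (\<lambda>t. 1 / z t - (1 - h) * t)"
        using a by (intro continuous_intros continuous_on_subset[OF cz]) auto
      fix t assume t: "a < t" "t < x"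
      have zt: "z t > 0" and low: "((q t)\<^sup>2 - t - \<mu>) / (z t)\<^sup>2 > 1 - h" using t2(2)[of t] t a x by auto
      have t0': "t > 0" using t a by simp
      have "DERIV (\<lambda>t. 1 / z t - (1 - h) * t) t :> (0 * z t - 1 * (t + \<mu> - (q t)\<^sup>2)) / (z t * z t) - (1 - h)"
        using zt by (auto intro!: derivative_eq_intros Dz t0')
      moreover have "(0 * z t - 1 * (t + \<mu> - (q t)\<^sup>2)) / (z t * z t) = ((q t)\<^sup>2 - t - \<mu>) / (z t)\<^sup>2" by (simp add: power2_eq_square)
      ultimately show "DERIV (\<lambda>t. 1 / z t - (1 - h) * t) t :> ((q t)\<^sup>2 - t - \<mu>) / (z t)\<^sup>2 - (1 - h)" by simp
      show "((q t)\<^sup>2 - t - \<mu>) / (z t)\<^sup>2 - (1 - h) \<ge> 0" using low by simp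
    qed
    have "((\<lambda>a. 1 / z a - (1 - h) * a) \<longlongrightarrow> 0 - (1 - h) * 0) (at_right 0)"
      using tendsto_inverse_0_at_top[OF zinf] by (intro tendsto_intros) (simp add: inverse_eq_divide)
    then have "0 - (1 - h) * 0 \<le> 1 / z x - (1 - h) * x"
    proof (rule tendsto_upperbound)
      show "\<forall>\<^sub>F a in at_right 0. 1 / z a - (1 - h) * a \<le> 1 / z x - (1 - h) * x"
        unfolding eventually_at_right_field by (rule exI[of _ x]) (use x mono in auto)
    qed simp
    then show ?thesis by simp
  qed
  have Px: "PP \<mu> x \<le> (1 + h) * x"
  proof -
    have "PP \<mu> x - (1 + h) * x \<le> PP \<mu> 0 - (1 + h) * 0"
    proof (rule ge_by_deriv[where F="\<lambda>t. PP \<mu> t - (1 + h) * t" and F'="\<lambda>t. s0 \<sigma> W t * UU \<mu> t - (1 + h)"])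
      fix t assume t: "0 < t" "t < x"
      show "DERIV (\<lambda>t. PP \<mu> t - (1 + h) * t) t :> s0 \<sigma> W t * UU \<mu> t - (1 + h)"
        using t by (auto intro!: derivative_eq_intros DPP)
      show "s0 \<sigma> W t * UU \<mu> t - (1 + h) \<le> 0" using t2(2)[of t] t x by auto
    qed (use x in \<open>auto intro!: continuous_intros continuous_on_subset[OF cPP]\<close>)
    then show ?thesis using PP0 by simp
  qed
  have zpos: "z x > 0" using t2(2)[of x] x by simp
  have "z x * PP \<mu> x \<le> z x * ((1 + h) * x)" using Px zpos by simp
  also have "\<dots> \<le> (1 + h) / (1 - h)"
  proof -
    have "(1 - h) * x * z x \<le> 1" using zx zpos by (simp add: field_simps)
    then have "(1 + h) * ((1 - h) * x * z x) \<le> (1 + h) * 1" using h by (intro mult_left_mono) auto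
    then show ?thesis using h by (simp add: field_simps)
  qed
  finally have "d x \<le> (1 + h) / (1 - h) - (1 - h)" using t2(2)[of x] x unfolding d_def by auto
  then show False using dmono[of x] x h(3) by simp
qed

theorem riccati_iff_PP:
  assumes "\<sigma> = 2 / sqrt \<beta>"
  shows "riccati_no_explosion \<beta> \<mu> W \<longleftrightarrow> (\<forall>t>0. PP \<mu> t > 0)"
  using riccati_if_PP_pos[OF _ assms] PP_pos_if_riccati[OF _ assms] by blast

end

section \<open>The rescaled string equation\<close>

text \<open>The rescaled system. With \<open>W t = b (\<epsilon>\<^sup>2 t) / \<epsilon>\<close>, \<open>\<epsilon> = \<eta> powr (-1/6)\<close> and \<open>h = 2/\<beta>\<close>, the string equation of
  \<open>G_{\<beta>,a}\<close> at spectral parameter \<open>\<eta> - \<mu> \<eta> powr (2/3)\<close> becomes \<open>y' = (GG U1 - y)/\<epsilon>\<close>, \<open>U1' = (U1 - kap y/GG)/\<epsilon>\<close>.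
  Writing \<open>U1 = y + \<epsilon> v\<close> and removing the diagonal part with \<open>exp (\<plusminus> JJ)\<close> gives a canonical system whose
  coefficients \<open>se\<close>, \<open>ge\<close> converge to \<open>s0\<close>, \<open>g0\<close>.\<close>

definition GG :: "real \<Rightarrow> real \<Rightarrow> real \<Rightarrow> (real \<Rightarrow> real) \<Rightarrow> real \<Rightarrow> real" where
  "GG \<sigma> h \<epsilon> W t = exp (\<epsilon> * (\<sigma> * W t - h * \<epsilon> * t))"
definition al :: "real \<Rightarrow> real \<Rightarrow> real \<Rightarrow> (real \<Rightarrow> real) \<Rightarrow> real \<Rightarrow> real" where
  "al \<sigma> h \<epsilon> W t = (GG \<sigma> h \<epsilon> W t - 1) / \<epsilon>"
definition JJ :: "real \<Rightarrow> real \<Rightarrow> real \<Rightarrow> (real \<Rightarrow> real) \<Rightarrow> real \<Rightarrow> real" where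
  "JJ \<sigma> h \<epsilon> W t = integral {0..t} (al \<sigma> h \<epsilon> W)"
definition kap :: "real \<Rightarrow> real \<Rightarrow> real \<Rightarrow> real" where
  "kap \<mu> \<epsilon> t = (1 - \<mu> * \<epsilon>\<^sup>2) * exp (- (\<epsilon>\<^sup>2 * t))"
definition se :: "real \<Rightarrow> real \<Rightarrow> real \<Rightarrow> (real \<Rightarrow> real) \<Rightarrow> real \<Rightarrow> real" where
  "se \<sigma> h \<epsilon> W t = GG \<sigma> h \<epsilon> W t * exp (- 2 * JJ \<sigma> h \<epsilon> W t)"
definition ge :: "real \<Rightarrow> real \<Rightarrow> real \<Rightarrow> real \<Rightarrow> (real \<Rightarrow> real) \<Rightarrow> real \<Rightarrow> real" where
  "ge \<sigma> h \<mu> \<epsilon> W t = - ((2 - GG \<sigma> h \<epsilon> W t - kap \<mu> \<epsilon> t / GG \<sigma> h \<epsilon> W t) / \<epsilon>\<^sup>2) * exp (2 * JJ \<sigma> h \<epsilon> W t)"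
definition yy :: "real \<Rightarrow> real \<Rightarrow> real \<Rightarrow> real \<Rightarrow> (real \<Rightarrow> real) \<Rightarrow> real \<Rightarrow> real" where
  "yy \<sigma> h \<mu> \<epsilon> W t = exp (JJ \<sigma> h \<epsilon> W t) * phi (se \<sigma> h \<epsilon> W) (ge \<sigma> h \<mu> \<epsilon> W) t"
definition U1 :: "real \<Rightarrow> real \<Rightarrow> real \<Rightarrow> real \<Rightarrow> (real \<Rightarrow> real) \<Rightarrow> real \<Rightarrow> real" where
  "U1 \<sigma> h \<mu> \<epsilon> W t = yy \<sigma> h \<mu> \<epsilon> W t + \<epsilon> * (exp (- JJ \<sigma> h \<epsilon> W t) * uu (se \<sigma> h \<epsilon> W) (ge \<sigma> h \<mu> \<epsilon> W) t)"
definition NE :: "real \<Rightarrow> real \<Rightarrow> real \<Rightarrow> real \<Rightarrow> (real \<Rightarrow> real) \<Rightarrow> bool" where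
  "NE \<sigma> h \<mu> \<epsilon> W \<longleftrightarrow> (\<forall>t\<ge>0. U1 \<sigma> h \<mu> \<epsilon> W t > 0)"

context
  fixes \<sigma> h \<mu> \<epsilon> :: real and W :: "real \<Rightarrow> real"
  assumes cW: "continuous_on {0..} W" and eps: "\<epsilon> > 0"
begin

lemma cGG: "continuous_on {0..} (GG \<sigma> h \<epsilon> W)" unfolding GG_def[abs_def] by (intro continuous_intros cW)
lemma GGpos: "GG \<sigma> h \<epsilon> W t > 0" by (simp add: GG_def)
lemma cal: "continuous_on {0..} (al \<sigma> h \<epsilon> W)" unfolding al_def[abs_def] by (intro continuous_intros cGG) (use eps in auto)
lemma cJJ: "continuous_on {0..} (JJ \<sigma> h \<epsilon> W)" unfolding JJ_def[abs_def] by (rule continuous_on_integral_upper[OF cal])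
lemma DJJ: "t > 0 \<Longrightarrow> DERIV (JJ \<sigma> h \<epsilon> W) t :> al \<sigma> h \<epsilon> W t" unfolding JJ_def[abs_def] by (rule DERIV_integral_upper[OF cal])
lemma ckap: "continuous_on A (kap \<mu> \<epsilon>)" unfolding kap_def[abs_def] by (intro continuous_intros)
lemma cse: "continuous_on {0..} (se \<sigma> h \<epsilon> W)" unfolding se_def[abs_def] by (intro continuous_intros cGG cJJ)
lemma cge: "continuous_on {0..} (ge \<sigma> h \<mu> \<epsilon> W)" unfolding ge_def[abs_def]
  by (intro continuous_intros cGG cJJ ckap) (use eps GGpos in \<open>auto simp: less_le\<close>)
lemma sepos: "se \<sigma> h \<epsilon> W t > 0" by (simp add: se_def GGpos)
lemmas solE = lsolD[OF lsol_phi[OF cse cge]]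
lemma cyy: "continuous_on {0..} (yy \<sigma> h \<mu> \<epsilon> W)" unfolding yy_def[abs_def] by (intro continuous_intros cJJ solE)
lemma cU1: "continuous_on {0..} (U1 \<sigma> h \<mu> \<epsilon> W)" unfolding U1_def[abs_def] by (intro continuous_intros cJJ cyy solE)

lemma Dyy:
  assumes t: "t > 0"
  shows "DERIV (yy \<sigma> h \<mu> \<epsilon> W) t :> (GG \<sigma> h \<epsilon> W t * U1 \<sigma> h \<mu> \<epsilon> W t - yy \<sigma> h \<mu> \<epsilon> W t) / \<epsilon>"
proof -
  let ?p = "phi (se \<sigma> h \<epsilon> W) (ge \<sigma> h \<mu> \<epsilon> W)" and ?u = "uu (se \<sigma> h \<epsilon> W) (ge \<sigma> h \<mu> \<epsilon> W)"
  let ?J = "JJ \<sigma> h \<epsilon> W t" and ?G = "GG \<sigma> h \<epsilon> W t"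
  have "DERIV (yy \<sigma> h \<mu> \<epsilon> W) t :> exp ?J * al \<sigma> h \<epsilon> W t * ?p t + exp ?J * (se \<sigma> h \<epsilon> W t * ?u t)"
    unfolding yy_def[abs_def] by (auto intro!: derivative_eq_intros DJJ solE t)
  moreover have "exp ?J * al \<sigma> h \<epsilon> W t * ?p t + exp ?J * (se \<sigma> h \<epsilon> W t * ?u t) = (?G * U1 \<sigma> h \<mu> \<epsilon> W t - yy \<sigma> h \<mu> \<epsilon> W t) / \<epsilon>"
  proof -
    have e: "exp ?J * exp (- 2 * ?J) = exp (- ?J)" by (subst exp_add[symmetric]) simp
    have "exp ?J * (se \<sigma> h \<epsilon> W t * ?u t) = ?G * (exp ?J * exp (- 2 * ?J)) * ?u t" by (simp add: se_def)
    then have "exp ?J * (se \<sigma> h \<epsilon> W t * ?u t) = ?G * exp (- ?J) * ?u t" unfolding e .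
    then show ?thesis unfolding U1_def yy_def al_def using eps by (simp add: field_simps)
  qed
  ultimately show ?thesis by simp
qed

lemma DU1:
  assumes t: "t > 0"
  shows "DERIV (U1 \<sigma> h \<mu> \<epsilon> W) t :> (U1 \<sigma> h \<mu> \<epsilon> W t - kap \<mu> \<epsilon> t * yy \<sigma> h \<mu> \<epsilon> W t / GG \<sigma> h \<epsilon> W t) / \<epsilon>"
proof -
  let ?p = "phi (se \<sigma> h \<epsilon> W) (ge \<sigma> h \<mu> \<epsilon> W)" and ?u = "uu (se \<sigma> h \<epsilon> W) (ge \<sigma> h \<mu> \<epsilon> W)"
  let ?J = "JJ \<sigma> h \<epsilon> W t" and ?G = "GG \<sigma> h \<epsilon> W t" and ?k = "kap \<mu> \<epsilon> t"
  let ?v = "exp (- ?J) * ?u t"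
  have "DERIV (\<lambda>t. exp (- JJ \<sigma> h \<epsilon> W t) * ?u t) t :> exp (- ?J) * (- al \<sigma> h \<epsilon> W t) * ?u t + exp (- ?J) * (- ge \<sigma> h \<mu> \<epsilon> W t * ?p t)"
    by (auto intro!: derivative_eq_intros DJJ solE t)
  from DERIV_add[OF Dyy[OF t] DERIV_cmult[OF this, of \<epsilon>]]
  have "DERIV (U1 \<sigma> h \<mu> \<epsilon> W) t :> (?G * U1 \<sigma> h \<mu> \<epsilon> W t - yy \<sigma> h \<mu> \<epsilon> W t) / \<epsilon>
     + \<epsilon> * (exp (- ?J) * (- al \<sigma> h \<epsilon> W t) * ?u t + exp (- ?J) * (- ge \<sigma> h \<mu> \<epsilon> W t * ?p t))"
    unfolding U1_def[abs_def] .
  moreover have "(?G * U1 \<sigma> h \<mu> \<epsilon> W t - yy \<sigma> h \<mu> \<epsilon> W t) / \<epsilon>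
     + \<epsilon> * (exp (- ?J) * (- al \<sigma> h \<epsilon> W t) * ?u t + exp (- ?J) * (- ge \<sigma> h \<mu> \<epsilon> W t * ?p t))
     = (U1 \<sigma> h \<mu> \<epsilon> W t - ?k * yy \<sigma> h \<mu> \<epsilon> W t / ?G) / \<epsilon>"
  proof -
    have e: "exp (- ?J) * exp (2 * ?J) = exp ?J" by (subst exp_add[symmetric]) simp
    have "exp (- ?J) * (- ge \<sigma> h \<mu> \<epsilon> W t * ?p t) = ((2 - ?G - ?k / ?G) / \<epsilon>\<^sup>2) * (exp (- ?J) * exp (2 * ?J)) * ?p t"
      by (simp add: ge_def)
    then have g: "exp (- ?J) * (- ge \<sigma> h \<mu> \<epsilon> W t * ?p t) = ((2 - ?G - ?k / ?G) / \<epsilon>\<^sup>2) * yy \<sigma> h \<mu> \<epsilon> W t"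
      unfolding e yy_def by simp
    have U: "U1 \<sigma> h \<mu> \<epsilon> W t = yy \<sigma> h \<mu> \<epsilon> W t + \<epsilon> * ?v" by (simp add: U1_def)
    have a: "exp (- ?J) * (- al \<sigma> h \<epsilon> W t) * ?u t = - ((?G - 1) / \<epsilon>) * ?v" by (simp add: al_def)
    have id: "(G * (y + \<epsilon> * v) - y) / \<epsilon> + \<epsilon> * (- ((G - 1) / \<epsilon>) * v + ((2 - G - k / G) / \<epsilon>\<^sup>2) * y) = ((y + \<epsilon> * v) - k * y / G) / \<epsilon>"
      if "G > 0" for G y v k :: real
      using eps that by (simp add: field_simps power2_eq_square)
    show ?thesis unfolding g a U by (rule id[OF GGpos])
  qed
  ultimately show ?thesis by simp
qed

lemma yy0: "yy \<sigma> h \<mu> \<epsilon> W 0 = 0" and U10: "U1 \<sigma> h \<mu> \<epsilon> W 0 = \<epsilon>"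
  unfolding U1_def yy_def using phi_0[OF cse cge] uu_0[OF cse cge] by (auto simp: JJ_def)

text \<open>Pulled back to the original time and multiplied by \<open>exp (x / \<epsilon>^3)\<close>
  and \<open>exp (- (x / \<epsilon>^3))\<close>, which account for the leading rate
  \<open>2 / \<epsilon>^3\<close> of \<open>a\<close>, the pair \<open>yy\<close>, \<open>U1\<close>
  solves the string system. The factor \<open>1 / \<epsilon>\<close> in \<open>k\<close> normalises
  its initial value to 1, so by uniqueness \<open>k\<close> is \<open>U lam\<close>, a positive
  multiple of \<open>U1\<close>. For \<open>\<epsilon> = \<eta> powr (-1/6)\<close> the hypotheses
  on \<open>a\<close> and \<open>lam\<close> read \<open>a = 2 sqrt \<eta> - 2 / \<beta>\<close> and
  \<open>lam = \<eta> - \<mu> \<eta> powr (2/3)\<close>.\<close>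

lemma NN_iff_NE:
  assumes h: "h = 2 / \<beta>" and \<sigma>: "\<sigma> = 2 / sqrt \<beta>" and a: "a = 2 / \<epsilon>^3 - 2 / \<beta>" and lam: "lam = (1 - \<mu> * \<epsilon>\<^sup>2) / \<epsilon>^6"
    and B: "\<And>x. x \<ge> 0 \<Longrightarrow> B x = \<epsilon> * W (x / \<epsilon>\<^sup>2)" and cB: "continuous_on {0..} B"
  shows "string_eq.NN (s_dens \<beta> a B) (m_dens \<beta> a B) lam \<longleftrightarrow> NE \<sigma> h \<mu> \<epsilon> W"
proof -
  interpret string_eq "s_dens \<beta> a B" "m_dens \<beta> a B" by (rule string_eq_dens[OF cB])
  let ?y = "yy \<sigma> h \<mu> \<epsilon> W" and ?U = "U1 \<sigma> h \<mu> \<epsilon> W" and ?G = "GG \<sigma> h \<epsilon> W"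
  define f where "f x = \<epsilon>\<^sup>2 * exp (x / \<epsilon>^3) * ?y (x / \<epsilon>\<^sup>2)" for x
  define k where "k x = exp (- (x / \<epsilon>^3)) * ?U (x / \<epsilon>\<^sup>2) / \<epsilon>" for x
  have expo: "s_dens \<beta> a B x = exp (2 * (x / \<epsilon>^3)) * ?G (x / \<epsilon>\<^sup>2)" "m_dens \<beta> a B x = exp (- (2 * (x / \<epsilon>^3))) * exp (- x) / ?G (x / \<epsilon>\<^sup>2)" if "x \<ge> 0" for x
  proof -
    have g: "?G (x / \<epsilon>\<^sup>2) = exp (\<epsilon> * \<sigma> * W (x / \<epsilon>\<^sup>2) - h * x)"
      unfolding GG_def using eps by (simp add: field_simps power2_eq_square)
    have e: "\<epsilon> * \<sigma> * W (x / \<epsilon>\<^sup>2) = (2 / sqrt \<beta>) * B x" using B[OF that] \<sigma> by simp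
    have ax: "a * x = 2 * (x / \<epsilon>^3) - h * x" unfolding a h by (simp add: algebra_simps)
    show "s_dens \<beta> a B x = exp (2 * (x / \<epsilon>^3)) * ?G (x / \<epsilon>\<^sup>2)"
      unfolding s_dens_def g e ax exp_add[symmetric] by (simp add: algebra_simps)
    have "- (a + 1) * x - (2 / sqrt \<beta>) * B x = (- (2 * (x / \<epsilon>^3)) + (- x)) - ((2 / sqrt \<beta>) * B x - h * x)"
      using ax by (simp add: algebra_simps)
    then show "m_dens \<beta> a B x = exp (- (2 * (x / \<epsilon>^3))) * exp (- x) / ?G (x / \<epsilon>\<^sup>2)"
      unfolding m_dens_def g e exp_add[symmetric] exp_diff[symmetric] by simp
  qed
  have sc: "x / \<epsilon>\<^sup>2 > 0" if "x > 0" for x using that eps by simp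
  have Dsc: "DERIV (\<lambda>x. x / \<epsilon>\<^sup>2) x :> 1 / \<epsilon>\<^sup>2" "DERIV (\<lambda>x. x / \<epsilon>^3) x :> 1 / \<epsilon>^3" for x
    by (rule DERIV_cdivide[OF DERIV_ident])+
  have sol: "lsol (s_dens \<beta> a B) (\<lambda>t. lam * m_dens \<beta> a B t) f k"
    unfolding lsol_def
  proof (intro conjI allI impI)
    have cc: "continuous_on {0..} (\<lambda>x. g (x / \<epsilon>\<^sup>2))" if "continuous_on {0..} g" for g :: "real \<Rightarrow> real"
      by (rule continuous_on_compose2[OF that]) (use eps in \<open>auto intro!: continuous_intros\<close>)
    show "continuous_on {0..} f" unfolding f_def[abs_def] using eps by (intro continuous_intros cc[OF cyy]) auto
    show "continuous_on {0..} k" unfolding k_def[abs_def] using eps by (intro continuous_intros cc[OF cU1]) auto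
    fix x :: real assume x: "x > 0"
    let ?E = "exp (x / \<epsilon>^3)"
    have Dy: "DERIV (\<lambda>x. ?y (x / \<epsilon>\<^sup>2)) x :> (?G (x / \<epsilon>\<^sup>2) * ?U (x / \<epsilon>\<^sup>2) - ?y (x / \<epsilon>\<^sup>2)) / \<epsilon> * (1 / \<epsilon>\<^sup>2)"
      by (rule DERIV_chain2[OF Dyy[OF sc[OF x]] Dsc(1)])
    have DU: "DERIV (\<lambda>x. ?U (x / \<epsilon>\<^sup>2)) x :> (?U (x / \<epsilon>\<^sup>2) - kap \<mu> \<epsilon> (x / \<epsilon>\<^sup>2) * ?y (x / \<epsilon>\<^sup>2) / ?G (x / \<epsilon>\<^sup>2)) / \<epsilon> * (1 / \<epsilon>\<^sup>2)"
      by (rule DERIV_chain2[OF DU1[OF sc[OF x]] Dsc(1)])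
    have "DERIV f x :> \<epsilon>\<^sup>2 * (?E * (1 / \<epsilon>^3)) * ?y (x / \<epsilon>\<^sup>2) + \<epsilon>\<^sup>2 * ?E * ((?G (x / \<epsilon>\<^sup>2) * ?U (x / \<epsilon>\<^sup>2) - ?y (x / \<epsilon>\<^sup>2)) / \<epsilon> * (1 / \<epsilon>\<^sup>2))"
      unfolding f_def[abs_def]
      by (rule DERIV_cong[OF DERIV_mult[OF DERIV_cmult[OF DERIV_chain2[OF DERIV_exp Dsc(2)]] Dy]]) simp
    also have "\<epsilon>\<^sup>2 * (?E * (1 / \<epsilon>^3)) * ?y (x / \<epsilon>\<^sup>2) + \<epsilon>\<^sup>2 * ?E * ((?G (x / \<epsilon>\<^sup>2) * ?U (x / \<epsilon>\<^sup>2) - ?y (x / \<epsilon>\<^sup>2)) / \<epsilon> * (1 / \<epsilon>\<^sup>2))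
       = ?E * ?G (x / \<epsilon>\<^sup>2) * ?U (x / \<epsilon>\<^sup>2) / \<epsilon>"
      using eps by (simp add: field_simps power2_eq_square power3_eq_cube)
    also have "\<dots> = s_dens \<beta> a B x * k x"
    proof -
      have e: "exp (2 * (x / \<epsilon>^3)) * exp (- (x / \<epsilon>^3)) = ?E" by (subst exp_add[symmetric]) simp
      have "s_dens \<beta> a B x * k x = (exp (2 * (x / \<epsilon>^3)) * exp (- (x / \<epsilon>^3))) * ?G (x / \<epsilon>\<^sup>2) * ?U (x / \<epsilon>\<^sup>2) / \<epsilon>"
        unfolding expo(1)[OF less_imp_le[OF x]] k_def by simp
      then show ?thesis unfolding e by simp
    qed
    finally show "DERIV f x :> s_dens \<beta> a B x * k x" .
    let ?F = "exp (- (x / \<epsilon>^3))"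
    have "DERIV (\<lambda>x. exp (- (x / \<epsilon>^3))) x :> ?F * - (1 / \<epsilon>^3)"
      by (rule DERIV_chain2[OF DERIV_exp DERIV_minus[OF Dsc(2)]])
    then have "DERIV k x :> (?F * - (1 / \<epsilon>^3) * ?U (x / \<epsilon>\<^sup>2) + (?U (x / \<epsilon>\<^sup>2) - kap \<mu> \<epsilon> (x / \<epsilon>\<^sup>2) * ?y (x / \<epsilon>\<^sup>2) / ?G (x / \<epsilon>\<^sup>2)) / \<epsilon> * (1 / \<epsilon>\<^sup>2) * ?F) / \<epsilon>"
      unfolding k_def[abs_def] by (intro DERIV_cdivide DERIV_mult DU)
    also have "(?F * - (1 / \<epsilon>^3) * ?U (x / \<epsilon>\<^sup>2) + (?U (x / \<epsilon>\<^sup>2) - kap \<mu> \<epsilon> (x / \<epsilon>\<^sup>2) * ?y (x / \<epsilon>\<^sup>2) / ?G (x / \<epsilon>\<^sup>2)) / \<epsilon> * (1 / \<epsilon>\<^sup>2) * ?F) / \<epsilon>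
       = - (?F * kap \<mu> \<epsilon> (x / \<epsilon>\<^sup>2) * ?y (x / \<epsilon>\<^sup>2) / ?G (x / \<epsilon>\<^sup>2)) / \<epsilon>^4"
      using eps GGpos[of "x / \<epsilon>\<^sup>2"] by (simp add: field_simps power2_eq_square power3_eq_cube power4_eq_xxxx)
    also have "\<dots> = - (lam * m_dens \<beta> a B x) * f x"
    proof -
      have e: "exp (- (2 * (x / \<epsilon>^3))) * ?E = ?F" by (subst exp_add[symmetric]) simp
      have kx: "kap \<mu> \<epsilon> (x / \<epsilon>\<^sup>2) = (1 - \<mu> * \<epsilon>\<^sup>2) * exp (- x)" unfolding kap_def using eps by simp
      have l: "lam * \<epsilon>\<^sup>2 = (1 - \<mu> * \<epsilon>\<^sup>2) / \<epsilon>^4" unfolding lam using eps by (simp add: field_simps)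
      have "- (lam * m_dens \<beta> a B x) * f x = - ((lam * \<epsilon>\<^sup>2) * exp (- x) * (exp (- (2 * (x / \<epsilon>^3))) * ?E) * ?y (x / \<epsilon>\<^sup>2) / ?G (x / \<epsilon>\<^sup>2))"
        unfolding expo(2)[OF less_imp_le[OF x]] f_def by simp
      also have "\<dots> = - ((1 - \<mu> * \<epsilon>\<^sup>2) / \<epsilon>^4 * exp (- x) * ?F * ?y (x / \<epsilon>\<^sup>2) / ?G (x / \<epsilon>\<^sup>2))" unfolding e l ..
      finally show ?thesis unfolding kx by (simp add: ac_simps)
    qed
    finally show "DERIV k x :> - (lam * m_dens \<beta> a B x) * f x" .
  qed
  have f0: "f 0 = 0" and k0: "k 0 = 1" using eps yy0 U10 by (auto simp: f_def k_def)
  have Uk: "U lam x = k x" if "x \<ge> 0" for x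
    using lsol_unique(2)[OF cs cg sol f0 that] k0 by (simp add: U_def)
  have "NN lam \<longleftrightarrow> (\<forall>x\<ge>0. ?U (x / \<epsilon>\<^sup>2) > 0)"
    unfolding NN_def using Uk eps by (auto simp: k_def zero_less_divide_iff zero_less_mult_iff)
  also have "\<dots> \<longleftrightarrow> (\<forall>t\<ge>0. ?U t > 0)"
  proof
    assume a: "\<forall>x\<ge>0. ?U (x / \<epsilon>\<^sup>2) > 0"
    show "\<forall>t\<ge>0. ?U t > 0"
    proof (intro allI impI)
      fix t :: real assume "t \<ge> 0"
      then have "t * \<epsilon>\<^sup>2 \<ge> 0" by simp
      then have "?U ((t * \<epsilon>\<^sup>2) / \<epsilon>\<^sup>2) > 0" using a by blast
      then show "?U t > 0" using eps by simp
    qed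
  qed (use eps in simp)
  finally show ?thesis by (simp add: NE_def)
qed

end

section \<open>Convergence of the rescaled coefficients and solutions\<close>

lemma abs_exp_minus_one_le: "\<bar>exp z - 1\<bar> \<le> \<bar>z\<bar> * exp \<bar>z\<bar>" for z :: real
proof (cases "z \<ge> 0")
  case True
  have "1 + (- z) \<le> exp (- z)" by (rule exp_ge_add_one_self)
  then have "(1 - z) * exp z \<le> exp (- z) * exp z" by (intro mult_right_mono) auto
  then have "exp z - 1 \<le> z * exp z" by (simp add: exp_minus_inverse algebra_simps mult_exp_exp)
  then show ?thesis using True by simp
next
  case False
  have a: "1 + z \<le> exp z" by (rule exp_ge_add_one_self)
  have "exp z \<le> 1" using False by simp
  then have "\<bar>exp z - 1\<bar> \<le> \<bar>z\<bar> * 1" using False a by (simp only: mult_1_right)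
  also have "\<dots> \<le> \<bar>z\<bar> * exp \<bar>z\<bar>" by (intro mult_left_mono) auto
  finally show ?thesis .
qed

lemma exp_minus_one_le: fixes z :: real assumes "z < 1" shows "exp z - 1 \<le> z / (1 - z)"
proof -
  have "1 + (- z) \<le> exp (- z)" by (rule exp_ge_add_one_self)
  then have "(1 - z) * exp z \<le> 1" using mult_right_mono[of "1 - z" "exp (- z)" "exp z"] by (simp add: mult_exp_exp)
  then show ?thesis using assms by (simp add: field_simps)
qed

text \<open>Resolves the apparent singularity \<open>1 / \<epsilon>^2\<close>:
  \<open>G + k / G - 2\<close> equals \<open>((G - 1)^2 - (1 - k)) / G\<close>, and both
  \<open>(G - 1)^2\<close> and \<open>1 - k\<close> are of order \<open>\<epsilon>^2\<close> at
  fixed \<open>t\<close>.\<close>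

lemma ge_alt:
  assumes "\<epsilon> > 0"
  shows "ge \<sigma> h \<mu> \<epsilon> W t = ((al \<sigma> h \<epsilon> W t)\<^sup>2 / GG \<sigma> h \<epsilon> W t - ((1 - kap \<mu> \<epsilon> t) / \<epsilon>\<^sup>2) / GG \<sigma> h \<epsilon> W t) * exp (2 * JJ \<sigma> h \<epsilon> W t)"
proof -
  have "- ((2 - G - k / G) / \<epsilon>\<^sup>2) = ((G - 1) / \<epsilon>)\<^sup>2 / G - ((1 - k) / \<epsilon>\<^sup>2) / G" if "G > 0" for G k :: real
    using assms that by (simp add: field_simps power2_eq_square)
  then show ?thesis unfolding ge_def al_def by (simp add: GG_def)
qed

text \<open>Both bounds come from \<open>1 + x <= exp x\<close>, taken at
  \<open>x = \<epsilon>^2 t\<close> and at \<open>x = - \<epsilon>^2 t\<close>; they squeeze the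
  quotient to \<open>t + \<mu>\<close>.\<close>

lemma one_minus_kap_bounds:
  assumes "\<epsilon> > 0" "t \<ge> 0"
  shows "t / (1 + \<epsilon>\<^sup>2 * t) + \<mu> * exp (- (\<epsilon>\<^sup>2 * t)) \<le> (1 - kap \<mu> \<epsilon> t) / \<epsilon>\<^sup>2" "(1 - kap \<mu> \<epsilon> t) / \<epsilon>\<^sup>2 \<le> t + \<mu> * exp (- (\<epsilon>\<^sup>2 * t))"
proof -
  let ?\<theta> = "\<epsilon>\<^sup>2 * t"
  have e2: "\<epsilon>\<^sup>2 > 0" and th: "?\<theta> \<ge> 0" using assms by auto
  have eq: "(1 - kap \<mu> \<epsilon> t) / \<epsilon>\<^sup>2 = (1 - exp (- ?\<theta>)) / \<epsilon>\<^sup>2 + \<mu> * exp (- ?\<theta>)"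
    unfolding kap_def using e2 by (simp add: field_simps)
  have "1 + (- ?\<theta>) \<le> exp (- ?\<theta>)" by (rule exp_ge_add_one_self)
  then have "(1 - exp (- ?\<theta>)) / \<epsilon>\<^sup>2 \<le> ?\<theta> / \<epsilon>\<^sup>2" using e2 by (intro divide_right_mono) auto
  then show "(1 - kap \<mu> \<epsilon> t) / \<epsilon>\<^sup>2 \<le> t + \<mu> * exp (- ?\<theta>)" unfolding eq using e2 by simp
  have "1 + ?\<theta> \<le> exp ?\<theta>" by (rule exp_ge_add_one_self)
  then have "exp (- ?\<theta>) \<le> 1 / (1 + ?\<theta>)" using th by (simp add: exp_minus field_simps)
  then have "?\<theta> / (1 + ?\<theta>) \<le> 1 - exp (- ?\<theta>)" using th by (simp add: field_simps)
  then have "(?\<theta> / (1 + ?\<theta>)) / \<epsilon>\<^sup>2 \<le> (1 - exp (- ?\<theta>)) / \<epsilon>\<^sup>2" using e2 by (intro divide_right_mono) auto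
  then show "t / (1 + ?\<theta>) + \<mu> * exp (- ?\<theta>) \<le> (1 - kap \<mu> \<epsilon> t) / \<epsilon>\<^sup>2" unfolding eq using e2 by simp
qed

context
  fixes \<sigma> h \<mu> :: real and W :: "real \<Rightarrow> real" and e :: "nat \<Rightarrow> real"
  assumes cW: "continuous_on {0..} W" and e0: "\<And>n. 0 < e n" and e1: "\<And>n. e n \<le> 1" and elim: "e \<longlonglongrightarrow> 0"
begin

lemma lim_N: "(\<lambda>n. \<sigma> * W t - h * e n * t) \<longlonglongrightarrow> \<sigma> * W t"
proof -
  have "(\<lambda>n. \<sigma> * W t - h * e n * t) \<longlonglongrightarrow> \<sigma> * W t - h * 0 * t" by (intro tendsto_intros elim)
  then show ?thesis by simp
qed

lemma lim_eN: "(\<lambda>n. e n * (\<sigma> * W t - h * e n * t)) \<longlonglongrightarrow> 0"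
  using tendsto_mult[OF elim lim_N[of t]] by simp

lemma lim_GG: "(\<lambda>n. GG \<sigma> h (e n) W t) \<longlonglongrightarrow> 1"
  using tendsto_exp[OF lim_eN[of t]] by (simp add: GG_def)

lemma lim_al: "(\<lambda>n. al \<sigma> h (e n) W t) \<longlonglongrightarrow> \<sigma> * W t"
proof (rule tendsto_sandwich[OF _ _ lim_N])
  let ?N = "\<lambda>n. \<sigma> * W t - h * e n * t"
  show "\<forall>\<^sub>F n in sequentially. ?N n \<le> al \<sigma> h (e n) W t"
  proof (rule always_eventually, rule allI)
    fix n
    have "1 + e n * ?N n \<le> exp (e n * ?N n)" by (rule exp_ge_add_one_self)
    then show "?N n \<le> al \<sigma> h (e n) W t" using e0[of n] by (simp add: al_def GG_def field_simps)
  qed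
  have "(\<lambda>n. ?N n / (1 - e n * ?N n)) \<longlonglongrightarrow> \<sigma> * W t / (1 - 0)" by (intro tendsto_intros lim_N lim_eN) simp
  then show "(\<lambda>n. ?N n / (1 - e n * ?N n)) \<longlonglongrightarrow> \<sigma> * W t" by simp
  have "\<forall>\<^sub>F n in sequentially. e n * ?N n < 1" using order_tendstoD(2)[OF lim_eN[of t], of 1] by simp
  then show "\<forall>\<^sub>F n in sequentially. al \<sigma> h (e n) W t \<le> ?N n / (1 - e n * ?N n)"
  proof eventually_elim
    case (elim n)
    have "(exp (e n * ?N n) - 1) / e n \<le> (e n * ?N n / (1 - e n * ?N n)) / e n"
      using exp_minus_one_le[OF elim] e0[of n] by (intro divide_right_mono) auto
    then show ?case using e0[of n] by (simp add: al_def GG_def)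
  qed
qed

lemma coeff_bounds:
  obtains B where "B > 0" "\<And>n t. 0 \<le> t \<Longrightarrow> t \<le> T \<Longrightarrow> \<bar>al \<sigma> h (e n) W t\<bar> \<le> B" "\<And>n t. 0 \<le> t \<Longrightarrow> t \<le> T \<Longrightarrow> GG \<sigma> h (e n) W t \<le> B"
    "\<And>n t. 0 \<le> t \<Longrightarrow> t \<le> T \<Longrightarrow> 1 / GG \<sigma> h (e n) W t \<le> B"
proof -
  obtain K where K: "K > 0" "\<And>t. 0 \<le> t \<Longrightarrow> t \<le> T \<Longrightarrow> \<bar>W t\<bar> \<le> K" by (rule continuous_bounded_Icc[OF cW]) auto
  define b where "b = \<bar>\<sigma>\<bar> * K + \<bar>h\<bar> * \<bar>T\<bar> + 1"
  have b1: "b \<ge> 1" using K by (simp add: b_def)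
  have N: "\<bar>\<sigma> * W t - h * e n * t\<bar> \<le> b" if "0 \<le> t" "t \<le> T" for n t
  proof -
    have "\<bar>\<sigma> * W t\<bar> \<le> \<bar>\<sigma>\<bar> * K" using K(2)[OF that] by (simp add: abs_mult mult_left_mono)
    moreover have "\<bar>h * e n * t\<bar> \<le> \<bar>h\<bar> * 1 * \<bar>T\<bar>"
      unfolding abs_mult using e0[of n] e1[of n] that by (intro mult_mono) auto
    ultimately show ?thesis unfolding b_def by linarith
  qed
  have eN: "\<bar>e n * (\<sigma> * W t - h * e n * t)\<bar> \<le> b" if "0 \<le> t" "t \<le> T" for n t
    using mult_mono[OF e1[of n] N[OF that, of n]] e0[of n] by (simp add: abs_mult)
  show ?thesis
  proof (rule that[of "b * exp b"])
    show "b * exp b > 0" using b1 by simp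
    fix n and t :: real assume t: "0 \<le> t" "t \<le> T"
    let ?N = "\<sigma> * W t - h * e n * t"
    have "\<bar>exp (e n * ?N) - 1\<bar> \<le> \<bar>e n * ?N\<bar> * exp \<bar>e n * ?N\<bar>" by (rule abs_exp_minus_one_le)
    also have "\<dots> \<le> (e n * b) * exp b" using N[OF t, of n] eN[OF t, of n] e0[of n] b1
      by (intro mult_mono) (auto simp: abs_mult)
    finally have "\<bar>exp (e n * ?N) - 1\<bar> / e n \<le> (e n * b) * exp b / e n" using e0[of n] by (intro divide_right_mono) auto
    then show "\<bar>al \<sigma> h (e n) W t\<bar> \<le> b * exp b" using e0[of n] by (simp add: al_def GG_def)
    have e': "exp b \<le> b * exp b" using b1 by simp
    have "exp (e n * ?N) \<le> exp b" using eN[OF t, of n] by simp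
    then show "GG \<sigma> h (e n) W t \<le> b * exp b" unfolding GG_def by (rule order_trans[OF _ e'])
    have "exp (- (e n * ?N)) \<le> exp b" using eN[OF t, of n] by (subst exp_le_cancel_iff) linarith
    moreover have "1 / GG \<sigma> h (e n) W t = exp (- (e n * ?N))" by (simp add: GG_def exp_minus inverse_eq_divide)
    ultimately show "1 / GG \<sigma> h (e n) W t \<le> b * exp b" using order_trans[OF _ e'] by simp
  qed
qed

lemma JJ_bound:
  obtains B where "B > 0" "\<And>n t. 0 \<le> t \<Longrightarrow> t \<le> T \<Longrightarrow> \<bar>JJ \<sigma> h (e n) W t\<bar> \<le> B"
proof -
  obtain B where B: "B > 0" "\<And>n t. 0 \<le> t \<Longrightarrow> t \<le> T \<Longrightarrow> \<bar>al \<sigma> h (e n) W t\<bar> \<le> B" by (rule coeff_bounds) auto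
  show ?thesis
  proof (rule that[of "B * \<bar>T\<bar> + 1"])
    show "B * \<bar>T\<bar> + 1 > 0" using B(1) by (smt (verit) mult_nonneg_nonneg abs_ge_zero)
    fix n and t :: real assume t: "0 \<le> t" "t \<le> T"
    have "norm (integral {0..t} (al \<sigma> h (e n) W)) \<le> integral {0..t} (\<lambda>_. B)"
      by (rule integral_norm_bound_integral) (use t B in \<open>auto intro!: integrable_on_atLeast_subinterval cal[OF cW e0]\<close>)
    also have "\<dots> = B * t" using t by (simp add: mult.commute)
    also have "\<dots> \<le> B * \<bar>T\<bar> + 1" using t B(1) mult_left_mono[of t "\<bar>T\<bar>" B] by linarith
    finally show "\<bar>JJ \<sigma> h (e n) W t\<bar> \<le> B * \<bar>T\<bar> + 1" by (simp add: JJ_def)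
  qed
qed

lemma lim_JJ:
  assumes "t \<ge> 0" shows "(\<lambda>n. JJ \<sigma> h (e n) W t) \<longlonglongrightarrow> \<sigma> * integral {0..t} W"
proof -
  obtain B where B: "B > 0" "\<And>n x. 0 \<le> x \<Longrightarrow> x \<le> t \<Longrightarrow> \<bar>al \<sigma> h (e n) W x\<bar> \<le> B" by (rule coeff_bounds) auto
  have "(\<lambda>n. integral {0..t} (al \<sigma> h (e n) W)) \<longlonglongrightarrow> integral {0..t} (\<lambda>x. \<sigma> * W x)"
    by (rule dominated_convergence(2)[where h="\<lambda>_. B"])
      (use B lim_al in \<open>auto intro!: integrable_on_atLeast_subinterval cal[OF cW e0]\<close>)
  then show ?thesis by (simp add: JJ_def)
qed

lemma lim_kap:
  assumes t: "t \<ge> 0" shows "(\<lambda>n. (1 - kap \<mu> (e n) t) / (e n)\<^sup>2) \<longlonglongrightarrow> t + \<mu>"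
proof (rule tendsto_sandwich)
  have "(\<lambda>n. exp (- ((e n)\<^sup>2 * t))) \<longlonglongrightarrow> exp (- (0\<^sup>2 * t))" by (intro tendsto_intros elim)
  then have x: "(\<lambda>n. exp (- ((e n)\<^sup>2 * t))) \<longlonglongrightarrow> 1" by simp
  have "(\<lambda>n. t / (1 + (e n)\<^sup>2 * t) + \<mu> * exp (- ((e n)\<^sup>2 * t))) \<longlonglongrightarrow> t / (1 + 0\<^sup>2 * t) + \<mu> * 1" by (intro tendsto_intros elim x) simp
  then show "(\<lambda>n. t / (1 + (e n)\<^sup>2 * t) + \<mu> * exp (- ((e n)\<^sup>2 * t))) \<longlonglongrightarrow> t + \<mu>" by simp
  have "(\<lambda>n. t + \<mu> * exp (- ((e n)\<^sup>2 * t))) \<longlonglongrightarrow> t + \<mu> * 1" by (intro tendsto_intros x)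
  then show "(\<lambda>n. t + \<mu> * exp (- ((e n)\<^sup>2 * t))) \<longlonglongrightarrow> t + \<mu>" by simp
qed (use one_minus_kap_bounds[OF e0 t] in \<open>auto intro!: always_eventually\<close>)

lemma solutions_converge:
  assumes T: "T \<ge> 0"
  shows "uniform_limit {0..T} (\<lambda>n. phi (se \<sigma> h (e n) W) (ge \<sigma> h \<mu> (e n) W)) (PP \<sigma> W \<mu>) sequentially"
    "uniform_limit {0..T} (\<lambda>n. uu (se \<sigma> h (e n) W) (ge \<sigma> h \<mu> (e n) W)) (UU \<sigma> W \<mu>) sequentially"
proof -
  obtain B where B: "B > 0" "\<And>n t. 0 \<le> t \<Longrightarrow> t \<le> T \<Longrightarrow> \<bar>al \<sigma> h (e n) W t\<bar> \<le> B" "\<And>n t. 0 \<le> t \<Longrightarrow> t \<le> T \<Longrightarrow> GG \<sigma> h (e n) W t \<le> B"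
    "\<And>n t. 0 \<le> t \<Longrightarrow> t \<le> T \<Longrightarrow> 1 / GG \<sigma> h (e n) W t \<le> B" by (rule coeff_bounds) auto
  obtain J where J: "J > 0" "\<And>n t. 0 \<le> t \<Longrightarrow> t \<le> T \<Longrightarrow> \<bar>JJ \<sigma> h (e n) W t\<bar> \<le> J" by (rule JJ_bound) auto
  define K where "K = (B + (B\<^sup>2 * B + (T + \<bar>\<mu>\<bar>) * B)) * exp (2 * J)"
  have sb: "\<bar>se \<sigma> h (e n) W t\<bar> \<le> K" if t: "0 \<le> t" "t \<le> T" for n t
  proof -
    have "\<bar>se \<sigma> h (e n) W t\<bar> = GG \<sigma> h (e n) W t * exp (- 2 * JJ \<sigma> h (e n) W t)" by (simp add: se_def GG_def)
    also have "\<dots> \<le> (B + (B\<^sup>2 * B + (T + \<bar>\<mu>\<bar>) * B)) * exp (2 * J)"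
    proof (rule mult_mono)
      have "B\<^sup>2 * B + (T + \<bar>\<mu>\<bar>) * B \<ge> 0" using B(1) T by simp
      then show "GG \<sigma> h (e n) W t \<le> B + (B\<^sup>2 * B + (T + \<bar>\<mu>\<bar>) * B)" using B(3)[OF t, of n] by linarith
      show "exp (- 2 * JJ \<sigma> h (e n) W t) \<le> exp (2 * J)" using J(2)[OF t, of n] by (subst exp_le_cancel_iff) linarith
      show "0 \<le> B + (B\<^sup>2 * B + (T + \<bar>\<mu>\<bar>) * B)" using B(1) T by simp
    qed simp
    finally show ?thesis by (simp add: K_def)
  qed
  have gb: "\<bar>ge \<sigma> h \<mu> (e n) W t\<bar> \<le> K" if t: "0 \<le> t" "t \<le> T" for n t
  proof -
    let ?G = "GG \<sigma> h (e n) W t" and ?a = "al \<sigma> h (e n) W t" and ?k = "(1 - kap \<mu> (e n) t) / (e n)\<^sup>2"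
    have G: "?G > 0" by (simp add: GG_def)
    have k: "\<bar>?k\<bar> \<le> T + \<bar>\<mu>\<bar>"
    proof -
      have ex: "\<bar>\<mu> * exp (- ((e n)\<^sup>2 * t))\<bar> \<le> \<bar>\<mu>\<bar> * 1" unfolding abs_mult using t by (intro mult_left_mono) auto
      have "t / (1 + (e n)\<^sup>2 * t) \<ge> 0" using t by simp
      then show ?thesis using one_minus_kap_bounds[OF e0[of n] t(1), of \<mu>] ex t unfolding abs_le_iff by linarith
    qed
    have "\<bar>?a\<^sup>2 / ?G - ?k / ?G\<bar> \<le> ?a\<^sup>2 * (1 / ?G) + \<bar>?k\<bar> * (1 / ?G)" using G by (simp add: abs_triangle_ineq4[THEN order_trans] abs_divide)
    also have "\<dots> \<le> B\<^sup>2 * B + (T + \<bar>\<mu>\<bar>) * B"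
    proof (intro add_mono mult_mono)
      show "?a\<^sup>2 \<le> B\<^sup>2" using B(2)[OF t, of n] B(1) by (intro abs_le_square_iff[THEN iffD1]) auto
    qed (use B(4)[OF t, of n] k G B(1) T in auto)
    also have "\<dots> \<le> B + (B\<^sup>2 * B + (T + \<bar>\<mu>\<bar>) * B)" using B(1) by simp
    finally have 1: "\<bar>?a\<^sup>2 / ?G - ?k / ?G\<bar> \<le> B + (B\<^sup>2 * B + (T + \<bar>\<mu>\<bar>) * B)" .
    have 2: "exp (2 * JJ \<sigma> h (e n) W t) \<le> exp (2 * J)" using J(2)[OF t, of n] by (subst exp_le_cancel_iff) linarith
    show ?thesis unfolding ge_alt[OF e0] K_def abs_mult by (rule mult_mono) (use 1 2 in auto)
  qed
  have ls: "(\<lambda>n. se \<sigma> h (e n) W t) \<longlonglongrightarrow> s0 \<sigma> W t" if "0 \<le> t" for t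
  proof -
    have "(\<lambda>n. se \<sigma> h (e n) W t) \<longlonglongrightarrow> 1 * exp (- 2 * (\<sigma> * integral {0..t} W))"
      unfolding se_def by (intro tendsto_intros lim_GG lim_JJ that)
    then show ?thesis by (simp add: s0_def mult.assoc)
  qed
  have lg: "(\<lambda>n. ge \<sigma> h \<mu> (e n) W t) \<longlonglongrightarrow> g0 \<sigma> \<mu> W t" if "0 \<le> t" for t
  proof -
    have "(\<lambda>n. ge \<sigma> h \<mu> (e n) W t) \<longlonglongrightarrow> ((\<sigma> * W t)\<^sup>2 / 1 - (t + \<mu>) / 1) * exp (2 * (\<sigma> * integral {0..t} W))"
      unfolding ge_alt[OF e0] by (intro tendsto_intros lim_GG lim_JJ lim_al lim_kap that) auto
    then show ?thesis by (simp add: g0_def power_mult_distrib algebra_simps)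
  qed
  show "uniform_limit {0..T} (\<lambda>n. phi (se \<sigma> h (e n) W) (ge \<sigma> h \<mu> (e n) W)) (PP \<sigma> W \<mu>) sequentially"
    "uniform_limit {0..T} (\<lambda>n. uu (se \<sigma> h (e n) W) (ge \<sigma> h \<mu> (e n) W)) (UU \<sigma> W \<mu>) sequentially"
    unfolding PP_def[OF cW] UU_def[OF cW]
    by (rule phi_continuous_dependence[OF cs0[OF cW] cg0[OF cW] cse[OF cW e0] cge[OF cW e0] sb gb ls lg T]; assumption)+
qed

text \<open>The \<open>uu\<close> part of \<open>U1\<close> carries a factor
  \<open>\<epsilon>\<close>, so only the \<open>phi\<close> part is left in the limit.\<close>

lemma U1_tendsto:
  assumes t: "t \<ge> 0"
  shows "(\<lambda>n. U1 \<sigma> h \<mu> (e n) W t) \<longlonglongrightarrow> exp (\<sigma> * integral {0..t} W) * PP \<sigma> W \<mu> t"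
proof -
  have p: "(\<lambda>n. phi (se \<sigma> h (e n) W) (ge \<sigma> h \<mu> (e n) W) t) \<longlonglongrightarrow> PP \<sigma> W \<mu> t"
    and u: "(\<lambda>n. uu (se \<sigma> h (e n) W) (ge \<sigma> h \<mu> (e n) W) t) \<longlonglongrightarrow> UU \<sigma> W \<mu> t"
    using tendsto_uniform_limitI[OF solutions_converge(1)[OF t], of t] tendsto_uniform_limitI[OF solutions_converge(2)[OF t], of t] t by auto
  have "(\<lambda>n. U1 \<sigma> h \<mu> (e n) W t) \<longlonglongrightarrow> exp (\<sigma> * integral {0..t} W) * PP \<sigma> W \<mu> t + 0 * (exp (- (\<sigma> * integral {0..t} W)) * UU \<sigma> W \<mu> t)"
    unfolding U1_def yy_def by (intro tendsto_intros lim_JJ t p u elim)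
  then show ?thesis by simp
qed

theorem eventually_not_NE:
  assumes "\<not> (\<forall>t>0. PP \<sigma> W \<mu> t > 0)"
  shows "\<forall>\<^sub>F n in sequentially. \<not> NE \<sigma> h \<mu> (e n) W"
proof -
  obtain t where t: "t > 0" "PP \<sigma> W \<mu> t < 0"
    by (rule exists_phi_neg[OF cs0[OF cW] cg0[OF cW] s0pos[OF cW] assms[unfolded PP_def[OF cW]]]) (auto simp: PP_def[OF cW])
  have "exp (\<sigma> * integral {0..t} W) * PP \<sigma> W \<mu> t < 0" using t by (simp add: mult_pos_neg)
  from order_tendstoD(2)[OF U1_tendsto this] t
  have "\<forall>\<^sub>F n in sequentially. U1 \<sigma> h \<mu> (e n) W t < 0" by simp
  then show ?thesis
  proof eventually_elim
    case (elim n)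
    then have "\<not> U1 \<sigma> h \<mu> (e n) W t > 0" by simp
    then show ?case unfolding NE_def using less_imp_le[OF t(1)] by blast
  qed
qed

end

text \<open>In \<open>\<theta> = \<epsilon>^2 t\<close> and \<open>w = - \<epsilon> q\<close> the
  scale disappears: \<open>w <= max (sqrt \<theta>) \<theta> / 4\<close>. For
  \<open>\<theta> >= 1\<close> the factor \<open>exp (- \<theta>)\<close> in \<open>kap\<close>
  beats \<open>exp w\<close> and a fixed margin remains. For \<open>\<theta> < 1\<close> the gain
  \<open>1 - kap >= 19/40 \<theta>\<close> faces a loss
  \<open>exp w + exp (- w) - 2 <= 2 w^2 <= \<theta> / 8\<close>. The barrier constant 1/4 and the
  factor 40 leave enough room for 1/5 in both cases.\<close>

lemma drift_lower_bound:
  assumes \<epsilon>: "\<epsilon> > 0" and \<mu>: "\<bar>\<mu>\<bar> * \<epsilon>\<^sup>2 \<le> 1/10" and t: "40 * \<bar>\<mu>\<bar> \<le> t" "t > 0"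
    and q: "- (max (sqrt t) (\<epsilon> * t) / 4) \<le> q" "q \<le> 0"
  shows "min t (1 / \<epsilon>\<^sup>2) / 5 \<le> (2 - exp (\<epsilon> * q) - kap \<mu> \<epsilon> t * exp (- (\<epsilon> * q))) / \<epsilon>\<^sup>2"
proof -
  define \<theta> where "\<theta> = \<epsilon>\<^sup>2 * t"
  define w where "w = - (\<epsilon> * q)"
  have e2: "\<epsilon>\<^sup>2 > 0" using \<epsilon> by simp
  have \<theta>0: "\<theta> > 0" using e2 t by (simp add: \<theta>_def)
  have w0: "w \<ge> 0" using q \<epsilon> by (simp add: w_def mult_nonneg_nonpos)
  have w1: "w \<le> max (sqrt \<theta>) \<theta> / 4"
  proof -
    have "\<epsilon> * (- q) \<le> \<epsilon> * (max (sqrt t) (\<epsilon> * t) / 4)" using q \<epsilon> by (intro mult_left_mono) auto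
    also have "\<dots> = max (\<epsilon> * sqrt t) (\<epsilon> * (\<epsilon> * t)) / 4" using \<epsilon> by (simp add: max_mult_distrib_left)
    also have "\<epsilon> * sqrt t = sqrt \<theta>" using \<epsilon> by (simp add: \<theta>_def real_sqrt_mult)
    also have "\<epsilon> * (\<epsilon> * t) = \<theta>" by (simp add: \<theta>_def power2_eq_square)
    finally show ?thesis by (simp add: w_def)
  qed
  have k: "kap \<mu> \<epsilon> t \<le> (1 + \<bar>\<mu>\<bar> * \<epsilon>\<^sup>2) * exp (- \<theta>)"
    unfolding kap_def \<theta>_def[symmetric]
  proof (rule mult_right_mono)
    have "- \<mu> * \<epsilon>\<^sup>2 \<le> \<bar>\<mu>\<bar> * \<epsilon>\<^sup>2" by (intro mult_right_mono) auto
    then show "1 - \<mu> * \<epsilon>\<^sup>2 \<le> 1 + \<bar>\<mu>\<bar> * \<epsilon>\<^sup>2" by simp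
  qed simp
  have main: "min \<theta> 1 / 5 \<le> 2 - exp (- w) - kap \<mu> \<epsilon> t * exp w"
  proof (cases "\<theta> \<ge> 1")
    case True
    have "sqrt \<theta> \<le> \<theta>" using True by (simp add: real_le_lsqrt power2_eq_square)
    then have w2: "w \<le> \<theta> / 4" using w1 by simp
    have "exp w * exp (- \<theta>) \<le> exp (- (3/4))" unfolding exp_add[symmetric] using w2 True by (subst exp_le_cancel_iff) simp
    moreover have "exp (- (3/4)) \<le> (4/7::real)"
    proof -
      have "1 + 3/4 \<le> exp (3/4::real)" by (rule exp_ge_add_one_self)
      then show ?thesis by (simp add: exp_minus field_simps)
    qed
    ultimately have a: "exp w * exp (- \<theta>) \<le> 4/7" by linarith
    have "kap \<mu> \<epsilon> t * exp w \<le> (1 + \<bar>\<mu>\<bar> * \<epsilon>\<^sup>2) * exp (- \<theta>) * exp w" using k by (intro mult_right_mono) auto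
    also have "\<dots> = (1 + \<bar>\<mu>\<bar> * \<epsilon>\<^sup>2) * (exp w * exp (- \<theta>))" by simp
    also have "\<dots> \<le> (1 + 1/10) * (4/7)" using a \<mu> by (intro mult_mono) auto
    finally have "kap \<mu> \<epsilon> t * exp w \<le> 44/70" by simp
    moreover have "exp (- w) \<le> 1" using w0 by simp
    moreover have "min \<theta> 1 / 5 \<le> 1/5" by simp
    ultimately show ?thesis by linarith
  next
    case False
    have sq: "\<theta> \<le> sqrt \<theta>" using False \<theta>0 by (intro real_le_rsqrt) (simp add: power2_eq_square mult_left_le)
    then have w2: "w \<le> sqrt \<theta> / 4" using w1 by simp
    have ww: "w\<^sup>2 \<le> \<theta> / 16"
    proof -
      have "w\<^sup>2 \<le> (sqrt \<theta> / 4)\<^sup>2" using w2 w0 by (intro power_mono) auto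
      then show ?thesis using \<theta>0 by (simp add: power_divide)
    qed
    have wle1: "w \<le> 1"
    proof -
      have "sqrt \<theta> \<le> 1" using False \<theta>0 by simp
      then show ?thesis using w2 by linarith
    qed
    have ew: "exp w \<le> 1 + w + w\<^sup>2" by (rule exp_bound[OF w0 wle1])
    have emw: "exp (- w) \<le> 1 - w + w\<^sup>2"
    proof -
      have "1 + w \<le> exp w" by (rule exp_ge_add_one_self)
      then have "exp (- w) \<le> 1 / (1 + w)" using w0 by (simp add: exp_minus field_simps)
      also have "\<dots> \<le> 1 - w + w\<^sup>2"
      proof -
        have "(1 - w + w\<^sup>2) * (1 + w) = 1 + w^3" by (simp add: algebra_simps power2_eq_square power3_eq_cube)
        then have "1 \<le> (1 - w + w\<^sup>2) * (1 + w)" using w0 by simp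
        then show ?thesis using w0 by (simp add: pos_divide_le_eq)
      qed
      finally show ?thesis .
    qed
    have et: "exp (- \<theta>) \<le> 1 - \<theta> / 2"
    proof -
      have "1 + \<theta> \<le> exp \<theta>" by (rule exp_ge_add_one_self)
      then have "exp (- \<theta>) \<le> 1 / (1 + \<theta>)" using \<theta>0 by (simp add: exp_minus field_simps)
      also have "\<dots> \<le> 1 - \<theta> / 2"
      proof -
        have "\<theta> * \<theta> \<le> \<theta>" using False \<theta>0 by (simp add: mult_left_le)
        then have "1 \<le> (1 - \<theta> / 2) * (1 + \<theta>)" by (simp add: algebra_simps)
        then show ?thesis using \<theta>0 by (simp add: pos_divide_le_eq)
      qed
      finally show ?thesis .
    qed
    have m: "\<bar>\<mu>\<bar> * \<epsilon>\<^sup>2 \<le> \<theta> / 40"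
      using mult_right_mono[OF t(1), of "\<epsilon>\<^sup>2"] e2 by (simp add: \<theta>_def mult.commute mult.assoc)
    have "(1 + \<bar>\<mu>\<bar> * \<epsilon>\<^sup>2) * exp (- \<theta>) \<le> exp (- \<theta>) + \<bar>\<mu>\<bar> * \<epsilon>\<^sup>2"
      using \<theta>0 mult_left_mono[of "exp (- \<theta>)" 1 "\<bar>\<mu>\<bar> * \<epsilon>\<^sup>2"] by (simp add: distrib_right)
    then have kk: "1 - kap \<mu> \<epsilon> t \<ge> \<theta> / 2 - \<theta> / 40" using k et m by linarith
    have "\<theta> / 2 - \<theta> / 40 \<ge> 0" using \<theta>0 by simp
    then have "(1 - kap \<mu> \<epsilon> t) * exp w \<ge> (\<theta> / 2 - \<theta> / 40) * 1" using kk w0 by (intro mult_mono) auto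
    then have a: "exp w - kap \<mu> \<epsilon> t * exp w \<ge> \<theta> * (19 / 40)" by (simp add: left_diff_distrib)
    have c: "2 - exp (- w) - exp w \<ge> - (\<theta> / 8)" using ew emw ww by linarith
    have m: "min \<theta> 1 = \<theta>" using False by simp
    show ?thesis unfolding m using a c \<theta>0 by linarith
  qed
  have "min t (1 / \<epsilon>\<^sup>2) = min \<theta> 1 / \<epsilon>\<^sup>2"
    using e2 by (auto simp: \<theta>_def min_def field_simps)
  then have "min t (1 / \<epsilon>\<^sup>2) / 5 = (min \<theta> 1 / 5) / \<epsilon>\<^sup>2" by simp
  also have "\<dots> \<le> (2 - exp (- w) - kap \<mu> \<epsilon> t * exp w) / \<epsilon>\<^sup>2" using main e2 by (intro divide_right_mono) auto
  finally show ?thesis by (simp add: w_def)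
qed

text \<open>With \<open>r = t powr (1/4)\<close> the bounds on the noise are of order
  \<open>r^3\<close> and \<open>r * (t - s + 2)\<close>. If \<open>\<epsilon> * r\<close> is large,
  the barrier \<open>\<epsilon> * t / 4 = \<epsilon> * r * r^3 / 4\<close> beats the first. If not,
  \<open>r <= (16 * C + 8) / \<epsilon>\<close>; then the slope \<open>2 * C * r\<close> of the
  second bound is covered by the drift, through \<open>small\<close> and the size of
  \<open>t\<close>, and its constant part \<open>4 * C * r\<close> by
  \<open>sqrt t / 4 = r^2 / 4\<close>.\<close>

lemma growth_dominated:
  fixes C h \<epsilon> t s D :: real
  assumes C: "C \<ge> 0" and h: "h \<ge> 0" and \<epsilon>: "0 < \<epsilon>" "\<epsilon> \<le> 1" and t: "(40 * C + 20 * h + 8) ^ 4 \<le> t" and s: "0 \<le> s" "s \<le> t"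
    and D1: "D \<le> 2 * C * (1 + t) powr (3/4)" and D2: "D \<le> C * (1 + t) powr (1/4) * (t - s + 2)"
    and small: "2 * C * (16 * C + 8) / \<epsilon> + h * \<epsilon> \<le> 1 / (20 * \<epsilon>\<^sup>2)"
  shows "D + h * \<epsilon> * (t - s) < max (sqrt t) (\<epsilon> * t) / 4 - 1 + min t (1 / \<epsilon>\<^sup>2) / 20 * (t - s)"
proof -
  define r where "r = t powr (1/4)"
  define R0 where "R0 = 40 * C + 20 * h + 8"
  have R0: "R0 \<ge> 8" using C h by (simp add: R0_def)
  have tR: "R0 ^ 4 \<le> t" using t by (simp add: R0_def)
  have "R0 ^ 4 > 0" using R0 by simp
  then have t0: "t > 0" using tR by linarith
  have r0: "r > 0" using t0 by (simp add: r_def)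
  have rR: "r \<ge> R0"
  proof -
    have "(R0 ^ 4) powr (1/4) \<le> r" unfolding r_def using tR R0 by (intro powr_mono2) auto
    moreover have "(R0 ^ 4) powr (1/4) = R0"
    proof -
      have "R0 ^ 4 = R0 powr 4" using R0 by simp
      then show ?thesis using R0 by (simp only: powr_powr) simp
    qed
    ultimately show ?thesis by simp
  qed
  have r4: "r ^ 4 = t"
  proof -
    have "r ^ 4 = r powr 4" using r0 by simp
    then show ?thesis using t0 unfolding r_def by (simp only: powr_powr) simp
  qed
  have r2: "sqrt t = r\<^sup>2"
  proof -
    have "t = (r\<^sup>2)\<^sup>2" unfolding r4[symmetric] by (simp flip: power_mult)
    then show ?thesis by (simp only: real_sqrt_abs) simp
  qed
  have r3: "t powr (3/4) = r ^ 3"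
  proof -
    have "r ^ 3 = r powr 3" using r0 by simp
    then show ?thesis using t0 unfolding r_def by (simp only: powr_powr) simp
  qed
  have t1: "t \<ge> 1"
  proof -
    have "1 \<le> R0 ^ 4" using R0 by (intro one_le_power) auto
    then show ?thesis using tR by simp
  qed
  have two: "(1 + t) powr p \<le> 2 * t powr p" if "0 \<le> p" "p \<le> 1" for p
  proof -
    have "(1 + t) powr p \<le> (2 * t) powr p" using t1 that by (intro powr_mono2) auto
    also have "\<dots> = 2 powr p * t powr p" using t1 by (simp add: powr_mult)
    also have "\<dots> \<le> 2 powr 1 * t powr p" using that by (intro mult_right_mono powr_mono) auto
    finally show ?thesis by simp
  qed
  define d where "d = t - s"
  have d0: "d \<ge> 0" using s by (simp add: d_def)
  have rge: "r \<ge> 8" "r \<ge> 40 * C + 20 * h + 8" using rR R0 by (auto simp: R0_def)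
  have rr: "r * r \<ge> (40 * C + 20 * h + 8) * r" using rge(2) r0 by (intro mult_right_mono) auto
  have r4ge: "r ^ 4 \<ge> r * r"
  proof -
    have "1 \<le> r * r" using rge mult_mono[of 1 r 1 r] by simp
    then have "1 * (r * r) \<le> (r * r) * (r * r)" by (intro mult_right_mono) auto
    then show ?thesis by (simp add: power4_eq_xxxx mult.assoc)
  qed
  have hr: "h \<le> h * r" using h rge by (simp add: mult_le_cancel_left1)
  have lin: "2 * C * r + h \<le> t / 20"
  proof -
    have "40 * C * r + 20 * h \<le> (40 * C + 20 * h + 8) * r" using hr r0 by (simp add: distrib_right)
    then show ?thesis using rr r4ge r4 by simp
  qed
  have he: "h * \<epsilon> \<le> h" using h \<epsilon> by (simp add: mult_left_le)
  have Cr: "2 * C * r \<ge> 0" using C r0 by simp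
  have sm: "0 \<le> 2 * C * (16 * C + 8) / \<epsilon>" using C \<epsilon> by simp
  have hmin: "h * \<epsilon> \<le> min t (1 / \<epsilon>\<^sup>2) / 20"
  proof -
    have "h * \<epsilon> \<le> t / 20" using lin he Cr by linarith
    moreover have "h * \<epsilon> \<le> (1 / \<epsilon>\<^sup>2) / 20" using small sm by (simp add: field_simps)
    ultimately show ?thesis by (simp add: min_def)
  qed
  show ?thesis
  proof (cases "\<epsilon> * r \<ge> 16 * C + 8")
    case True
    have "2 * C * (1 + t) powr (3/4) \<le> 2 * C * (2 * r ^ 3)" using two[of "3/4"] C r3 by (intro mult_left_mono) auto
    then have "D \<le> 2 * C * (2 * r ^ 3)" using D1 by linarith
    also have "\<dots> = 4 * C * r ^ 3" by simp
    finally have D: "D \<le> 4 * C * r ^ 3" .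
    have "(16 * C + 8) * r ^ 3 \<le> (\<epsilon> * r) * r ^ 3" using True r0 by (intro mult_right_mono) auto
    also have "\<dots> = \<epsilon> * t" by (simp add: r4[symmetric] power4_eq_xxxx power3_eq_cube)
    also have "\<dots> \<le> max (sqrt t) (\<epsilon> * t)" by simp
    finally have m: "(16 * C + 8) * r ^ 3 \<le> max (sqrt t) (\<epsilon> * t)" .
    have "r ^ 3 \<ge> 1" using rge by (intro one_le_power) auto
    then have "D + 1 < max (sqrt t) (\<epsilon> * t) / 4" using D m by (simp add: distrib_right)
    moreover have "h * \<epsilon> * (t - s) \<le> min t (1 / \<epsilon>\<^sup>2) / 20 * (t - s)" using hmin s by (intro mult_right_mono) auto
    ultimately show ?thesis by linarith
  next
    case False
    have "C * (1 + t) powr (1/4) \<le> C * (2 * r)" using two[of "1/4"] C by (intro mult_left_mono) (auto simp: r_def)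
    then have "C * (1 + t) powr (1/4) * (t - s + 2) \<le> C * (2 * r) * (t - s + 2)" using s by (intro mult_right_mono) auto
    then have D: "D \<le> 2 * C * r * d + 4 * C * r" using D2 by (simp add: d_def algebra_simps)
    have re: "r \<le> (16 * C + 8) / \<epsilon>" using False \<epsilon> by (simp add: field_simps)
    have "2 * C * r \<le> 2 * C * (16 * C + 8) / \<epsilon>" using mult_left_mono[OF re, of "2 * C"] C by simp
    then have "2 * C * r + h * \<epsilon> \<le> (1 / \<epsilon>\<^sup>2) / 20" using small by (simp add: field_simps)
    moreover have "2 * C * r + h * \<epsilon> \<le> t / 20" using lin he by linarith
    ultimately have "2 * C * r + h * \<epsilon> \<le> min t (1 / \<epsilon>\<^sup>2) / 20" by (simp add: min_def)
    then have "(2 * C * r + h * \<epsilon>) * d \<le> min t (1 / \<epsilon>\<^sup>2) / 20 * d" using d0 by (rule mult_right_mono)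
    then have a: "2 * C * r * d + h * \<epsilon> * d \<le> min t (1 / \<epsilon>\<^sup>2) / 20 * d" by (simp add: distrib_right)
    have "C * r \<ge> 0" "h * r \<ge> 0" using C h r0 by auto
    moreover have "(40 * C + 20 * h + 8) * r = 40 * (C * r) + 20 * (h * r) + 8 * r" by (simp add: algebra_simps)
    ultimately have "16 * (C * r) + 8 < r * r" using rr rge by linarith
    then have "4 * C * r + 1 < r\<^sup>2 / 4" by (simp add: power2_eq_square)
    then have "4 * C * r + 1 < max (sqrt t) (\<epsilon> * t) / 4" unfolding r2[symmetric] by linarith
    then show ?thesis using D a unfolding d_def by linarith
  qed
qed

text \<open>Until \<open>U1\<close> vanishes, \<open>q = (1/\<epsilon>) ln (GG U1 / y)\<close> solves \<open>dq = \<sigma> dW + \<dots>\<close>. Between the last visit of the level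
  \<open>-1\<close> and the first visit of \<open>-hb\<close> the drift exceeds the oscillation of the noise.\<close>

lemma barrier:
  fixes \<epsilon> T :: real and y u N :: "real \<Rightarrow> real"
  assumes \<epsilon>: "\<epsilon> > 0" and T: "T > 16"
    and cy: "continuous_on {0..} y" and cu: "continuous_on {0..} u" and cN: "continuous_on {0..} N"
    and Dy: "\<And>t. t > 0 \<Longrightarrow> DERIV y t :> (exp (\<epsilon> * N t) * u t - y t) / \<epsilon>"
    and Du: "\<And>t. t > 0 \<Longrightarrow> DERIV u t :> (u t - k t * y t / exp (\<epsilon> * N t)) / \<epsilon>"
    and yT: "y T > 0" and uT: "u T > 0" and qT: "N T + ln (u T / y T) / \<epsilon> \<ge> -1"
    and drift: "\<And>t q. t \<ge> T \<Longrightarrow> - (max (sqrt t) (\<epsilon> * t) / 4) \<le> q \<Longrightarrow> q \<le> 0 \<Longrightarrow>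
       min t (1 / \<epsilon>\<^sup>2) / 5 \<le> (2 - exp (\<epsilon> * q) - k t * exp (- (\<epsilon> * q))) / \<epsilon>\<^sup>2"
    and noise: "\<And>s t. T \<le> s \<Longrightarrow> s \<le> t \<Longrightarrow> N s - N t < max (sqrt t) (\<epsilon> * t) / 4 - 1 + min t (1 / \<epsilon>\<^sup>2) / 20 * (t - s)"
    and b: "b \<ge> T"
  shows "u b > 0"
proof (rule ccontr)
  assume nb: "\<not> u b > 0"
  let ?hb = "\<lambda>t. max (sqrt t) (\<epsilon> * t) / 4"
  have T0: "T > 0" using T by simp
  obtain c where c: "T < c" "c \<le> b" "u c = 0" "\<And>x. T \<le> x \<Longrightarrow> x < c \<Longrightarrow> u x > 0"
    using first_zero[of T b u] nb uT b continuous_on_subset[OF cu, of "{T..b}"] T0 by auto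
  have ypos: "y t > 0" if t: "T \<le> t" "t \<le> c" for t
  proof -
    have "exp (T / \<epsilon>) * y T \<le> exp (t / \<epsilon>) * y t"
    proof (rule le_by_deriv[where F="\<lambda>t. exp (t / \<epsilon>) * y t" and F'="\<lambda>t. exp (t / \<epsilon>) * exp (\<epsilon> * N t) * u t / \<epsilon>", OF t(1)])
      show "continuous_on {T..t} (\<lambda>t. exp (t / \<epsilon>) * y t)"
        using \<epsilon> T0 by (intro continuous_intros continuous_on_subset[OF cy]) auto
      fix x assume x: "T < x" "x < t"
      have "DERIV (\<lambda>t. exp (t / \<epsilon>) * y t) x :> exp (x / \<epsilon>) * (1 / \<epsilon>) * y x + (exp (\<epsilon> * N x) * u x - y x) / \<epsilon> * exp (x / \<epsilon>)"
        by (intro DERIV_mult Dy DERIV_chain2[OF DERIV_exp DERIV_cdivide[OF DERIV_ident]]) (use x T0 in auto)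
      also have "exp (x / \<epsilon>) * (1 / \<epsilon>) * y x + (exp (\<epsilon> * N x) * u x - y x) / \<epsilon> * exp (x / \<epsilon>) = exp (x / \<epsilon>) * exp (\<epsilon> * N x) * u x / \<epsilon>"
        using \<epsilon> by (simp add: field_simps)
      finally show "DERIV (\<lambda>t. exp (t / \<epsilon>) * y t) x :> exp (x / \<epsilon>) * exp (\<epsilon> * N x) * u x / \<epsilon>" .
      show "exp (x / \<epsilon>) * exp (\<epsilon> * N x) * u x / \<epsilon> \<ge> 0" using c(4)[of x] x t \<epsilon> by simp
    qed
    moreover have "exp (T / \<epsilon>) * y T > 0" using yT by simp
    ultimately have "exp (t / \<epsilon>) * y t > 0" by linarith
    then show ?thesis by (simp add: zero_less_mult_iff)
  qed
  define z where "z t = ln (u t / y t) / \<epsilon>" for t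
  define q where "q t = N t + z t" for t
  \<comment> \<open>Expresses \<open>q > - ?hb\<close> in a form that stays continuous up to
    \<open>c\<close>, where \<open>u\<close> vanishes and the logarithm in \<open>z\<close> leaves
    its domain.\<close>
  define r where "r t = u t - y t * exp (- (\<epsilon> * (?hb t + N t)))" for t
  have chb: "continuous_on A ?hb" for A by (intro continuous_intros) auto
  have cr: "continuous_on {T..c} r" unfolding r_def[abs_def]
    by (intro continuous_intros chb continuous_on_subset[OF cu] continuous_on_subset[OF cy] continuous_on_subset[OF cN]) (use T0 in auto)
  have ratio: "u t / y t = exp (\<epsilon> * z t)" if "T \<le> t" "t < c" for t
    using c(4)[OF that] ypos[of t] that \<epsilon> by (simp add: z_def)
  have r_iff: "r t > 0 \<longleftrightarrow> q t > - ?hb t" "r t = 0 \<longleftrightarrow> q t = - ?hb t" if t: "T \<le> t" "t < c" for t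
  proof -
    have yp: "y t > 0" using ypos[of t] t by simp
    have "u t = y t * exp (\<epsilon> * z t)" using ratio[OF t] yp by (simp add: field_simps)
    then have "r t = y t * (exp (\<epsilon> * z t) - exp (- (\<epsilon> * (?hb t + N t))))" by (simp add: r_def right_diff_distrib)
    then have "r t > 0 \<longleftrightarrow> \<epsilon> * z t > - (\<epsilon> * (?hb t + N t))" "r t = 0 \<longleftrightarrow> \<epsilon> * z t = - (\<epsilon> * (?hb t + N t))"
      using yp by (auto simp: zero_less_mult_iff)
    moreover have "- (\<epsilon> * (?hb t + N t)) = \<epsilon> * (- ?hb t - N t)" by (simp add: algebra_simps)
    ultimately show "r t > 0 \<longleftrightarrow> q t > - ?hb t" "r t = 0 \<longleftrightarrow> q t = - ?hb t"
      using \<epsilon> unfolding q_def by auto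
  qed
  have hb1: "?hb t > 1" if "t \<ge> T" for t
  proof -
    have "sqrt 16 < sqrt t" using that T by (subst real_sqrt_less_iff) simp
    then have "4 < sqrt t" by simp
    then show ?thesis by simp
  qed
  have rT: "r T > 0" using r_iff(1)[of T] c(1) qT hb1[of T] unfolding q_def z_def by simp
  have rc: "r c < 0" using ypos[of c] c by (simp add: r_def)
  obtain t1 where t1: "T < t1" "t1 \<le> c" "r t1 = 0" "\<And>x. T \<le> x \<Longrightarrow> x < t1 \<Longrightarrow> r x > 0"
    using first_zero[OF cr rT] rc c(1) by (metis less_imp_le)
  have t1c: "t1 < c" using t1 rc by (cases "t1 = c") auto
  have q1: "q t1 = - ?hb t1" using r_iff(2)[of t1] t1 t1c by simp
  have qlow: "q x > - ?hb x" if "T \<le> x" "x < t1" for x using r_iff(1)[of x] t1(4)[OF that] that t1c by simp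
  have cz: "continuous_on {T..t1} z"
  proof -
    have "u x / y x > 0" "y x \<noteq> 0" if "x \<in> {T..t1}" for x using c(4)[of x] ypos[of x] that t1c by auto
    then show ?thesis unfolding z_def[abs_def] using \<epsilon> T0
      by (intro continuous_intros continuous_on_subset[OF cu] continuous_on_subset[OF cy]) (auto simp: less_le)
  qed
  have cq: "continuous_on {T..t1} q" unfolding q_def[abs_def]
    by (intro continuous_intros cz continuous_on_subset[OF cN]) (use T0 in auto)
  have "q T \<ge> -1" using qT by (simp add: q_def z_def)
  moreover have "q t1 < -1" using q1 hb1[of t1] t1 by simp
  ultimately obtain s where s: "T \<le> s" "s < t1" "q s = -1" "\<And>x. s < x \<Longrightarrow> x \<le> t1 \<Longrightarrow> q x < -1"
    using last_reach[OF cq] t1(1) by (metis less_imp_le)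
  let ?Z = "\<lambda>t. (2 - exp (\<epsilon> * q t) - k t * exp (- (\<epsilon> * q t))) / \<epsilon>\<^sup>2"
  have Dz: "DERIV z t :> ?Z t" if t: "T < t" "t < t1" for t
  proof -
    have up: "u t > 0" and yp: "y t > 0" using c(4)[of t] ypos[of t] t t1c by auto
    have t0: "t > 0" using t T0 by simp
    have "DERIV (\<lambda>t. ln (u t / y t) / \<epsilon>) t :> (1 / (u t / y t) * (((u t - k t * y t / exp (\<epsilon> * N t)) / \<epsilon> * y t - u t * ((exp (\<epsilon> * N t) * u t - y t) / \<epsilon>)) / (y t * y t))) / \<epsilon>"
      by (intro DERIV_cdivide DERIV_chain2[OF DERIV_ln_divide] DERIV_divide Du Dy t0) (use up yp in auto)
    also have "(1 / (u t / y t) * (((u t - k t * y t / exp (\<epsilon> * N t)) / \<epsilon> * y t - u t * ((exp (\<epsilon> * N t) * u t - y t) / \<epsilon>)) / (y t * y t))) / \<epsilon> = ?Z t"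
    proof -
      have e: "exp (\<epsilon> * q t) = exp (\<epsilon> * N t) * (u t / y t)"
        unfolding q_def distrib_left exp_add using ratio[of t] t t1c by simp
      have id: "(1 / (U / Y) * (((U - K * Y / G) / \<epsilon> * Y - U * ((G * U - Y) / \<epsilon>)) / (Y * Y))) / \<epsilon> = (2 - G * (U / Y) - K * (1 / (G * (U / Y)))) / \<epsilon>\<^sup>2"
        if "U > 0" "Y > 0" "G > 0" for U Y G K :: real
        using that \<epsilon> by (simp add: field_simps power2_eq_square)
      have "exp (- (\<epsilon> * q t)) = 1 / exp (\<epsilon> * q t)" by (simp add: exp_minus inverse_eq_divide)
      then show ?thesis unfolding e using id[OF up yp, of "exp (\<epsilon> * N t)" "k t"] by simp
    qed
    finally show ?thesis by (simp add: z_def[abs_def])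
  qed
  have Zlow: "min t (1 / \<epsilon>\<^sup>2) / 5 \<le> ?Z t" if t: "s < t" "t < t1" for t
    by (rule drift) (use qlow[of t] s(4)[of t] s(1) t in auto)
  define E where "E = 1 / \<epsilon>\<^sup>2"
  have E0: "E > 0" using \<epsilon> by (simp add: E_def)
  \<comment> \<open>After \<open>t1 / 2\<close> the rate \<open>min t E\<close> is at least half of
    \<open>min t1 E\<close>, and the interval from \<open>s'\<close> to \<open>t1\<close> has at
    least half the length of that from \<open>s\<close>. The two halvings turn the factor 1/5 of
    \<open>drift\<close> into the 1/20 of \<open>noise\<close>.\<close>
  define s' where "s' = max s (t1 / 2)"
  have s': "s \<le> s'" "s' \<le> t1" "t1 / 2 \<le> s'" using s t1 T0 by (auto simp: s'_def)
  have z1: "z s \<le> z s'"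
  proof (rule le_by_deriv[OF s'(1)])
    show "continuous_on {s..s'} z" by (rule continuous_on_subset[OF cz]) (use s s' in auto)
    fix t assume t: "s < t" "t < s'"
    show "DERIV z t :> ?Z t" using Dz[of t] t s s' by simp
    have "0 \<le> min t (1 / \<epsilon>\<^sup>2) / 5" using t s T0 by simp
    also have "\<dots> \<le> ?Z t" by (rule Zlow) (use t s' in auto)
    finally show "?Z t \<ge> 0" .
  qed
  have z2: "z s' - min s' E / 5 * s' \<le> z t1 - min s' E / 5 * t1"
  proof (rule le_by_deriv[where F="\<lambda>t. z t - min s' E / 5 * t" and F'="\<lambda>t. ?Z t - min s' E / 5", OF s'(2)])
    show "continuous_on {s'..t1} (\<lambda>t. z t - min s' E / 5 * t)"
      by (intro continuous_intros continuous_on_subset[OF cz]) (use s s' in auto)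
    fix t assume t: "s' < t" "t < t1"
    have "DERIV z t :> ?Z t" using Dz[of t] t s s' by simp
    then show "DERIV (\<lambda>t. z t - min s' E / 5 * t) t :> ?Z t - min s' E / 5" by (auto intro!: derivative_eq_intros)
    have "min s' E / 5 \<le> min t (1 / \<epsilon>\<^sup>2) / 5" unfolding E_def[symmetric] using t by (intro divide_right_mono) auto
    also have "\<dots> \<le> ?Z t" by (rule Zlow) (use t s' in auto)
    finally show "?Z t - min s' E / 5 \<ge> 0" by (simp only: diff_ge_0_iff_ge)
  qed
  have "min t1 E / 20 * (t1 - s) \<le> min s' E / 5 * (t1 - s')"
  proof -
    have "min t1 E / 2 \<le> min s' E" using s'(3) E0 by (auto simp: min_def)
    moreover have "(t1 - s) / 2 \<le> t1 - s'" using s t1 T0 by (auto simp: s'_def max_def)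
    ultimately have "(min t1 E / 2) * ((t1 - s) / 2) \<le> min s' E * (t1 - s')" using s t1 T0 E0 s' by (intro mult_mono) auto
    then show ?thesis by (simp add: field_simps)
  qed
  then have "z s + min t1 E / 20 * (t1 - s) \<le> z t1" using z1 z2 by (simp add: right_diff_distrib)
  moreover have "N s - N t1 < ?hb t1 - 1 + min t1 E / 20 * (t1 - s)" unfolding E_def by (rule noise) (use s in auto)
  moreover have "N t1 + z t1 = - ?hb t1" "N s + z s = -1" using q1 s(3) by (auto simp: q_def)
  ultimately show False by linarith
qed

text \<open>The exponents leave room above the true orders of Brownian growth, so that eighth
  moments suffice to prove both bounds. The summand 2 keeps the second bound away from 0 for close
  times: oscillations over unit intervals matter, Hoelder continuity does not.\<close>

definition growth :: "real \<Rightarrow> (real \<Rightarrow> real) \<Rightarrow> bool" where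
  "growth C W \<longleftrightarrow> C \<ge> 0 \<and> (\<forall>t\<ge>0. \<bar>W t\<bar> \<le> C * (1 + t) powr (3/4)) \<and>
     (\<forall>s t. 0 \<le> s \<longrightarrow> s \<le> t \<longrightarrow> \<bar>W t - W s\<bar> \<le> C * (1 + t) powr (1/4) * (t - s + 2))"

text \<open>Two solutions of the Riccati equation for \<open>\<mu>' < \<mu>\<close> cannot both stay below \<open>0\<close>:
  their difference \<open>D\<close> would satisfy \<open>D' \<ge> D\<^sup>2\<close> and blow up.\<close>

lemma riccati_nonneg_again:
  assumes cW: "continuous_on {0..} W" and less: "\<mu>' < \<mu>" and p': "\<And>t. t > 0 \<Longrightarrow> PP \<sigma> W \<mu>' t > 0"
  shows "t > 0 \<Longrightarrow> PP \<sigma> W \<mu> t > 0" "\<exists>T\<ge>T0. \<sigma> * W T + ZZ \<sigma> W \<mu> T \<ge> 0"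
proof -
  note c = cs0[OF cW, of \<sigma>] cg0[OF cW, of \<sigma> \<mu>] cg0[OF cW, of \<sigma> \<mu>'] s0pos[OF cW, of \<sigma>]
  have lt: "g0 \<sigma> \<mu> W t < g0 \<sigma> \<mu>' W t" for t using less by (simp add: g0_def)
  have p2: "phi (s0 \<sigma> W) (g0 \<sigma> \<mu>' W) t > 0" if "t > 0" for t using p'[OF that] by (simp add: PP_def[OF cW])
  have pp: "PP \<sigma> W \<mu> t > 0" if "t > 0" for t
    unfolding PP_def[OF cW] by (rule sturm_phi_pos[OF c(1-4) less_imp_le[OF lt] p2 that order_refl]) auto
  then show "t > 0 \<Longrightarrow> PP \<sigma> W \<mu> t > 0" .
  obtain w where w: "w > 0" "\<And>x. x \<ge> 1 \<Longrightarrow> wron (s0 \<sigma> W) (g0 \<sigma> \<mu> W) (g0 \<sigma> \<mu>' W) x \<ge> w"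
    by (rule wron_pos_strict[OF c(1-4) less_imp_le[OF lt] p2 lt]) auto
  define D where "D t = ZZ \<sigma> W \<mu> t - ZZ \<sigma> W \<mu>' t" for t
  have Dpos: "D t > 0" if t: "t \<ge> 1" for t
  proof -
    have pa: "PP \<sigma> W \<mu> t > 0" "PP \<sigma> W \<mu>' t > 0" using pp[of t] p'[of t] t by auto
    have "D t = s0 \<sigma> W t * wron (s0 \<sigma> W) (g0 \<sigma> \<mu> W) (g0 \<sigma> \<mu>' W) t / (PP \<sigma> W \<mu> t * PP \<sigma> W \<mu>' t)"
      unfolding D_def ZZ_def[OF cW] wron_def PP_def[OF cW, symmetric] UU_def[OF cW, symmetric] using pa by (simp add: field_simps)
    also have "\<dots> > 0" using w(2)[OF t] w(1) c(4) pa by simp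
    finally show ?thesis .
  qed
  show "\<exists>T\<ge>T0. \<sigma> * W T + ZZ \<sigma> W \<mu> T \<ge> 0"
  proof (rule ccontr)
    assume "\<not> ?thesis"
    then have neg: "\<sigma> * W t + ZZ \<sigma> W \<mu> t < 0" if "t \<ge> T0" for t using that by force
    define a where "a = max T0 1"
    have a: "a \<ge> 1" "a \<ge> T0" by (auto simp: a_def)
    \<comment> \<open>A positive solution of \<open>D' >= D^2\<close> cannot survive longer than
      \<open>1 / D a\<close> after \<open>a\<close>.\<close>
    define b where "b = a + 1 / D a + 1"
    have ab: "a \<le> b" using Dpos[OF a(1)] by (simp add: b_def)
    let ?D' = "\<lambda>t. (t + \<mu> - (\<sigma> * W t + ZZ \<sigma> W \<mu> t)\<^sup>2) - (t + \<mu>' - (\<sigma> * W t + ZZ \<sigma> W \<mu>' t)\<^sup>2)"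
    have DD: "DERIV D t :> ?D' t" if "t > 0" for t
      unfolding D_def[abs_def] by (intro DERIV_diff DZZ[OF cW] that pp p')
    have D2: "?D' t \<ge> (D t)\<^sup>2" if t: "t \<ge> a" for t
    proof -
      let ?q = "\<sigma> * W t + ZZ \<sigma> W \<mu> t"
      have "D t > 0" "?q < 0" using Dpos[of t] neg[of t] t a by auto
      then have "?q * D t \<le> 0" by (simp add: mult_nonpos_nonneg)
      moreover have "?D' t = (\<mu> - \<mu>') - 2 * (?q * D t) + (D t)\<^sup>2" unfolding D_def by (simp add: power2_eq_square algebra_simps)
      ultimately show ?thesis using less by linarith
    qed
    have "1 / D b + b \<le> 1 / D a + a"
    proof (rule ge_by_deriv[where F="\<lambda>t. 1 / D t + t" and F'="\<lambda>t. - ?D' t / (D t)\<^sup>2 + 1", OF ab])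
      have "D t \<noteq> 0" if "t \<in> {a..b}" for t using Dpos[of t] that a by auto
      moreover have "continuous_on {a..b} D"
      proof (rule DERIV_continuous_on)
        fix t assume t: "t \<in> {a..b}"
        show "(D has_real_derivative ?D' t) (at t within {a..b})"
          by (rule has_field_derivative_at_within[OF DD]) (use t a in auto)
      qed
      ultimately show "continuous_on {a..b} (\<lambda>t. 1 / D t + t)" by (intro continuous_intros) auto
      fix t assume t: "a < t" "t < b"
      have dt: "D t > 0" using Dpos[of t] t a by simp
      have "DERIV (\<lambda>t. 1 / D t + t) t :> (0 * D t - 1 * ?D' t) / (D t * D t) + 1"
        by (intro DERIV_add DERIV_divide DD DERIV_const DERIV_ident) (use t a dt in auto)
      then show "DERIV (\<lambda>t. 1 / D t + t) t :> - ?D' t / (D t)\<^sup>2 + 1" by (simp add: power2_eq_square)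
      have "?D' t / (D t)\<^sup>2 \<ge> 1" using D2[of t] t dt by (subst le_divide_eq_1_pos) auto
      then show "- ?D' t / (D t)\<^sup>2 + 1 \<le> 0" by (simp only: minus_divide_left[symmetric])
    qed
    moreover have "1 / D b > 0" using Dpos[of b] ab a by simp
    ultimately show False unfolding b_def by linarith
  qed
qed

lemma ln_one_plus_lower: fixes x :: real assumes "1 + x > 0" shows "ln (1 + x) \<ge> x / (1 + x)"
proof -
  have "ln (1 / (1 + x)) \<le> 1 / (1 + x) - 1" by (rule ln_le_minus_one) (use assms in simp)
  moreover have "ln (1 / (1 + x)) = - ln (1 + x)" using assms by (simp add: ln_div)
  moreover have "1 / (1 + x) - 1 = - (x / (1 + x))" using assms by (simp add: field_simps)
  ultimately show ?thesis by linarith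
qed

section \<open>Survival of the rescaled solution\<close>

context
  fixes \<sigma> h \<mu> :: real and W :: "real \<Rightarrow> real" and e :: "nat \<Rightarrow> real"
  assumes cW: "continuous_on {0..} W" and e0: "\<And>n. 0 < e n" and e1: "\<And>n. e n \<le> 1" and elim: "e \<longlonglongrightarrow> 0"
begin

text \<open>Near 0 the limit \<open>PP\<close> vanishes, so uniform closeness says nothing about the
  sign of \<open>phi\<close>. There \<open>UU > 1/2\<close> carries over to positivity of
  \<open>uu\<close>, which makes \<open>phi\<close> increase from 0. On \<open>[d, T]\<close> the
  limit has a positive minimum, and the part of \<open>U1\<close> with factor
  \<open>\<epsilon>\<close> is too small to matter.\<close>

lemma U1_pos_on_compact:
  assumes T: "T > 0" and pp: "\<And>t. t > 0 \<Longrightarrow> PP \<sigma> W \<mu> t > 0"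
  shows "\<forall>\<^sub>F n in sequentially. (\<forall>t\<in>{0..T}. U1 \<sigma> h \<mu> (e n) W t > 0) \<and> yy \<sigma> h \<mu> (e n) W T > 0"
proof -
  let ?p = "\<lambda>n. phi (se \<sigma> h (e n) W) (ge \<sigma> h \<mu> (e n) W)" and ?u = "\<lambda>n. uu (se \<sigma> h (e n) W) (ge \<sigma> h \<mu> (e n) W)"
  note conv = solutions_converge[OF cW e0 e1 elim less_imp_le[OF T], of \<sigma> h \<mu>]
  obtain d0 where d0: "d0 > 0" "\<And>x. 0 < x \<Longrightarrow> x \<le> d0 \<Longrightarrow> phi (s0 \<sigma> W) (g0 \<sigma> \<mu> W) x > 0 \<and> uu (s0 \<sigma> W) (g0 \<sigma> \<mu> W) x > 1/2"
    by (rule phi_uu_pos_near_0[OF cs0[OF cW, of \<sigma>] cg0[OF cW, of \<sigma> \<mu>] s0pos[OF cW, of \<sigma>]]) auto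
  define d where "d = min d0 T"
  have d: "0 < d" "d \<le> T" using d0 T by (auto simp: d_def)
  have Ud: "UU \<sigma> W \<mu> x > 1/2" if "0 < x" "x \<le> d" for x using d0(2)[of x] that by (simp add: d_def UU_def[OF cW])
  have "continuous_on {d..T} (PP \<sigma> W \<mu>)" by (rule continuous_on_subset[OF cPP[OF cW]]) (use d in auto)
  then obtain x0 where x0: "x0 \<in> {d..T}" "\<And>y. y \<in> {d..T} \<Longrightarrow> PP \<sigma> W \<mu> x0 \<le> PP \<sigma> W \<mu> y"
    using continuous_attains_inf[of "{d..T}" "PP \<sigma> W \<mu>"] d by auto
  define c where "c = PP \<sigma> W \<mu> x0"
  have c: "c > 0" using pp[of x0] x0(1) d by (simp add: c_def)
  obtain M where M: "M > 0" "\<And>t. 0 \<le> t \<Longrightarrow> t \<le> T \<Longrightarrow> \<bar>UU \<sigma> W \<mu> t\<bar> \<le> M" by (rule continuous_bounded_Icc[OF cUU[OF cW]]) auto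
  obtain J where J: "J > 0" "\<And>n t. 0 \<le> t \<Longrightarrow> t \<le> T \<Longrightarrow> \<bar>JJ \<sigma> h (e n) W t\<bar> \<le> J" by (rule JJ_bound[OF cW e0 e1 elim]) auto
  have "(\<lambda>n. e n * (exp J * (M + 1))) \<longlonglongrightarrow> 0 * (exp J * (M + 1))" by (intro tendsto_intros elim)
  then have "(\<lambda>n. e n * (exp J * (M + 1))) \<longlonglongrightarrow> 0" by simp
  moreover have "exp (- J) * (c / 2) > 0" using c by simp
  ultimately have small: "\<forall>\<^sub>F n in sequentially. e n * (exp J * (M + 1)) < exp (- J) * (c / 2)" by (rule order_tendstoD)
  have u1: "\<forall>\<^sub>F n in sequentially. \<forall>t\<in>{0..T}. dist (?p n t) (PP \<sigma> W \<mu> t) < c / 2" using uniform_limitD[OF conv(1), of "c / 2"] c by simp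
  have u2: "\<forall>\<^sub>F n in sequentially. \<forall>t\<in>{0..T}. dist (?u n t) (UU \<sigma> W \<mu> t) < 1 / 4" using uniform_limitD[OF conv(2), of "1 / 4"] by simp
  show ?thesis using small u1 u2
  proof eventually_elim
    case (elim n)
    have pn: "?p n t > c / 2" if "d \<le> t" "t \<le> T" for t
    proof -
      have "dist (?p n t) (PP \<sigma> W \<mu> t) < c / 2" using elim(2) that d by auto
      moreover have "PP \<sigma> W \<mu> t \<ge> c" using x0(2)[of t] that by (simp add: c_def)
      ultimately show ?thesis unfolding dist_real_def by linarith
    qed
    have "U1 \<sigma> h \<mu> (e n) W t > 0" if t: "t \<in> {0..T}" for t
    proof (cases "t = 0")
      case True
      then show ?thesis using U10[OF cW e0[of n]] e0[of n] by simp
    next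
      case False
      show ?thesis
      proof (cases "t \<le> d")
        case True
        have un: "?u n x > 0" if "0 < x" "x \<le> t" for x
        proof -
          have "dist (?u n x) (UU \<sigma> W \<mu> x) < 1 / 4" using elim(3) that t by auto
          moreover have "UU \<sigma> W \<mu> x > 1/2" using Ud[of x] that True by simp
          ultimately show ?thesis unfolding dist_real_def by linarith
        qed
        have "?p n 0 < ?p n t"
        proof (rule lsol_increasing[OF lsol_phi[OF cse[OF cW e0] cge[OF cW e0]]])
          fix x assume "0 < x" "x < t"
          then show "se \<sigma> h (e n) W x * ?u n x > 0" using un[of x] sepos[OF cW e0[of n]] by simp
        qed (use False t in auto)
        then have "?p n t > 0" using phi_0[OF cse[OF cW e0] cge[OF cW e0]] by simp
        moreover have "?u n t > 0" using un[of t] False t by simp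
        ultimately show ?thesis unfolding U1_def yy_def using e0[of n] by (simp add: add_pos_pos)
      next
        case F2: False
        have j: "\<bar>JJ \<sigma> h (e n) W t\<bar> \<le> J" using J(2)[of t n] t by simp
        have "exp (- J) * (c / 2) \<le> exp (JJ \<sigma> h (e n) W t) * ?p n t"
          using pn[of t] F2 t j c by (intro mult_mono) auto
        moreover have "\<bar>e n * (exp (- JJ \<sigma> h (e n) W t) * ?u n t)\<bar> \<le> e n * (exp J * (M + 1))"
        proof -
          have "dist (?u n t) (UU \<sigma> W \<mu> t) < 1 / 4" using elim(3) t by blast
          moreover have "\<bar>UU \<sigma> W \<mu> t\<bar> \<le> M" using M(2)[of t] t by simp
          ultimately have "\<bar>?u n t\<bar> \<le> M + 1" unfolding dist_real_def by linarith
          then show ?thesis unfolding abs_mult using e0[of n] j by (intro mult_mono) auto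
        qed
        ultimately show ?thesis unfolding U1_def yy_def using elim(1) by linarith
      qed
    qed
    moreover have "yy \<sigma> h \<mu> (e n) W T > 0" unfolding yy_def using pn[of T] d c by simp
    ultimately show ?case by blast
  qed
qed

text \<open>The quotient \<open>U1 / yy\<close> is \<open>1 + \<epsilon> r\<close> with
  \<open>r\<close> converging to \<open>ZZ\<close>, and \<open>ln (1 + x) >= x / (1 + x)\<close>
  controls its logarithm from below. Starting from a limit value of at least 0, the level -1 leaves
  room for the approximation.\<close>

lemma q_eventually_ge:
  assumes T: "T > 0" and pp: "\<And>t. t > 0 \<Longrightarrow> PP \<sigma> W \<mu> t > 0" and q: "\<sigma> * W T + ZZ \<sigma> W \<mu> T \<ge> 0"
  shows "\<forall>\<^sub>F n in sequentially. (\<sigma> * W T - h * e n * T) + ln (U1 \<sigma> h \<mu> (e n) W T / yy \<sigma> h \<mu> (e n) W T) / e n \<ge> -1"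
proof -
  let ?p = "\<lambda>n. phi (se \<sigma> h (e n) W) (ge \<sigma> h \<mu> (e n) W) T" and ?u = "\<lambda>n. uu (se \<sigma> h (e n) W) (ge \<sigma> h \<mu> (e n) W) T"
  note conv = solutions_converge[OF cW e0 e1 elim less_imp_le[OF T], of \<sigma> h \<mu>]
  have p: "?p \<longlonglongrightarrow> PP \<sigma> W \<mu> T" and u: "?u \<longlonglongrightarrow> UU \<sigma> W \<mu> T"
    using tendsto_uniform_limitI[OF conv(1), of T] tendsto_uniform_limitI[OF conv(2), of T] T by auto
  define r where "r n = exp (- 2 * JJ \<sigma> h (e n) W T) * ?u n / ?p n" for n
  have pT: "PP \<sigma> W \<mu> T > 0" using pp[OF T] .
  have "r \<longlonglongrightarrow> exp (- 2 * (\<sigma> * integral {0..T} W)) * UU \<sigma> W \<mu> T / PP \<sigma> W \<mu> T"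
    unfolding r_def[abs_def] using pT T by (intro tendsto_intros p u lim_JJ[OF cW e0 e1 elim]) auto
  then have r: "r \<longlonglongrightarrow> ZZ \<sigma> W \<mu> T" by (simp add: ZZ_def[OF cW] s0_def mult.assoc)
  have "(\<lambda>n. (\<sigma> * W T - h * e n * T) + r n / (1 + e n * r n)) \<longlonglongrightarrow> (\<sigma> * W T - h * 0 * T) + ZZ \<sigma> W \<mu> T / (1 + 0 * ZZ \<sigma> W \<mu> T)"
    by (intro tendsto_intros elim r) auto
  then have l: "(\<lambda>n. (\<sigma> * W T - h * e n * T) + r n / (1 + e n * r n)) \<longlonglongrightarrow> \<sigma> * W T + ZZ \<sigma> W \<mu> T" by simp
  have ev1: "\<forall>\<^sub>F n in sequentially. (\<sigma> * W T - h * e n * T) + r n / (1 + e n * r n) > -1"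
    using order_tendstoD(1)[OF l, of "-1"] q by simp
  have ev2: "\<forall>\<^sub>F n in sequentially. (\<forall>t\<in>{0..T}. U1 \<sigma> h \<mu> (e n) W t > 0) \<and> yy \<sigma> h \<mu> (e n) W T > 0"
    by (rule U1_pos_on_compact[OF T]) (rule pp)
  show ?thesis using ev1 ev2
  proof eventually_elim
    case (elim n)
    have yp: "yy \<sigma> h \<mu> (e n) W T > 0" and up: "U1 \<sigma> h \<mu> (e n) W T > 0" using elim(2) T by auto
    have pn: "?p n > 0" using yp unfolding yy_def by (simp add: zero_less_mult_iff)
    have "U1 \<sigma> h \<mu> (e n) W T / yy \<sigma> h \<mu> (e n) W T = 1 + e n * r n"
    proof -
      have x: "exp (- JJ \<sigma> h (e n) W T) = exp (JJ \<sigma> h (e n) W T) * exp (- 2 * JJ \<sigma> h (e n) W T)" by (subst exp_add[symmetric]) simp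
      show ?thesis unfolding U1_def yy_def r_def x using pn by (simp add: field_simps)
    qed
    moreover have "1 + e n * r n > 0" using calculation yp up by (metis divide_pos_pos)
    then have "ln (1 + e n * r n) \<ge> e n * r n / (1 + e n * r n)" by (rule ln_one_plus_lower)
    then have "ln (1 + e n * r n) / e n \<ge> (e n * r n / (1 + e n * r n)) / e n" using e0[of n] by (intro divide_right_mono) auto
    then have "ln (1 + e n * r n) / e n \<ge> r n / (1 + e n * r n)" using e0[of n] by simp
    ultimately show ?case using elim(1) by simp
  qed
qed

text \<open>The time \<open>T\<close> may depend on the path and on \<open>\<mu>\<close>, but not on
  \<open>n\<close>: before \<open>T\<close> the convergence on a compact interval decides, and after
  \<open>T\<close> the barrier, whose constants are uniform in \<open>e n\<close>.\<close>

theorem eventually_NE: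
  assumes \<sigma>: "\<sigma> \<ge> 0" and h: "h \<ge> 0" and g: "growth C W" and less: "\<mu>' < \<mu>" and p': "\<And>t. t > 0 \<Longrightarrow> PP \<sigma> W \<mu>' t > 0"
  shows "\<forall>\<^sub>F n in sequentially. NE \<sigma> h \<mu> (e n) W"
proof -
  have pp: "PP \<sigma> W \<mu> t > 0" if "t > 0" for t by (rule riccati_nonneg_again(1)[OF cW less p' that])
  define C' where "C' = \<sigma> * C"
  have C: "C \<ge> 0" and g1: "\<And>t. t \<ge> 0 \<Longrightarrow> \<bar>W t\<bar> \<le> C * (1 + t) powr (3/4)"
    and g2: "\<And>s t. 0 \<le> s \<Longrightarrow> s \<le> t \<Longrightarrow> \<bar>W t - W s\<bar> \<le> C * (1 + t) powr (1/4) * (t - s + 2)"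
    using g by (auto simp: growth_def)
  have C'0: "C' \<ge> 0" using \<sigma> C by (simp add: C'_def)
  \<comment> \<open>The first term is the threshold of \<open>growth_dominated\<close> for the noise
    constant \<open>C'\<close>; the second serves \<open>drift_lower_bound\<close> and the condition
    \<open>T > 16\<close> of \<open>barrier\<close>.\<close>
  define T0 where "T0 = max ((40 * C' + 20 * h + 8) ^ 4) (40 * \<bar>\<mu>\<bar> + 17)"
  obtain T where T: "T \<ge> T0" "\<sigma> * W T + ZZ \<sigma> W \<mu> T \<ge> 0" using riccati_nonneg_again(2)[OF cW less p', of T0] by blast
  have T17: "T \<ge> 17" "40 * \<bar>\<mu>\<bar> \<le> T" "(40 * C' + 20 * h + 8) ^ 4 \<le> T" using T(1) by (auto simp: T0_def)
  have Tp: "T > 0" using T17 by simp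
  have "(\<lambda>n. 2 * C' * (16 * C' + 8) * e n + h * (e n)^3) \<longlonglongrightarrow> 2 * C' * (16 * C' + 8) * 0 + h * 0^3" by (intro tendsto_intros elim)
  then have "(\<lambda>n. 2 * C' * (16 * C' + 8) * e n + h * (e n)^3) \<longlonglongrightarrow> 0" by simp
  then have ev1: "\<forall>\<^sub>F n in sequentially. 2 * C' * (16 * C' + 8) * e n + h * (e n)^3 < 1/20" by (rule order_tendstoD) simp
  have "(\<lambda>n. \<bar>\<mu>\<bar> * (e n)\<^sup>2) \<longlonglongrightarrow> \<bar>\<mu>\<bar> * 0\<^sup>2" by (intro tendsto_intros elim)
  then have "(\<lambda>n. \<bar>\<mu>\<bar> * (e n)\<^sup>2) \<longlonglongrightarrow> 0" by simp
  then have ev2: "\<forall>\<^sub>F n in sequentially. \<bar>\<mu>\<bar> * (e n)\<^sup>2 < 1/10" by (rule order_tendstoD) simp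
  have ev3: "\<forall>\<^sub>F n in sequentially. (\<forall>t\<in>{0..T}. U1 \<sigma> h \<mu> (e n) W t > 0) \<and> yy \<sigma> h \<mu> (e n) W T > 0"
    by (rule U1_pos_on_compact[OF Tp]) (rule pp)
  have ev4: "\<forall>\<^sub>F n in sequentially. (\<sigma> * W T - h * e n * T) + ln (U1 \<sigma> h \<mu> (e n) W T / yy \<sigma> h \<mu> (e n) W T) / e n \<ge> -1"
    by (rule q_eventually_ge[OF Tp _ T(2)]) (rule pp)
  show ?thesis using ev1 ev2 ev3 ev4
  proof eventually_elim
    case (elim n)
    let ?N = "\<lambda>t. \<sigma> * W t - h * e n * t"
    have small: "2 * C' * (16 * C' + 8) / e n + h * e n \<le> 1 / (20 * (e n)\<^sup>2)"
    proof -
      have "(2 * C' * (16 * C' + 8) * e n + h * (e n)^3) / (e n)\<^sup>2 \<le> (1/20) / (e n)\<^sup>2" using elim(1) by (intro divide_right_mono) auto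
      moreover have "(2 * C' * (16 * C' + 8) * e n + h * (e n)^3) / (e n)\<^sup>2 = 2 * C' * (16 * C' + 8) / e n + h * e n"
        using e0[of n] by (simp add: add_divide_distrib power2_eq_square power3_eq_cube)
      ultimately show ?thesis by simp
    qed
    have "U1 \<sigma> h \<mu> (e n) W b > 0" if b: "b \<ge> T" for b
    proof (rule barrier[where N="?N" and y="yy \<sigma> h \<mu> (e n) W" and k="kap \<mu> (e n)" and T=T and \<epsilon>="e n", OF e0 _ cyy[OF cW e0] cU1[OF cW e0]])
      show "continuous_on {0..} ?N" by (intro continuous_intros cW)
      show "DERIV (yy \<sigma> h \<mu> (e n) W) t :> (exp (e n * ?N t) * U1 \<sigma> h \<mu> (e n) W t - yy \<sigma> h \<mu> (e n) W t) / e n" if "t > 0" for t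
        using Dyy[OF cW e0[of n] that, of \<sigma> h \<mu>] by (simp add: GG_def)
      show "DERIV (U1 \<sigma> h \<mu> (e n) W) t :> (U1 \<sigma> h \<mu> (e n) W t - kap \<mu> (e n) t * yy \<sigma> h \<mu> (e n) W t / exp (e n * ?N t)) / e n" if "t > 0" for t
        using DU1[OF cW e0[of n] that, of \<sigma> h \<mu>] by (simp add: GG_def)
      show "yy \<sigma> h \<mu> (e n) W T > 0" "U1 \<sigma> h \<mu> (e n) W T > 0" using elim(3) Tp by auto
      show "?N T + ln (U1 \<sigma> h \<mu> (e n) W T / yy \<sigma> h \<mu> (e n) W T) / e n \<ge> -1" using elim(4) .
      show "min t (1 / (e n)\<^sup>2) / 5 \<le> (2 - exp (e n * q) - kap \<mu> (e n) t * exp (- (e n * q))) / (e n)\<^sup>2"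
        if "t \<ge> T" "- (max (sqrt t) (e n * t) / 4) \<le> q" "q \<le> 0" for t q
        by (rule drift_lower_bound[OF e0]) (use that elim(2) T17 in auto)
      show "?N s - ?N t < max (sqrt t) (e n * t) / 4 - 1 + min t (1 / (e n)\<^sup>2) / 20 * (t - s)" if st: "T \<le> s" "s \<le> t" for s t
      proof -
        have s0: "0 \<le> s" using st Tp by simp
        define D where "D = \<sigma> * \<bar>W t - W s\<bar>"
        have "\<bar>W t - W s\<bar> \<le> 2 * (C * (1 + t) powr (3/4))"
        proof -
          have "C * (1 + s) powr (3/4) \<le> C * (1 + t) powr (3/4)" using C st s0 by (intro mult_left_mono powr_mono2) auto
          then show ?thesis using g1[of s] g1[of t] st s0 by linarith
        qed
        then have D1: "D \<le> 2 * C' * (1 + t) powr (3/4)" using mult_left_mono[OF _ \<sigma>] unfolding D_def C'_def by fastforce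
        have D2: "D \<le> C' * (1 + t) powr (1/4) * (t - s + 2)" using mult_left_mono[OF g2[OF s0 st(2)] \<sigma>] unfolding D_def C'_def by (simp add: mult.assoc)
        have "D + h * e n * (t - s) < max (sqrt t) (e n * t) / 4 - 1 + min t (1 / (e n)\<^sup>2) / 20 * (t - s)"
          by (rule growth_dominated[OF C'0 h e0 e1 _ s0 st(2) D1 D2 small]) (use T17 st in auto)
        moreover have "?N s - ?N t \<le> D + h * e n * (t - s)"
        proof -
          have "\<sigma> * (W s - W t) \<le> D" unfolding D_def using \<sigma> by (intro mult_left_mono) auto
          then show ?thesis by (simp add: algebra_simps)
        qed
        ultimately show ?thesis by linarith
      qed
    qed (use b T17 in auto)
    moreover have "U1 \<sigma> h \<mu> (e n) W b > 0" if "0 \<le> b" "b \<le> T" for b using elim(3) that by auto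
    ultimately show ?case unfolding NE_def using linear by blast
  qed
qed

end

section \<open>Brownian paths\<close>

lemma is_std_BM_D:
  assumes "is_std_BM M b"
  shows "prob_space M" "\<And>t. t \<ge> 0 \<Longrightarrow> (\<lambda>w. b w t) \<in> borel_measurable M"
    "\<And>w. w \<in> space M \<Longrightarrow> b w 0 = 0" "\<And>w. w \<in> space M \<Longrightarrow> continuous_on {0..} (b w)"
    "\<And>s t. 0 \<le> s \<Longrightarrow> s < t \<Longrightarrow> distributed M lborel (\<lambda>w. b w t - b w s) (\<lambda>x. ennreal (normal_density 0 (sqrt (t - s)) x))"
    "\<And>(ts::nat \<Rightarrow> real) n. 0 \<le> ts 0 \<Longrightarrow> (\<And>i. i < n \<Longrightarrow> ts i < ts (Suc i)) \<Longrightarrow>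
        prob_space.indep_vars M (\<lambda>_. borel) (\<lambda>i w. b w (ts (Suc i)) - b w (ts i)) {..<n}"
proof -
  note D = assms[unfolded is_std_BM_def]
  show "prob_space M" by (rule conjunct1[OF D])
  note D2 = conjunct2[OF D]
  show "t \<ge> 0 \<Longrightarrow> (\<lambda>w. b w t) \<in> borel_measurable M" for t using conjunct1[OF D2] by blast
  note D3 = conjunct2[OF D2]
  show "w \<in> space M \<Longrightarrow> b w 0 = 0" "w \<in> space M \<Longrightarrow> continuous_on {0..} (b w)" for w using conjunct1[OF D3] by blast+
  note D4 = conjunct2[OF D3]
  show "0 \<le> s \<Longrightarrow> s < t \<Longrightarrow> distributed M lborel (\<lambda>w. b w t - b w s) (\<lambda>x. ennreal (normal_density 0 (sqrt (t - s)) x))" for s t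
    using conjunct1[OF D4] by blast
  note D5 = conjunct2[OF D4]
  show "prob_space.indep_vars M (\<lambda>_. borel) (\<lambda>i w. b w (ts (Suc i)) - b w (ts i)) {..<n}"
    if "0 \<le> ts 0" "\<And>i. i < n \<Longrightarrow> ts i < ts (Suc i)" for ts :: "nat \<Rightarrow> real" and n
    using spec[OF spec[OF D5, of ts], of n] that by blast
qed

lemma proc_BM: assumes "is_std_BM M b" shows "proc M b"
  unfolding proc_def using is_std_BM_D(2)[OF assms] is_std_BM_D(4)[OF assms] by auto

text \<open>The constant is the Gaussian moment \<open>8! / (2^4 * 4!) = 105\<close>.\<close>

lemma BM_moment8:
  assumes b: "is_std_BM M b" and st: "0 \<le> s" "s < t"
  shows "(\<integral>\<^sup>+w. ennreal ((b w t - b w s) ^ 8) \<partial>M) = ennreal (105 * (t - s) ^ 4)"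
proof -
  let ?s = "sqrt (t - s)"
  have sp: "0 < ?s" using st by simp
  have hb: "has_bochner_integral lborel (\<lambda>x. normal_density 0 ?s x * (x - 0) ^ (2 * 4)) (fact (2 * 4) / ((2 / ?s\<^sup>2) ^ 4 * fact 4))"
    by (rule normal_moment_even[OF sp])
  have val: "fact (2 * 4) / ((2 / ?s\<^sup>2) ^ 4 * fact 4) = 105 * (t - s) ^ 4"
    using st by (simp add: fact_numeral power_divide)
  have "(\<integral>\<^sup>+w. ennreal ((b w t - b w s) ^ 8) \<partial>M) = (\<integral>\<^sup>+x. ennreal (normal_density 0 ?s x) * ennreal (x ^ 8) \<partial>lborel)"
    by (rule distributed_nn_integral[OF is_std_BM_D(5)[OF b st], symmetric]) measurable
  also have "\<dots> = (\<integral>\<^sup>+x. ennreal (normal_density 0 ?s x * x ^ 8) \<partial>lborel)"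
    by (intro nn_integral_cong) (simp add: ennreal_mult)
  also have "\<dots> = ennreal (LINT x|lborel. normal_density 0 ?s x * x ^ 8)"
    by (rule nn_integral_eq_integral) (use integrable.intros[OF hb] in auto)
  also have "(LINT x|lborel. normal_density 0 ?s x * x ^ 8) = 105 * (t - s) ^ 4"
    using has_bochner_integral_integral_eq[OF hb] val by simp
  finally show ?thesis .
qed

text \<open>Kolmogorov chaining anchored at \<open>n\<close>: passing from a dyadic point of level
  \<open>k + 1\<close> to one of level \<open>k\<close> costs at most one increment, so dyadic
  points stay within a geometric series of \<open>W n\<close>, and continuity extends the bound to
  all \<open>x\<close>.\<close>

lemma dyadic_chaining:
  fixes W :: "real \<Rightarrow> real"
  assumes cW: "continuous_on {0..} W" and n: "n \<ge> 0" and \<rho>: "0 < \<rho>" "\<rho> < 1" and c: "c \<ge> 0"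
    and inc: "\<And>k j. j < 2 ^ k \<Longrightarrow> \<bar>W (n + real (Suc j) / 2 ^ k) - W (n + real j / 2 ^ k)\<bar> \<le> c * \<rho> ^ k"
    and x: "n \<le> x" "x \<le> n + 1"
  shows "\<bar>W x - W n\<bar> \<le> c / (1 - \<rho>)"
proof -
  have dy: "\<bar>W (n + real i / 2 ^ k) - W n\<bar> \<le> c * (\<Sum>l\<le>k. \<rho> ^ l)" if "i \<le> 2 ^ k" for i k
    using that
  proof (induction k arbitrary: i)
    case 0
    then consider "i = 0" | "i = 1" by fastforce
    then show ?case using inc[of 0 0] c by cases auto
  next
    case (Suc k)
    define i' where "i' = i div 2"
    have i'le: "i' \<le> 2 ^ k" using Suc.prems by (simp add: i'_def)
    have eq: "real (2 * i') / 2 ^ Suc k = real i' / 2 ^ k" by simp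
    have sum: "c * (\<Sum>l\<le>Suc k. \<rho> ^ l) = c * (\<Sum>l\<le>k. \<rho> ^ l) + c * \<rho> ^ Suc k" by (simp add: distrib_left)
    have pos: "c * \<rho> ^ Suc k \<ge> 0" using c \<rho> by simp
    show ?case
    proof (cases "even i")
      case True
      then have "i = 2 * i'" by (simp add: i'_def)
      then show ?thesis using Suc.IH[OF i'le] eq sum pos by simp
    next
      case False
      then have i: "i = Suc (2 * i')" by (simp add: i'_def)
      have "2 * i' < 2 ^ Suc k" using Suc.prems i by simp
      from inc[OF this] have "\<bar>W (n + real i / 2 ^ Suc k) - W (n + real i' / 2 ^ k)\<bar> \<le> c * \<rho> ^ Suc k"
        unfolding eq i .
      then show ?thesis using Suc.IH[OF i'le] sum by linarith
    qed
  qed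
  have geo: "c * (\<Sum>l\<le>k. \<rho> ^ l) \<le> c / (1 - \<rho>)" for k
  proof -
    have "(\<Sum>l<Suc k. \<rho> ^ l) \<le> (\<Sum>l. \<rho> ^ l)" by (rule sum_le_suminf) (use \<rho> in \<open>auto intro!: summable_geometric\<close>)
    also have "\<dots> = 1 / (1 - \<rho>)" using \<rho> by (simp add: suminf_geometric)
    finally have "(\<Sum>l\<le>k. \<rho> ^ l) \<le> 1 / (1 - \<rho>)" by (simp add: lessThan_Suc_atMost)
    then show ?thesis using c mult_left_mono[of "\<Sum>l\<le>k. \<rho> ^ l" "1 / (1 - \<rho>)" c] by simp
  qed
  define i where "i k = nat \<lfloor>2 ^ k * (x - n)\<rfloor>" for k
  have ir: "real (i k) = of_int \<lfloor>2 ^ k * (x - n)\<rfloor>" for k using x by (simp add: i_def)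
  have ile: "i k \<le> 2 ^ k" for k
  proof -
    have "2 ^ k * (x - n) \<le> 2 ^ k * 1" using x by (intro mult_left_mono) auto
    then have "real (i k) \<le> 2 ^ k" unfolding ir by linarith
    then have "real (i k) \<le> real (2 ^ k)" by simp
    then show ?thesis by (simp only: of_nat_le_iff)
  qed
  have lim: "(\<lambda>k. n + real (i k) / 2 ^ k) \<longlonglongrightarrow> x"
  proof (rule tendsto_sandwich)
    have "(\<lambda>k. x - (1/2) ^ k) \<longlonglongrightarrow> x - 0" by (intro tendsto_intros LIMSEQ_power_zero) simp
    then show "(\<lambda>k. x - (1/2::real) ^ k) \<longlonglongrightarrow> x" by simp
    show "(\<lambda>k. x) \<longlonglongrightarrow> x" by simp
    show "\<forall>\<^sub>F k in sequentially. x - (1/2) ^ k \<le> n + real (i k) / 2 ^ k"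
    proof (rule always_eventually, rule allI)
      fix k
      have "2 ^ k * (x - n) - 1 \<le> real (i k)" unfolding ir by linarith
      then have "(2 ^ k * (x - n) - 1) / 2 ^ k \<le> real (i k) / 2 ^ k" by (intro divide_right_mono) auto
      moreover have "(2 ^ k * (x - n) - 1) / 2 ^ k = x - n - (1/2) ^ k" by (simp add: diff_divide_distrib power_divide)
      ultimately show "x - (1/2) ^ k \<le> n + real (i k) / 2 ^ k" by linarith
    qed
    show "\<forall>\<^sub>F k in sequentially. n + real (i k) / 2 ^ k \<le> x"
    proof (rule always_eventually, rule allI)
      fix k
      have "real (i k) \<le> 2 ^ k * (x - n)" unfolding ir by linarith
      then have "real (i k) / 2 ^ k \<le> x - n" by (simp add: divide_le_eq mult.commute)
      then show "n + real (i k) / 2 ^ k \<le> x" by simp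
    qed
  qed
  have "(\<lambda>k. W (n + real (i k) / 2 ^ k)) \<longlonglongrightarrow> W x"
    by (rule continuous_on_tendsto_compose[OF cW lim]) (use n x in auto)
  then have "(\<lambda>k. \<bar>W (n + real (i k) / 2 ^ k) - W n\<bar>) \<longlonglongrightarrow> \<bar>W x - W n\<bar>" by (intro tendsto_intros)
  then show ?thesis
    by (rule LIMSEQ_le_const2) (use order_trans[OF dy[OF ile] geo] in blast)
qed

text \<open>The integers \<open>a\<close>, \<open>b\<close> below \<open>s\<close>, \<open>t\<close>
  are joined by \<open>b - a\<close> unit oscillations, and each end adds one. As
  \<open>b - a + 2 <= 2 * (t - s + 2)\<close>, the constant \<open>2 * c\<close> suffices for the
  increments.\<close>

lemma growth_if_unit_oscillation:
  fixes W :: "real \<Rightarrow> real"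
  assumes c: "c \<ge> 0" and r: "r \<ge> 0" and osc: "\<And>n x. real n \<le> x \<Longrightarrow> x \<le> real n + 1 \<Longrightarrow> \<bar>W x - W (real n)\<bar> \<le> c * (real n + 1) powr (1/4)"
    and val: "\<And>n::nat. \<bar>W (real n)\<bar> \<le> r * (real n + 1) powr (3/4)"
  shows "growth (r + 2 * c) W"
  unfolding growth_def
proof (intro conjI allI impI)
  show "0 \<le> r + 2 * c" using c r by simp
  have fl: "real (nat \<lfloor>t\<rfloor>) \<le> t" "t \<le> real (nat \<lfloor>t\<rfloor>) + 1" if "t \<ge> 0" for t :: real using that by linarith+
  fix t :: real assume t: "0 \<le> t"
  let ?n = "nat \<lfloor>t\<rfloor>"
  have p1: "(real ?n + 1) powr (1/4) \<le> (1 + t) powr (3/4)"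
  proof -
    have "(real ?n + 1) powr (1/4) \<le> (1 + t) powr (1/4)" using fl[OF t] by (intro powr_mono2) auto
    also have "\<dots> \<le> (1 + t) powr (3/4)" using t by (intro powr_mono) auto
    finally show ?thesis .
  qed
  have p3: "(real ?n + 1) powr (3/4) \<le> (1 + t) powr (3/4)" using fl[OF t] by (intro powr_mono2) auto
  have "\<bar>W t\<bar> \<le> \<bar>W (real ?n)\<bar> + \<bar>W t - W (real ?n)\<bar>" by linarith
  also have "\<dots> \<le> r * (1 + t) powr (3/4) + c * (1 + t) powr (3/4)"
    by (intro add_mono order_trans[OF val] order_trans[OF osc[OF fl[OF t]]] mult_left_mono p1 p3 c r)
  also have "\<dots> \<le> (r + 2 * c) * (1 + t) powr (3/4)" using c by (simp add: distrib_right)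
  finally show "\<bar>W t\<bar> \<le> (r + 2 * c) * (1 + t) powr (3/4)" .
next
  fix s t :: real assume s: "0 \<le> s" "s \<le> t"
  have t: "t \<ge> 0" using s by simp
  have "nat \<lfloor>s\<rfloor> \<le> nat \<lfloor>t\<rfloor>" using s by (intro nat_mono floor_mono)
  moreover have "real (nat \<lfloor>x\<rfloor>) \<le> x" "x \<le> real (nat \<lfloor>x\<rfloor>) + 1" if "x \<ge> 0" for x :: real using that by linarith+
  ultimately obtain a b where ab: "a \<le> b" and a: "real a \<le> s" "s \<le> real a + 1" and b: "real b \<le> t" "t \<le> real b + 1"
    using s(1) t by blast
  let ?K = "c * (1 + t) powr (1/4)"
  have K: "c * (real n + 1) powr (1/4) \<le> ?K" if "real n \<le> t" for n
    using that c by (intro mult_left_mono powr_mono2) auto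
  have K0: "?K \<ge> 0" using c by simp
  have steps: "\<bar>W (real (a + k)) - W (real a)\<bar> \<le> real k * ?K" if "a + k \<le> b" for k
    using that
  proof (induction k)
    case (Suc k)
    have "real (a + k) \<le> real b" using Suc.prems by simp
    then have "real (a + k) \<le> t" using b(1) by simp
    then have st: "\<bar>W (real (a + k) + 1) - W (real (a + k))\<bar> \<le> ?K" using osc[of "a + k" "real (a + k) + 1"] K[of "a + k"] by linarith
    have sk: "real (a + Suc k) = real (a + k) + 1" by simp
    have "\<bar>W (real (a + Suc k)) - W (real (a + k))\<bar> \<le> ?K" unfolding sk by (rule st)
    moreover have "\<bar>W (real (a + k)) - W (real a)\<bar> \<le> real k * ?K" using Suc.IH Suc.prems by simp
    moreover have "real (Suc k) * ?K = real k * ?K + ?K" by (simp add: distrib_right)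
    ultimately show ?case by linarith
  qed simp
  have "\<bar>W (real b) - W (real a)\<bar> \<le> real (b - a) * ?K" using steps[of "b - a"] ab by simp
  moreover have "\<bar>W t - W (real b)\<bar> \<le> ?K" using osc[OF b] K[OF b(1)] by linarith
  moreover have "\<bar>W s - W (real a)\<bar> \<le> ?K" using osc[OF a] K[of a] a(1) s by linarith
  ultimately have "\<bar>W t - W s\<bar> \<le> real (b - a) * ?K + 2 * ?K" by linarith
  also have "\<dots> = (real (b - a) + 2) * ?K" by (simp add: distrib_right)
  also have "\<dots> \<le> (2 * (t - s + 2)) * ?K"
  proof (rule mult_right_mono[OF _ K0])
    have "real (b - a) = real b - real a" using ab by (rule of_nat_diff)
    then show "real (b - a) + 2 \<le> 2 * (t - s + 2)" using a b s(2) by simp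
  qed
  also have "\<dots> = (2 * c) * (1 + t) powr (1/4) * (t - s + 2)" by simp
  also have "\<dots> \<le> (r + 2 * c) * (1 + t) powr (1/4) * (t - s + 2)" using r s by (intro mult_right_mono) auto
  finally show "\<bar>W t - W s\<bar> \<le> (r + 2 * c) * (1 + t) powr (1/4) * (t - s + 2)" .
qed

lemma root8_bound:
  fixes x R y p :: real
  assumes "x ^ 8 \<le> R * y ^ 8" "R \<ge> 0" "y \<ge> 0"
  shows "\<bar>x\<bar> \<le> root 8 R * y"
proof -
  have "\<bar>x\<bar> ^ 8 \<le> (root 8 R * y) ^ 8" using assms by (simp add: power_mult_distrib real_root_pow_pos2)
  then have "\<bar>x\<bar> ^ Suc 7 \<le> (root 8 R * y) ^ Suc 7" by simp
  then show ?thesis by (rule power_le_imp_le_base) (use assms in simp)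
qed

text \<open>Two weighted sums of eighth powers have finite mean, so they are almost surely finite
  and bound each of their terms. In \<open>F\<close> the \<open>2^k\<close> increments of level
  \<open>k\<close> have eighth moment \<open>105 * 16^(-k)\<close> each, so the weight
  \<open>4^k\<close> leaves \<open>2^(-k)\<close>; the eighth root gives the rate
  \<open>\<rho> = 2 powr (-1/4)\<close> and the factor \<open>(n + 1) powr (1/4)\<close>. In
  \<open>G\<close> the moment \<open>105 * n^4\<close> meets the weight \<open>(n + 1)^(-6)\<close>,
  which stays summable and gives the exponent 6/8.\<close>

lemma AE_growth:
  assumes b: "is_std_BM M b"
  shows "AE w in M. \<exists>C. growth C (b w)"
proof -
  interpret prob_space M by (rule is_std_BM_D(1)[OF b])
  note meas = is_std_BM_D(2)[OF b]
  define \<Delta> where "\<Delta> n k j w = b w (real n + real (Suc j) / 2 ^ k) - b w (real n + real j / 2 ^ k)" for n k j :: nat and w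
  define F where "F w = (\<Sum>n. \<Sum>k. \<Sum>j<(2::nat)^k. ennreal (4 ^ k / (real n + 1)\<^sup>2) * ennreal (\<Delta> n k j w ^ 8))" for w
  define G where "G w = (\<Sum>n. ennreal (1 / (real n + 1) ^ 6) * ennreal (b w (real n) ^ 8))" for w
  have m\<Delta>[measurable]: "\<Delta> n k j \<in> borel_measurable M" for n k j unfolding \<Delta>_def[abs_def] by (intro borel_measurable_diff meas) auto
  have mb[measurable]: "(\<lambda>w. b w (real n)) \<in> borel_measurable M" for n by (rule meas) simp
  have mF: "F \<in> borel_measurable M" unfolding F_def[abs_def] by measurable
  have mG: "G \<in> borel_measurable M" unfolding G_def[abs_def] by measurable
  have I\<Delta>: "(\<integral>\<^sup>+w. ennreal (\<Delta> n k j w ^ 8) \<partial>M) = ennreal (105 * (1 / 2 ^ k) ^ 4)" for n k j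
  proof -
    have "real n + real (Suc j) / 2 ^ k - (real n + real j / 2 ^ k) = 1 / 2 ^ k" by (simp add: add_divide_distrib)
    then show ?thesis unfolding \<Delta>_def using BM_moment8[OF b, of "real n + real j / 2 ^ k" "real n + real (Suc j) / 2 ^ k"]
      by (simp add: divide_strict_right_mono)
  qed
  have inv_sq: "summable (\<lambda>n. 1 / (real n + 1)\<^sup>2)"
  proof -
    have "summable (\<lambda>n. inverse (real (Suc n) ^ 2))" using inverse_power_summable[of 2, where 'a=real] by (subst summable_Suc_iff) simp
    then show ?thesis by (simp add: inverse_eq_divide add.commute)
  qed
  have "(\<integral>\<^sup>+w. F w \<partial>M) = (\<Sum>n. \<Sum>k. \<Sum>j<(2::nat)^k. ennreal (4 ^ k / (real n + 1)\<^sup>2) * ennreal (105 * (1 / 2 ^ k) ^ 4))"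
    unfolding F_def by (simp add: nn_integral_suminf nn_integral_sum nn_integral_cmult I\<Delta>)
  also have "\<dots> = (\<Sum>n. \<Sum>k. ennreal (105 / (real n + 1)\<^sup>2 * (1 / 2) ^ k))"
  proof (intro suminf_cong)
    fix n k :: nat
    have "(\<Sum>j<(2::nat)^k. ennreal (4 ^ k / (real n + 1)\<^sup>2) * ennreal (105 * (1 / 2 ^ k) ^ 4)) = (\<Sum>j<(2::nat)^k. ennreal (4 ^ k / (real n + 1)\<^sup>2 * (105 * (1 / 2 ^ k) ^ 4)))"
      by (intro sum.cong refl ennreal_mult[symmetric]) auto
    also have "\<dots> = ennreal (\<Sum>j<(2::nat)^k. 4 ^ k / (real n + 1)\<^sup>2 * (105 * (1 / 2 ^ k) ^ 4))" by (rule sum_ennreal) simp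
    also have "(\<Sum>j<(2::nat)^k. 4 ^ k / (real n + 1)\<^sup>2 * (105 * (1 / 2 ^ k) ^ 4)) = 105 / (real n + 1)\<^sup>2 * (1 / 2) ^ k"
    proof -
      have "(1 / 2 ^ k) ^ 4 = ((1 / 2 :: real) ^ 4) ^ k" by (simp only: power_one_over[symmetric] power_mult[symmetric] mult.commute)
      then have "(2::real) ^ k * 4 ^ k * (1 / 2 ^ k) ^ 4 = (2 * 4 * (1 / 2) ^ 4) ^ k" by (simp only: power_mult_distrib)
      moreover have "2 * 4 * (1 / 2) ^ 4 = (1 / 2 :: real)" by (simp add: power4_eq_xxxx)
      ultimately have "(2::real) ^ k * 4 ^ k * (1 / 2 ^ k) ^ 4 = (1 / 2) ^ k" by (simp only:)
      then show ?thesis by (simp add: field_simps)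
    qed
    finally show "(\<Sum>j<(2::nat)^k. ennreal (4 ^ k / (real n + 1)\<^sup>2) * ennreal (105 * (1 / 2 ^ k) ^ 4)) = ennreal (105 / (real n + 1)\<^sup>2 * (1 / 2) ^ k)" .
  qed
  also have "\<dots> = (\<Sum>n. ennreal (105 / (real n + 1)\<^sup>2 * 2))"
  proof (intro suminf_cong suminf_ennreal_eq)
    fix n :: nat
    have "(\<lambda>k. (1/2::real) ^ k) sums (1 / (1 - 1/2))" by (rule geometric_sums) simp
    then show "(\<lambda>k. 105 / (real n + 1)\<^sup>2 * (1 / 2) ^ k) sums (105 / (real n + 1)\<^sup>2 * 2)" by (intro sums_mult) simp
  qed simp
  also have "\<dots> \<noteq> \<infinity>"
  proof -
    have "summable (\<lambda>n. 210 * (1 / (real n + 1)\<^sup>2))" by (rule summable_mult[OF inv_sq])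
    then have "summable (\<lambda>n. 105 / (real n + 1)\<^sup>2 * 2)" by simp
    then show ?thesis unfolding infinity_ennreal_def by (rule ennreal_suminf_neq_top) simp
  qed
  finally have Ffin: "AE w in M. F w \<noteq> \<infinity>" by (intro nn_integral_PInf_AE mF)
  have Ib: "(\<integral>\<^sup>+w. ennreal (b w (real n) ^ 8) \<partial>M) = ennreal (105 * real n ^ 4)" for n
  proof (cases "n = 0")
    case True
    have "(\<integral>\<^sup>+w. ennreal (b w (real n) ^ 8) \<partial>M) = (\<integral>\<^sup>+w. 0 \<partial>M)" by (rule nn_integral_cong) (simp add: True is_std_BM_D(3)[OF b])
    then show ?thesis using True by simp
  next
    case False
    have "(\<integral>\<^sup>+w. ennreal (b w (real n) ^ 8) \<partial>M) = (\<integral>\<^sup>+w. ennreal ((b w (real n) - b w 0) ^ 8) \<partial>M)" by (rule nn_integral_cong) (simp add: is_std_BM_D(3)[OF b])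
    then show ?thesis using BM_moment8[OF b, of 0 "real n"] False by simp
  qed
  have "(\<integral>\<^sup>+w. G w \<partial>M) = (\<Sum>n. ennreal (1 / (real n + 1) ^ 6) * ennreal (105 * real n ^ 4))"
    unfolding G_def by (simp add: nn_integral_suminf nn_integral_cmult Ib)
  also have "\<dots> = (\<Sum>n. ennreal (1 / (real n + 1) ^ 6 * (105 * real n ^ 4)))"
    by (intro suminf_cong ennreal_mult[symmetric]) auto
  also have "\<dots> \<noteq> \<infinity>"
  proof -
    have "summable (\<lambda>n. 1 / (real n + 1) ^ 6 * (105 * real n ^ 4))"
    proof (rule summable_comparison_test[OF _ summable_mult[OF inv_sq, of 105]], intro exI allI impI)
      fix n :: nat
      have "real n ^ 4 \<le> (real n + 1) ^ 4" by (intro power_mono) auto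
      then have "real n ^ 4 / (real n + 1) ^ 6 \<le> (real n + 1) ^ 4 / (real n + 1) ^ 6" by (intro divide_right_mono) auto
      also have "\<dots> = 1 / (real n + 1)\<^sup>2" by (simp add: divide_simps)
      finally show "norm (1 / (real n + 1) ^ 6 * (105 * real n ^ 4)) \<le> 105 * (1 / (real n + 1)\<^sup>2)" by simp
    qed
    then show ?thesis unfolding infinity_ennreal_def by (rule ennreal_suminf_neq_top) simp
  qed
  finally have Gfin: "AE w in M. G w \<noteq> \<infinity>" by (intro nn_integral_PInf_AE mG)
  have "AE w in M. w \<in> space M" by (rule AE_space)
  with Ffin Gfin show ?thesis
  proof eventually_elim
    case (elim w)
    define R where "R = enn2real (F w)"
    define Q where "Q = enn2real (G w)"
    have R: "F w = ennreal R" "R \<ge> 0" using elim(1) by (auto simp: R_def less_top)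
    have Q: "G w = ennreal Q" "Q \<ge> 0" using elim(2) by (auto simp: Q_def less_top)
    define \<rho> where "\<rho> = (2::real) powr (- 1/4)"
    have \<rho>: "0 < \<rho>" "\<rho> < 1" unfolding \<rho>_def using powr_less_mono[of "-1/4" 0 2] by auto
    have \<rho>8: "\<rho> ^ 8 = 1 / 4"
    proof -
      have "\<rho> ^ 8 = \<rho> powr 8" using \<rho> by simp
      also have "\<dots> = 2 powr (- 2)" unfolding \<rho>_def by (simp only: powr_powr) simp
      also have "\<dots> = 1 / 4" by (simp add: powr_minus powr_numeral inverse_eq_divide)
      finally show ?thesis .
    qed
    have q8: "((real n + 1) powr (1/4)) ^ 8 = (real n + 1)\<^sup>2" "((real n + 1) powr (3/4)) ^ 8 = (real n + 1) ^ 6" for n :: nat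
    proof -
      have p: "(real n + 1) powr x > 0" for x by simp
      have "((real n + 1) powr (1/4)) ^ 8 = ((real n + 1) powr (1/4)) powr 8" using p by simp
      also have "\<dots> = (real n + 1) powr 2" by (simp only: powr_powr) simp
      finally show "((real n + 1) powr (1/4)) ^ 8 = (real n + 1)\<^sup>2" by simp
      have "((real n + 1) powr (3/4)) ^ 8 = ((real n + 1) powr (3/4)) powr 8" using p by simp
      also have "\<dots> = (real n + 1) powr 6" by (simp only: powr_powr) simp
      finally show "((real n + 1) powr (3/4)) ^ 8 = (real n + 1) ^ 6" by simp
    qed
    have inc: "\<bar>\<Delta> n k j w\<bar> \<le> root 8 R * (real n + 1) powr (1/4) * \<rho> ^ k" if j: "j < 2 ^ k" for n k j
    proof -
      have "ennreal (4 ^ k / (real n + 1)\<^sup>2) * ennreal (\<Delta> n k j w ^ 8) \<le> (\<Sum>j<(2::nat)^k. ennreal (4 ^ k / (real n + 1)\<^sup>2) * ennreal (\<Delta> n k j w ^ 8))"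
        by (rule member_le_sum) (use j in auto)
      also have "\<dots> \<le> (\<Sum>k. \<Sum>j<(2::nat)^k. ennreal (4 ^ k / (real n + 1)\<^sup>2) * ennreal (\<Delta> n k j w ^ 8))"
        using sum_le_suminf[of "\<lambda>k. \<Sum>j<(2::nat)^k. ennreal (4 ^ k / (real n + 1)\<^sup>2) * ennreal (\<Delta> n k j w ^ 8)" "{k}"] by simp
      also have "\<dots> \<le> F w" unfolding F_def
        using sum_le_suminf[of "\<lambda>n. \<Sum>k. \<Sum>j<(2::nat)^k. ennreal (4 ^ k / (real n + 1)\<^sup>2) * ennreal (\<Delta> n k j w ^ 8)" "{n}"] by simp
      finally have "ennreal (4 ^ k / (real n + 1)\<^sup>2 * \<Delta> n k j w ^ 8) \<le> ennreal R" unfolding R(1) by (subst ennreal_mult) auto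
      then have "4 ^ k / (real n + 1)\<^sup>2 * \<Delta> n k j w ^ 8 \<le> R" using R(2) by (simp add: ennreal_le_iff)
      then have "\<Delta> n k j w ^ 8 \<le> R * ((real n + 1)\<^sup>2 * (1 / 4) ^ k)" by (simp add: field_simps power_divide)
      also have "(real n + 1)\<^sup>2 * (1 / 4) ^ k = ((real n + 1) powr (1/4) * \<rho> ^ k) ^ 8"
      proof -
        have "(\<rho> ^ k) ^ 8 = (\<rho> ^ 8) ^ k" by (simp only: power_mult[symmetric] mult.commute)
        then show ?thesis unfolding power_mult_distrib q8 \<rho>8 by simp
      qed
      finally show ?thesis using root8_bound[of "\<Delta> n k j w" R "(real n + 1) powr (1/4) * \<rho> ^ k"] R(2) \<rho> by (simp add: mult.assoc)
    qed
    have osc: "\<bar>b w x - b w (real n)\<bar> \<le> (root 8 R / (1 - \<rho>)) * (real n + 1) powr (1/4)" if "real n \<le> x" "x \<le> real n + 1" for n x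
    proof -
      have "\<bar>b w x - b w (real n)\<bar> \<le> (root 8 R * (real n + 1) powr (1/4)) / (1 - \<rho>)"
        by (rule dyadic_chaining[OF is_std_BM_D(4)[OF b elim(3)] _ \<rho> _ _ that]) (use inc R(2) in \<open>auto simp: \<Delta>_def\<close>)
      then show ?thesis by simp
    qed
    have val: "\<bar>b w (real n)\<bar> \<le> root 8 Q * (real n + 1) powr (3/4)" for n :: nat
    proof -
      have "ennreal (1 / (real n + 1) ^ 6) * ennreal (b w (real n) ^ 8) \<le> G w" unfolding G_def
        using sum_le_suminf[of "\<lambda>n. ennreal (1 / (real n + 1) ^ 6) * ennreal (b w (real n) ^ 8)" "{n}"] by simp
      then have "ennreal (1 / (real n + 1) ^ 6 * b w (real n) ^ 8) \<le> ennreal Q" unfolding Q(1) by (subst ennreal_mult) auto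
      then have "1 / (real n + 1) ^ 6 * b w (real n) ^ 8 \<le> Q" using Q(2) by (simp add: ennreal_le_iff)
      then have "b w (real n) ^ 8 \<le> Q * (real n + 1) ^ 6" by (simp add: field_simps)
      then show ?thesis using root8_bound[of "b w (real n)" Q "(real n + 1) powr (3/4)"] Q(2) by (simp add: q8)
    qed
    show ?case
      by (rule exI, rule growth_if_unit_oscillation[OF _ _ osc val]) (use R(2) Q(2) \<rho> in auto)
  qed
qed

section \<open>Scaling and uniqueness of the law of Brownian motion\<close>

lemma BM_scaling:
  assumes b: "is_std_BM M b" and k: "k > 0"
  shows "is_std_BM M (\<lambda>w t. k * b w (t / k\<^sup>2))"
proof -
  interpret prob_space M by (rule is_std_BM_D(1)[OF b])
  have k2: "k\<^sup>2 > 0" using k by simp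
  show ?thesis
    unfolding is_std_BM_def
  proof (intro conjI allI impI ballI)
    show "prob_space M" by unfold_locales
    show "(\<lambda>w. k * b w (t / k\<^sup>2)) \<in> borel_measurable M" if "0 \<le> t" for t
      by (intro borel_measurable_times borel_measurable_const is_std_BM_D(2)[OF b]) (use that k2 in simp)
    show "k * b w (0 / k\<^sup>2) = 0" if "w \<in> space M" for w using is_std_BM_D(3)[OF b that] by simp
    show "continuous_on {0..} (\<lambda>t. k * b w (t / k\<^sup>2))" if "w \<in> space M" for w
      by (intro continuous_intros continuous_on_compose2[OF is_std_BM_D(4)[OF b that]]) (use k2 in auto)
    fix s t :: real assume st: "0 \<le> s \<and> s < t"
    have "distributed M lborel (\<lambda>w. b w (t / k\<^sup>2) - b w (s / k\<^sup>2)) (\<lambda>x. ennreal (normal_density 0 (sqrt (t / k\<^sup>2 - s / k\<^sup>2)) x))"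
      by (rule is_std_BM_D(5)[OF b]) (use st k2 in \<open>auto simp: divide_strict_right_mono\<close>)
    then have "distributed M lborel (\<lambda>w. 0 + k * (b w (t / k\<^sup>2) - b w (s / k\<^sup>2))) (\<lambda>x. ennreal (normal_density (0 + k * 0) (\<bar>k\<bar> * sqrt (t / k\<^sup>2 - s / k\<^sup>2)) x))"
      by (rule normal_density_affine) (use st k k2 in \<open>auto simp: divide_strict_right_mono\<close>)
    moreover have "\<bar>k\<bar> * sqrt (t / k\<^sup>2 - s / k\<^sup>2) = sqrt (t - s)"
      using k by (simp add: diff_divide_distrib[symmetric] real_sqrt_divide)
    ultimately show "distributed M lborel (\<lambda>w. k * b w (t / k\<^sup>2) - k * b w (s / k\<^sup>2)) (\<lambda>x. ennreal (normal_density 0 (sqrt (t - s)) x))"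
      by (simp add: right_diff_distrib)
  next
    fix ts :: "nat \<Rightarrow> real" and n :: nat assume ts: "0 \<le> ts 0 \<and> (\<forall>i<n. ts i < ts (Suc i))"
    have "indep_vars (\<lambda>_. borel) (\<lambda>i w. b w (ts (Suc i) / k\<^sup>2) - b w (ts i / k\<^sup>2)) {..<n}"
      by (rule is_std_BM_D(6)[OF b, of "\<lambda>i. ts i / k\<^sup>2"]) (use ts k2 in \<open>auto simp: divide_strict_right_mono\<close>)
    then have "indep_vars (\<lambda>_. borel) (\<lambda>i w. k * (b w (ts (Suc i) / k\<^sup>2) - b w (ts i / k\<^sup>2))) {..<n}"
      by (rule indep_vars_compose2[where Y="\<lambda>_ x. k * x"]) simp
    then show "indep_vars (\<lambda>_. borel) (\<lambda>i w. k * b w (ts (Suc i) / k\<^sup>2) - k * b w (ts i / k\<^sup>2)) {..<n}"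
      by (simp add: right_diff_distrib)
  qed
qed

lemma BM_increments_law:
  assumes b: "is_std_BM M b" and ts: "0 \<le> ts 0" "\<And>i. i < n \<Longrightarrow> ts i < ts (Suc i)" and n: "n > 0"
  shows "distr M (\<Pi>\<^sub>M i\<in>{..<n}. borel) (\<lambda>w. \<lambda>i\<in>{..<n}. b w (ts (Suc i)) - b w (ts i))
    = (\<Pi>\<^sub>M i\<in>{..<n}. density lborel (\<lambda>x. ennreal (normal_density 0 (sqrt (ts (Suc i) - ts i)) x)))"
proof -
  interpret prob_space M by (rule is_std_BM_D(1)[OF b])
  have tsn: "0 \<le> ts i" if "i \<le> n" for i
    using that by (induction i) (use ts in \<open>auto intro: order_trans less_imp_le simp: Suc_le_eq\<close>)
  have "indep_vars (\<lambda>_. borel) (\<lambda>i w. b w (ts (Suc i)) - b w (ts i)) {..<n}" by (rule is_std_BM_D(6)[OF b ts]) auto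
  moreover have "(\<lambda>w. b w (ts (Suc i)) - b w (ts i)) \<in> borel_measurable M" if "i \<in> {..<n}" for i
    by (intro borel_measurable_diff is_std_BM_D(2)[OF b] tsn) (use that in auto)
  ultimately have "distr M (\<Pi>\<^sub>M i\<in>{..<n}. borel) (\<lambda>w. \<lambda>i\<in>{..<n}. b w (ts (Suc i)) - b w (ts i))
     = (\<Pi>\<^sub>M i\<in>{..<n}. distr M borel (\<lambda>w. b w (ts (Suc i)) - b w (ts i)))"
    using n by (subst (asm) indep_vars_iff_distr_eq_PiM') auto
  also have "\<dots> = (\<Pi>\<^sub>M i\<in>{..<n}. density lborel (\<lambda>x. ennreal (normal_density 0 (sqrt (ts (Suc i) - ts i)) x)))"
  proof (rule PiM_cong[OF refl])
    fix i assume i: "i \<in> {..<n}"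
    have "distributed M lborel (\<lambda>w. b w (ts (Suc i)) - b w (ts i)) (\<lambda>x. ennreal (normal_density 0 (sqrt (ts (Suc i) - ts i)) x))"
      by (rule is_std_BM_D(5)[OF b]) (use tsn[of i] ts(2)[of i] i in auto)
    from distributed_distr_eq_density[OF this]
    show "distr M borel (\<lambda>w. b w (ts (Suc i)) - b w (ts i)) = density lborel (\<lambda>x. ennreal (normal_density 0 (sqrt (ts (Suc i) - ts i)) x))"
      by (subst distr_cong[OF refl _ refl, of _ lborel]) auto
  qed
  finally show ?thesis .
qed

text \<open>Values at the times in \<open>J\<close> are partial sums of independent Gaussian
  increments. Inserting 0 anchors the grid where the path vanishes, and inserting 1 guarantees an
  increment even for empty \<open>J\<close>. The right-hand side does not mention the particular
  motion, which is the point.\<close>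

lemma BM_fdd_emeasure:
  assumes b: "is_std_BM M b" and J: "finite J" "J \<subseteq> {0..}" and A: "\<And>t. t \<in> J \<Longrightarrow> A t \<in> sets borel"
    and xs: "xs = sorted_list_of_set (insert 0 (insert 1 J))" and n: "n = length xs - 1"
    and idx: "\<And>t. t \<in> J \<Longrightarrow> idx t \<le> n \<and> xs ! idx t = t"
  shows "emeasure M {w \<in> space M. \<forall>t\<in>J. b w t \<in> A t}
    = emeasure (\<Pi>\<^sub>M i\<in>{..<n}. density lborel (\<lambda>x. ennreal (normal_density 0 (sqrt (xs ! Suc i - xs ! i)) x)))
        {x \<in> space (\<Pi>\<^sub>M i\<in>{..<n}. borel). \<forall>t\<in>J. (\<Sum>i<idx t. x i) \<in> A t}"
proof -
  let ?ts = "\<lambda>i. xs ! i"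
  have set_xs: "set xs = insert 0 (insert 1 J)" unfolding xs using J by (intro set_sorted_list_of_set) auto
  have len: "length xs = card (insert 0 (insert 1 J))"
    unfolding set_xs[symmetric] by (rule distinct_card[symmetric]) (simp only: xs distinct_sorted_list_of_set)
  have "card {0::real, 1} \<le> card (insert 0 (insert 1 J))" by (rule card_mono) (use J in auto)
  then have len2: "length xs \<ge> 2" using len by simp
  have n0: "n > 0" "length xs = Suc n" using len2 by (auto simp: n)
  have sorted: "sorted_wrt (<) xs" unfolding xs by (rule strict_sorted_list_of_set)
  have inc: "xs ! i < xs ! Suc i" if "i < n" for i
    by (rule sorted_wrt_nth_less[OF sorted]) (use that n0 in auto)
  have nn: "xs ! i \<ge> 0" if "i \<le> n" for i
  proof -
    have "xs ! i \<in> set xs" using that n0 by (intro nth_mem) simp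
    then show ?thesis using set_xs J by auto
  qed
  have ts0: "xs ! 0 = 0"
  proof -
    have "0 \<in> set xs" using set_xs by simp
    then obtain m where m: "m < length xs" "xs ! m = 0" by (auto simp: in_set_conv_nth)
    show ?thesis
    proof (cases "m = 0")
      case False
      then have "xs ! 0 < xs ! m" by (intro sorted_wrt_nth_less[OF sorted]) (use m in auto)
      then show ?thesis using m nn[of 0] by simp
    qed (use m in simp)
  qed
  let ?D = "\<lambda>w. \<lambda>i\<in>{..<n}. b w (xs ! Suc i) - b w (xs ! i)"
  let ?B = "{x \<in> space (\<Pi>\<^sub>M i\<in>{..<n}. (borel :: real measure)). \<forall>t\<in>J. (\<Sum>i<idx t. x i) \<in> A t}"
  have law: "distr M (\<Pi>\<^sub>M i\<in>{..<n}. borel) ?D = (\<Pi>\<^sub>M i\<in>{..<n}. density lborel (\<lambda>x. ennreal (normal_density 0 (sqrt (xs ! Suc i - xs ! i)) x)))"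
    by (rule BM_increments_law[OF b]) (use ts0 inc n0 in auto)
  have Dm: "?D \<in> measurable M (\<Pi>\<^sub>M i\<in>{..<n}. borel)"
    by (intro measurable_restrict borel_measurable_diff is_std_BM_D(2)[OF b] nn) auto
  have "Measurable.pred (\<Pi>\<^sub>M i\<in>{..<n}. (borel :: real measure)) (\<lambda>x. \<forall>t\<in>J. (\<Sum>i<idx t. x i) \<in> A t)"
  proof (rule pred_intros_finite[OF J(1)])
    fix t assume t: "t \<in> J"
    have "(\<lambda>x. \<Sum>i<idx t. x i) \<in> borel_measurable (\<Pi>\<^sub>M i\<in>{..<n}. (borel :: real measure))"
      by (intro borel_measurable_sum measurable_component_singleton) (use idx[OF t] in auto)
    then show "Measurable.pred (\<Pi>\<^sub>M i\<in>{..<n}. (borel :: real measure)) (\<lambda>x. (\<Sum>i<idx t. x i) \<in> A t)"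
      by (rule pred_sets2[OF A[OF t]])
  qed
  then have B: "?B \<in> sets (\<Pi>\<^sub>M i\<in>{..<n}. borel)" by (simp add: pred_def)
  have "{w \<in> space M. \<forall>t\<in>J. b w t \<in> A t} = ?D -` ?B \<inter> space M"
  proof -
    have "b w t = (\<Sum>i<idx t. ?D w i)" if w: "w \<in> space M" and t: "t \<in> J" for w t
    proof -
      have "(\<Sum>i<idx t. ?D w i) = (\<Sum>i<idx t. b w (xs ! Suc i) - b w (xs ! i))"
        by (rule sum.cong) (use idx[OF t] in auto)
      also have "\<dots> = b w (xs ! idx t) - b w (xs ! 0)" by (rule sum_lessThan_telescope)
      finally show ?thesis using idx[OF t] ts0 is_std_BM_D(3)[OF b w] by simp
    qed
    then show ?thesis using measurable_space[OF Dm] by auto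
  qed
  then have "emeasure M {w \<in> space M. \<forall>t\<in>J. b w t \<in> A t} = emeasure (distr M (\<Pi>\<^sub>M i\<in>{..<n}. borel) ?D) ?B"
    using emeasure_distr[OF Dm B] by simp
  then show ?thesis unfolding law .
qed

text \<open>Elements of a product space over \<open>{0..}\<close> are extensional, hence the
  restriction.\<close>

definition path_map :: "(real \<Rightarrow> real) \<Rightarrow> real \<Rightarrow> real" where "path_map f = restrict f {0..}"

text \<open>Cylinder sets determine a finite measure on the product, and
  \<open>BM_fdd_emeasure\<close> gives both laws the same value on them.\<close>

lemma BM_law_unique:
  assumes b: "is_std_BM M b" and b': "is_std_BM M b'"
  shows "distr M (\<Pi>\<^sub>M t\<in>{0..}. borel) (\<lambda>w. path_map (b w)) = distr M (\<Pi>\<^sub>M t\<in>{0..}. borel) (\<lambda>w. path_map (b' w))"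
proof (rule measure_eqI_PiM_infinite)
  interpret prob_space M by (rule is_std_BM_D(1)[OF b])
  have meas: "(\<lambda>w. path_map (c w)) \<in> measurable M (\<Pi>\<^sub>M t\<in>{0..}. borel)" if "is_std_BM M c" for c
    unfolding path_map_def by (intro measurable_restrict is_std_BM_D(2)[OF that]) auto
  show "finite_measure (distr M (\<Pi>\<^sub>M t\<in>{0..}. borel) (\<lambda>w. path_map (b w)))"
    using prob_space_distr[OF meas[OF b]] by (simp add: prob_space_def)
  fix A :: "real \<Rightarrow> real set" and J assume J: "finite J" "J \<subseteq> {0..}" and A: "\<And>i. i \<in> J \<Longrightarrow> A i \<in> sets borel"
  define xs where "xs = sorted_list_of_set (insert 0 (insert 1 J))"
  define n where "n = length xs - 1"
  have "\<exists>m. m \<le> n \<and> xs ! m = t" if "t \<in> J" for t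
  proof -
    have "set xs = insert 0 (insert 1 J)" unfolding xs_def using J by (intro set_sorted_list_of_set) auto
    then have "t \<in> set xs" using that by simp
    then obtain m where "m < length xs" "xs ! m = t" by (auto simp: in_set_conv_nth)
    then show ?thesis by (intro exI[of _ m]) (auto simp: n_def)
  qed
  then obtain idx where idx: "\<And>t. t \<in> J \<Longrightarrow> idx t \<le> n \<and> xs ! idx t = t" by metis
  have pe: "prod_emb {0..} (\<lambda>_. borel) J (Pi\<^sub>E J A) \<in> sets (\<Pi>\<^sub>M t\<in>{0..}. (borel :: real measure))"
    by (rule sets_PiM_I) (use J A in auto)
  have ev: "emeasure (distr M (\<Pi>\<^sub>M t\<in>{0..}. borel) (\<lambda>w. path_map (c w))) (prod_emb {0..} (\<lambda>_. borel) J (Pi\<^sub>E J A))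
     = emeasure M {w \<in> space M. \<forall>t\<in>J. c w t \<in> A t}" if c: "is_std_BM M c" for c
  proof -
    have "(\<lambda>w. path_map (c w)) -` prod_emb {0..} (\<lambda>_. borel) J (Pi\<^sub>E J A) \<inter> space M = {w \<in> space M. \<forall>t\<in>J. c w t \<in> A t}"
      using J(2) by (auto simp: prod_emb_def path_map_def PiE_iff restrict_def extensional_def subset_eq)
    then show ?thesis using emeasure_distr[OF meas[OF c] pe] by simp
  qed
  show "emeasure (distr M (\<Pi>\<^sub>M t\<in>{0..}. borel) (\<lambda>w. path_map (b w))) (prod_emb {0..} (\<lambda>_. borel) J (Pi\<^sub>E J A))
    = emeasure (distr M (\<Pi>\<^sub>M t\<in>{0..}. borel) (\<lambda>w. path_map (b' w))) (prod_emb {0..} (\<lambda>_. borel) J (Pi\<^sub>E J A))"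
    unfolding ev[OF b] ev[OF b']
    by (rule trans[OF BM_fdd_emeasure[OF b J A xs_def n_def idx] BM_fdd_emeasure[OF b' J A xs_def n_def idx, symmetric]])
qed simp_all

text \<open>The trace sigma-algebra avoids any claim that the continuous functions form a measurable
  subset of the product, and makes the identity a continuous process, so that the measurability
  results for processes apply to path functionals.\<close>

definition path_space :: "(real \<Rightarrow> real) measure" where
  "path_space = restrict_space (\<Pi>\<^sub>M t\<in>{0..}. borel) {f. continuous_on {0..} f}"

lemma proc_path_space: "proc path_space (\<lambda>f. f)"
  unfolding proc_def
proof (intro conjI allI impI ballI)
  fix t :: real assume "0 \<le> t"
  then have "(\<lambda>f. f t) \<in> borel_measurable (\<Pi>\<^sub>M t\<in>{0..}. (borel :: real measure))" by (intro measurable_component_singleton) simp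
  then show "(\<lambda>f. f t) \<in> borel_measurable path_space" unfolding path_space_def by (rule measurable_restrict_space1)
next
  fix f assume "f \<in> space path_space"
  then show "continuous_on {0..} f" by (simp add: path_space_def space_restrict_space)
qed

text \<open>A measurable set of the trace is the set of continuous functions cut with a
  product-measurable \<open>A\<close>. All paths are continuous, so the event is the preimage of
  \<open>A\<close> and its probability depends on the law alone.\<close>

lemma BM_path_functional:
  assumes b: "is_std_BM M b" and b': "is_std_BM M b'"
    and cong: "\<And>f g. (\<And>t. t \<ge> 0 \<Longrightarrow> f t = g t) \<Longrightarrow> Q f \<longleftrightarrow> Q g"
    and Q: "Measurable.pred path_space Q"
  shows "measure M {w \<in> space M. Q (b w)} = measure M {w \<in> space M. Q (b' w)}"
proof -
  have "{f \<in> space path_space. Q f} \<in> sets path_space" using Q by (simp add: pred_def)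
  then obtain A where A: "A \<in> sets (\<Pi>\<^sub>M t\<in>{0..}. (borel :: real measure))" "{f \<in> space path_space. Q f} = {f. continuous_on {0..} f} \<inter> A"
    unfolding path_space_def sets_restrict_space by auto
  have m: "measure M {w \<in> space M. Q (c w)} = measure (distr M (\<Pi>\<^sub>M t\<in>{0..}. borel) (\<lambda>w. path_map (c w))) A" if c: "is_std_BM M c" for c
  proof -
    have meas: "(\<lambda>w. path_map (c w)) \<in> measurable M (\<Pi>\<^sub>M t\<in>{0..}. borel)"
      unfolding path_map_def by (intro measurable_restrict is_std_BM_D(2)[OF c]) auto
    have "Q (c w) \<longleftrightarrow> path_map (c w) \<in> A" if w: "w \<in> space M" for w
    proof -
      have ct: "continuous_on {0..} (path_map (c w))"
        using is_std_BM_D(4)[OF c w] by (subst continuous_on_cong[OF refl, of _ _ "c w"]) (auto simp: path_map_def)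
      have sp: "path_map (c w) \<in> space path_space"
        using measurable_space[OF meas w] ct by (simp add: path_space_def space_restrict_space)
      have "Q (c w) \<longleftrightarrow> Q (path_map (c w))" by (rule cong) (simp add: path_map_def)
      also have "\<dots> \<longleftrightarrow> path_map (c w) \<in> {f \<in> space path_space. Q f}" using sp by simp
      also have "\<dots> \<longleftrightarrow> path_map (c w) \<in> A" unfolding A(2) using ct by simp
      finally show ?thesis .
    qed
    then have "{w \<in> space M. Q (c w)} = (\<lambda>w. path_map (c w)) -` A \<inter> space M" by auto
    then show ?thesis using measure_distr[OF meas A(1)] by simp
  qed
  show ?thesis unfolding m[OF b] m[OF b'] BM_law_unique[OF b b'] ..
qed

text \<open>The rate \<open>a\<close> of \<open>SS\<close> and the rate \<open>- (a + 1)\<close> of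
  \<open>m\<close> leave \<open>exp (- t)\<close>, while the noise contributes at most
  \<open>exp (2 * \<kappa> * (1 + t) powr (3/4))\<close>, which is subexponential.\<close>

lemma TC_if_growth:
  assumes c: "continuous_on {0..} bp" and g: "growth C bp" and \<beta>: "\<beta> > 0" and a: "a > 0"
  shows "string_eq.TC (s_dens \<beta> a bp) (m_dens \<beta> a bp)"
proof -
  interpret string_eq "s_dens \<beta> a bp" "m_dens \<beta> a bp" by (rule string_eq_dens[OF c])
  define \<kappa> where "\<kappa> = 2 / sqrt \<beta> * C"
  have C: "C \<ge> 0" and gb: "\<And>t. t \<ge> 0 \<Longrightarrow> \<bar>bp t\<bar> \<le> C * (1 + t) powr (3/4)" using g by (auto simp: growth_def)
  have \<kappa>: "\<kappa> \<ge> 0" using C \<beta> by (simp add: \<kappa>_def)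
  have bb: "\<bar>2 / sqrt \<beta> * bp t\<bar> \<le> \<kappa> * (1 + t) powr (3/4)" if "t \<ge> 0" for t
  proof -
    have "2 / sqrt \<beta> * \<bar>bp t\<bar> \<le> 2 / sqrt \<beta> * (C * (1 + t) powr (3/4))" using gb[OF that] \<beta> by (intro mult_left_mono) auto
    then show ?thesis using \<beta> by (simp add: \<kappa>_def abs_mult)
  qed
  have Sle: "SS t \<le> exp (\<kappa> * (1 + t) powr (3/4)) * (exp (a * t) / a)" if t: "t \<ge> 0" for t
  proof -
    have "SS t \<le> integral {0..t} (\<lambda>z. exp (\<kappa> * (1 + t) powr (3/4)) * exp (a * z))"
      unfolding SS_def
    proof (rule integral_le)
      fix z assume z: "z \<in> {0..t}"
      have "\<kappa> * (1 + z) powr (3/4) \<le> \<kappa> * (1 + t) powr (3/4)" using z \<kappa> by (intro mult_left_mono powr_mono2) auto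
      moreover have "2 / sqrt \<beta> * bp z \<le> \<kappa> * (1 + z) powr (3/4)" by (rule order_trans[OF abs_ge_self bb]) (use z in simp)
      ultimately have "a * z + 2 / sqrt \<beta> * bp z \<le> \<kappa> * (1 + t) powr (3/4) + a * z" by linarith
      then show "s_dens \<beta> a bp z \<le> exp (\<kappa> * (1 + t) powr (3/4)) * exp (a * z)" unfolding s_dens_def exp_add[symmetric] by (subst exp_le_cancel_iff)
    qed (auto intro!: integrable_on_atLeast_subinterval continuous_intros cs)
    also have "\<dots> = exp (\<kappa> * (1 + t) powr (3/4)) * integral {0..t} (\<lambda>z. exp (a * z))" by simp
    also have "integral {0..t} (\<lambda>z. exp (a * z)) = exp (a * t) / a - exp (a * 0) / a"
    proof (rule integral_of_DERIV)
      show "DERIV (\<lambda>z. exp (a * z) / a) x :> exp (a * x)" for x using a by (auto intro!: derivative_eq_intros)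
    qed (use t a in \<open>auto intro!: continuous_intros\<close>)
    also have "exp (\<kappa> * (1 + t) powr (3/4)) * (exp (a * t) / a - exp (a * 0) / a) \<le> exp (\<kappa> * (1 + t) powr (3/4)) * (exp (a * t) / a)"
      using a by (intro mult_left_mono) auto
    finally show ?thesis .
  qed
  have mle: "m_dens \<beta> a bp t \<le> exp (- (a + 1) * t + \<kappa> * (1 + t) powr (3/4))" if "t \<ge> 0" for t
  proof -
    have "- (2 / sqrt \<beta> * bp t) \<le> \<kappa> * (1 + t) powr (3/4)" by (rule order_trans[OF abs_ge_minus_self bb[OF that]])
    then have "- (a + 1) * t - 2 / sqrt \<beta> * bp t \<le> - (a + 1) * t + \<kappa> * (1 + t) powr (3/4)" by linarith
    then show ?thesis unfolding m_dens_def by (subst exp_le_cancel_iff)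
  qed
  \<comment> \<open>From here on \<open>4 * \<kappa> <= (1 + t) powr (1/4)\<close>, so the exponent
    of the noise is at most \<open>(1 + t) / 2\<close> and a multiple of
    \<open>exp (- (t / 2))\<close> remains as a bound.\<close>
  define X where "X = (4 * \<kappa> + 1) ^ 4"
  have X0: "X \<ge> 0" by (simp add: X_def)
  show ?thesis
    unfolding TC_def
  proof (rule bddint_compare[where g="\<lambda>t. exp (- (t / 2))" and c="exp (1/2) / a" and X=X])
    fix t assume t: "t \<ge> X"
    have t0: "t \<ge> 0" using t X0 by simp
    have "4 * \<kappa> \<le> (1 + t) powr (1/4)"
    proof -
      have "4 * \<kappa> \<le> ((4 * \<kappa> + 1) powr 4) powr (1/4)" using \<kappa> by (simp only: powr_powr) simp
      also have "\<dots> = X powr (1/4)" using \<kappa> by (simp add: X_def)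
      also have "\<dots> \<le> (1 + t) powr (1/4)" using t X0 by (intro powr_mono2) auto
      finally show ?thesis .
    qed
    then have "4 * \<kappa> * (1 + t) powr (3/4) \<le> (1 + t) powr (1/4) * (1 + t) powr (3/4)" by (intro mult_right_mono) auto
    also have "\<dots> = 1 + t" using t0 by (simp add: powr_add[symmetric])
    finally have k: "2 * (\<kappa> * (1 + t) powr (3/4)) \<le> (1 + t) / 2" by simp
    have "SS t * m_dens \<beta> a bp t \<le> (exp (\<kappa> * (1 + t) powr (3/4)) * (exp (a * t) / a)) * exp (- (a + 1) * t + \<kappa> * (1 + t) powr (3/4))"
      by (intro mult_mono Sle mle t0) (use a mpos[OF t0] in \<open>auto simp: less_imp_le\<close>)
    also have "\<dots> = exp (\<kappa> * (1 + t) powr (3/4) + a * t + (- (a + 1) * t + \<kappa> * (1 + t) powr (3/4))) / a" by (simp only: exp_add) simp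
    also have "\<dots> \<le> exp (1/2 + (- (t / 2))) / a"
    proof (rule divide_right_mono)
      have "\<kappa> * (1 + t) powr (3/4) + a * t + (- (a + 1) * t + \<kappa> * (1 + t) powr (3/4)) = 2 * (\<kappa> * (1 + t) powr (3/4)) - t" by (simp add: algebra_simps)
      then show "exp (\<kappa> * (1 + t) powr (3/4) + a * t + (- (a + 1) * t + \<kappa> * (1 + t) powr (3/4))) \<le> exp (1/2 + (- (t / 2)))"
        using k by (simp add: field_simps)
    qed (use a in simp)
    also have "\<dots> = exp (1/2) / a * exp (- (t / 2))" by (simp only: exp_add) simp
    finally show "SS t * m_dens \<beta> a bp t \<le> exp (1/2) / a * exp (- (t / 2))" .
  next
    show "bddint (\<lambda>t. exp (- (t / 2)))"
      unfolding bddint_def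
    proof (intro exI allI impI)
      fix x :: real assume x: "x \<ge> 0"
      have "integral {0..x} (\<lambda>t. exp (- (t / 2))) = (- 2 * exp (- (x / 2))) - (- 2 * exp (- (0 / 2)))"
        by (rule integral_of_DERIV) (use x in \<open>auto intro!: continuous_intros derivative_eq_intros\<close>)
      also have "\<dots> \<le> 2" by simp
      finally show "integral {0..x} (\<lambda>t. exp (- (t / 2))) \<le> 2" .
    qed
  qed (use a X0 in \<open>auto intro!: cSm continuous_intros\<close>)
qed

section \<open>Convergence\<close>

text \<open>The events agree on paths of controlled growth through \<open>TC_NN_iff\<close>.
  Measurability of both over all of \<open>M\<close> turns this almost sure agreement into equality
  of the measures.\<close>

lemma prob_Lambda0_ge_eq_NN:
  assumes b: "is_std_BM M b" and \<beta>: "\<beta> > 0" and a: "a > 0" and lam: "lam > 0"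
  shows "measure M {w \<in> space M. lam \<le> Lambda0 \<beta> a (b w)}
    = measure M {w \<in> space M. string_eq.NN (s_dens \<beta> a (b w)) (m_dens \<beta> a (b w)) lam}"
proof -
  interpret prob_space M by (rule is_std_BM_D(1)[OF b])
  interpret B: string_proc M "\<lambda>w. s_dens \<beta> a (b w)" "\<lambda>w. m_dens \<beta> a (b w)" by (rule string_proc_dens[OF proc_BM[OF b]])
  have eq: "lam \<le> Lambda0 \<beta> a (b w) \<longleftrightarrow> string_eq.NN (s_dens \<beta> a (b w)) (m_dens \<beta> a (b w)) lam"
    if w: "w \<in> space M" and g: "growth C (b w)" for w C
  proof -
    have c: "continuous_on {0..} (b w)" by (rule is_std_BM_D(4)[OF b w])
    interpret string_eq "s_dens \<beta> a (b w)" "m_dens \<beta> a (b w)" by (rule string_eq_dens[OF c])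
    have tc: TC by (rule TC_if_growth[OF c g \<beta> a])
    obtain l where l: "ev l" using TC_NN_iff(1)[OF tc] by (elim exE)
    obtain n :: nat where n: "l < real n" using reals_Archimedean2[of l] by (elim exE)
    have ex: "\<exists>n::nat. \<exists>l<real n. ev l" using l n by (intro exI conjI)
    show ?thesis unfolding Lambda0_ge_iff[OF c] if_P[OF ex] TC_NN_iff(2)[OF tc lam] by (auto simp: not_less)
  qed
  have m1: "{w \<in> space M. lam \<le> Lambda0 \<beta> a (b w)} \<in> sets M"
    using pred_Lambda0_ge[OF proc_BM[OF b], of lam \<beta> a] by (simp only: pred_def)
  have m2: "{w \<in> space M. string_eq.NN (s_dens \<beta> a (b w)) (m_dens \<beta> a (b w)) lam} \<in> sets M"
    using B.pred_NN[of lam] by (simp only: pred_def)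
  show ?thesis
  proof (rule finite_measure_eq_AE[OF _ m1 m2])
    show "AE w in M. (w \<in> {w \<in> space M. lam \<le> Lambda0 \<beta> a (b w)})
      = (w \<in> {w \<in> space M. string_eq.NN (s_dens \<beta> a (b w)) (m_dens \<beta> a (b w)) lam})"
      using AE_growth[OF b] AE_space
    proof eventually_elim
      case (elim w)
      then obtain C where "growth C (b w)" by (elim exE)
      from eq[OF elim(2) this] show ?case by simp
    qed
  qed
qed

lemma prob_NN_law:
  assumes b: "is_std_BM M b" and b': "is_std_BM M b'"
  shows "measure M {w \<in> space M. string_eq.NN (s_dens \<beta> a (b w)) (m_dens \<beta> a (b w)) lam}
    = measure M {w \<in> space M. string_eq.NN (s_dens \<beta> a (b' w)) (m_dens \<beta> a (b' w)) lam}"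
proof -
  define Q where "Q f \<longleftrightarrow> (\<forall>x\<ge>0. uu (s_dens \<beta> a f) (\<lambda>t. lam * m_dens \<beta> a f t) x > 0)" for f
  have NQ: "string_eq.NN (s_dens \<beta> a f) (m_dens \<beta> a f) lam \<longleftrightarrow> Q f" if "continuous_on {0..} f" for f
    unfolding Q_def string_eq.NN_def[OF string_eq_dens[OF that]] string_eq.U_def[OF string_eq_dens[OF that]] ..
  interpret B: string_proc path_space "\<lambda>w. s_dens \<beta> a w" "\<lambda>w. m_dens \<beta> a w" by (rule string_proc_dens[OF proc_path_space])
  have Q: "Measurable.pred path_space Q"
    using B.pred_NN[of lam] by (subst measurable_cong[OF NQ[symmetric]]) (rule procD(2)[OF proc_path_space])
  have cong: "Q f \<longleftrightarrow> Q g" if "\<And>t. t \<ge> 0 \<Longrightarrow> f t = g t" for f g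
  proof -
    have "uu (s_dens \<beta> a f) (\<lambda>t. lam * m_dens \<beta> a f t) x = uu (s_dens \<beta> a g) (\<lambda>t. lam * m_dens \<beta> a g t) x" if "x \<ge> 0" for x
      by (rule phi_cong(2)[OF _ _ that]) (simp_all add: s_dens_def m_dens_def \<open>\<And>t. t \<ge> 0 \<Longrightarrow> f t = g t\<close>)
    then show ?thesis unfolding Q_def by simp
  qed
  have "{w \<in> space M. string_eq.NN (s_dens \<beta> a (c w)) (m_dens \<beta> a (c w)) lam} = {w \<in> space M. Q (c w)}"
    if "is_std_BM M c" for c
    using NQ[OF is_std_BM_D(4)[OF that]] by auto
  from this[OF b] this[OF b'] show ?thesis using BM_path_functional[OF b b' cong Q] by simp
qed

text \<open>The motion inside \<open>Lambda0\<close> is exchanged for the rescaled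
  \<open>?b\<close>, equal in law, whose string equation becomes the rescaled system of the unscaled
  path \<open>b w\<close>. Events for different \<open>\<epsilon>\<close> then concern one and the
  same path, and a pathwise limit becomes possible.\<close>

lemma prob_Lambda0_ge_eq_NE:
  assumes b: "is_std_BM M b" and \<beta>: "\<beta> > 0" and \<epsilon>: "\<epsilon> > 0" and h: "h = 2 / \<beta>" and \<sigma>: "\<sigma> = 2 / sqrt \<beta>"
    and a: "a = 2 / \<epsilon>^3 - 2 / \<beta>" and lam: "lam = (1 - \<mu> * \<epsilon>\<^sup>2) / \<epsilon>^6"
  shows "Measurable.pred M (\<lambda>w. NE \<sigma> h \<mu> \<epsilon> (b w))"
    and "a > 0 \<Longrightarrow> lam > 0 \<Longrightarrow> measure M {w \<in> space M. lam \<le> Lambda0 \<beta> a (b w)} = measure M {w \<in> space M. NE \<sigma> h \<mu> \<epsilon> (b w)}"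
proof -
  let ?b = "\<lambda>w t. \<epsilon> * b w (t / \<epsilon>\<^sup>2)"
  have b': "is_std_BM M ?b" by (rule BM_scaling[OF b \<epsilon>])
  interpret B: string_proc M "\<lambda>w. s_dens \<beta> a (?b w)" "\<lambda>w. m_dens \<beta> a (?b w)" by (rule string_proc_dens[OF proc_BM[OF b']])
  have NE: "string_eq.NN (s_dens \<beta> a (?b w)) (m_dens \<beta> a (?b w)) lam \<longleftrightarrow> NE \<sigma> h \<mu> \<epsilon> (b w)" if w: "w \<in> space M" for w
    by (rule NN_iff_NE[OF is_std_BM_D(4)[OF b w] \<epsilon> h \<sigma> a lam refl is_std_BM_D(4)[OF b' w]])
  show "Measurable.pred M (\<lambda>w. NE \<sigma> h \<mu> \<epsilon> (b w))"
    using B.pred_NN[of lam] by (subst measurable_cong[OF NE[symmetric]])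
  assume pos: "a > 0" "lam > 0"
  have "measure M {w \<in> space M. lam \<le> Lambda0 \<beta> a (b w)}
    = measure M {w \<in> space M. string_eq.NN (s_dens \<beta> a (?b w)) (m_dens \<beta> a (?b w)) lam}"
    by (rule trans[OF prob_Lambda0_ge_eq_NN[OF b \<beta> pos] prob_NN_law[OF b b']])
  also have "{w \<in> space M. string_eq.NN (s_dens \<beta> a (?b w)) (m_dens \<beta> a (?b w)) lam} = {w \<in> space M. NE \<sigma> h \<mu> \<epsilon> (b w)}"
    using NE by auto
  finally show "measure M {w \<in> space M. lam \<le> Lambda0 \<beta> a (b w)} = measure M {w \<in> space M. NE \<sigma> h \<mu> \<epsilon> (b w)}" .
qed

lemma (in finite_measure) tendsto_measure_if_eventually_eq:
  assumes A: "\<And>n. A n \<in> sets M" and B: "B \<in> sets M"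
    and ev: "AE w in M. \<forall>\<^sub>F n in sequentially. w \<in> A n \<longleftrightarrow> w \<in> B"
  shows "(\<lambda>n. measure M (A n)) \<longlonglongrightarrow> measure M B"
proof -
  have "(\<lambda>n. LINT w|M. indicat_real (A n) w) \<longlonglongrightarrow> (LINT w|M. indicat_real B w)"
  proof (rule integral_dominated_convergence[where w="\<lambda>_. 1"])
    show "AE w in M. (\<lambda>n. indicat_real (A n) w) \<longlonglongrightarrow> indicat_real B w"
      using ev
    proof eventually_elim
      case (elim w)
      show ?case
        by (rule tendsto_eventually) (use elim in \<open>eventually_elim, simp add: indicator_def\<close>)
    qed
  qed (use A B in \<open>auto simp: indicator_def\<close>)
  then show ?thesis using A B by simp
qed

text \<open>Indicators need not converge at level \<open>\<mu>\<close> itself: outside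
  \<open>R \<mu>\<close> the events eventually fail, and on \<open>R \<nu>\<close> with
  \<open>\<nu> < \<mu>\<close> they eventually hold almost surely, but paths in
  \<open>R \<mu>\<close> that lie in no such \<open>R \<nu>\<close> stay undecided. Left continuity
  of the distribution function closes this gap.\<close>

lemma prob_NE_tendsto:
  assumes b: "is_std_BM M b" and \<beta>: "\<beta> > 0" and h: "h = 2 / \<beta>" and \<sigma>: "\<sigma> = 2 / sqrt \<beta>"
    and e0: "\<And>n. 0 < e n" and e1: "\<And>n. e n \<le> 1" and elim: "e \<longlonglongrightarrow> 0"
    and cont: "isCont (TW_cdf_left M b \<beta>) \<mu>"
  shows "(\<lambda>n. measure M {w \<in> space M. NE \<sigma> h \<mu> (e n) (b w)}) \<longlonglongrightarrow> TW_cdf_left M b \<beta> \<mu>"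
proof -
  interpret prob_space M by (rule is_std_BM_D(1)[OF b])
  define R where "R \<nu> = {w \<in> space M. \<forall>t>0. PP \<sigma> (b w) \<nu> t > 0}" for \<nu>
  define N where "N n = {w \<in> space M. NE \<sigma> h \<mu> (e n) (b w)}" for n
  note c = is_std_BM_D(4)[OF b]
  have F: "TW_cdf_left M b \<beta> \<nu> = measure M (R \<nu>)" for \<nu>
  proof -
    have "{w \<in> space M. riccati_no_explosion \<beta> \<nu> (b w)} = R \<nu>"
      unfolding R_def using riccati_iff_PP[OF c \<sigma>] by auto
    then show ?thesis by (simp add: TW_cdf_left_def)
  qed
  have R: "R \<nu> \<in> sets M" for \<nu>
  proof -
    have int: "proc M (\<lambda>w t. integral {0..t} (b w))" by (rule proc_integral[OF proc_BM[OF b]])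
    have "proc M (\<lambda>w. phi (s0 \<sigma> (b w)) (g0 \<sigma> \<nu> (b w)))"
      unfolding s0_def[abs_def] g0_def[abs_def]
      by (intro proc_phi(1) proc_exp proc_mult proc_diff proc_power proc_const int proc_BM[OF b] continuous_intros)
    from pred_all_pos[OF this] have "{w \<in> space M. \<forall>t>0. phi (s0 \<sigma> (b w)) (g0 \<sigma> \<nu> (b w)) t > 0} \<in> sets M"
      by (simp only: pred_def)
    also have "{w \<in> space M. \<forall>t>0. phi (s0 \<sigma> (b w)) (g0 \<sigma> \<nu> (b w)) t > 0} = R \<nu>"
      unfolding R_def using PP_def[OF c] by auto
    finally show ?thesis .
  qed
  have N: "N n \<in> sets M" for n
    using prob_Lambda0_ge_eq_NE(1)[OF b \<beta> e0 h \<sigma> refl refl, of \<mu> n] by (simp only: pred_def N_def)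
  \<comment> \<open>The union with \<open>R \<mu>\<close> here, and the intersection with
    \<open>R \<nu>\<close> in \<open>low\<close>, turn one-sided eventual inclusions into eventual
    equality, so that dominated convergence applies.\<close>
  have up: "(\<lambda>n. measure M (N n \<union> R \<mu>)) \<longlonglongrightarrow> measure M (R \<mu>)"
  proof (rule tendsto_measure_if_eventually_eq)
    show "AE w in M. \<forall>\<^sub>F n in sequentially. w \<in> N n \<union> R \<mu> \<longleftrightarrow> w \<in> R \<mu>"
    proof (rule AE_I2)
      fix w assume w: "w \<in> space M"
      show "\<forall>\<^sub>F n in sequentially. w \<in> N n \<union> R \<mu> \<longleftrightarrow> w \<in> R \<mu>"
      proof (cases "w \<in> R \<mu>")
        case False
        then have "\<not> (\<forall>t>0. PP \<sigma> (b w) \<mu> t > 0)" using w by (simp add: R_def)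
        from eventually_not_NE[OF c[OF w] e0 e1 elim this, of h] show ?thesis
          by eventually_elim (simp add: N_def)
      qed simp
    qed
  qed (use N R in auto)
  have low: "(\<lambda>n. measure M (N n \<inter> R \<nu>)) \<longlonglongrightarrow> measure M (R \<nu>)" if \<nu>: "\<nu> < \<mu>" for \<nu>
  proof (rule tendsto_measure_if_eventually_eq)
    show "AE w in M. \<forall>\<^sub>F n in sequentially. w \<in> N n \<inter> R \<nu> \<longleftrightarrow> w \<in> R \<nu>"
      using AE_growth[OF b] AE_space
    proof eventually_elim
      case (elim w)
      then obtain C where g: "growth C (b w)" by (elim exE)
      show ?case
      proof (cases "w \<in> R \<nu>")
        case True
        then have p: "PP \<sigma> (b w) \<nu> t > 0" if "t > 0" for t using that by (simp add: R_def)
        have "\<forall>\<^sub>F n in sequentially. NE \<sigma> h \<mu> (e n) (b w)"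
          by (rule eventually_NE[OF c[OF elim(2)] e0 e1 \<open>e \<longlonglongrightarrow> 0\<close> _ _ g \<nu> p]) (use \<beta> h \<sigma> in auto)
        then show ?thesis by eventually_elim (use elim(2) in \<open>simp add: N_def\<close>)
      qed simp
    qed
  qed (use N R in auto)
  show ?thesis
    unfolding F N_def[symmetric]
  proof (rule order_tendstoI)
    fix y assume "measure M (R \<mu>) < y"
    from order_tendstoD(2)[OF up this] show "\<forall>\<^sub>F n in sequentially. measure M (N n) < y"
    proof eventually_elim
      case (elim n)
      have "measure M (N n) \<le> measure M (N n \<union> R \<mu>)" by (rule finite_measure_mono) (use N R in auto)
      then show ?case using elim by simp
    qed
  next
    fix y assume y: "y < measure M (R \<mu>)"
    have "(TW_cdf_left M b \<beta> \<longlongrightarrow> TW_cdf_left M b \<beta> \<mu>) (at_left \<mu>)"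
      by (rule filterlim_mono[OF cont[unfolded isCont_def] order_refl]) (simp add: at_le)
    from order_tendstoD(1)[OF this, of y] y have "\<forall>\<^sub>F \<nu> in at_left \<mu>. \<nu> < \<mu> \<and> y < measure M (R \<nu>)"
      unfolding F by (intro eventually_conj) (simp_all add: eventually_at_filter)
    then have "\<exists>\<nu>. \<nu> < \<mu> \<and> y < measure M (R \<nu>)" by (rule eventually_happens'[rotated]) simp
    then obtain \<nu> where \<nu>: "\<nu> < \<mu>" "y < measure M (R \<nu>)" by (elim exE conjE)
    from order_tendstoD(1)[OF low[OF \<nu>(1)] \<nu>(2)] show "\<forall>\<^sub>F n in sequentially. y < measure M (N n)"
    proof eventually_elim
      case (elim n)
      have "measure M (N n \<inter> R \<nu>) \<le> measure M (N n)" by (rule finite_measure_mono) (use N R in auto)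
      then show ?case using elim by simp
    qed
  qed
qed

theorem theorem3:
  fixes M :: "'a measure" and b :: "'a \<Rightarrow> real \<Rightarrow> real" and \<beta> :: real
  assumes "\<beta> > 0" and "is_std_BM M b"
  shows "\<forall>\<mu>. isCont (TW_cdf_left M b \<beta>) \<mu> \<longrightarrow>
           ((\<lambda>\<eta>::real. measure M {w \<in> space M.
               (\<eta> - Lambda0 \<beta> (2 * sqrt \<eta> - 2 / \<beta>) (b w)) / \<eta> powr (2/3) \<le> \<mu>})
            \<longlongrightarrow> TW_cdf_left M b \<beta> \<mu>) at_top"
proof (intro allI impI tendsto_at_topI_sequentially)
  fix \<mu> :: real and X :: "nat \<Rightarrow> real"
  assume cont: "isCont (TW_cdf_left M b \<beta>) \<mu>" and X: "filterlim X at_top sequentially"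
  note \<beta> = assms(1) and b = assms(2)
  let ?f = "\<lambda>\<eta>::real. measure M {w \<in> space M. (\<eta> - Lambda0 \<beta> (2 * sqrt \<eta> - 2 / \<beta>) (b w)) / \<eta> powr (2/3) \<le> \<mu>}"
  \<comment> \<open>In terms of \<open>\<epsilon>\<close> the three conditions say
    \<open>\<epsilon> <= 1\<close>, \<open>a > 0\<close> and \<open>lam > 0\<close>, as the
    reduction to \<open>NE\<close> and its limit require. They hold for large \<open>\<eta>\<close>
    only, whence the index shift \<open>K\<close> in \<open>Y\<close>.\<close>
  have "\<forall>\<^sub>F \<eta>::real in at_top. 1 \<le> \<eta> \<and> 2 * sqrt \<eta> - 2 / \<beta> > 0 \<and> \<eta> - \<mu> * \<eta> powr (2/3) > 0"
  proof (intro eventually_conj)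
    show "\<forall>\<^sub>F \<eta>::real in at_top. 1 \<le> \<eta>" by (rule eventually_ge_at_top)
    have "filterlim (\<lambda>\<eta>::real. 2 * sqrt \<eta> - 2 / \<beta>) at_top at_top" by real_asymp
    then show "\<forall>\<^sub>F \<eta>::real in at_top. 2 * sqrt \<eta> - 2 / \<beta> > 0" unfolding filterlim_at_top_dense by (rule spec)
    have "filterlim (\<lambda>\<eta>::real. \<eta> - \<mu> * \<eta> powr (2/3)) at_top at_top" by real_asymp
    then show "\<forall>\<^sub>F \<eta>::real in at_top. \<eta> - \<mu> * \<eta> powr (2/3) > 0" unfolding filterlim_at_top_dense by (rule spec)
  qed
  from filterlim_iff[THEN iffD1, OF X, rule_format, OF this]
  obtain K where K: "\<And>n. n \<ge> K \<Longrightarrow> 1 \<le> X n \<and> 2 * sqrt (X n) - 2 / \<beta> > 0 \<and> X n - \<mu> * X n powr (2/3) > 0"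
    unfolding eventually_sequentially by auto
  define Y where "Y n = X (n + K)" for n
  have Y1: "1 \<le> Y n" and Ya: "2 * sqrt (Y n) - 2 / \<beta> > 0" and Yl: "Y n - \<mu> * Y n powr (2/3) > 0" for n
    using K[of "n + K"] by (auto simp: Y_def)
  have Y: "filterlim Y at_top sequentially"
    unfolding Y_def by (rule filterlim_compose[OF X filterlim_add_const_nat_at_top])
  define e where "e n = Y n powr (-1/6)" for n
  have e0: "e n > 0" for n using Y1[of n] by (simp add: e_def)
  have e1: "e n \<le> 1" for n using Y1[of n] powr_mono[of "-1/6" 0 "Y n"] by (simp add: e_def)
  have elim: "e \<longlonglongrightarrow> 0"
    unfolding e_def by (rule tendsto_neg_powr[OF _ Y]) simp
  have ep: "e n ^ k = Y n powr (- real k / 6)" for n k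
    using Y1[of n] e0[of n] by (simp add: powr_realpow[OF e0, symmetric]) (simp add: e_def powr_powr)
  have eq: "?f (Y n) = measure M {w \<in> space M. NE (2 / sqrt \<beta>) (2 / \<beta>) \<mu> (e n) (b w)}" for n
  proof -
    have p: "Y n > 0" using Y1[of n] by simp
    have a: "2 * sqrt (Y n) - 2 / \<beta> = 2 / e n ^ 3 - 2 / \<beta>"
      using p by (simp add: ep powr_half_sqrt[symmetric] powr_minus_divide)
    have l: "Y n - \<mu> * Y n powr (2/3) = (1 - \<mu> * (e n)\<^sup>2) / e n ^ 6"
    proof -
      have "(1 - \<mu> * (e n)\<^sup>2) / e n ^ 6 = 1 / Y n powr (-1) - \<mu> * (Y n powr (-1/3) / Y n powr (-1))"
        by (simp add: ep diff_divide_distrib left_diff_distrib)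
      also have "Y n powr (-1/3) / Y n powr (-1) = Y n powr (2/3)" unfolding powr_diff[symmetric] by simp
      also have "1 / Y n powr (-1) = Y n" using p by (simp add: powr_minus_divide)
      finally show ?thesis by simp
    qed
    have "(Y n - L) / Y n powr (2/3) \<le> \<mu> \<longleftrightarrow> Y n - \<mu> * Y n powr (2/3) \<le> L" for L
      using p by (simp add: pos_divide_le_eq algebra_simps)
    then have "?f (Y n) = measure M {w \<in> space M. Y n - \<mu> * Y n powr (2/3) \<le> Lambda0 \<beta> (2 * sqrt (Y n) - 2 / \<beta>) (b w)}"
      by simp
    also have "\<dots> = measure M {w \<in> space M. NE (2 / sqrt \<beta>) (2 / \<beta>) \<mu> (e n) (b w)}"
      by (rule prob_Lambda0_ge_eq_NE(2)[OF b \<beta> e0 refl refl a l Ya Yl])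
    finally show ?thesis .
  qed
  have "(\<lambda>n. ?f (Y n)) \<longlonglongrightarrow> TW_cdf_left M b \<beta> \<mu>"
    unfolding eq by (rule prob_NE_tendsto[OF b \<beta> refl refl e0 e1 elim cont])
  then show "(\<lambda>n. ?f (X n)) \<longlonglongrightarrow> TW_cdf_left M b \<beta> \<mu>"
    unfolding Y_def by (rule LIMSEQ_offset)
qed

end
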